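(* Let $\alpha\in(0,1)$, $\beta\in[1-\frac1\alpha,\infty)$, fix $0<\gamma<\alpha$ and $\bar\eta_\alpha>0$, and set $T_\alpha=-\ln(2^\alpha-1)$. (a) For any $f\in L^2(\mathbf{e}_{\alpha,\beta})$ (resp. $f\in\mathrm{Ran}(\Lambda_{\alpha,\beta})\cup L^2(\overline{\mathbf{e}}_{\gamma,\beta,\alpha})$), we have $$P_tf(x)=\sum_{n=0}^\infty e^{-nt}\langle f,\mathcal{R}_n\rangle_{\mathbf{e}_{\alpha,\beta}}\mathcal{P}_n(x),$$ where for any $t>T_\alpha$ (resp. $t>0$) the identity holds in $L^2(\mathbf{e}_{\alpha,\beta})$. $P_t$ is holomorphic in $t$ on $\{z\in\mathbb{C}:\Re(z)>T_\alpha\}$. (b) For any $f\in L^2(\mathbf{e}_{\alpha,\beta})$ (resp. $f\in\mathrm{Ran}(\Lambda_{\alpha,\beta})\cup L^2(\overline{\mathbf{e}}_{\gamma,\beta,\alpha})$), $(t,x)\mapsto P_tf(x)$ belongs to $C^\infty((T_\alpha,\infty)\times[0,\infty))$ (resp. to $C^\infty((0,\infty)\times[0,\infty))$), and for any integers $k,p\ge0$, $$\frac{d^k}{dt^k}(P_tf)^{(p)}(x)=\sum_{n=p}^\infty(-n)^ke^{-nt}\langle f,\mathcal{R}_n\rangle_{\mathbf{e}_{\alpha,\beta}}\mathcal{P}_n^{(p)}(x),$$ where for any $t>T_\alpha$ (resp. $t>0$) the series converges locally uniformly in $x\in[0,\infty)$. (c) The heat kernel of $(P_t)$ is absolutely continuous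 with a density $(t,x,y)\mapsto P_t(x,y)$ which is $C^\infty$ on $(0,\infty)\times[0,\infty)\times(0,\infty)$ and satisfies, for any $t,y>0$, $x\ge0$, and any integers $k,p,q\ge0$, $$\frac{d^k}{dt^k}P_t^{(p,q)}(x,y)=\sum_{n=p}^\infty(-n)^ke^{-nt}\,\mathcal{W}_n^{(q)}(y)\,\mathcal{P}_n^{(p)}(x),$$ where the series is locally uniformly convergent in $(t,x,y)$, $P_t^{(p,q)}$ denotes $\partial_x^p\partial_y^qP_t(x,y)$, and $\mathcal{W}_n(y)=\mathcal{R}_n(y)\mathbf{e}_{\alpha,\beta}(y)$ for $n\ge 0$. (d) $(P_t)_{t\ge0}$ is a strong Feller semigroup, i.e. for any $t>0$ and any bounded Borel function $f$ on $[0,\infty)$, $P_tf$ is a bounded continuous function on $[0,\infty)$.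
   Context: $\mathbf{e}_{\alpha,\beta}(x)=\frac{x^{\beta+\frac1\alpha-1}e^{-x^{1/\alpha}}}{\alpha\,\Gamma(\alpha\beta+1)}$, $\mathbf{e}(x)=e^{-x}$, and $\overline{\mathbf{e}}_{\gamma,\beta,\alpha}(x)=x^{\beta+\frac1\alpha-1}e^{\bar\eta_\alpha x^{1/\gamma}}$, for $x>0$. $L^2(w)$ is the weighted Hilbert space on $(0,\infty)$ with inner product $\langle f,g\rangle_w=\int_0^\infty f(x)g(x)w(x)\,dx$. Polynomials: $$\mathcal{P}_n(x)=\Gamma(\alpha\beta+1)\sum_{k=0}^n(-1)^k\frac{\binom nk}{\Gamma(\alpha k+\alpha\beta+1)}x^k,\quad n\ge0.$$ Functions: $\mathcal{R}_n(x)=\frac{1}{n!\,\mathbf{e}_{\alpha,\beta}(x)}\frac{d^n}{dx^n}\big(x^n\mathbf{e}_{\alpha,\beta}(x)\big)$, $n\ge 0$. $\Lambda_{\alpha,\beta}:L^2(\mathbf{e})\to L^2(\mathbf{e}_{\alpha,\beta})$ is the bounded operator $\Lambda_{\alpha,\beta}f(x)=\int_0^\infty f(xy)\lambda_{\alpha,\beta}(y)\,dy$, where $\lambda_{\alpha,\beta}$ is the probability density on $(0,\infty)$ with $\int_0^\infty y^s\lambda_{\alpha,\beta}(y)\,dy=\frac{\Gamma(s+1)\Gamma(\alpha\beta+1)}{\Gamma(\alpha s+\alpha\beta+1)}$ for $\Re(s)>-1$. $(P_t)_{t\ge0}$ is the Gauss-Laguerre semigroup: the contraction Markov semigroup on $L^2(\mathbf{e}_{\alpha,\beta})$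 (which is also a Feller semigroup on $C_0([0,\infty))$) whose generator has the polynomials as a core, on which it acts as $$\mathbf{L}_{\alpha,\beta}f(x)=(d_{\alpha,\beta}-x)f'(x)+\frac{\sin(\alpha\pi)}{\pi}\,x\int_0^1 f''(xy)\,g_{\alpha,\beta}(y)\,dy,$$ with $d_{\alpha,\beta}=\frac{\Gamma(\alpha\beta+\alpha+1)}{\Gamma(\alpha\beta+1)}$ and $g_{\alpha,\beta}(y)=\frac{\Gamma(\alpha)}{\beta+\frac1\alpha+1}y^{\beta+\frac1\alpha+1}{}_2F_1(\alpha(\beta+1)+1,\alpha+1;\alpha(\beta+1)+2;y^{1/\alpha})$. *)

theory Defs
  imports "HOL-Probability.Probability"
begin

section \<open>Weighted \<open>L\<^sup>2\<close> spaces on the open half-line\<close>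

text \<open>
  Elements of the weighted space are represented by functions, and equality of elements is
  equality almost everywhere; the values of the functions outside \<open>{0<..}\<close> play no role.
  The definitions are polymorphic so that they also give the complexified space, which is
  needed to speak of holomorphic families of operators.
\<close>

definition wmeas :: "(real \<Rightarrow> real) \<Rightarrow> real measure" where
  "wmeas w = density (restrict_space lborel {0<..}) (\<lambda>x. ennreal (w x))"

definition L2 :: "(real \<Rightarrow> real) \<Rightarrow> (real \<Rightarrow> 'b::{banach, second_countable_topology}) set" where
  "L2 w = {f. f \<in> borel_measurable (wmeas w) \<and> integrable (wmeas w) (\<lambda>x. (norm (f x))\<^sup>2)}"

definition L2_norm :: "(real \<Rightarrow> real) \<Rightarrow> (real \<Rightarrow> 'b::{banach, second_countable_topology}) \<Rightarrow> real" where
  "L2_norm w f = sqrt (LINT x|wmeas w. (norm (f x))\<^sup>2)"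

definition L2_inner :: "(real \<Rightarrow> real) \<Rightarrow> (real \<Rightarrow> real) \<Rightarrow> (real \<Rightarrow> real) \<Rightarrow> real" where
  "L2_inner w f g = (LBINT x:{0<..}. f x * g x * w x)"

text \<open>Membership in \<open>L2\<close> is demanded explicitly because \<open>L2_norm\<close> is \<open>0\<close> on functions that are
  not square integrable.\<close>

definition L2_tendsto ::
  "(real \<Rightarrow> real) \<Rightarrow> ('i \<Rightarrow> real \<Rightarrow> real) \<Rightarrow> (real \<Rightarrow> real) \<Rightarrow> 'i filter \<Rightarrow> bool" where
  "L2_tendsto w F f net \<longleftrightarrow>
     f \<in> L2 w \<and> (\<forall>\<^sub>F i in net. F i \<in> L2 w) \<and>
     ((\<lambda>i. L2_norm w (\<lambda>x. F i x - f x)) \<longlongrightarrow> 0) net"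

definition bounded_op :: "(real \<Rightarrow> real) \<Rightarrow> ((real \<Rightarrow> complex) \<Rightarrow> real \<Rightarrow> complex) \<Rightarrow> bool" where
  "bounded_op w A \<longleftrightarrow>
     (\<forall>f\<in>L2 w. A f \<in> L2 w) \<and>
     (\<forall>f\<in>L2 w. \<forall>g\<in>L2 w. \<forall>a b. AE x in wmeas w.
        A (\<lambda>y. a * f y + b * g y) x = a * A f x + b * A g x) \<and>
     (\<exists>C. \<forall>f\<in>L2 w. L2_norm w (A f) \<le> C * L2_norm w f)"

text \<open>Complex differentiability on \<open>Z\<close> with respect to the operator norm.\<close>

definition op_holomorphic_on ::
  "(real \<Rightarrow> real) \<Rightarrow> (complex \<Rightarrow> (real \<Rightarrow> complex) \<Rightarrow> real \<Rightarrow> complex) \<Rightarrow> complex set \<Rightarrow> bool" where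
  "op_holomorphic_on w A Z \<longleftrightarrow>
     (\<forall>z\<in>Z. bounded_op w (A z)) \<and>
     (\<forall>z0\<in>Z. \<exists>D. bounded_op w D \<and>
        (\<forall>\<epsilon>>0. \<forall>\<^sub>F z in at z0 within Z. \<forall>f\<in>L2 w.
           L2_norm w (\<lambda>x. (A z f x - A z0 f x) / (z - z0) - D f x) \<le> \<epsilon> * L2_norm w f))"

section \<open>Smoothness up to the boundary and local uniform convergence\<close>

text \<open>Derivatives are taken within \<open>S\<close>, hence are one-sided at boundary points of \<open>S\<close>.\<close>

primrec Ck_on :: "nat \<Rightarrow> ('a::real_normed_vector \<Rightarrow> real) \<Rightarrow> 'a set \<Rightarrow> bool" where
  "Ck_on 0 f S \<longleftrightarrow> continuous_on S f"
| "Ck_on (Suc k) f S \<longleftrightarrow>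
     (\<exists>f'. (\<forall>x\<in>S. (f has_derivative f' x) (at x within S)) \<and> (\<forall>v. Ck_on k (\<lambda>x. f' x v) S))"

definition smooth_on :: "('a::real_normed_vector \<Rightarrow> real) \<Rightarrow> 'a set \<Rightarrow> bool" where
  "smooth_on f S \<longleftrightarrow> (\<forall>k. Ck_on k f S)"

definition iter_deriv_within :: "real set \<Rightarrow> nat \<Rightarrow> (real \<Rightarrow> real) \<Rightarrow> real \<Rightarrow> real" where
  "iter_deriv_within S n = (\<lambda>g x. vector_derivative g (at x within S)) ^^ n"

definition locally_uniform_limit_on ::
  "'a::metric_space set \<Rightarrow> (nat \<Rightarrow> 'a \<Rightarrow> real) \<Rightarrow> ('a \<Rightarrow> real) \<Rightarrow> bool" where
  "locally_uniform_limit_on S F g \<longleftrightarrow>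
     (\<forall>a\<in>S. \<exists>r>0. uniform_limit (S \<inter> ball a r) F g sequentially)"

section \<open>Weights, polynomials and co-eigenfunctions\<close>

definition e_w :: "real \<Rightarrow> real \<Rightarrow> real \<Rightarrow> real" where
  "e_w \<alpha> \<beta> x =
     x powr (\<beta> + 1/\<alpha> - 1) * exp (- (x powr (1/\<alpha>))) / (\<alpha> * Gamma (\<alpha> * \<beta> + 1))"

definition e_lag :: "real \<Rightarrow> real" where
  "e_lag x = exp (- x)"

definition e_bar :: "real \<Rightarrow> real \<Rightarrow> real \<Rightarrow> real \<Rightarrow> real \<Rightarrow> real" where
  "e_bar \<eta> \<gamma> \<beta> \<alpha> x = x powr (\<beta> + 1/\<alpha> - 1) * exp (\<eta> * x powr (1/\<gamma>))"

definition P_poly :: "real \<Rightarrow> real \<Rightarrow> nat \<Rightarrow> real \<Rightarrow> real" where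
  "P_poly \<alpha> \<beta> n x =
     Gamma (\<alpha> * \<beta> + 1) *
     (\<Sum>k\<le>n. (-1) ^ k * real (n choose k) / Gamma (\<alpha> * real k + \<alpha> * \<beta> + 1) * x ^ k)"

definition R_fun :: "real \<Rightarrow> real \<Rightarrow> nat \<Rightarrow> real \<Rightarrow> real" where
  "R_fun \<alpha> \<beta> n x = 1 / (fact n * e_w \<alpha> \<beta> x) * (deriv ^^ n) (\<lambda>y. y ^ n * e_w \<alpha> \<beta> y) x"

definition W_fun :: "real \<Rightarrow> real \<Rightarrow> nat \<Rightarrow> real \<Rightarrow> real" where
  "W_fun \<alpha> \<beta> n y = R_fun \<alpha> \<beta> n y * e_w \<alpha> \<beta> y"

definition T_crit :: "real \<Rightarrow> real" where
  "T_crit \<alpha> = - ln (2 powr \<alpha> - 1)"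

section \<open>The operator \<open>\<Lambda>\<close>\<close>

definition is_lambda_density :: "real \<Rightarrow> real \<Rightarrow> (real \<Rightarrow> real) \<Rightarrow> bool" where
  "is_lambda_density \<alpha> \<beta> lam \<longleftrightarrow>
     (\<forall>y>0. 0 \<le> lam y) \<and>
     set_integrable lborel {0<..} lam \<and> (LBINT y:{0<..}. lam y) = 1 \<and>
     (\<forall>s::complex. Re s > -1 \<longrightarrow>
        set_integrable lborel {0<..} (\<lambda>y. complex_of_real y powr s * complex_of_real (lam y)) \<and>
        (LBINT y:{0<..}. complex_of_real y powr s * complex_of_real (lam y)) =
          Gamma (s + 1) * Gamma (of_real (\<alpha> * \<beta> + 1)) / Gamma (of_real \<alpha> * s + of_real (\<alpha> * \<beta> + 1)))"

definition Lambda_op :: "(real \<Rightarrow> real) \<Rightarrow> (real \<Rightarrow> real) \<Rightarrow> real \<Rightarrow> real" where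
  "Lambda_op lam f x = (LBINT y:{0<..}. f (x * y) * lam y)"

definition Ran_Lambda :: "real \<Rightarrow> real \<Rightarrow> (real \<Rightarrow> real) \<Rightarrow> (real \<Rightarrow> real) set" where
  "Ran_Lambda \<alpha> \<beta> lam =
     {f \<in> L2 (e_w \<alpha> \<beta>). \<exists>g\<in>L2 e_lag. AE x in wmeas (e_w \<alpha> \<beta>). f x = Lambda_op lam g x}"

section \<open>The Gauss-Laguerre semigroup\<close>

abbreviation half_line :: "real measure" where
  "half_line \<equiv> restrict_space borel {0..}"

definition C0 :: "(real \<Rightarrow> real) set" where
  "C0 = {f. continuous_on {0..} f \<and> (f \<longlongrightarrow> 0) at_top}"

text \<open>The semigroup is given by its transition kernels (heat kernel) \<open>K t x\<close>, probability measures
  on \<open>[0, \<infinity>)\<close> for \<open>t \<ge> 0\<close> and \<open>x \<ge> 0\<close>.\<close>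

definition sg :: "(real \<Rightarrow> real \<Rightarrow> real measure) \<Rightarrow> real \<Rightarrow>
    (real \<Rightarrow> 'b::{banach, second_countable_topology}) \<Rightarrow> real \<Rightarrow> 'b" where
  "sg K t f x = (LINT y|K t x. f y)"

definition feller_semigroup :: "(real \<Rightarrow> real \<Rightarrow> real measure) \<Rightarrow> bool" where
  "feller_semigroup K \<longleftrightarrow>
     (\<forall>t\<ge>0. K t \<in> half_line \<rightarrow>\<^sub>M prob_algebra half_line) \<and>
     (\<forall>x\<ge>0. K 0 x = return half_line x) \<and>
     (\<forall>s\<ge>0. \<forall>t\<ge>0. \<forall>x\<ge>0. K (s + t) x = K s x \<bind> K t) \<and>
     (\<forall>t\<ge>0. \<forall>f\<in>C0. sg K t f \<in> C0) \<and>
     (\<forall>f\<in>C0. uniform_limit {0..} (\<lambda>t. sg K t f) f (at_right 0))"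

text \<open>The contraction semigroup on the weighted space is realised by the same kernels: it is the
  extension by continuity from \<open>C0\<close>.  The semigroup law is already part of
  \<open>feller_semigroup\<close>.\<close>

definition L2_contraction_semigroup ::
  "(real \<Rightarrow> real) \<Rightarrow> (real \<Rightarrow> real \<Rightarrow> real measure) \<Rightarrow> bool" where
  "L2_contraction_semigroup w K \<longleftrightarrow>
     (\<forall>f\<in>L2 w. \<forall>t\<ge>0.
        (AE x in wmeas w. integrable (K t x) f) \<and>
        sg K t f \<in> L2 w \<and> L2_norm w (sg K t f) \<le> L2_norm w (f :: real \<Rightarrow> real)) \<and>
     (\<forall>f\<in>L2 w. L2_tendsto w (\<lambda>t. sg K t f) f (at_right 0))"

definition L2_generator ::
  "(real \<Rightarrow> real) \<Rightarrow> (real \<Rightarrow> real \<Rightarrow> real measure) \<Rightarrow> (real \<Rightarrow> real) \<Rightarrow> (real \<Rightarrow> real) \<Rightarrow> bool" where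
  "L2_generator w K f g \<longleftrightarrow>
     f \<in> L2 w \<and> L2_tendsto w (\<lambda>t x. (sg K t f x - f x) / t) g (at_right 0)"

definition d_GL :: "real \<Rightarrow> real \<Rightarrow> real" where
  "d_GL \<alpha> \<beta> = Gamma (\<alpha> * \<beta> + \<alpha> + 1) / Gamma (\<alpha> * \<beta> + 1)"

definition hyp2F1 :: "real \<Rightarrow> real \<Rightarrow> real \<Rightarrow> real \<Rightarrow> real" where
  "hyp2F1 a b c z = eval_fps (fps_hypergeo [a, b] [c] 1) z"

definition g_GL :: "real \<Rightarrow> real \<Rightarrow> real \<Rightarrow> real" where
  "g_GL \<alpha> \<beta> y =
     Gamma \<alpha> / (\<beta> + 1/\<alpha> + 1) * y powr (\<beta> + 1/\<alpha> + 1) *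
     hyp2F1 (\<alpha> * (\<beta> + 1) + 1) (\<alpha> + 1) (\<alpha> * (\<beta> + 1) + 2) (y powr (1/\<alpha>))"

definition L_GL :: "real \<Rightarrow> real \<Rightarrow> (real \<Rightarrow> real) \<Rightarrow> real \<Rightarrow> real" where
  "L_GL \<alpha> \<beta> f x =
     (d_GL \<alpha> \<beta> - x) * deriv f x +
     sin (\<alpha> * pi) / pi * x * (LBINT y:{0<..<1}. (deriv ^^ 2) f (x * y) * g_GL \<alpha> \<beta> y)"

text \<open>The last conjunct says that the polynomials are a core: they are dense in the domain of the
  generator for the graph norm.\<close>

definition gauss_laguerre_semigroup ::
  "real \<Rightarrow> real \<Rightarrow> (real \<Rightarrow> real \<Rightarrow> real measure) \<Rightarrow> bool" where
  "gauss_laguerre_semigroup \<alpha> \<beta> K \<longleftrightarrow>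
     feller_semigroup K \<and>
     L2_contraction_semigroup (e_w \<alpha> \<beta>) K \<and>
     (\<forall>p. L2_generator (e_w \<alpha> \<beta>) K (poly p) (L_GL \<alpha> \<beta> (poly p))) \<and>
     (\<forall>f g. L2_generator (e_w \<alpha> \<beta>) K f g \<longrightarrow>
        (\<forall>\<epsilon>>0. \<exists>p. L2_norm (e_w \<alpha> \<beta>) (\<lambda>x. f x - poly p x) < \<epsilon> \<and>
                   L2_norm (e_w \<alpha> \<beta>) (\<lambda>x. g x - L_GL \<alpha> \<beta> (poly p) x) < \<epsilon>))"

end

theory Submission
  imports Defs "HOL-Complex_Analysis.Complex_Analysis"
begin

text \<open>
  Write \<open>W\<^sub>n = R\<^sub>n e\<close> for the co-eigenfunctions multiplied by the weight
  \<open>e\<close>, and \<open>m\<^sub>k = \<Gamma>(\<alpha>k + \<alpha>\<beta> + 1) / \<Gamma>(\<alpha>\<beta> + 1)\<close> for the moments of the weight. The proof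
  rests on the generating function
  \<open>\<Sum>n. W\<^sub>n(y) q\<^sup>n = e(y / (1 - q)) / (1 - q)\<close> for \<open>|q| < 1\<close> (\<open>rodrigues_sums\<close>).

  Integrated against powers, it gives the biorthogonality of the \<open>W\<^sub>n\<close> and the \<open>P\<^sub>n\<close>. Cauchy's
  inequality on a circle in the \<open>q\<close>-plane gives the size of the \<open>W\<^sub>n\<close>: as long as
  \<open>|q| \<le> (1 + r)\<^sup>\<alpha> - 1\<close>, the dilated weight decays at least like \<open>exp(- y\<^bsup>1/\<alpha>\<^esup> / (1 + r))\<close>, and
  for \<open>r < 1\<close> this is square integrable against \<open>1/e\<close>. As \<open>r\<close> tends to \<open>1\<close>, the radius tends to
  \<open>2\<^sup>\<alpha> - 1 = exp(- T\<^sub>\<alpha>)\<close>; hence \<open>|\<langle>f, R\<^sub>n\<rangle>|\<close> grows at most like \<open>exp(\<tau> n)\<close> for each \<open>\<tau> > T\<^sub>\<alpha>\<close>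
  (\<open>coeff_L2_bound\<close>), which is where the critical time comes from. The \<open>P\<^sub>n\<close> in turn grow
  subexponentially in \<open>n\<close>, locally uniformly in the complex plane, because \<open>m\<^sub>k\<close> grows faster than
  any geometric sequence (\<open>cP_bound\<close>). Moreover \<open>\<parallel>P\<^sub>n\<parallel> \<le> 1\<close> (\<open>P_norm_le_1\<close>): if \<open>X\<close> and \<open>Y\<close> are
  independent with densities \<open>e\<close> and \<open>\<lambda>\<close>, then \<open>X Y\<close> has the moments \<open>k!\<close> and so is exponentially
  distributed, \<open>P\<^sub>n(X)\<close> is the conditional mean of the Laguerre polynomial \<open>L\<^sub>n(X Y)\<close>, and
  Jensen's inequality applies.

  The semigroup enters as follows. The generator maps \<open>P\<^sub>n\<close> to \<open>- n P\<^sub>n\<close> (\<open>L_GL_P\<close>, by termwise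
  integration of the hypergeometric series), and the contraction property turns this into
  \<open>P\<^sub>t P\<^sub>n = exp(- n t) P\<^sub>n\<close> (\<open>sg_P\<close>). For \<open>t > T\<^sub>\<alpha>\<close> the series \<open>\<Sum>n. exp(- n t) P\<^sub>n(x) W\<^sub>n(y)\<close> has
  exponential moments in \<open>y\<close>; by biorthogonality and the eigenvalue equation its moments are those
  of the transition kernel, and a measure with exponential moments is determined by its moments
  (\<open>moments_determine_density\<close>). So the series is the transition density for almost all \<open>x\<close>
  (\<open>sg_large_t\<close>). Expanding \<open>P\<^sub>t P\<^sub>s f = P\<^bsub>t+s\<^esub> f\<close> in two ways for large \<open>t\<close> gives
  \<open>\<langle>P\<^sub>s f, R\<^sub>n\<rangle> = exp(- n s) \<langle>f, R\<^sub>n\<rangle>\<close> for every \<open>s \<ge> 0\<close>, and since the \<open>R\<^sub>n\<close> are complete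
  (\<open>coeff_complete\<close>) the expansion of \<open>P\<^sub>s f\<close> holds whenever \<open>exp(- n s) \<langle>f, R\<^sub>n\<rangle>\<close> decays
  geometrically (\<open>sg_expansion\<close>). That is the case for \<open>s > T\<^sub>\<alpha>\<close> in general, and for all \<open>s > 0\<close> if
  the coefficients grow subexponentially: for \<open>f = \<Lambda> g\<close> the coefficients are those of \<open>g\<close> in the
  Laguerre basis, for \<open>f\<close> in \<open>L\<^sup>2\<close> of the heavy weight the cruder bound
  \<open>|W\<^sub>n(y)| \<le> C\<^sub>r(y) r\<^bsup>-n\<^esup>\<close>, valid for every \<open>r < 1\<close> with \<open>C\<^sub>r(y)\<close> growing in \<open>y\<close>, can be integrated
  against \<open>f\<close>, and the same is true of bounded functions with bounded support.

  Continuous functions with compact support determine the kernel. For them the Feller property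
  extends the expansion from almost every \<open>x > 0\<close> to every \<open>x \<ge> 0\<close>, which identifies the heat kernel
  for all \<open>t > 0\<close> (\<open>K_eq_heat_density\<close>). Cauchy estimates for the derivatives of \<open>P\<^sub>n\<close> and \<open>W\<^sub>n\<close>
  make all termwise differentiated series converge locally uniformly, which gives smoothness; the
  strong Feller property is Scheffe's lemma for the densities; and holomorphy in the operator norm
  reduces to an estimate of the scalar functions \<open>exp(- n z)\<close>.
\<close>

section \<open>Rodrigues formulas and their generating functions\<close>

text \<open>
  The Leibniz rule for a product with the identity, all of whose derivatives beyond the first vanish.
\<close>

lemma higher_deriv_ident_mult:
  fixes f :: "complex \<Rightarrow> complex"
  assumes "f holomorphic_on S" "open S" "z \<in> S"
  shows "(deriv ^^ Suc n) (\<lambda>w. w * f w) z =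
           z * (deriv ^^ Suc n) f z + of_nat (Suc n) * (deriv ^^ n) f z"
  using assms(3)
proof (induction n arbitrary: z)
  case 0
  have "(f has_field_derivative deriv f z) (at z)"
    using assms(1,2) 0 holomorphic_derivI by blast
  then have "((\<lambda>w. w * f w) has_field_derivative (1 * f z + deriv f z * z)) (at z)"
    by (intro DERIV_mult DERIV_ident)
  then show ?case by (simp add: DERIV_imp_deriv)
next
  case (Suc n)
  have h: "(deriv ^^ k) f holomorphic_on S" for k
    using assms by (simp add: holomorphic_higher_deriv)
  have d: "((deriv ^^ k) f has_field_derivative (deriv ^^ Suc k) f z) (at z)" for k
    using holomorphic_derivI[OF h assms(2) Suc.prems] by simp
  have ev: "\<forall>\<^sub>F w in nhds z. (deriv ^^ Suc n) (\<lambda>w. w * f w) w =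
       w * (deriv ^^ Suc n) f w + of_nat (Suc n) * (deriv ^^ n) f w"
    using eventually_nhds_in_open[OF assms(2) Suc.prems]
    by eventually_elim (rule Suc.IH)
  have "((\<lambda>w. w * (deriv ^^ Suc n) f w + of_nat (Suc n) * (deriv ^^ n) f w) has_field_derivative
     (1 * (deriv ^^ Suc n) f z + (deriv ^^ Suc (Suc n)) f z * z + of_nat (Suc n) * (deriv ^^ Suc n) f z)) (at z)"
    by (intro DERIV_add DERIV_mult DERIV_cmult DERIV_ident d)
  then have "deriv (\<lambda>w. w * (deriv ^^ Suc n) f w + of_nat (Suc n) * (deriv ^^ n) f w) z =
     (1 * (deriv ^^ Suc n) f z + (deriv ^^ Suc (Suc n)) f z * z + of_nat (Suc n) * (deriv ^^ Suc n) f z)"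
    by (rule DERIV_imp_deriv)
  moreover have "(deriv ^^ Suc (Suc n)) (\<lambda>w. w * f w) z =
     deriv (\<lambda>w. w * (deriv ^^ Suc n) f w + of_nat (Suc n) * (deriv ^^ n) f w) z"
    using deriv_cong_ev[OF ev refl] by (simp only: funpow.simps o_apply)
  ultimately show ?case by (simp add: algebra_simps del: funpow.simps)
qed

lemma one_minus_nz: "cmod q < 1 \<Longrightarrow> 1 - q \<noteq> 0"
  by auto

text \<open>
  With \<open>v = 1 / (1 - q)\<close>, the \<open>n\<close>-th derivative of \<open>v F(z v)\<close> with respect to \<open>q\<close> is
  \<open>v\<^bsup>n+1\<^esup>\<close> times the \<open>n\<close>-th derivative of \<open>w\<^sup>n F(w)\<close> at \<open>z v\<close>: the inductive step is the Leibniz rule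
  above. At \<open>q = 0\<close> this says that the Rodrigues expressions are Taylor coefficients.
\<close>

lemma rodrigues_sums:
  fixes F :: "complex \<Rightarrow> complex"
  assumes F: "F holomorphic_on S" "open S"
    and S: "\<And>q. cmod q < 1 \<Longrightarrow> z / (1 - q) \<in> S" and q: "cmod q < 1"
  shows "(\<lambda>n. (deriv ^^ n) (\<lambda>w. w ^ n * F w) z / fact n * q ^ n) sums (F (z / (1 - q)) / (1 - q))"
proof -
  define G where "G = (\<lambda>q. F (z / (1 - q)) / (1 - q))"
  have hol: "(\<lambda>w. w ^ n * F w) holomorphic_on S" for n
    using F by (intro holomorphic_intros)
  have hold: "(deriv ^^ k) (\<lambda>w. w ^ n * F w) holomorphic_on S" for n k
    using hol F by (simp add: holomorphic_higher_deriv)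
  have key: "(deriv ^^ n) G q = (1 / (1 - q)) ^ Suc n * (deriv ^^ n) (\<lambda>w. w ^ n * F w) (z / (1 - q))"
    if "q \<in> ball 0 1" for n q
    using that
  proof (induction n arbitrary: q)
    case 0
    then show ?case by (simp add: G_def)
  next
    case (Suc n)
    let ?H = "(deriv ^^ n) (\<lambda>w. w ^ n * F w)"
    have nz: "1 - q \<noteq> 0" using Suc.prems one_minus_nz by auto
    have inS: "z / (1 - q) \<in> S" using S Suc.prems by simp
    have ev: "\<forall>\<^sub>F q in nhds q. (deriv ^^ n) G q = (1 / (1 - q)) ^ Suc n * ?H (z / (1 - q))"
      using eventually_nhds_in_open[OF open_ball Suc.prems]
      by eventually_elim (rule Suc.IH)
    have dH: "(?H has_field_derivative deriv ?H (z / (1 - q))) (at (z / (1 - q)))"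
      using holomorphic_derivI[OF hold F(2) inS] .
    have dv: "((\<lambda>q. z / (1 - q)) has_field_derivative z / (1 - q)^2) (at q)"
      by (rule derivative_eq_intros refl nz | simp add: nz power2_eq_square)+
    have d1: "((\<lambda>q. ?H (z / (1 - q))) has_field_derivative deriv ?H (z / (1 - q)) * (z / (1 - q)^2)) (at q)"
      using DERIV_chain2[OF dH dv] .
    have d2: "((\<lambda>q. (1 / (1 - q)) ^ Suc n) has_field_derivative of_nat (Suc n) * (1 / (1 - q)) ^ n * (1 / (1 - q)^2)) (at q)"
      by (rule derivative_eq_intros refl nz | simp add: nz power2_eq_square)+
    have "((\<lambda>q. (1 / (1 - q)) ^ Suc n * ?H (z / (1 - q))) has_field_derivative
        of_nat (Suc n) * (1 / (1 - q)) ^ n * (1 / (1 - q)^2) * ?H (z / (1 - q)) +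
        deriv ?H (z / (1 - q)) * (z / (1 - q)^2) * (1 / (1 - q)) ^ Suc n) (at q)"
      by (rule DERIV_mult[OF d2 d1])
    then have "deriv (\<lambda>q. (1 / (1 - q)) ^ Suc n * ?H (z / (1 - q))) q =
        of_nat (Suc n) * (1 / (1 - q)) ^ n * (1 / (1 - q)^2) * ?H (z / (1 - q)) +
        deriv ?H (z / (1 - q)) * (z / (1 - q)^2) * (1 / (1 - q)) ^ Suc n"
      by (rule DERIV_imp_deriv)
    also have "\<dots> = (1 / (1 - q)) ^ Suc (Suc n) * (z / (1 - q) * (deriv ^^ Suc n) (\<lambda>w. w ^ n * F w) (z / (1 - q))
            + of_nat (Suc n) * ?H (z / (1 - q)))"
    proof -
      define v where "v = 1 / (1 - q)"
      have "1 / (1 - q)^2 = v * v" "z / (1 - q)^2 = z * v * v" "z / (1 - q) = z * v"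
        by (simp_all add: v_def power2_eq_square)
      then show ?thesis
        by (simp only: v_def[symmetric] funpow.simps o_apply power_Suc) (simp add: algebra_simps)
    qed
    also have "\<dots> = (1 / (1 - q)) ^ Suc (Suc n) * (deriv ^^ Suc n) (\<lambda>w. w * (w ^ n * F w)) (z / (1 - q))"
      by (subst higher_deriv_ident_mult[OF hol F(2) inS]) simp
    also have "(\<lambda>w. w * (w ^ n * F w)) = (\<lambda>w. w ^ Suc n * F w)"
      by (simp add: mult_ac)
    finally show ?case using deriv_cong_ev[OF ev refl] by (simp only: funpow.simps o_apply)
  qed
  have "G holomorphic_on ball 0 1"
  proof -
    have "(\<lambda>q. F (z / (1 - q))) holomorphic_on ball 0 1"
      by (rule holomorphic_on_compose_gen[of "\<lambda>q. z / (1 - q)" _ F S, unfolded o_def])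
         (auto intro!: holomorphic_intros F S simp: one_minus_nz)
    then show ?thesis unfolding G_def by (intro holomorphic_intros) (auto simp: one_minus_nz)
  qed
  from holomorphic_power_series[OF this, of q]
  have "(\<lambda>n. (deriv ^^ n) G 0 / fact n * (q - 0) ^ n) sums G q" using q by simp
  then show ?thesis using key[of 0] by (simp add: G_def)
qed

text \<open>
  Cauchy's inequality, phrased for the coefficients of a convergent power series.
\<close>

lemma cauchy_coeff_bound:
  fixes a :: "nat \<Rightarrow> complex"
  assumes sm: "\<And>q. cmod q < 1 \<Longrightarrow> (\<lambda>n. a n * q ^ n) sums G q"
    and r: "0 < r" "r < 1" and B: "\<And>q. cmod q = r \<Longrightarrow> cmod (G q) \<le> B"
  shows "cmod (a n) \<le> B / r ^ n"
proof -
  have holG: "G holomorphic_on ball 0 1"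
    by (rule power_series_holomorphic[where a=a]) (use sm in auto)
  have cf: "a n = (deriv ^^ n) G 0 / fact n"
  proof -
    have "G has_fps_expansion Abs_fps a"
      unfolding has_fps_expansion_def
    proof (intro conjI)
      have "summable (\<lambda>n. fps_nth (Abs_fps a) n * (of_real (1/2)) ^ n)"
        using sm[of "of_real (1/2)"] by (auto simp: sums_iff norm_divide)
      then have "ereal (norm (of_real (1/2)::complex)) \<le> fps_conv_radius (Abs_fps a)"
        unfolding fps_conv_radius_def by (rule conv_radius_geI)
      then show "fps_conv_radius (Abs_fps a) > 0"
        by (rule less_le_trans[rotated]) (simp add: norm_divide zero_ereal_def)
      have "\<forall>\<^sub>F z in nhds 0. z \<in> ball (0::complex) 1"
        by (rule eventually_nhds_in_open) auto
      then show "\<forall>\<^sub>F z in nhds 0. eval_fps (Abs_fps a) z = G z"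
        by eventually_elim (use sm in \<open>auto simp: eval_fps_def sums_iff\<close>)
    qed
    then show ?thesis by (metis fps_nth_Abs_fps fps_nth_fps_expansion)
  qed
  have "cmod ((deriv ^^ n) G 0) \<le> fact n * B / r ^ n"
    by (rule Cauchy_inequality)
       (use r B in \<open>auto intro!: holomorphic_on_subset[OF holG]
          holomorphic_on_imp_continuous_on[OF holomorphic_on_subset[OF holG]]\<close>)
  then show ?thesis by (simp add: cf norm_divide field_simps)
qed

text \<open>
  All functions whose derivatives occur are restrictions of holomorphic ones. This transfers to the
  real line the existence of derivatives of every order, and Cauchy's inequality for them.
\<close>

lemma higher_deriv_complex_of_real:
  fixes F :: "complex \<Rightarrow> complex" and f :: "real \<Rightarrow> real"
  assumes F: "F holomorphic_on S" "open S" and U: "open U" "of_real ` U \<subseteq> S"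
    and eq: "\<And>x. x \<in> U \<Longrightarrow> F (of_real x) = of_real (f x)" and x: "x \<in> U"
  shows "(deriv ^^ n) F (of_real x) = of_real ((deriv ^^ n) f x)"
    and "((deriv ^^ n) f has_real_derivative (deriv ^^ Suc n) f x) (at x)"
proof -
  have gen: "(deriv ^^ n) F (of_real x) = of_real ((deriv ^^ n) f x) \<and>
      ((deriv ^^ n) f has_real_derivative (deriv ^^ Suc n) f x) (at x)" if "x \<in> U" for x n
    using that
  proof (induction n arbitrary: x)
    have step: "(g has_real_derivative deriv g x) (at x) \<and> deriv G (of_real x) = of_real (deriv g x)"
      if G: "G holomorphic_on S" and e: "\<And>x. x \<in> U \<Longrightarrow> G (of_real x) = of_real (g x)" and xU: "x \<in> U"
      for G :: "complex \<Rightarrow> complex" and g :: "real \<Rightarrow> real" and x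
    proof -
      have "(G has_field_derivative deriv G (of_real x)) (at (of_real x))"
        using holomorphic_derivI[OF G F(2)] U(2) xU by blast
      then have "((\<lambda>t. G (of_real t)) has_vector_derivative deriv G (of_real x)) (at x)"
        by (rule has_vector_derivative_real_field)
      then have v: "((\<lambda>t. of_real (g t) :: complex) has_vector_derivative deriv G (of_real x)) (at x)"
        by (rule has_vector_derivative_transform_within_open[OF _ U(1) xU]) (simp add: e)
      have re: "(g has_real_derivative Re (deriv G (of_real x))) (at x)"
        using bounded_linear.has_vector_derivative[OF bounded_linear_Re v] by (simp add: o_def has_real_derivative_iff_has_vector_derivative)
      have im: "((\<lambda>t. 0::real) has_vector_derivative Im (deriv G (of_real x))) (at x)"
        using bounded_linear.has_vector_derivative[OF bounded_linear_Im v] by (simp add: o_def)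
      have "Im (deriv G (of_real x)) = 0"
        using vector_derivative_unique_at[OF im has_vector_derivative_const] .
      moreover have "deriv g x = Re (deriv G (of_real x))" using re by (rule DERIV_imp_deriv)
      ultimately show ?thesis using re by (simp add: complex_eq_iff)
    qed
    {
      case 0
      show ?case using step[OF F(1) eq 0] by (simp add: eq 0)
    next
      case (Suc n)
      have h: "(deriv ^^ n) F holomorphic_on S" "(deriv ^^ Suc n) F holomorphic_on S"
        using F holomorphic_higher_deriv by blast+
      have e: "\<And>x. x \<in> U \<Longrightarrow> (deriv ^^ n) F (of_real x) = of_real ((deriv ^^ n) f x)"
        using Suc.IH by blast
      have e': "(deriv ^^ Suc n) F (of_real x) = of_real ((deriv ^^ Suc n) f x)" if "x \<in> U" for x
        using step[OF h(1) e that] by simp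
      show ?case using step[OF h(2) e' Suc.prems] e'[OF Suc.prems] by simp
    }
  qed
  from gen[OF x] show "(deriv ^^ n) F (of_real x) = of_real ((deriv ^^ n) f x)"
    "((deriv ^^ n) f has_real_derivative (deriv ^^ Suc n) f x) (at x)" by auto
qed

section \<open>Complex powers\<close>

lemma cmod_powr_of_real: "z \<noteq> 0 \<Longrightarrow> cmod (z powr of_real a) = cmod z powr a"
  by (simp add: powr_def)

text \<open>
  For given \<open>|q|\<close> the extreme case is \<open>q < 0\<close>: along the segment from \<open>0\<close> to \<open>q\<close> the derivative of
  \<open>(1 - s q)\<^sup>a\<close> is dominated by that of \<open>(1 + s |q|)\<^sup>a\<close>, because \<open>a - 1 \<ge> 0\<close>.
\<close>

lemma cmod_one_minus_powr_le:
  assumes a: "1 \<le> a" and q: "cmod q < 1"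
  shows "cmod ((1 - q) powr of_real a - 1) \<le> (1 + cmod q) powr a - 1"
proof -
  let ?f = "\<lambda>s::real. (1 - of_real s * q) powr of_real a"
  let ?g = "\<lambda>s::real. (1 + s * cmod q) powr a"
  have sq: "cmod (of_real s * q) < 1" if "s \<in> {0..1}" for s
    using that q by (auto simp: norm_mult intro: le_less_trans[OF mult_left_le_one_le])
  have re: "Re (1 - of_real s * q) > 0" if "s \<in> {0..1}" for s
    using sq[OF that] abs_Re_le_cmod[of "of_real s * q"] by simp
  have df: "(?f has_vector_derivative (of_real a * (1 - of_real s * q) powr (of_real a - 1) * (- q))) (at s within {0..1})"
    if s: "s \<in> {0..1}" for s
  proof -
    have np: "1 - of_real s * q \<notin> \<real>\<^sub>\<le>\<^sub>0" using re[OF s] by (auto simp: complex_nonpos_Reals_iff)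
    have "((\<lambda>w. (1 - w * q) powr of_real a) has_field_derivative
        (of_real a * (1 - of_real s * q) powr (of_real a - 1) * (- q))) (at (of_real s))"
      using np by (auto intro!: derivative_eq_intros)
    from has_vector_derivative_real_field[OF this] show ?thesis
      by (rule has_vector_derivative_at_within)
  qed
  have dg: "(?g has_vector_derivative (a * (1 + s * cmod q) powr (a - 1) * cmod q)) (at s within {0..1})"
    if s: "s \<in> {0..1}" for s
  proof -
    have "0 < 1 + s * cmod q" using s by (auto intro: add_pos_nonneg)
    then have "(?g has_real_derivative (a * (1 + s * cmod q) powr (a - 1) * cmod q)) (at s)"
      by (auto intro!: derivative_eq_intros)
    then show ?thesis
      by (simp add: has_real_derivative_iff_has_vector_derivative has_vector_derivative_at_within)
  qed
  have le: "norm (of_real a * (1 - of_real s * q) powr (of_real a - 1) * (- q)) \<le>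
        a * (1 + s * cmod q) powr (a - 1) * cmod q" if s: "s \<in> {0..1}" for s
  proof -
    have "cmod ((1 - of_real s * q) powr (of_real (a - 1))) = cmod (1 - of_real s * q) powr (a - 1)"
      using re[OF s] by (intro cmod_powr_of_real) (metis less_irrefl zero_complex.sel(1))
    also have "\<dots> \<le> (1 + s * cmod q) powr (a - 1)"
      using a s norm_triangle_ineq4[of 1 "of_real s * q"] by (intro powr_mono2) (auto simp: norm_mult)
    finally show ?thesis using a by (auto simp: norm_mult intro!: mult_right_mono mult_left_mono)
  qed
  have "norm (?f 1 - ?f 0) \<le> ?g 1 - ?g 0"
  proof (rule differentiable_bound_general[where f'="\<lambda>s. of_real a * (1 - of_real s * q) powr (of_real a - 1) * (- q)"
        and \<phi>'="\<lambda>s. a * (1 + s * cmod q) powr (a - 1) * cmod q"])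
    show "continuous_on {0..1} ?f" using df has_vector_derivative_continuous continuous_on_eq_continuous_within by blast
    show "continuous_on {0..1} ?g" using dg has_vector_derivative_continuous continuous_on_eq_continuous_within by blast
    fix s :: real assume s: "0 < s" "s < 1"
    then have s': "s \<in> {0..1}" by auto
    have i: "at s within {0..1} = at s" using s by (intro at_within_interior) auto
    show "(?f has_vector_derivative (of_real a * (1 - of_real s * q) powr (of_real a - 1) * (- q))) (at s)"
      using df[OF s'] i by simp
    show "(?g has_vector_derivative (a * (1 + s * cmod q) powr (a - 1) * cmod q)) (at s)"
      using dg[OF s'] i by simp
    show "norm (of_real a * (1 - of_real s * q) powr (of_real a - 1) * (- q)) \<le>
        a * (1 + s * cmod q) powr (a - 1) * cmod q" using le[OF s'] .
  qed simp
  then show ?thesis by simp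
qed

text \<open>
  Inversion maps the disc of radius \<open>r\<close> around \<open>1\<close> to the disc with diameter from \<open>1 / (1 + r)\<close> to
  \<open>1 / (1 - r)\<close>.
\<close>

lemma Re_inverse_ge:
  assumes "cmod (\<xi> - 1) \<le> r" "0 \<le> r" "r < 1"
  shows "Re (1 / \<xi>) \<ge> 1 / (1 + r)"
proof -
  have "cmod (\<xi> - 1)^2 \<le> r^2" using assms by (intro power_mono) auto
  then have 1: "(Re \<xi> - 1)^2 + (Im \<xi>)^2 \<le> r^2" by (simp add: cmod_power2)
  have re: "Re \<xi> \<le> 1 + r" using abs_Re_le_cmod[of "\<xi> - 1"] assms by simp
  have rp: "Re \<xi> > 0" using abs_Re_le_cmod[of "\<xi> - 1"] assms by simp
  have "(1 - r) * Re \<xi> \<le> (1 - r) * (1 + r)" using re assms by (intro mult_left_mono) auto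
  then have "(Re \<xi>)^2 + (Im \<xi>)^2 \<le> (1 + r) * Re \<xi>"
    using 1 by (simp add: power2_eq_square algebra_simps)
  moreover have "(Re \<xi>)^2 + (Im \<xi>)^2 > 0" using rp by (simp add: add_pos_nonneg)
  ultimately have "Re \<xi> / ((Re \<xi>)^2 + (Im \<xi>)^2) \<ge> 1 / (1 + r)"
    using assms by (simp add: field_simps)
  then show ?thesis by (simp add: Re_divide)
qed

text \<open>
  Used with \<open>a = 1/\<alpha>\<close>. For \<open>|q| \<le> (1 + r)\<^sup>\<alpha> - 1\<close> the point \<open>(1 - q)\<^bsup>1/\<alpha>\<^esup>\<close> stays in the disc of radius
  \<open>r\<close> around \<open>1\<close>, which bounds the decay of the weight after dilation by \<open>1 / (1 - q)\<close>.
\<close>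

lemma Re_inverse_powr_ge:
  assumes a: "1 \<le> a" and r: "0 \<le> r" "r < 1" and q: "cmod q < 1" "cmod q \<le> (1 + r) powr (1 / a) - 1"
  shows "Re ((1 / (1 - q)) powr of_real a) \<ge> 1 / (1 + r)"
proof -
  have re: "Re (1 - q) > 0" using abs_Re_le_cmod[of q] q by simp
  then have np: "1 - q \<notin> \<real>\<^sub>\<le>\<^sub>0" by (auto simp: complex_nonpos_Reals_iff)
  have "(1 + cmod q) powr a \<le> ((1 + r) powr (1/a)) powr a"
    using q a by (intro powr_mono2) auto
  also have "\<dots> = 1 + r" using a r by (simp add: powr_powr)
  finally have "cmod ((1 - q) powr of_real a - 1) \<le> r"
    using cmod_one_minus_powr_le[OF a q(1)] by simp
  from Re_inverse_ge[OF this r] have "Re (1 / ((1 - q) powr of_real a)) \<ge> 1 / (1 + r)" .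
  moreover have "(1 / (1 - q)) powr of_real a = 1 / ((1 - q) powr of_real a)"
    using np re one_minus_nz[OF q(1)] Ln_inverse[OF np] by (simp add: powr_def divide_inverse exp_minus)
  ultimately show ?thesis by simp
qed

section \<open>The co-eigenfunctions\<close>

text \<open>
  The boundary value \<open>\<alpha> = 1\<close> is included: with \<open>\<beta> = 0\<close> it gives the weight \<open>exp(- x)\<close> and the
  Laguerre polynomials, so that both sides of \<open>\<Lambda>\<close> are instances of one locale.
\<close>

locale gauss_laguerre_weight =
  fixes \<alpha> \<beta> :: real
  assumes \<alpha>_pos: "0 < \<alpha>" and \<alpha>_le_1: "\<alpha> \<le> 1" and \<beta>_ge: "1 - 1/\<alpha> \<le> \<beta>"
begin

abbreviation "\<delta> \<equiv> \<beta> + 1/\<alpha> - 1"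
abbreviation "c\<^sub>0 \<equiv> \<alpha> * Gamma (\<alpha> * \<beta> + 1)"
abbreviation "ew \<equiv> e_w \<alpha> \<beta>"
abbreviation "W \<equiv> W_fun \<alpha> \<beta>"

lemma \<delta>_nonneg: "\<delta> \<ge> 0"
  using \<beta>_ge by simp

lemma shape_ge: "\<alpha> * \<beta> + 1 \<ge> \<alpha>"
proof -
  have "\<alpha> * (1 - 1/\<alpha>) \<le> \<alpha> * \<beta>" using \<beta>_ge \<alpha>_pos by (intro mult_left_mono) auto
  then show ?thesis using \<alpha>_pos by (simp add: algebra_simps)
qed

lemma shape_pos: "\<alpha> * \<beta> + 1 > 0"
  using shape_ge \<alpha>_pos by linarith

lemma c\<^sub>0_pos: "c\<^sub>0 > 0"
  using \<alpha>_pos shape_pos by (simp add: Gamma_real_pos)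

lemma inverse_\<alpha>_ge_1: "1 \<le> 1 / \<alpha>"
  using \<alpha>_pos \<alpha>_le_1 by simp

lemma ew_pos: "x > 0 \<Longrightarrow> ew x > 0"
  using \<alpha>_pos shape_pos by (simp add: e_w_def Gamma_real_pos)

lemma ew_nonneg: "ew x \<ge> 0"
  using \<alpha>_pos shape_pos by (simp add: e_w_def Gamma_real_pos less_imp_le)

text \<open>
  The holomorphic continuation of the weight from the half-line.
\<close>

definition cew :: "complex \<Rightarrow> complex" where
  "cew z = z powr of_real \<delta> * exp (- (z powr of_real (1/\<alpha>))) / of_real c\<^sub>0"

definition cW :: "nat \<Rightarrow> complex \<Rightarrow> complex" where
  "cW n z = (deriv ^^ n) (\<lambda>w. w ^ n * cew w) z / fact n"

lemma cew_holomorphic: "cew holomorphic_on - \<real>\<^sub>\<le>\<^sub>0"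
  unfolding cew_def using c\<^sub>0_pos by (intro holomorphic_intros) auto

lemma cew_of_real: "x > 0 \<Longrightarrow> cew (of_real x) = of_real (ew x)"
  by (simp only: cew_def e_w_def powr_of_real less_imp_le) (simp flip: exp_of_real)

lemma open_slit: "open (- \<real>\<^sub>\<le>\<^sub>0 :: complex set)"
  using closed_nonpos_Reals_complex by (simp add: open_Compl)

lemma dilation_in_slit:
  assumes "Re z > 0" "cmod q < 1"
  shows "z / (1 - q) \<in> - \<real>\<^sub>\<le>\<^sub>0"
proof
  assume "z / (1 - q) \<in> \<real>\<^sub>\<le>\<^sub>0"
  then obtain s where s: "z / (1 - q) = of_real s" "s \<le> 0" by (auto elim: nonpos_Reals_cases)
  have "z = of_real s * (1 - q)" using s(1) one_minus_nz[OF assms(2)] by (simp add: field_simps)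
  then have "Re z = s * (1 - Re q)" by simp
  moreover have "1 - Re q > 0" using assms(2) abs_Re_le_cmod[of q] by simp
  ultimately show False using assms(1) mult_nonpos_nonneg[OF s(2), of "1 - Re q"] by simp
qed

lemma cW_sums:
  "Re z > 0 \<Longrightarrow> cmod q < 1 \<Longrightarrow> (\<lambda>n. cW n z * q ^ n) sums (cew (z / (1 - q)) / (1 - q))"
  unfolding cW_def
  by (rule rodrigues_sums[OF cew_holomorphic open_slit dilation_in_slit])

lemma right_half_slit: "{z. Re z > 0} \<subseteq> - \<real>\<^sub>\<le>\<^sub>0"
  by (auto simp: complex_nonpos_Reals_iff)

lemma open_right_half: "open {z. Re z > 0}"
  by (simp add: open_halfspace_Re_gt)

lemma cW_holomorphic: "cW n holomorphic_on {z. Re z > 0}"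
proof -
  have "(\<lambda>w. w ^ n * cew w) holomorphic_on {z. Re z > 0}"
    by (intro holomorphic_intros holomorphic_on_subset[OF cew_holomorphic right_half_slit])
  then show ?thesis unfolding cW_def[abs_def]
    by (intro holomorphic_on_divide holomorphic_on_const holomorphic_higher_deriv[OF _ open_right_half]) auto
qed

lemma W_eq: "x > 0 \<Longrightarrow> W n x = (deriv ^^ n) (\<lambda>y. y ^ n * ew y) x / fact n"
  using ew_pos[of x] by (simp add: W_fun_def R_fun_def)

lemma W_of_real: "x > 0 \<Longrightarrow> cW n (of_real x) = of_real (W n x)"
proof -
  assume x: "x > 0"
  have "(\<lambda>w. w ^ n * cew w) holomorphic_on - \<real>\<^sub>\<le>\<^sub>0"
    by (intro holomorphic_intros cew_holomorphic)
  from higher_deriv_complex_of_real(1)[OF this open_slit, of "{0<..}" "\<lambda>y. y ^ n * ew y" x n]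
  have "(deriv ^^ n) (\<lambda>w. w ^ n * cew w) (of_real x) = of_real ((deriv ^^ n) (\<lambda>y. y ^ n * ew y) x)"
    using x by (simp add: cew_of_real image_subset_iff)
  then show ?thesis using x by (simp add: cW_def W_eq)
qed

lemma
  assumes "x > 0"
  shows W_deriv_of_real: "(deriv ^^ k) (cW n) (of_real x) = of_real ((deriv ^^ k) (W n) x)"
    and W_has_deriv: "((deriv ^^ k) (W n) has_real_derivative (deriv ^^ Suc k) (W n) x) (at x)"
  using higher_deriv_complex_of_real[OF cW_holomorphic open_right_half, of "{0<..}" n "W n" x k] assms
  by (simp_all add: W_of_real image_subset_iff)

lemma W_sums:
  assumes x: "x > 0" and q: "\<bar>q\<bar> < 1"
  shows "(\<lambda>n. W n x * q ^ n) sums (ew (x / (1 - q)) / (1 - q))"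
proof -
  have "(\<lambda>n. cW n (of_real x) * of_real q ^ n) sums (cew (of_real x / (1 - of_real q)) / (1 - of_real q))"
    by (rule cW_sums) (use assms in auto)
  also have "(of_real x / (1 - of_real q) :: complex) = of_real (x / (1 - q))" by simp
  also have "cew (of_real (x / (1 - q))) / (1 - of_real q) = of_real (ew (x / (1 - q)) / (1 - q))"
    using x q by (subst cew_of_real) auto
  also have "(\<lambda>n. cW n (of_real x) * of_real q ^ n) = (\<lambda>n. of_real (W n x * q ^ n))"
    using x by (simp add: W_of_real)
  finally show ?thesis by (simp only: sums_of_real_iff)
qed

lemma W_measurable: "(\<lambda>x. indicator {0<..} x * W n x) \<in> borel_measurable borel"
proof -
  have "continuous_on {0<..} (W n)"
    using W_has_deriv[of _ 0 n] by (auto intro!: DERIV_isCont continuous_at_imp_continuous_on)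
  then have "(\<lambda>x. indicator {0<..} x *\<^sub>R W n x) \<in> borel_measurable borel"
    by (intro borel_measurable_continuous_on_indicator) auto
  then show ?thesis by simp
qed

lemma norm_dilation_le:
  assumes "cmod q = r" "r < 1"
  shows "cmod (1 / (1 - q)) \<le> 1 / (1 - r)" "cmod (z / (1 - q)) \<le> cmod z / (1 - r)"
proof -
  have "1 - r \<le> cmod (1 - q)" using norm_triangle_ineq2[of 1 q] assms by simp
  then show "cmod (1 / (1 - q)) \<le> 1 / (1 - r)" "cmod (z / (1 - q)) \<le> cmod z / (1 - r)"
    using assms by (auto simp: norm_divide intro!: frac_le)
qed

lemma cmod_cew: "z \<noteq> 0 \<Longrightarrow> cmod (cew z) = cmod z powr \<delta> * exp (- Re (z powr of_real (1/\<alpha>))) / c\<^sub>0"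
  by (simp only: cew_def norm_divide norm_mult cmod_powr_of_real norm_exp_eq_Re norm_of_real not_False_eq_True
      uminus_complex.sel abs_of_pos[OF c\<^sub>0_pos])

text \<open>
  A bound for the generating function on the circle \<open>|q| = r\<close> at modulus \<open>x\<close> of the space variable,
  which ignores the decay of the weight.
\<close>

definition cW_majorant :: "real \<Rightarrow> real \<Rightarrow> real" where
  "cW_majorant r x = (x / (1 - r)) powr \<delta> * exp ((x / (1 - r)) powr (1/\<alpha>)) / (c\<^sub>0 * (1 - r))"

lemma cW_majorant_mono: "0 \<le> x \<Longrightarrow> x \<le> y \<Longrightarrow> r < 1 \<Longrightarrow> cW_majorant r x \<le> cW_majorant r y"
  unfolding cW_majorant_def using \<delta>_nonneg c\<^sub>0_pos \<alpha>_pos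
  by (intro divide_right_mono mult_mono powr_mono2 iffD2[OF exp_le_cancel_iff] divide_right_mono) auto

text \<open>
  Cauchy's inequality for the generating function. Every \<open>r < 1\<close> is allowed, at the price of a bound
  that grows exponentially in \<open>|z|\<^bsup>1/\<alpha>\<^esup>\<close>.
\<close>

lemma cW_bound:
  assumes r: "0 < r" "r < 1" and z: "Re z > 0"
  shows "cmod (cW n z) \<le> cW_majorant r (cmod z) / r ^ n"
proof (rule cauchy_coeff_bound[OF cW_sums[OF z] r])
  fix q :: complex assume q: "cmod q = r"
  let ?w = "z / (1 - q)"
  have nz: "?w \<noteq> 0" using z q r one_minus_nz[of q] by auto
  have 1: "- Re (?w powr of_real (1/\<alpha>)) \<le> (cmod z / (1 - r)) powr (1/\<alpha>)"
  proof -
    have "- Re (?w powr of_real (1/\<alpha>)) \<le> cmod (?w powr of_real (1/\<alpha>))"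
      using abs_Re_le_cmod[of "?w powr of_real (1/\<alpha>)"] by linarith
    also have "\<dots> = cmod ?w powr (1/\<alpha>)" by (rule cmod_powr_of_real[OF nz])
    also have "\<dots> \<le> (cmod z / (1 - r)) powr (1/\<alpha>)"
      using norm_dilation_le(2)[OF q r(2), of z] \<alpha>_pos by (intro powr_mono2) auto
    finally show ?thesis .
  qed
  have 2: "cmod ?w powr \<delta> \<le> (cmod z / (1 - r)) powr \<delta>"
    using norm_dilation_le(2)[OF q r(2), of z] \<delta>_nonneg by (intro powr_mono2) auto
  have "cmod (cew ?w / (1 - q)) = cmod (cew ?w) * cmod (1 / (1 - q))"
    by (simp add: norm_divide)
  also have "\<dots> \<le> (cmod z / (1 - r)) powr \<delta> * exp ((cmod z / (1 - r)) powr (1/\<alpha>)) / c\<^sub>0 * (1 / (1 - r))"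
    unfolding cmod_cew[OF nz] using 1 2 c\<^sub>0_pos r norm_dilation_le(1)[OF q r(2)]
    by (intro mult_mono divide_right_mono) auto
  finally show "cmod (cew (z / (1 - q)) / (1 - q)) \<le> cW_majorant r (cmod z)"
    by (simp add: cW_majorant_def)
qed auto

lemma W_bound:
  assumes "0 < r" "r < 1" "x > 0"
  shows "\<bar>W n x\<bar> \<le> cW_majorant r x / r ^ n"
  using cW_bound[of r "of_real x" n] assms by (simp add: W_of_real)

lemma rate_bounds: "0 < r \<Longrightarrow> r < 1 \<Longrightarrow> 0 < (1 + r) powr \<alpha> - 1 \<and> (1 + r) powr \<alpha> - 1 \<le> r"
proof -
  assume r: "0 < r" "r < 1"
  have "1 < (1 + r) powr \<alpha>" using r \<alpha>_pos by (intro gr_one_powr) auto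
  moreover have "(1 + r) powr \<alpha> \<le> (1 + r) powr 1" using r \<alpha>_le_1 by (intro powr_mono) auto
  ultimately show ?thesis using r by simp
qed

text \<open>
  Cauchy's inequality on the smaller circle \<open>|q| = (1 + r)\<^sup>\<alpha> - 1\<close>, on which the generating function
  still decays in \<open>x\<close>. Decay in \<open>x\<close> is paid for by a worse geometric rate in \<open>n\<close>.
\<close>

lemma W_bound_decay:
  assumes r: "0 < r" "r < 1" and x: "x > 0"
  defines "\<rho> \<equiv> (1 + r) powr \<alpha> - 1"
  shows "\<bar>W n x\<bar> \<le> (x / (1 - \<rho>)) powr \<delta> * exp (- (x powr (1/\<alpha>) / (1 + r))) / (c\<^sub>0 * (1 - \<rho>)) / \<rho> ^ n"
proof -
  have \<rho>: "0 < \<rho>" "\<rho> < 1" using rate_bounds[OF r] r by (auto simp: \<rho>_def)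
  have "cmod (cW n (of_real x)) \<le>
     (x / (1 - \<rho>)) powr \<delta> * exp (- (x powr (1/\<alpha>) / (1 + r))) / (c\<^sub>0 * (1 - \<rho>)) / \<rho> ^ n"
  proof (rule cauchy_coeff_bound[OF cW_sums \<rho>])
    fix q :: complex assume q: "cmod q = \<rho>"
    let ?w = "of_real x / (1 - q)"
    have nz: "?w \<noteq> 0" "1 / (1 - q) \<noteq> 0" using x q \<rho> one_minus_nz[of q] by auto
    have "?w powr of_real (1/\<alpha>) = of_real (x powr (1/\<alpha>)) * (1 / (1 - q)) powr of_real (1/\<alpha>)"
    proof -
      have "Ln (of_real x * (1 / (1 - q))) = of_real (ln x) + Ln (1 / (1 - q))"
        using Ln_times_of_real[OF x nz(2)] Ln_of_real[OF x] by simp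
      then have "exp (of_real (1/\<alpha>) * Ln (of_real x * (1 / (1 - q)))) =
          exp (of_real (1/\<alpha>) * of_real (ln x)) * exp (of_real (1/\<alpha>) * Ln (1 / (1 - q)))"
        by (simp only: ring_distribs exp_add)
      moreover have "exp (of_real (1/\<alpha>) * of_real (ln x) :: complex) = of_real (x powr (1/\<alpha>))"
        using x by (simp add: powr_def flip: exp_of_real)
      ultimately show ?thesis using nz x by (simp add: powr_def)
    qed
    then have "Re (?w powr of_real (1/\<alpha>)) = x powr (1/\<alpha>) * Re ((1 / (1 - q)) powr of_real (1/\<alpha>))"
      by simp
    moreover have "Re ((1 / (1 - q)) powr of_real (1/\<alpha>)) \<ge> 1 / (1 + r)"
      by (rule Re_inverse_powr_ge) (use inverse_\<alpha>_ge_1 r q \<rho> in \<open>auto simp: \<rho>_def\<close>)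
    ultimately have 1: "- Re (?w powr of_real (1/\<alpha>)) \<le> - (x powr (1/\<alpha>) / (1 + r))"
      using mult_left_mono[of "1 / (1 + r)" _ "x powr (1/\<alpha>)"] by fastforce
    have 2: "cmod ?w powr \<delta> \<le> (x / (1 - \<rho>)) powr \<delta>"
      using norm_dilation_le(2)[OF q \<rho>(2), of "of_real x"] x \<delta>_nonneg by (intro powr_mono2) auto
    have "cmod (cew ?w / (1 - q)) = cmod (cew ?w) * cmod (1 / (1 - q))"
      by (simp add: norm_divide)
    also have "\<dots> \<le> (x / (1 - \<rho>)) powr \<delta> * exp (- (x powr (1/\<alpha>) / (1 + r))) / c\<^sub>0 * (1 / (1 - \<rho>))"
      unfolding cmod_cew[OF nz(1)] using 1 2 c\<^sub>0_pos \<rho> norm_dilation_le(1)[OF q \<rho>(2)]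
      by (intro mult_mono divide_right_mono) auto
    finally show "cmod (cew (of_real x / (1 - q)) / (1 - q)) \<le>
        (x / (1 - \<rho>)) powr \<delta> * exp (- (x powr (1/\<alpha>) / (1 + r))) / (c\<^sub>0 * (1 - \<rho>))"
      by simp
  qed (use x in auto)
  then show ?thesis using x by (simp add: W_of_real)
qed

text \<open>
  Cauchy's inequality for the \<open>k\<close>-th derivative on discs of radius \<open>y0/4\<close>, which stay in the right
  half-plane.
\<close>

lemma W_deriv_bound:
  assumes y0: "y0 > 0" and r: "0 < r" "r < 1"
  shows "\<exists>C\<ge>0. \<forall>n. \<forall>y\<in>ball y0 (y0/4). \<bar>(deriv ^^ k) (W n) y\<bar> \<le> C / r ^ n"
proof (intro exI conjI allI ballI)
  let ?B = "cW_majorant r (2 * y0)"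
  have Bpos: "?B \<ge> 0" using c\<^sub>0_pos r by (simp add: cW_majorant_def)
  show "0 \<le> fact k * ?B / (y0/4) ^ k" using Bpos y0 by simp
  fix n y assume y: "y \<in> ball y0 (y0/4)"
  have yy: "y > 3/4 * y0" "y < 5/4 * y0" using y by (auto simp: dist_real_def abs_less_iff abs_if split: if_splits)
  have sub: "Re z > 0 \<and> cmod z \<le> 2 * y0" if z: "z \<in> cball (of_real y) (y0/4)" for z
  proof -
    have d: "cmod (z - of_real y) \<le> y0/4" using z by (simp add: dist_norm norm_minus_commute)
    have "\<bar>Re z - y\<bar> \<le> y0/4" using abs_Re_le_cmod[of "z - of_real y"] d by simp
    then have "Re z > 0" using yy y0 by linarith
    moreover have "cmod z \<le> cmod (z - of_real y) + cmod (of_real y)"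
      using norm_triangle_ineq[of "z - of_real y" "of_real y"] by simp
    ultimately show ?thesis using yy y0 d by (simp add: abs_le_iff)
  qed
  have hol: "cW n holomorphic_on cball (of_real y) (y0/4)"
    by (rule holomorphic_on_subset[OF cW_holomorphic]) (use sub in auto)
  have "cmod ((deriv ^^ k) (cW n) (of_real y)) \<le> fact k * (?B / r ^ n) / (y0/4) ^ k"
  proof (rule Cauchy_inequality)
    show "cW n holomorphic_on ball (of_real y) (y0/4)"
      by (rule holomorphic_on_subset[OF hol]) auto
    show "continuous_on (cball (of_real y) (y0/4)) (cW n)"
      by (rule holomorphic_on_imp_continuous_on[OF hol])
    fix z assume "cmod (of_real y - z) = y0/4"
    then have z: "z \<in> cball (of_real y) (y0/4)" by (simp add: dist_norm)
    have "cmod (cW n z) \<le> cW_majorant r (cmod z) / r ^ n" using cW_bound[OF r] sub[OF z] by blast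
    also have "\<dots> \<le> ?B / r ^ n"
      using sub[OF z] r by (intro divide_right_mono cW_majorant_mono) auto
    finally show "cmod (cW n z) \<le> ?B / r ^ n" .
  qed (use y0 in auto)
  moreover have "(deriv ^^ k) (cW n) (of_real y) = of_real ((deriv ^^ k) (W n) y)"
    by (rule W_deriv_of_real) (use yy y0 in auto)
  ultimately show "\<bar>(deriv ^^ k) (W n) y\<bar> \<le> fact k * ?B / (y0/4) ^ k / r ^ n"
    by (simp add: mult_ac)
qed

end

section \<open>Moment determinacy\<close>

lemma power_le_exp: "0 \<le> x \<Longrightarrow> x ^ k \<le> fact k * exp (x::real)"
proof -
  assume x: "0 \<le> x"
  have "(\<Sum>n\<in>{k}. x ^ n /\<^sub>R fact n) \<le> exp x"
    unfolding exp_def using x by (intro sum_le_suminf summable_exp_generic) auto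
  then show ?thesis by (simp add: divide_simps mult_ac)
qed

lemma power_le_exp_scaled: "0 < e \<Longrightarrow> \<bar>x\<bar> ^ k \<le> fact k / e ^ k * exp (e * \<bar>x::real\<bar>)"
  using power_le_exp[of "e * \<bar>x\<bar>" k] by (simp add: power_mult_distrib field_simps)

text \<open>
  Termwise integration of the exponential series, dominated by \<open>exp (e \<bar>V x\<bar>) |G x|\<close>.
\<close>

lemma exp_series_integral:
  fixes V :: "'a \<Rightarrow> real" and G :: "'a \<Rightarrow> complex"
  assumes [measurable]: "V \<in> borel_measurable M" "G \<in> borel_measurable M"
    and int: "integrable M (\<lambda>x. exp (e * \<bar>V x\<bar>) * cmod (G x))" and z: "cmod z \<le> e"
  shows "(\<lambda>j. z ^ j / fact j * (CLINT x|M. of_real (V x) ^ j * G x)) sums (CLINT x|M. exp (z * of_real (V x)) * G x)"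
proof -
  have e: "e \<ge> 0" using z norm_ge_zero order_trans by blast
  have part: "(\<Sum>j<J. cmod z ^ j / fact j * \<bar>V x\<bar> ^ j) \<le> exp (e * \<bar>V x\<bar>)" for J x
  proof -
    have "(\<Sum>j<J. cmod z ^ j / fact j * \<bar>V x\<bar> ^ j) \<le> (\<Sum>j<J. (e * \<bar>V x\<bar>) ^ j /\<^sub>R fact j)"
      using z by (intro sum_mono) (auto simp: power_mult_distrib divide_simps intro!: mult_right_mono power_mono)
    also have "\<dots> \<le> exp (e * \<bar>V x\<bar>)"
      unfolding exp_def using e by (intro sum_le_suminf summable_exp_generic) auto
    finally show ?thesis .
  qed
  have term_int: "integrable M (\<lambda>x. z ^ j / fact j * (of_real (V x) ^ j * G x))" for j
  proof (rule Bochner_Integration.integrable_bound[OF int])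
    show "AE x in M. norm (z ^ j / fact j * (of_real (V x) ^ j * G x)) \<le> norm (exp (e * \<bar>V x\<bar>) * cmod (G x))"
    proof (rule AE_I2)
      fix x
      have "cmod z ^ j / fact j * \<bar>V x\<bar> ^ j \<le> (\<Sum>j<Suc j. cmod z ^ j / fact j * \<bar>V x\<bar> ^ j)"
        by (rule member_le_sum) auto
      also have "\<dots> \<le> exp (e * \<bar>V x\<bar>)" by (rule part)
      finally have "cmod z ^ j / fact j * \<bar>V x\<bar> ^ j * cmod (G x) \<le> exp (e * \<bar>V x\<bar>) * cmod (G x)"
        by (rule mult_right_mono) simp
      then show "norm (z ^ j / fact j * (of_real (V x) ^ j * G x)) \<le> norm (exp (e * \<bar>V x\<bar>) * cmod (G x))"
        by (simp add: norm_mult norm_divide norm_power mult_ac)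
    qed
  qed measurable
  have "(\<lambda>J. CLINT x|M. (\<Sum>j<J. z ^ j / fact j * (of_real (V x) ^ j * G x))) \<longlonglongrightarrow> (CLINT x|M. exp (z * of_real (V x)) * G x)"
  proof (rule integral_dominated_convergence[where w="\<lambda>x. exp (e * \<bar>V x\<bar>) * cmod (G x)"])
    show "AE x in M. (\<lambda>J. \<Sum>j<J. z ^ j / fact j * (of_real (V x) ^ j * G x)) \<longlonglongrightarrow> exp (z * of_real (V x)) * G x"
    proof (rule AE_I2)
      fix x
      have "(\<lambda>j. (z * of_real (V x)) ^ j /\<^sub>R fact j) sums exp (z * of_real (V x))"
        by (rule exp_converges)
      then have "(\<lambda>j. (z * of_real (V x)) ^ j /\<^sub>R fact j * G x) sums (exp (z * of_real (V x)) * G x)"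
        by (rule sums_mult2)
      then show "(\<lambda>J. \<Sum>j<J. z ^ j / fact j * (of_real (V x) ^ j * G x)) \<longlonglongrightarrow> exp (z * of_real (V x)) * G x"
        by (simp add: sums_def power_mult_distrib scaleR_conv_of_real divide_inverse mult_ac)
    qed
    fix J
    show "AE x in M. norm (\<Sum>j<J. z ^ j / fact j * (of_real (V x) ^ j * G x)) \<le> exp (e * \<bar>V x\<bar>) * cmod (G x)"
    proof (rule AE_I2)
      fix x
      have "norm (\<Sum>j<J. z ^ j / fact j * (of_real (V x) ^ j * G x)) \<le> (\<Sum>j<J. cmod z ^ j / fact j * \<bar>V x\<bar> ^ j * cmod (G x))"
        by (rule order_trans[OF norm_sum]) (simp add: norm_mult norm_divide norm_power mult_ac)
      also have "\<dots> = (\<Sum>j<J. cmod z ^ j / fact j * \<bar>V x\<bar> ^ j) * cmod (G x)" by (simp add: sum_distrib_right)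
      also have "\<dots> \<le> exp (e * \<bar>V x\<bar>) * cmod (G x)" by (intro mult_right_mono part) simp
      finally show "norm (\<Sum>j<J. z ^ j / fact j * (of_real (V x) ^ j * G x)) \<le> exp (e * \<bar>V x\<bar>) * cmod (G x)" .
    qed
  qed (use int in \<open>auto\<close>)
  moreover have "(CLINT x|M. (\<Sum>j<J. z ^ j / fact j * (of_real (V x) ^ j * G x))) =
      (\<Sum>j<J. z ^ j / fact j * (CLINT x|M. of_real (V x) ^ j * G x))" for J
    by (subst Bochner_Integration.integral_sum[OF term_int]) simp
  ultimately show ?thesis by (simp add: sums_def)
qed

text \<open>
  The gap between \<open>d\<close> and \<open>e\<close> pays for the power of \<open>V\<close>.
\<close>

lemma exp_moment_absorb:
  fixes V g :: "'a \<Rightarrow> real"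
  assumes [measurable]: "V \<in> borel_measurable M" "g \<in> borel_measurable M"
    and e: "0 < e" "0 \<le> d" "d < e" and int: "integrable M (\<lambda>x. exp (e * \<bar>V x\<bar>) * g x)"
  shows "integrable M (\<lambda>x. exp (d * \<bar>V x\<bar>) * \<bar>V x\<bar> ^ k * \<bar>g x\<bar>)"
proof (rule Bochner_Integration.integrable_bound)
  show "integrable M (\<lambda>x. fact k / (e - d) ^ k * (exp (e * \<bar>V x\<bar>) * g x))" using int by simp
  show "AE x in M. norm (exp (d * \<bar>V x\<bar>) * \<bar>V x\<bar> ^ k * \<bar>g x\<bar>) \<le> norm (fact k / (e - d) ^ k * (exp (e * \<bar>V x\<bar>) * g x))"
  proof (rule AE_I2)
    fix x
    have "\<bar>V x\<bar> ^ k \<le> fact k / (e - d) ^ k * exp ((e - d) * \<bar>V x\<bar>)" using e by (intro power_le_exp_scaled) auto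
    then have "exp (d * \<bar>V x\<bar>) * \<bar>V x\<bar> ^ k \<le> exp (d * \<bar>V x\<bar>) * (fact k / (e - d) ^ k * exp ((e - d) * \<bar>V x\<bar>))"
      by (rule mult_left_mono) simp
    also have "\<dots> = fact k / (e - d) ^ k * exp (e * \<bar>V x\<bar>)" by (simp add: exp_add[symmetric] algebra_simps)
    finally show "norm (exp (d * \<bar>V x\<bar>) * \<bar>V x\<bar> ^ k * \<bar>g x\<bar>) \<le> norm (fact k / (e - d) ^ k * (exp (e * \<bar>V x\<bar>) * g x))"
      using e mult_right_mono[of _ _ "\<bar>g x\<bar>"] by (fastforce simp: abs_mult mult.assoc)
  qed
qed measurable

text \<open>
  If the characteristic function and all its derivatives vanish at \<open>\<theta>\<close>, then so they do at
  \<open>\<theta> + h\<close> for \<open>|h| \<le> e/2\<close>, by expanding \<open>exp(\<i> h V)\<close>; only half of the available exponential moment is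
  used for this, the rest absorbs the powers of \<open>V\<close>. Steps of constant length reach every \<open>\<theta>\<close>.
\<close>

lemma signed_moments_zero_imp_char_zero:
  fixes V g :: "'a \<Rightarrow> real"
  assumes [measurable]: "V \<in> borel_measurable M" "g \<in> borel_measurable M"
    and e: "0 < e" and int: "integrable M (\<lambda>x. exp (e * \<bar>V x\<bar>) * g x)"
    and mom: "\<And>k. (LINT x|M. V x ^ k * g x) = 0"
  shows "(CLINT x|M. iexp (\<theta> * V x) * of_real (g x)) = 0"
proof -
  define Q where "Q = (\<lambda>\<theta>. \<forall>k. (CLINT x|M. iexp (\<theta> * V x) * (of_real (V x) ^ k * of_real (g x))) = 0)"
  have Q0: "Q 0"
  proof -
    have "(CLINT x|M. of_real (V x) ^ k * of_real (g x)) = of_real (LINT x|M. V x ^ k * g x)" for k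
      by (simp flip: of_real_power of_real_mult)
    then show ?thesis using mom by (simp add: Q_def)
  qed
  have step: "Q (\<theta> + h)" if Q: "Q \<theta>" and h: "\<bar>h\<bar> \<le> e / 2" for \<theta> h
    unfolding Q_def
  proof
    fix k
    let ?G = "\<lambda>x. iexp (\<theta> * V x) * (of_real (V x) ^ k * of_real (g x)) :: complex"
    have i: "integrable M (\<lambda>x. exp (e/2 * \<bar>V x\<bar>) * cmod (?G x))"
      using exp_moment_absorb[OF _ _ e, of V M g "e/2" k] int e
      by (simp add: norm_mult norm_power mult_ac)
    have "(\<lambda>j. (\<i> * of_real h) ^ j / fact j * (CLINT x|M. of_real (V x) ^ j * ?G x)) sums (CLINT x|M. exp (\<i> * of_real h * of_real (V x)) * ?G x)"
      by (rule exp_series_integral[OF _ _ i]) (use h in \<open>auto simp: norm_mult\<close>)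
    moreover have "(CLINT x|M. of_real (V x) ^ j * ?G x) = 0" for j
      using Q[unfolded Q_def, rule_format, of "j + k"] by (simp add: power_add mult_ac)
    ultimately have "(CLINT x|M. exp (\<i> * of_real h * of_real (V x)) * ?G x) = 0"
      by (simp add: sums_iff)
    moreover have "(\<lambda>x. exp (\<i> * of_real h * of_real (V x)) * ?G x) = (\<lambda>x. iexp ((\<theta> + h) * V x) * (of_real (V x) ^ k * of_real (g x)))"
      by (rule ext) (simp add: ring_distribs exp_add mult_ac)
    ultimately show "(CLINT x|M. iexp ((\<theta> + h) * V x) * (of_real (V x) ^ k * of_real (g x))) = 0"
      by simp
  qed
  have all: "\<bar>\<theta>\<bar> \<le> real n * (e / 2) \<Longrightarrow> Q \<theta>" for n \<theta>
  proof (induction n arbitrary: \<theta>)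
    case 0 then show ?case using Q0 by simp
  next
    case (Suc n)
    define R where "R = real n * (e/2)"
    (* The nearest point already reached; the remaining distance is at most e/2. *)
    define \<theta>' where "\<theta>' = max (- R) (min R \<theta>)"
    have "0 \<le> R" "\<bar>\<theta>\<bar> \<le> R + e/2" using e Suc.prems by (simp_all add: R_def algebra_simps)
    then have "\<bar>\<theta>'\<bar> \<le> R" "\<bar>\<theta> - \<theta>'\<bar> \<le> e/2"
      using e by (auto simp: \<theta>'_def max_def min_def)
    then have "\<bar>\<theta>'\<bar> \<le> real n * (e/2)" "\<bar>\<theta> - \<theta>'\<bar> \<le> e/2"
      by (simp_all only: R_def)
    then show ?case using step[OF Suc.IH, of \<theta>' "\<theta> - \<theta>'"] by simp
  qed
  obtain n where "\<bar>\<theta>\<bar> / (e/2) \<le> real n" using real_arch_simple by blast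
  then have "Q \<theta>" using all[of \<theta> n] e by (simp add: field_simps)
  from this[unfolded Q_def, rule_format, of 0] show ?thesis by simp
qed

text \<open>
  The positive and the negative part of \<open>g\<close> have the same mass \<open>c\<close>, because the zeroth moment
  vanishes. Divided by \<open>c\<close> they are probability densities under which \<open>V\<close> has the same
  characteristic function, so Levy's uniqueness theorem applies.
\<close>

lemma signed_moments_zero_imp_zero:
  fixes V g :: "'a \<Rightarrow> real"
  assumes meas[measurable]: "V \<in> borel_measurable M" "g \<in> borel_measurable M"
    and e: "0 < e" and int: "integrable M (\<lambda>x. exp (e * \<bar>V x\<bar>) * g x)"
    and mom: "\<And>k. (LINT x|M. V x ^ k * g x) = 0"
    and A: "A \<in> sets borel"
  shows "(LINT x|M. indicator A (V x) * g x) = 0"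
proof -
  have ig: "integrable M g"
    by (rule Bochner_Integration.integrable_bound[OF int])
       (use e in \<open>auto simp: abs_mult intro!: AE_I2 mult_le_cancel_right1[THEN iffD2]\<close>)
  define p n where "p = (\<lambda>x. max 0 (g x))" and "n = (\<lambda>x. max 0 (- g x))"
  have [measurable]: "p \<in> borel_measurable M" "n \<in> borel_measurable M" by (auto simp: p_def n_def)
  have ip: "integrable M p" and in': "integrable M n" using ig by (auto simp: p_def n_def)
  have g: "g x = p x - n x" for x by (auto simp: p_def n_def)
  have pn: "p x \<ge> 0" "n x \<ge> 0" for x by (auto simp: p_def n_def)
  define c where "c = (LINT x|M. p x)"
  have "(LINT x|M. g x) = 0" using mom[of 0] by simp
  then have cn: "(LINT x|M. n x) = c" using ip in' by (simp add: g c_def)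
  have c0: "c \<ge> 0" using pn by (simp add: c_def)
  show ?thesis
  proof (cases "c = 0")
    case True
    have "AE x in M. p x = 0" "AE x in M. n x = 0"
      using integral_nonneg_eq_0_iff_AE[OF ip] integral_nonneg_eq_0_iff_AE[OF in'] True cn pn by (auto simp: c_def)
    then have "AE x in M. indicator A (V x) * g x = 0" by eventually_elim (simp add: g)
    then show ?thesis by (simp add: integral_eq_zero_AE)
  next
    case False
    then have c: "c > 0" using c0 by simp
    define N where "N = (\<lambda>f::'a\<Rightarrow>real. distr (density M (\<lambda>x. ennreal (f x / c))) borel V)"
    have rd: "real_distribution (N f)" and ch: "char (N f) \<theta> = (CLINT x|M. iexp (\<theta> * V x) * of_real (f x)) / c"
       and ms: "measure (N f) A = (LINT x|M. indicator A (V x) * f x) / c"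
      if f[measurable]: "f \<in> borel_measurable M" and f0: "\<And>x. f x \<ge> 0" and fi: "integrable M f" "(LINT x|M. f x) = c" for f \<theta>
    proof -
      have "emeasure (density M (\<lambda>x. ennreal (f x / c))) (space M) = (\<integral>\<^sup>+x. ennreal (f x / c) \<partial>M)"
        by (simp add: emeasure_density cong: nn_integral_cong)
      also have "\<dots> = ennreal (LINT x|M. f x / c)"
        using fi f0 c by (intro nn_integral_eq_integral) auto
      also have "\<dots> = 1" using fi c by simp
      finally have "prob_space (density M (\<lambda>x. ennreal (f x / c)))" by (intro prob_spaceI) simp
      then have "prob_space (N f)" unfolding N_def by (rule prob_space.prob_space_distr) simp
      then show "real_distribution (N f)"
        by (simp add: real_distribution_def real_distribution_axioms_def N_def)
      show "char (N f) \<theta> = (CLINT x|M. iexp (\<theta> * V x) * of_real (f x)) / c"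
        using c f0 unfolding char_def N_def
        by (subst integral_distr) (auto simp: integral_density scaleR_conv_of_real mult_ac simp flip: integral_divide)
      have "measure (N f) A = (LINT x|N f. indicator A x)" using A by (simp add: N_def)
      also have "\<dots> = (LINT x|M. f x / c * indicator A (V x))"
        unfolding N_def using A c f0 by (subst integral_distr) (auto simp: integral_density)
      finally show "measure (N f) A = (LINT x|M. indicator A (V x) * f x) / c"
        by (simp add: mult_ac)
    qed
    have iC: "integrable M (\<lambda>x. iexp (\<theta> * V x) * of_real (f x))" if "integrable M f" "f \<in> borel_measurable M" for \<theta> and f :: "'a \<Rightarrow> real"
      by (rule Bochner_Integration.integrable_bound[OF that(1)]) (use that(2) in \<open>auto simp: norm_mult\<close>)
    have iR: "integrable M (\<lambda>x. indicator A (V x) * f x)" if "integrable M f" "f \<in> borel_measurable M" for f :: "'a \<Rightarrow> real"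
      by (rule Bochner_Integration.integrable_bound[OF that(1)]) (use that(2) A in \<open>auto simp: indicator_def\<close>)
    have "char (N p) = char (N n)"
    proof
      fix \<theta>
      have "(CLINT x|M. iexp (\<theta> * V x) * of_real (g x)) = 0"
        by (rule signed_moments_zero_imp_char_zero[OF meas e int mom])
      then have "(CLINT x|M. iexp (\<theta> * V x) * of_real (p x)) = (CLINT x|M. iexp (\<theta> * V x) * of_real (n x))"
        using iC[OF ip] iC[OF in'] by (simp add: g ring_distribs)
      then show "char (N p) \<theta> = char (N n) \<theta>"
        using ch[of p] ch[of n] pn ip in' cn by (simp add: c_def)
    qed
    then have "N p = N n" using rd[of p] rd[of n] pn ip in' cn by (intro Levy_uniqueness) (auto simp: c_def)
    then have "(LINT x|M. indicator A (V x) * p x) = (LINT x|M. indicator A (V x) * n x)"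
      using ms[of p] ms[of n] pn ip in' cn c by (simp add: c_def)
    then show ?thesis using iR[OF ip] iR[OF in'] by (simp add: g ring_distribs)
  qed
qed

lemma powser_zero_imp_coeffs_zero:
  fixes a :: "nat \<Rightarrow> real"
  assumes r: "0 < r" and a: "\<And>s. \<bar>s\<bar> < r \<Longrightarrow> (\<lambda>n. a n * s ^ n) sums 0"
  shows "a k = 0"
proof (rule ccontr)
  assume nz: "a k \<noteq> 0"
  have "a 0 = 0" using a[of 0] r sums_unique2[OF a[of 0] powser_sums_zero] by simp
  then have "k > 0" using nz by (cases k) auto
  obtain s where s: "0 < s" "\<And>z. z \<in> cball 0 s - {0} \<Longrightarrow> (\<lambda>z::real. 0::real) z \<noteq> 0"
    by (rule powser_0_nonzero[OF r, of 0 a "\<lambda>_. 0" k]) (use a nz \<open>k > 0\<close> in auto)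
  show False using s(2)[of s] s(1) by simp
qed

lemma powser_coeffs_unique:
  fixes a b :: "nat \<Rightarrow> real"
  assumes "0 < r" and "\<And>s. \<bar>s\<bar> < r \<Longrightarrow> (\<lambda>n. a n * s ^ n) sums f s"
    and "\<And>s. \<bar>s\<bar> < r \<Longrightarrow> (\<lambda>n. b n * s ^ n) sums f s"
  shows "a k = b k"
  using powser_zero_imp_coeffs_zero[of r "\<lambda>n. a n - b n" k] assms sums_diff[of "\<lambda>n. a n * _ ^ n" _ "\<lambda>n. b n * _ ^ n"]
  by (fastforce simp: left_diff_distrib)

text \<open>
  Near \<open>0\<close> the moment generating function is a power series with the moments as coefficients.
\<close>

lemma signed_mgf_zero_imp_moments_zero:
  fixes V g :: "'a \<Rightarrow> real"
  assumes [measurable]: "V \<in> borel_measurable M" "g \<in> borel_measurable M"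
    and e: "0 < e" "0 < e'" and int: "integrable M (\<lambda>x. exp (e * \<bar>V x\<bar>) * g x)"
    and mgf: "\<And>s. \<bar>s\<bar> < e' \<Longrightarrow> (LINT x|M. exp (s * V x) * g x) = 0"
  shows "(LINT x|M. V x ^ k * g x) = 0"
proof (rule ccontr)
  assume nz: "(LINT x|M. V x ^ k * g x) \<noteq> 0"
  define a where "a = (\<lambda>j. (LINT x|M. V x ^ j * g x) / fact j)"
  have i: "integrable M (\<lambda>x. exp (e * \<bar>V x\<bar>) * cmod (of_real (g x)))"
    using integrable_norm[OF int] by (simp add: abs_mult)
  have sm: "(\<lambda>j. a j * s ^ j) sums (LINT x|M. exp (s * V x) * g x)" if "\<bar>s\<bar> \<le> e" for s
  proof -
    have eq: "(CLINT x|M. of_real (V x) ^ j * complex_of_real (g x)) = of_real (LINT x|M. V x ^ j * g x)" for j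
      by (simp flip: of_real_power of_real_mult)
    have eq2: "(CLINT x|M. exp (of_real s * of_real (V x)) * complex_of_real (g x)) = of_real (LINT x|M. exp (s * V x) * g x)"
    proof -
      have "(\<lambda>x. exp (of_real s * of_real (V x)) * complex_of_real (g x)) = (\<lambda>x. of_real (exp (s * V x) * g x))"
        by (simp add: exp_of_real[symmetric])
      then show ?thesis by (simp only: integral_complex_of_real)
    qed
    have "(\<lambda>j. of_real s ^ j / fact j * (CLINT x|M. of_real (V x) ^ j * of_real (g x))) sums
       (CLINT x|M. exp (of_real s * of_real (V x)) * of_real (g x))"
      by (rule exp_series_integral[OF _ _ i]) (use that in auto)
    then have "(\<lambda>j. complex_of_real (a j * s ^ j)) sums of_real (LINT x|M. exp (s * V x) * g x)"
      by (simp only: eq eq2 a_def) (simp add: mult.commute)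
    then show ?thesis by (simp only: sums_of_real_iff)
  qed
  have nz': "a k \<noteq> 0" using nz by (simp add: a_def)
  define r where "r = min e e'"
  have r: "r > 0" using e by (simp add: r_def)
  have f0: "(\<lambda>j. a j * s ^ j) sums 0" if "\<bar>s\<bar> < r" for s
    using sm[of s] mgf[of s] that by (simp add: r_def)
  show False using powser_zero_imp_coeffs_zero[OF r f0] nz' by blast
qed

text \<open>
  The measure \<open>N\<close> and the signed density \<open>h\<close> are compared on one space, the disjoint union \<open>M\<close> of a
  copy of \<open>N\<close> (tag \<open>True\<close>) and a normalised copy \<open>H\<close> of \<open>|h|\<close> (tag \<open>False\<close>). The signed density
  \<open>g\<close>, equal to \<open>1\<close> on the former and to \<open>- c sgn h\<close> on the latter, has vanishing moments.
\<close>

lemma moments_determine_density: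
  fixes N :: "real measure" and h :: "real \<Rightarrow> real"
  assumes N: "prob_space N" "sets N = sets borel" and h[measurable]: "h \<in> borel_measurable borel"
    and e: "0 < e" and iN: "integrable N (\<lambda>y. exp (e * \<bar>y\<bar>))"
    and ih: "integrable lborel (\<lambda>y. exp (e * \<bar>y\<bar>) * h y)"
    and mom: "\<And>k. (LINT y|N. y ^ k) = (LINT y|lborel. y ^ k * h y)"
  shows "AE y in lborel. 0 \<le> h y" and "N = density lborel (\<lambda>y. ennreal (h y))"
proof -
  note [measurable_cong] = N(2)
  interpret N: prob_space N by fact
  have ih0: "integrable lborel h"
    by (rule Bochner_Integration.integrable_bound[OF ih])
       (use e in \<open>auto simp: abs_mult intro!: AE_I2 mult_le_cancel_right1[THEN iffD2]\<close>)
  (* The summand 1 keeps c positive even if h vanishes; H only has to be a subprobability. *)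
  define c where "c = 1 + (LINT y|lborel. \<bar>h y\<bar>)"
  have c: "c > 0" unfolding c_def by (intro add_pos_nonneg) auto
  define H where "H = density lborel (\<lambda>y. ennreal (\<bar>h y\<bar> / c))"
  have [measurable_cong]: "sets H = sets borel" by (simp add: H_def)
  have sH: "subprob_space H"
  proof
    have "emeasure H (space H) = (\<integral>\<^sup>+y. ennreal (\<bar>h y\<bar> / c) \<partial>lborel)"
      by (simp add: H_def emeasure_density cong: nn_integral_cong)
    also have "\<dots> = ennreal (LINT y|lborel. \<bar>h y\<bar> / c)"
      using ih0 c by (intro nn_integral_eq_integral) auto
    also have "\<dots> \<le> 1" using c by (simp add: c_def)
    finally show "emeasure H (space H) \<le> 1" .
  qed (simp add: H_def)
  define B :: "(bool \<times> real) measure" where "B = count_space UNIV \<Otimes>\<^sub>M borel"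
  define \<kappa> where "\<kappa> = (\<lambda>b. distr (if b then N else H) B (\<lambda>y. (b, y)))"
  have pm[measurable]: "(\<lambda>y. (b, y)) \<in> borel \<rightarrow>\<^sub>M B" for b by (simp add: B_def)
  have \<kappa>: "\<kappa> \<in> count_space UNIV \<rightarrow>\<^sub>M subprob_algebra B"
  proof (rule measurableI)
    fix b :: bool
    have "subprob_space (\<kappa> b)" unfolding \<kappa>_def
      by (rule subprob_space.subprob_space_distr)
         (use sH N.subprob_space_axioms in \<open>auto simp: B_def space_pair_measure\<close>)
    then show "\<kappa> b \<in> space (subprob_algebra B)" by (simp add: space_subprob_algebra \<kappa>_def)
  qed simp
  define M where "M = count_space UNIV \<bind> \<kappa>"
  have sM[measurable_cong]: "sets M = sets B" unfolding M_def by (rule sets_bind) (auto simp: \<kappa>_def)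
  have nn: "(\<integral>\<^sup>+x. f x \<partial>M) = (\<integral>\<^sup>+y. f (True, y) \<partial>N) + (\<integral>\<^sup>+y. f (False, y) \<partial>H)"
    if f[measurable]: "f \<in> borel_measurable B" for f
  proof -
    have "(\<integral>\<^sup>+x. f x \<partial>M) = (\<integral>\<^sup>+b. \<integral>\<^sup>+x. f x \<partial>\<kappa> b \<partial>count_space UNIV)"
      unfolding M_def by (rule nn_integral_bind[OF f \<kappa>])
    also have "\<dots> = (\<integral>\<^sup>+x. f x \<partial>\<kappa> False) + (\<integral>\<^sup>+x. f x \<partial>\<kappa> True)"
      by (subst nn_integral_count_space_finite) (auto simp: UNIV_bool)
    finally show ?thesis by (simp add: \<kappa>_def nn_integral_distr add.commute)
  qed
  have int: "integrable M f \<longleftrightarrow> integrable N (\<lambda>y. f (True, y)) \<and> integrable H (\<lambda>y. f (False, y))"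
    if f[measurable]: "f \<in> borel_measurable B" for f :: "bool \<times> real \<Rightarrow> real"
    by (simp add: integrable_iff_bounded nn measurable_If)
  have lint: "(LINT x|M. f x) = (LINT y|N. f (True, y)) + (LINT y|H. f (False, y))"
    if f[measurable]: "f \<in> borel_measurable B" and i: "integrable N (\<lambda>y. f (True, y))" "integrable H (\<lambda>y. f (False, y))"
    for f :: "bool \<times> real \<Rightarrow> real"
  proof -
    have fin: "(\<integral>\<^sup>+y. ennreal (f (True, y)) \<partial>N) < \<infinity>" "(\<integral>\<^sup>+y. ennreal (- f (True, y)) \<partial>N) < \<infinity>"
       "(\<integral>\<^sup>+y. ennreal (f (False, y)) \<partial>H) < \<infinity>" "(\<integral>\<^sup>+y. ennreal (- f (False, y)) \<partial>H) < \<infinity>"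
      using i by (auto simp: real_integrable_def top.not_eq_extremum)
    have "integrable M f" using int[OF f] i by simp
    then show ?thesis using fin i
      by (simp add: real_lebesgue_integral_def nn enn2real_plus)
  qed
  define g where "g = (\<lambda>(b, y). if b then 1 else - c * sgn (h y))"
  have gm[measurable]: "g \<in> borel_measurable B" unfolding g_def B_def by measurable
  have sm[measurable]: "snd \<in> borel_measurable B" unfolding B_def by measurable
  have ihH: "integrable H (\<lambda>y. f y * (- c * sgn (h y)))" and lH: "(LINT y|H. f y * (- c * sgn (h y))) = - (LINT y|lborel. f y * h y)"
    if "integrable lborel (\<lambda>y. f y * h y)" "f \<in> borel_measurable borel" for f
  proof -
    have eq: "\<bar>h y\<bar> / c * (f y * (- c * sgn (h y))) = - (f y * h y)" for y
      using c by (simp add: abs_sgn mult_ac)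
    show "integrable H (\<lambda>y. f y * (- c * sgn (h y)))"
      unfolding H_def using that c
      by (subst integrable_real_density) (auto simp only: eq intro!: Bochner_Integration.integrable_minus, auto)
    show "(LINT y|H. f y * (- c * sgn (h y))) = - (LINT y|lborel. f y * h y)"
      unfolding H_def using that c by (subst integral_real_density) (auto simp only: eq, auto)
  qed
  have pow_int: "integrable lborel (\<lambda>y. y ^ k * h y)" "integrable N (\<lambda>y. y ^ k)" for k
  proof -
    have "integrable lborel (\<lambda>y. exp (0 * \<bar>y\<bar>) * \<bar>y\<bar> ^ k * \<bar>h y\<bar>)"
      by (rule exp_moment_absorb[where V="\<lambda>y. y" and e=e]) (use e ih in auto)
    then show "integrable lborel (\<lambda>y. y ^ k * h y)"
      by (rule Bochner_Integration.integrable_bound) (auto simp: abs_mult power_abs)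
    have "integrable N (\<lambda>y. exp (0 * \<bar>y\<bar>) * \<bar>y\<bar> ^ k * \<bar>1\<bar>)"
      by (rule exp_moment_absorb[where V="\<lambda>y. y" and e=e]) (use e iN in auto)
    then show "integrable N (\<lambda>y. y ^ k)"
      by (rule Bochner_Integration.integrable_bound) (auto simp: power_abs)
  qed
  have zero: "(LINT x|M. indicator A (snd x) * g x) = 0" if A: "A \<in> sets borel" for A
  proof (rule signed_moments_zero_imp_zero[OF _ _ e _ _ A])
    show "integrable M (\<lambda>x. exp (e * \<bar>snd x\<bar>) * g x)"
    proof (subst int)
      show "(\<lambda>x. exp (e * \<bar>snd x\<bar>) * g x) \<in> borel_measurable B" by measurable
    qed (use iN ihH[OF ih] in \<open>auto simp: g_def\<close>)
    fix k
    show "(LINT x|M. snd x ^ k * g x) = 0"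
    proof (subst lint)
      show "(\<lambda>x. snd x ^ k * g x) \<in> borel_measurable B" by measurable
    qed (use pow_int ihH[OF pow_int(1)] lH[OF pow_int(1)] mom in \<open>auto simp: g_def\<close>)
  qed (simp_all add: measurable_cong_sets[OF sM refl])
  have meas: "measure N A = (LINT y|lborel. indicator A y * h y)" if A[measurable]: "A \<in> sets borel" for A
  proof -
    have ia: "integrable lborel (\<lambda>y. indicator A y * h y)"
      using integrable_mult_indicator[OF _ ih0, of A] by simp
    have "0 = (LINT x|M. indicator A (snd x) * g x)" using zero[OF A] by simp
    also have "\<dots> = (LINT y|N. indicator A y) - (LINT y|lborel. indicator A y * h y)"
    proof (subst lint)
      show "(\<lambda>x. indicator A (snd x) * g x) \<in> borel_measurable B" by measurable
    qed (use ihH[OF ia] lH[OF ia] N.emeasure_finite in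
        \<open>auto simp: g_def N less_top[symmetric] intro!: integrable_real_indicator\<close>)
    finally show ?thesis using A N by simp
  qed
  show nonneg: "AE y in lborel. 0 \<le> h y"
  proof -
    let ?A = "{y. h y < 0}"
    have A: "?A \<in> sets borel" by measurable
    have "(LINT y|lborel. indicator ?A y * h y) \<ge> 0" using meas[OF A] by (metis measure_nonneg)
    then have le: "(LINT y|lborel. - (indicator ?A y * h y)) \<le> 0" by simp
    have ia: "integrable lborel (\<lambda>y. - (indicator ?A y * h y))"
      using integrable_mult_indicator[OF _ ih0, of ?A] A by simp
    have nn: "AE y in lborel. 0 \<le> - (indicator ?A y * h y)" by (auto simp: indicator_def)
    have "(LINT y|lborel. - (indicator ?A y * h y)) = 0"
      using le integral_nonneg_AE[OF nn] by linarith
    then have "AE y in lborel. - (indicator ?A y * h y) = 0"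
      using integral_nonneg_eq_0_iff_AE[OF ia nn] by simp
    then show ?thesis by eventually_elim (auto simp: indicator_def split: if_splits)
  qed
  show "N = density lborel (\<lambda>y. ennreal (h y))"
  proof (rule measure_eqI)
    fix A assume "A \<in> sets N"
    then have A[measurable]: "A \<in> sets borel" using N by simp
    have ia: "integrable lborel (\<lambda>y. indicator A y * h y)"
      using integrable_mult_indicator[OF _ ih0, of A] by simp
    have "emeasure N A = ennreal (LINT y|lborel. indicator A y * h y)"
      using meas[OF A] by (simp add: N.emeasure_eq_measure)
    also have "\<dots> = (\<integral>\<^sup>+y. ennreal (indicator A y * h y) \<partial>lborel)"
      by (rule nn_integral_eq_integral[symmetric, OF ia]) (use nonneg in \<open>auto simp: indicator_def\<close>)
    also have "\<dots> = emeasure (density lborel (\<lambda>y. ennreal (h y))) A"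
      by (subst emeasure_density) (auto intro!: nn_integral_cong simp: indicator_def)
    finally show "emeasure N A = emeasure (density lborel (\<lambda>y. ennreal (h y))) A" .
  qed (simp add: N)
qed

section \<open>Integration on the open half-line\<close>

abbreviation hl :: "real measure" where
  "hl \<equiv> restrict_space lborel {0<..}"

lemma space_hl [simp]: "space hl = {0<..}"
  by (simp add: space_restrict_space)

lemma borel_measurable_hl [measurable (raw)]: "f \<in> borel_measurable borel \<Longrightarrow> f \<in> borel_measurable hl"
  by (intro measurable_restrict_space1) simp

lemma borel_measurable_hl_iff:
  "(f :: real \<Rightarrow> 'b :: real_normed_vector) \<in> borel_measurable hl \<longleftrightarrow> (\<lambda>x. indicator {0<..} x *\<^sub>R f x) \<in> borel_measurable borel"
  by (subst borel_measurable_restrict_space_iff) auto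

lemma set_integral_hl:
  fixes f :: "real \<Rightarrow> 'b :: {banach, second_countable_topology}"
  shows "(LBINT x:{0<..}. f x) = integral\<^sup>L hl f"
  using integral_restrict_space[of "{0<..}" lborel f] by (simp add: set_lebesgue_integral_def)

lemma set_integrable_hl:
  fixes f :: "real \<Rightarrow> 'b :: {banach, second_countable_topology}"
  shows "set_integrable lborel {0<..} f \<longleftrightarrow> integrable hl f"
  using integrable_restrict_space[of "{0<..}" lborel f] by (simp add: set_integrable_def)

lemma AE_hl_I: "(\<And>x. x > 0 \<Longrightarrow> P x) \<Longrightarrow> AE x in hl. P x"
  by (rule AE_I2) simp

lemma hl_cong: "(\<And>x. x > 0 \<Longrightarrow> f x = g x) \<Longrightarrow> integral\<^sup>L hl f = integral\<^sup>L hl g"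
  by (rule Bochner_Integration.integral_cong) auto

lemma hl_integrable_cong: "(\<And>x. x > 0 \<Longrightarrow> f x = g x) \<Longrightarrow> integrable hl f \<longleftrightarrow> integrable hl g"
  by (rule Bochner_Integration.integrable_cong) auto

lemma hl_dilate:
  fixes f :: "real \<Rightarrow> 'b :: {banach, second_countable_topology}"
  assumes c: "c > 0"
  shows "integrable hl (\<lambda>x. f (c * x)) \<longleftrightarrow> integrable hl f"
    and "integral\<^sup>L hl f = c *\<^sub>R integral\<^sup>L hl (\<lambda>x. f (c * x))"
proof -
  let ?F = "\<lambda>x. indicator {0<..} x *\<^sub>R f x"
  have ind: "?F (0 + c * x) = indicator {0<..} x *\<^sub>R f (c * x)" for x
    using c by (auto simp: indicator_def zero_less_mult_iff)
  show "integrable hl (\<lambda>x. f (c * x)) \<longleftrightarrow> integrable hl f"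
    using lborel_integrable_real_affine_iff[of c ?F 0] c unfolding ind
    by (simp add: integrable_restrict_space)
  show "integral\<^sup>L hl f = c *\<^sub>R integral\<^sup>L hl (\<lambda>x. f (c * x))"
    using lborel_integral_real_affine[of c ?F 0] c unfolding ind
    by (simp add: integral_restrict_space)
qed

text \<open>
  The substitution \<open>y = u\<^sup>a\<close> turns both integrals into Gamma integrals.
\<close>

lemma powr_exp_hl:
  assumes a: "a > 0" and s: "s > -1" and \<kappa>: "\<kappa> > 0"
  shows "integrable hl (\<lambda>y. y powr s * exp (- (\<kappa> * y powr (1/a))))"
    and "integral\<^sup>L hl (\<lambda>y. y powr s * exp (- (y powr (1/a)))) = a * Gamma (a * (s + 1))"
proof -
  define z where "z = a * (s + 1)"
  have z: "z > 0" using a s by (simp add: z_def)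
  define f where "f = (\<lambda>\<kappa> y. y powr s * exp (- (\<kappa> * y powr (1/a))))"
  let ?g = "\<lambda>u. u powr a" and ?g' = "\<lambda>u. a * u powr (a - 1)"
  have img: "?g ` {0<..} = {0<..}"
  proof safe
    fix y :: real assume "y > 0"
    then show "y \<in> ?g ` {0<..}" using a by (intro image_eqI[of _ _ "y powr (1/a)"]) (auto simp: powr_powr)
  qed auto
  have H: "\<bar>?g' u\<bar> * f \<kappa> (?g u) = a * (u powr (z - 1) / exp (\<kappa> * u))" if "u > 0" for u \<kappa>
  proof -
    have "u powr (a - 1) * u powr (a * s) = u powr (z - 1)"
      by (simp add: z_def algebra_simps flip: powr_add)
    then show ?thesis using that a
      by (simp add: f_def powr_powr exp_minus divide_inverse mult.assoc[symmetric])
  qed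
  have inj: "inj_on ?g {0<..}" 
    by (rule inj_on_inverseI[of _ "\<lambda>y. y powr (1/a)"]) (use a in \<open>auto simp: powr_powr\<close>)
  have der: "(?g has_field_derivative ?g' u) (at u within {0<..})" if "u \<in> {0<..}" for u
    using that by (auto intro!: derivative_eq_intros)
  have cov: "((\<lambda>u. \<bar>?g' u\<bar> * F (?g u)) absolutely_integrable_on {0<..} \<and> integral {0<..} (\<lambda>u. \<bar>?g' u\<bar> * F (?g u)) = b)
      \<longleftrightarrow> (F absolutely_integrable_on {0<..} \<and> integral {0<..} F = b)" for F :: "real \<Rightarrow> real" and b
    using has_absolute_integral_change_of_variables_1'[of "{0<..}" ?g ?g' F b] der inj img by simp
  have base: "(\<lambda>u. \<bar>?g' u\<bar> * f \<kappa> (?g u)) absolutely_integrable_on {0<..}" if \<kappa>: "\<kappa> > 0" for \<kappa>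
  proof -
    have "(\<lambda>t. norm (complex_of_real t powr (of_real z - 1) / of_real (exp (\<kappa> * t)))) absolutely_integrable_on {0<..}"
      by (rule set_integrable_norm[OF absolutely_integrable_Gamma_integral]) (use z \<kappa> in auto)
    then have 1: "(\<lambda>t. a * norm (complex_of_real t powr (of_real z - 1) / of_real (exp (\<kappa> * t)))) absolutely_integrable_on {0<..}"
      by (rule set_integrable_mult_right)
    have 2: "a * norm (complex_of_real t powr (of_real z - 1) / of_real (exp (\<kappa> * t))) = \<bar>?g' t\<bar> * f \<kappa> (?g t)" if "t \<in> {0<..}" for t
      using that by (subst H) (auto simp: norm_divide norm_powr_real_powr)
    show ?thesis by (rule iffD1[OF set_integrable_cong[OF refl refl 2] 1])
  qed
  have m: "f \<kappa> \<in> borel_measurable borel" for \<kappa> unfolding f_def by measurable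
  have lb: "set_integrable lborel {0<..} (f \<kappa>)" if "\<kappa> > 0" for \<kappa>
  proof -
    have "f \<kappa> absolutely_integrable_on {0<..}" using cov[of "f \<kappa>"] base[OF that] by blast
    then show ?thesis using m unfolding set_integrable_def by (subst (asm) integrable_completion) auto
  qed
  then show "integrable hl (\<lambda>y. y powr s * exp (- (\<kappa> * y powr (1/a))))"
    using \<kappa> by (simp add: f_def set_integrable_hl)
  have "((\<lambda>t. t powr (z - 1) / exp t) has_integral Gamma z) {0<..}"
    by (rule iffD1[OF has_integral_spike_set_eq Gamma_integral_real[OF z]]) (auto intro: negligible_subset[of "{0}"])
  then have "((\<lambda>t. a * (t powr (z - 1) / exp t)) has_integral a * Gamma z) {0<..}"
    by (rule has_integral_mult_right)
  then have "integral {0<..} (\<lambda>t. a * (t powr (z - 1) / exp t)) = a * Gamma z"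
    by (rule integral_unique)
  also have "integral {0<..} (\<lambda>t. a * (t powr (z - 1) / exp t)) = integral {0<..} (\<lambda>u. \<bar>?g' u\<bar> * f 1 (?g u))"
    by (rule Henstock_Kurzweil_Integration.integral_cong) (use H[of _ 1] in auto)
  finally have "integral {0<..} (f 1) = a * Gamma z"
    using cov[of "f 1" "a * Gamma z"] base[of 1] by simp
  then have "(LBINT y:{0<..}. f 1 y) = a * Gamma z"
    using set_borel_integral_eq_integral(2)[OF lb[of 1]] by simp
  then show "integral\<^sup>L hl (\<lambda>y. y powr s * exp (- (y powr (1/a)))) = a * Gamma (a * (s + 1))"
    by (simp add: f_def set_integral_hl z_def)
qed

lemma cauchy_schwarz_integral:
  fixes f g :: "'a \<Rightarrow> real"
  assumes [measurable]: "f \<in> borel_measurable M" "g \<in> borel_measurable M"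
    and i: "integrable M (\<lambda>x. (f x)\<^sup>2)" "integrable M (\<lambda>x. (g x)\<^sup>2)"
  shows "integrable M (\<lambda>x. f x * g x)"
    and "(LINT x|M. \<bar>f x * g x\<bar>) \<le> sqrt (LINT x|M. (f x)\<^sup>2) * sqrt (LINT x|M. (g x)\<^sup>2)"
proof -
  show ifg: "integrable M (\<lambda>x. f x * g x)"
  proof (rule Bochner_Integration.integrable_bound)
    show "integrable M (\<lambda>x. (f x)\<^sup>2 + (g x)\<^sup>2)" using i by simp
    show "AE x in M. norm (f x * g x) \<le> norm ((f x)\<^sup>2 + (g x)\<^sup>2)"
    proof (rule AE_I2)
      fix x
      have "2 * (\<bar>f x\<bar> * \<bar>g x\<bar>) \<le> (f x)\<^sup>2 + (g x)\<^sup>2"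
        using sum_squares_bound[of "\<bar>f x\<bar>" "\<bar>g x\<bar>"] by simp
      moreover have "0 \<le> \<bar>f x\<bar> * \<bar>g x\<bar>" by simp
      ultimately have "\<bar>f x\<bar> * \<bar>g x\<bar> \<le> (f x)\<^sup>2 + (g x)\<^sup>2" by linarith
      then show "norm (f x * g x) \<le> norm ((f x)\<^sup>2 + (g x)\<^sup>2)" by (simp add: abs_mult)
    qed
  qed measurable
  let ?I = "LINT x|M. \<bar>f x * g x\<bar>" and ?F = "LINT x|M. (f x)\<^sup>2" and ?G = "LINT x|M. (g x)\<^sup>2"
  have nn: "0 \<le> ?I" "0 \<le> ?F" "0 \<le> ?G" by auto
  have "(\<integral>\<^sup>+x. ennreal \<bar>f x\<bar> * ennreal \<bar>g x\<bar> \<partial>M)\<^sup>2 \<le> (\<integral>\<^sup>+x. ennreal \<bar>f x\<bar> ^ 2 \<partial>M) * (\<integral>\<^sup>+x. ennreal \<bar>g x\<bar> ^ 2 \<partial>M)"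
    by (rule Cauchy_Schwarz_nn_integral) measurable
  also have "(\<integral>\<^sup>+x. ennreal \<bar>f x\<bar> * ennreal \<bar>g x\<bar> \<partial>M) = (\<integral>\<^sup>+x. ennreal \<bar>f x * g x\<bar> \<partial>M)"
    by (simp add: abs_mult ennreal_mult)
  also have "\<dots> = ennreal ?I" using ifg by (intro nn_integral_eq_integral) auto
  also have "(\<integral>\<^sup>+x. ennreal \<bar>f x\<bar> ^ 2 \<partial>M) = (\<integral>\<^sup>+x. ennreal ((f x)\<^sup>2) \<partial>M)" by (simp add: ennreal_power)
  also have "\<dots> = ennreal ?F" using i by (intro nn_integral_eq_integral) auto
  also have "(\<integral>\<^sup>+x. ennreal \<bar>g x\<bar> ^ 2 \<partial>M) = (\<integral>\<^sup>+x. ennreal ((g x)\<^sup>2) \<partial>M)" by (simp add: ennreal_power)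
  also have "\<dots> = ennreal ?G" using i by (intro nn_integral_eq_integral) auto
  finally have "ennreal (?I\<^sup>2) \<le> ennreal (?F * ?G)" using nn by (simp add: ennreal_power ennreal_mult)
  then have "?I\<^sup>2 \<le> ?F * ?G" using nn by (simp add: mult_nonneg_nonneg)
  then show "?I \<le> sqrt ?F * sqrt ?G"
    using real_le_rsqrt real_sqrt_mult by metis
qed

lemma L2_iff:
  fixes f :: "real \<Rightarrow> 'b :: {banach, second_countable_topology}"
  assumes [measurable]: "w \<in> borel_measurable borel" and w: "\<And>x. w x \<ge> 0"
  shows "f \<in> L2 w \<longleftrightarrow> f \<in> borel_measurable hl \<and> integrable hl (\<lambda>x. w x * (norm (f x))\<^sup>2)"
proof -
  have "f \<in> borel_measurable (wmeas w) \<longleftrightarrow> f \<in> borel_measurable hl"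
    unfolding wmeas_def by (simp add: measurable_def)
  moreover have "integrable (wmeas w) (\<lambda>x. (norm (f x))\<^sup>2) \<longleftrightarrow> integrable hl (\<lambda>x. w x * (norm (f x))\<^sup>2)"
    if [measurable]: "f \<in> borel_measurable hl"
    unfolding wmeas_def using w by (subst integrable_density) auto
  ultimately show ?thesis by (auto simp: L2_def)
qed

lemma integral_wmeas:
  fixes f :: "real \<Rightarrow> 'b :: {banach, second_countable_topology}"
  assumes [measurable]: "w \<in> borel_measurable borel" and w: "\<And>x. w x \<ge> 0" and [measurable]: "f \<in> borel_measurable hl"
  shows "integral\<^sup>L (wmeas w) f = integral\<^sup>L hl (\<lambda>x. w x *\<^sub>R f x)"
    and "integrable (wmeas w) f \<longleftrightarrow> integrable hl (\<lambda>x. w x *\<^sub>R f x)"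
  unfolding wmeas_def using w by (auto simp: integral_density integrable_density)

lemma L2_norm_eq:
  fixes f :: "real \<Rightarrow> 'b :: {banach, second_countable_topology}"
  assumes "w \<in> borel_measurable borel" "\<And>x. w x \<ge> 0" "f \<in> borel_measurable hl"
  shows "L2_norm w f = sqrt (LINT x|hl. w x * (norm (f x))\<^sup>2)"
  unfolding L2_norm_def using assms by (subst integral_wmeas) auto

lemma AE_wmeas:
  assumes [measurable]: "w \<in> borel_measurable borel" and w: "\<And>x. x > 0 \<Longrightarrow> w x > 0"
  shows "(AE x in wmeas w. P x) \<longleftrightarrow> (AE x in hl. P x)"
proof -
  have "(AE x in wmeas w. P x) \<longleftrightarrow> (AE x in hl. 0 < ennreal (w x) \<longrightarrow> P x)"
    unfolding wmeas_def by (rule AE_density) measurable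
  also have "\<dots> \<longleftrightarrow> (AE x in hl. P x)" by (rule AE_cong) (use w in \<open>auto simp: ennreal_less_zero_iff\<close>)
  finally show ?thesis .
qed

context gauss_laguerre_weight
begin

section \<open>Integrals against the co-eigenfunctions\<close>

lemma ew_measurable [measurable]: "ew \<in> borel_measurable borel"
  unfolding e_w_def[abs_def] by measurable

lemmas L2_ew_iff = L2_iff[OF ew_measurable ew_nonneg]
lemmas L2_norm_ew = L2_norm_eq[OF ew_measurable ew_nonneg]
lemmas AE_ew = AE_wmeas[OF ew_measurable ew_pos]

lemma L2_measurable: "f \<in> L2 ew \<Longrightarrow> f \<in> borel_measurable hl"
  by (simp add: L2_ew_iff)

definition moment :: "nat \<Rightarrow> real" where
  "moment k = Gamma (\<alpha> * real k + \<alpha> * \<beta> + 1) / Gamma (\<alpha> * \<beta> + 1)"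

lemma moment_pos: "moment k > 0"
proof -
  have "\<alpha> * real k + \<alpha> * \<beta> + 1 > 0" using shape_pos \<alpha>_pos by (simp add: add.assoc add_nonneg_pos)
  then show ?thesis using shape_pos by (simp add: moment_def Gamma_real_pos)
qed

lemma moment_0 [simp]: "moment 0 = 1"
  using Gamma_real_pos[OF shape_pos] by (simp add: moment_def)

lemma ew_moment:
  shows "integrable hl (\<lambda>y. y ^ k * ew y)" and "integral\<^sup>L hl (\<lambda>y. y ^ k * ew y) = moment k"
proof -
  have eq: "y ^ k * ew y = inverse c\<^sub>0 * (y powr (real k + \<delta>) * exp (- (y powr (1/\<alpha>))))" if "y > 0" for y
    using that unfolding e_w_def powr_add powr_realpow[OF that] by (simp add: divide_inverse)
  have s: "real k + \<delta> > -1" using \<delta>_nonneg by simp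
  show "integrable hl (\<lambda>y. y ^ k * ew y)"
    using powr_exp_hl(1)[OF \<alpha>_pos s, of 1] by (subst hl_integrable_cong[OF eq]) auto
  have "\<alpha> * (real k + \<delta> + 1) = \<alpha> * real k + \<alpha> * \<beta> + 1"
    using \<alpha>_pos by (simp add: field_simps)
  then have "integral\<^sup>L hl (\<lambda>y. inverse c\<^sub>0 * (y powr (real k + \<delta>) * exp (- (y powr (1/\<alpha>))))) =
      inverse c\<^sub>0 * (\<alpha> * Gamma (\<alpha> * real k + \<alpha> * \<beta> + 1))"
    using powr_exp_hl(2)[OF \<alpha>_pos s zero_less_one] by (simp only: integral_mult_right_zero)
  then show "integral\<^sup>L hl (\<lambda>y. y ^ k * ew y) = moment k"
  proof -
    have "integral\<^sup>L hl (\<lambda>y. y ^ k * ew y) = integral\<^sup>L hl (\<lambda>y. inverse c\<^sub>0 * (y powr (real k + \<delta>) * exp (- (y powr (1/\<alpha>)))))"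
      by (rule hl_cong) (rule eq)
    also have "\<dots> = inverse c\<^sub>0 * (\<alpha> * Gamma (\<alpha> * real k + \<alpha> * \<beta> + 1))" by fact
    also have "\<dots> = moment k" using \<alpha>_pos by (simp add: moment_def divide_inverse)
    finally show ?thesis .
  qed
qed

text \<open>
  The bounds of \<open>W_bound_decay\<close> in the form \<open>majorant r x / rate r ^ n\<close>. As \<open>r\<close> increases to \<open>1\<close>,
  \<open>rate r\<close> increases to \<open>exp (- T_crit \<alpha>)\<close>.
\<close>

definition rate :: "real \<Rightarrow> real" where "rate r = (1 + r) powr \<alpha> - 1"

definition majorant :: "real \<Rightarrow> real \<Rightarrow> real" where
  "majorant r x = (x / (1 - rate r)) powr \<delta> * exp (- (x powr (1/\<alpha>) / (1 + r))) / (c\<^sub>0 * (1 - rate r))"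

lemma rate: "0 < r \<Longrightarrow> r < 1 \<Longrightarrow> 0 < rate r \<and> rate r < 1"
  using rate_bounds[of r] by (simp add: rate_def)

lemma W_le_majorant: "0 < r \<Longrightarrow> r < 1 \<Longrightarrow> x > 0 \<Longrightarrow> \<bar>W n x\<bar> \<le> majorant r x / rate r ^ n"
  using W_bound_decay[of r x n] by (simp add: rate_def majorant_def)

lemma majorant_nonneg: "0 < r \<Longrightarrow> r < 1 \<Longrightarrow> majorant r x \<ge> 0"
  using rate[of r] c\<^sub>0_pos by (simp add: majorant_def)

lemma majorant_measurable [measurable]: "majorant r \<in> borel_measurable borel"
  unfolding majorant_def[abs_def] by measurable

lemma majorant_eq:
  assumes "0 < r" "r < 1" "x > 0"
  shows "majorant r x = inverse ((1 - rate r) powr \<delta> * (c\<^sub>0 * (1 - rate r))) * (x powr \<delta> * exp (- (1 / (1 + r) * x powr (1/\<alpha>))))"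
  using assms rate[of r] unfolding majorant_def by (subst powr_divide) (auto simp: divide_inverse mult_ac)

text \<open>
  Since \<open>y \<le> 1 + y\<^bsup>1/\<alpha>\<^esup>\<close> and \<open>1 / (1 + r) > 1/2\<close>, the decay of the majorant affords a factor
  \<open>exp (y/4)\<close>.
\<close>

lemma majorant_exp_integrable:
  assumes r: "0 < r" "r < 1"
  shows "integrable hl (\<lambda>y. exp (\<bar>y\<bar> / 4) * majorant r y)"
proof (rule Bochner_Integration.integrable_bound)
  let ?C = "exp (1/4) * inverse ((1 - rate r) powr \<delta> * (c\<^sub>0 * (1 - rate r)))"
  have \<kappa>: "1 / (1 + r) - 1 / 4 > 0" using r by (simp add: field_simps)
  show "integrable hl (\<lambda>y. ?C * (y powr \<delta> * exp (- ((1 / (1 + r) - 1/4) * y powr (1/\<alpha>)))))"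
    by (intro integrable_mult_right powr_exp_hl(1)) (use \<alpha>_pos \<delta>_nonneg \<kappa> in auto)
  have cpos: "inverse ((1 - rate r) powr \<delta> * (c\<^sub>0 * (1 - rate r))) \<ge> 0"
    using rate[OF r]
    by (simp only: inverse_nonnegative_iff_nonnegative)
       (intro mult_nonneg_nonneg[OF powr_ge_zero mult_nonneg_nonneg[OF less_imp_le[OF c\<^sub>0_pos]]], simp)
  show "AE y in hl. norm (exp (\<bar>y\<bar> / 4) * majorant r y) \<le> norm (?C * (y powr \<delta> * exp (- ((1 / (1 + r) - 1/4) * y powr (1/\<alpha>)))))"
  proof (rule AE_hl_I)
    fix y :: real assume y: "y > 0"
    have "y \<le> 1 + y powr (1/\<alpha>)"
    proof (cases "y \<le> 1")
      case True then show ?thesis by (smt (verit) powr_ge_zero)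
    next
      case False
      then have "y powr 1 \<le> y powr (1/\<alpha>)" using inverse_\<alpha>_ge_1 by (intro powr_mono) auto
      then show ?thesis using y by simp
    qed
    then have "exp (\<bar>y\<bar> / 4) \<le> exp (1/4) * exp (1/4 * y powr (1/\<alpha>))"
      using y by (simp flip: exp_add)
    then have "exp (\<bar>y\<bar> / 4) * majorant r y \<le> exp (1/4) * exp (1/4 * y powr (1/\<alpha>)) * majorant r y"
      by (rule mult_right_mono) (use majorant_nonneg[OF r] in auto)
    also have "\<dots> = ?C * (y powr \<delta> * exp (- ((1 / (1 + r) - 1/4) * y powr (1/\<alpha>))))"
    proof -
      have e: "exp (1/4 * y powr (1/\<alpha>)) * exp (- (1 / (1 + r) * y powr (1/\<alpha>))) = exp (- ((1 / (1 + r) - 1/4) * y powr (1/\<alpha>)))"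
        by (simp add: algebra_simps flip: exp_add)
      have "e0 * e1 * (K * (Y * e2)) = e0 * K * (Y * e3)" if "e1 * e2 = e3" for e0 e1 e2 e3 K Y :: real
        using that by auto
      from this[OF e] show ?thesis unfolding majorant_eq[OF r y] .
    qed
    finally show "norm (exp (\<bar>y\<bar> / 4) * majorant r y) \<le> norm (?C * (y powr \<delta> * exp (- ((1 / (1 + r) - 1/4) * y powr (1/\<alpha>)))))"
      using mult_nonneg_nonneg[OF exp_ge_zero majorant_nonneg[OF r], of "\<bar>y\<bar> / 4" y]
      unfolding real_norm_def by linarith
  qed
qed measurable

text \<open>
  With \<open>u = y\<^bsup>1/\<alpha>\<^esup>\<close>, the quotient decays like \<open>exp(- (2 / (1 + r) - 1) u)\<close>, and the exponent is
  negative exactly for \<open>r < 1\<close>. This condition on \<open>r\<close> is the source of the critical time.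
\<close>

lemma majorant_sq_integrable:
  assumes r: "0 < r" "r < 1"
  shows "integrable hl (\<lambda>y. (majorant r y)\<^sup>2 / ew y)"
proof -
  let ?C = "(inverse ((1 - rate r) powr \<delta> * (c\<^sub>0 * (1 - rate r))))\<^sup>2 * c\<^sub>0"
  have \<kappa>: "2 / (1 + r) - 1 > 0" using r by (simp add: field_simps)
  have eq: "(majorant r y)\<^sup>2 / ew y = ?C * (y powr \<delta> * exp (- ((2 / (1 + r) - 1) * y powr (1/\<alpha>))))" if y: "y > 0" for y
  proof -
    let ?u = "y powr (1/\<alpha>)"
    have "(y powr \<delta> * exp (- (1 / (1 + r) * ?u)))\<^sup>2 / (y powr \<delta> * exp (- ?u)) = y powr \<delta> * ((exp (- (1 / (1 + r) * ?u)))\<^sup>2 / exp (- ?u))"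
      using y by (simp add: power2_eq_square field_simps)
    also have "(exp (- (1 / (1 + r) * ?u)))\<^sup>2 / exp (- ?u) = exp (- ((2 / (1 + r) - 1) * ?u))"
      by (simp add: power2_eq_square algebra_simps flip: exp_add exp_diff)
    finally have quot: "(y powr \<delta> * exp (- (1 / (1 + r) * ?u)))\<^sup>2 / (y powr \<delta> * exp (- ?u)) =
        y powr \<delta> * exp (- ((2 / (1 + r) - 1) * ?u))" .
    have "(K * A)\<^sup>2 / (B / c) = K\<^sup>2 * c * (A\<^sup>2 / B)" for K A B c :: real
      by (simp add: power_mult_distrib)
    then show ?thesis unfolding majorant_eq[OF r y] e_w_def quot[symmetric] .
  qed
  show ?thesis
    by (subst hl_integrable_cong[OF eq])
       (assumption, rule integrable_mult_right, rule powr_exp_hl(1)[OF \<alpha>_pos _ \<kappa>], use \<delta>_nonneg in linarith)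
qed

text \<open>
  Cauchy-Schwarz for the product of \<open>majorant r / sqrt ew\<close> and \<open>sqrt ew * f\<close>.
\<close>

lemma majorant_L2:
  assumes r: "0 < r" "r < 1"
  shows "\<exists>C\<ge>0. \<forall>f\<in>L2 ew. integrable hl (\<lambda>y. majorant r y * norm (f y :: 'b :: {banach, second_countable_topology})) \<and>
           (LINT y|hl. majorant r y * norm (f y)) \<le> C * L2_norm ew f"
proof (intro exI[of _ "sqrt (LINT y|hl. (majorant r y)\<^sup>2 / ew y)"] conjI ballI)
  fix f :: "real \<Rightarrow> 'b" assume f: "f \<in> L2 ew"
  note [measurable] = L2_measurable[OF f]
  let ?F = "\<lambda>y. majorant r y / sqrt (ew y)" and ?G = "\<lambda>y. sqrt (ew y) * norm (f y)"
  have F2: "(?F y)\<^sup>2 = (majorant r y)\<^sup>2 / ew y" and G2: "(?G y)\<^sup>2 = ew y * (norm (f y))\<^sup>2" for y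
    using ew_nonneg[of y] by (auto simp: power_divide power_mult_distrib)
  have FG: "?F y * ?G y = majorant r y * norm (f y)" if "y > 0" for y
    using ew_pos[OF that] by simp
  have i: "integrable hl (\<lambda>y. (?F y)\<^sup>2)" "integrable hl (\<lambda>y. (?G y)\<^sup>2)"
    unfolding F2 G2 using majorant_sq_integrable[OF r] f by (auto simp: L2_ew_iff)
  note cs = cauchy_schwarz_integral[OF _ _ i]
  show "integrable hl (\<lambda>y. majorant r y * norm (f y))"
    using cs(1) by (subst hl_integrable_cong[OF FG[symmetric]]) auto
  have "(LINT y|hl. majorant r y * norm (f y)) = (LINT y|hl. \<bar>?F y * ?G y\<bar>)"
    by (rule hl_cong) (use FG majorant_nonneg[OF r] in \<open>metis abs_of_nonneg mult_nonneg_nonneg norm_ge_zero\<close>)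
  also have "\<dots> \<le> sqrt (LINT y|hl. (majorant r y)\<^sup>2 / ew y) * L2_norm ew f"
    using cs(2) unfolding F2 G2 L2_norm_ew[OF L2_measurable[OF f]] by simp
  finally show "(LINT y|hl. majorant r y * norm (f y)) \<le> sqrt (LINT y|hl. (majorant r y)\<^sup>2 / ew y) * L2_norm ew f" .
qed (use r ew_nonneg in \<open>auto intro!: integral_nonneg_AE AE_hl_I divide_nonneg_nonneg\<close>)

lemma W_measurable_hl [measurable]: "W n \<in> borel_measurable hl"
  using W_measurable[of n] by (simp add: borel_measurable_hl_iff)

lemma W_integrable_majorized:
  fixes f :: "real \<Rightarrow> 'b :: {banach, second_countable_topology}"
  assumes r: "0 < r" "r < 1" and [measurable]: "f \<in> borel_measurable hl"
    and i: "integrable hl (\<lambda>y. majorant r y * norm (f y))"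
  shows "integrable hl (\<lambda>y. W n y *\<^sub>R f y)"
    and "(LINT y|hl. norm (W n y *\<^sub>R f y)) \<le> (LINT y|hl. majorant r y * norm (f y)) / rate r ^ n"
proof -
  have le: "norm (W n y *\<^sub>R f y) \<le> majorant r y * norm (f y) / rate r ^ n" if "y > 0" for y
    using mult_right_mono[OF W_le_majorant[OF r that, of n] norm_ge_zero[of "f y"]] by simp
  have i': "integrable hl (\<lambda>y. majorant r y * norm (f y) / rate r ^ n)" using i by simp
  show iW: "integrable hl (\<lambda>y. W n y *\<^sub>R f y)"
    by (rule Bochner_Integration.integrable_bound[OF i'])
       (use le rate[OF r] majorant_nonneg[OF r] in \<open>auto intro!: AE_hl_I simp: abs_mult\<close>)
  have "(LINT y|hl. norm (W n y *\<^sub>R f y)) \<le> (LINT y|hl. majorant r y * norm (f y) / rate r ^ n)"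
    by (rule integral_mono_AE) (use integrable_norm[OF iW] i' le in \<open>auto intro!: AE_hl_I\<close>)
  then show "(LINT y|hl. norm (W n y *\<^sub>R f y)) \<le> (LINT y|hl. majorant r y * norm (f y)) / rate r ^ n" by simp
qed

lemma W_L2:
  assumes r: "0 < r" "r < 1"
  shows "\<exists>C\<ge>0. \<forall>n. \<forall>f\<in>L2 ew. integrable hl (\<lambda>y. W n y *\<^sub>R (f y :: 'b :: {banach, second_countable_topology})) \<and>
           (LINT y|hl. norm (W n y *\<^sub>R f y)) \<le> C / rate r ^ n * L2_norm ew f"
proof -
  obtain C where C: "C \<ge> 0" "\<And>f. f \<in> L2 ew \<Longrightarrow> integrable hl (\<lambda>y. majorant r y * norm (f y :: 'b)) \<and>
           (LINT y|hl. majorant r y * norm (f y)) \<le> C * L2_norm ew f"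
    using majorant_L2[OF r, where 'b='b] by blast
  show ?thesis
  proof (intro exI[of _ C] conjI allI ballI C(1))
    fix n and f :: "real \<Rightarrow> 'b" assume f: "f \<in> L2 ew"
    note W = W_integrable_majorized[OF r L2_measurable[OF f] conjunct1[OF C(2)[OF f]], of n]
    show "integrable hl (\<lambda>y. W n y *\<^sub>R f y)" by (rule W)
    have "(LINT y|hl. majorant r y * norm (f y)) / rate r ^ n \<le> C * L2_norm ew f / rate r ^ n"
      using C(2)[OF f] rate[OF r] by (intro divide_right_mono) auto
    then show "(LINT y|hl. norm (W n y *\<^sub>R f y)) \<le> C / rate r ^ n * L2_norm ew f"
      using W(2) by simp
  qed
qed

text \<open>
  The generating function integrated termwise: integrals against all the \<open>W n\<close> at once are Taylor
  coefficients of an integral against the dilated weight.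
\<close>

lemma W_genfun_integral:
  fixes f :: "real \<Rightarrow> real"
  assumes r: "0 < r" "r < 1" and [measurable]: "f \<in> borel_measurable hl"
    and i: "integrable hl (\<lambda>y. majorant r y * norm (f y))" and q: "\<bar>q\<bar> < rate r"
  shows "(\<lambda>n. (LINT y|hl. W n y * f y) * q ^ n) sums (LINT y|hl. ew (y / (1 - q)) / (1 - q) * f y)"
proof -
  note W = W_integrable_majorized[OF r _ i, simplified]
  have q1: "\<bar>q\<bar> < 1" using q rate[OF r] by simp
  have "(\<lambda>n. LINT y|hl. W n y * f y * q ^ n) sums (LINT y|hl. (\<Sum>n. W n y * f y * q ^ n))"
  proof (rule sums_integral)
    show "integrable hl (\<lambda>y. W n y * f y * q ^ n)" for n using W(1) by simp
    show "AE y in hl. summable (\<lambda>n. norm (W n y * f y * q ^ n))"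
    proof (rule AE_hl_I)
      fix y :: real assume y: "y > 0"
      show "summable (\<lambda>n. norm (W n y * f y * q ^ n))"
      proof (rule summable_comparison_test)
        show "summable (\<lambda>n. majorant r y * \<bar>f y\<bar> * (\<bar>q\<bar> / rate r) ^ n)"
          using q rate[OF r] by (intro summable_mult summable_geometric) simp
        have "norm (W n y * f y * q ^ n) \<le> majorant r y * \<bar>f y\<bar> * (\<bar>q\<bar> / rate r) ^ n" for n
          using mult_right_mono[OF W_le_majorant[OF r y, of n], of "\<bar>f y\<bar> * \<bar>q\<bar> ^ n"]
          by (simp add: abs_mult power_abs power_divide mult_ac)
        then show "\<exists>N. \<forall>n\<ge>N. norm (norm (W n y * f y * q ^ n)) \<le> majorant r y * \<bar>f y\<bar> * (\<bar>q\<bar> / rate r) ^ n"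
          by auto
      qed
    qed
    show "summable (\<lambda>n. LINT y|hl. norm (W n y * f y * q ^ n))"
    proof (rule summable_comparison_test)
      show "summable (\<lambda>n. (LINT y|hl. majorant r y * \<bar>f y\<bar>) * (\<bar>q\<bar> / rate r) ^ n)"
        using q rate[OF r] by (intro summable_mult summable_geometric) simp
      have "(LINT y|hl. norm (W n y * f y * q ^ n)) \<le> (LINT y|hl. majorant r y * \<bar>f y\<bar>) * (\<bar>q\<bar> / rate r) ^ n" for n
      proof -
        have "(LINT y|hl. norm (W n y * f y * q ^ n)) = (LINT y|hl. \<bar>W n y * f y\<bar>) * \<bar>q\<bar> ^ n"
          by (simp add: abs_mult power_abs)
        also have "\<dots> \<le> (LINT y|hl. majorant r y * \<bar>f y\<bar>) / rate r ^ n * \<bar>q\<bar> ^ n"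
          using W(2)[of n] by (intro mult_right_mono) auto
        finally show ?thesis by (simp add: power_divide)
      qed
      then show "\<exists>N. \<forall>n\<ge>N. norm (LINT y|hl. norm (W n y * f y * q ^ n)) \<le> (LINT y|hl. majorant r y * \<bar>f y\<bar>) * (\<bar>q\<bar> / rate r) ^ n"
        by (auto intro!: exI[of _ 0])
    qed
  qed
  also have "(LINT y|hl. (\<Sum>n. W n y * f y * q ^ n)) = (LINT y|hl. ew (y / (1 - q)) / (1 - q) * f y)"
  proof (rule hl_cong)
    fix y :: real assume "y > 0"
    from sums_mult2[OF W_sums[OF this q1], of "f y"]
    show "(\<Sum>n. W n y * f y * q ^ n) = ew (y / (1 - q)) / (1 - q) * f y"
      by (simp add: sums_iff mult_ac)
  qed
  finally show ?thesis by simp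
qed

lemma majorant_power_integrable:
  assumes r: "0 < r" "r < 1"
  shows "integrable hl (\<lambda>y. majorant r y * \<bar>y ^ k\<bar>)"
proof -
  have "integrable hl (\<lambda>y. exp (0 * \<bar>y\<bar>) * \<bar>y\<bar> ^ k * \<bar>majorant r y\<bar>)"
    by (rule exp_moment_absorb[where V="\<lambda>y. y" and e="1/4"])
       (use majorant_exp_integrable[OF r] in auto)
  then show ?thesis using majorant_nonneg[OF r] by (simp add: power_abs mult_ac)
qed

lemma dilated_moment:
  assumes "q < 1"
  shows "(LINT y|hl. ew (y / (1 - q)) / (1 - q) * y ^ k) = (1 - q) ^ k * moment k"
    and "integrable hl (\<lambda>y. ew (y / (1 - q)) / (1 - q) * y ^ k)"
proof -
  have c: "1 - q > 0" using assms by simp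
  have eq: "ew ((1 - q) * y / (1 - q)) / (1 - q) * ((1 - q) * y) ^ k = ((1 - q) ^ k / (1 - q)) * (y ^ k * ew y)" for y
    using c by (simp add: power_mult_distrib)
  show "(LINT y|hl. ew (y / (1 - q)) / (1 - q) * y ^ k) = (1 - q) ^ k * moment k"
    using c by (subst hl_dilate(2)[OF c]) (simp only: eq integral_mult_right_zero ew_moment, simp)
  show "integrable hl (\<lambda>y. ew (y / (1 - q)) / (1 - q) * y ^ k)"
    by (subst hl_dilate(1)[OF c, symmetric]) (simp only: eq integrable_mult_right ew_moment)
qed

section \<open>The polynomials\<close>

abbreviation "P \<equiv> P_poly \<alpha> \<beta>"

lemma P_eq: "P n x = (\<Sum>k\<le>n. (-1) ^ k * real (n choose k) / moment k * x ^ k)"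
  using Gamma_real_pos[OF shape_pos] by (simp add: P_poly_def moment_def sum_distrib_left mult_ac)

lemma P_measurable [measurable]: "P n \<in> borel_measurable borel"
  unfolding P_eq[abs_def] by measurable

text \<open>
  Against the dilated weight the \<open>k\<close>-th power has the integral \<open>(1 - q)\<^sup>k m\<^sub>k\<close>. The coefficients of
  \<open>P m\<close> cancel \<open>m\<^sub>k\<close>, and the binomial theorem yields \<open>(1 - (1 - q))\<^sup>m = q\<^sup>m\<close>.
\<close>

lemma W_P_integrable: "integrable hl (\<lambda>y. W n y * P m y)"
  and P_W_biorthogonal: "(LINT y|hl. W n y * P m y) = (if n = m then 1 else 0)"
proof -
  have r: "(0::real) < 1/2" "(1/2::real) < 1" by auto
  have i: "integrable hl (\<lambda>y. majorant (1/2) y * norm (P m y))"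
  proof (rule Bochner_Integration.integrable_bound)
    show "integrable hl (\<lambda>y. \<Sum>k\<le>m. \<bar>(-1) ^ k * real (m choose k) / moment k\<bar> * (majorant (1/2) y * \<bar>y ^ k\<bar>))"
      by (intro Bochner_Integration.integrable_sum integrable_mult_right majorant_power_integrable) auto
    show "AE y in hl. norm (majorant (1/2) y * norm (P m y)) \<le> norm (\<Sum>k\<le>m. \<bar>(-1) ^ k * real (m choose k) / moment k\<bar> * (majorant (1/2) y * \<bar>y ^ k\<bar>))"
    proof (rule AE_I2)
      fix y
      have "\<bar>P m y\<bar> \<le> (\<Sum>k\<le>m. \<bar>(-1) ^ k * real (m choose k) / moment k\<bar> * \<bar>y ^ k\<bar>)"
        unfolding P_eq by (rule order_trans[OF sum_abs]) (simp add: abs_mult)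
      then have "majorant (1/2) y * \<bar>P m y\<bar> \<le> majorant (1/2) y * (\<Sum>k\<le>m. \<bar>(-1) ^ k * real (m choose k) / moment k\<bar> * \<bar>y ^ k\<bar>)"
        by (rule mult_left_mono) (use majorant_nonneg[OF r] in auto)
      also have "\<dots> = (\<Sum>k\<le>m. \<bar>(-1) ^ k * real (m choose k) / moment k\<bar> * (majorant (1/2) y * \<bar>y ^ k\<bar>))"
        by (simp add: sum_distrib_left mult_ac)
      finally show "norm (majorant (1/2) y * norm (P m y)) \<le> norm (\<Sum>k\<le>m. \<bar>(-1) ^ k * real (m choose k) / moment k\<bar> * (majorant (1/2) y * \<bar>y ^ k\<bar>))"
        using majorant_nonneg[OF r, of y] by (simp add: abs_mult)
    qed
  qed measurable
  show "integrable hl (\<lambda>y. W n y * P m y)"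
    using W_integrable_majorized(1)[OF r _ i, of n] by simp
  have gen: "(\<lambda>n. (LINT y|hl. W n y * P m y) * q ^ n) sums (q ^ m)" if q: "\<bar>q\<bar> < rate (1/2)" for q
  proof -
    have q1: "q < 1" using q rate[OF r] by auto
    have "(LINT y|hl. ew (y / (1 - q)) / (1 - q) * P m y) =
        (LINT y|hl. (\<Sum>k\<le>m. (-1) ^ k * real (m choose k) / moment k * (ew (y / (1 - q)) / (1 - q) * y ^ k)))"
      by (simp add: P_eq sum_distrib_left mult_ac)
    also have "\<dots> = (\<Sum>k\<le>m. (-1) ^ k * real (m choose k) / moment k * ((1 - q) ^ k * moment k))"
      using dilated_moment[OF q1] by (subst Bochner_Integration.integral_sum) (auto simp del: times_divide_eq_left times_divide_eq_right)
    also have "\<dots> = (\<Sum>k\<le>m. real (m choose k) * (- (1 - q)) ^ k * 1 ^ (m - k))"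
      using moment_pos by (intro sum.cong refl) (auto simp: less_imp_neq[symmetric] simp flip: power_mult_distrib)
    also have "\<dots> = (- (1 - q) + 1) ^ m" by (simp only: binomial_ring)
    finally have "(LINT y|hl. ew (y / (1 - q)) / (1 - q) * P m y) = q ^ m" by simp
    then show ?thesis using W_genfun_integral[OF r _ i q] by simp
  qed
  have gen2: "(\<lambda>n. (if n = m then 1 else 0) * q ^ n) sums (q ^ m)" for q :: real
    using sums_single[of m "\<lambda>n. q ^ n"] by (simp add: if_distrib[of "\<lambda>x. x * _"] cong: if_cong)
  show "(LINT y|hl. W n y * P m y) = (if n = m then 1 else 0)"
    using powser_coeffs_unique[of "rate (1/2)" "\<lambda>n. (LINT y|hl. W n y * P m y)" "\<lambda>q. q ^ m" "\<lambda>n. if n = m then 1 else 0" n]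
       gen gen2 rate[OF r] by auto
qed

text \<open>
  The \<open>k\<close>-th moment is at least \<open>R ^ k\<close> times the mass of the weight beyond \<open>R\<close>, which is positive.
\<close>

lemma inverse_moment_superexponential:
  assumes R: "R > 0"
  shows "\<exists>C>0. \<forall>k. 1 / moment k \<le> C / R ^ k"
proof -
  define p where "p = (LINT y|hl. indicator {R..} y * ew y)"
  have iw: "integrable hl ew" using ew_moment(1)[of 0] by simp
  have i: "integrable hl (\<lambda>y. indicator {R..} y * ew y)"
    by (rule Bochner_Integration.integrable_bound[OF iw]) (auto simp: indicator_def)
  have nn: "AE y in hl. 0 \<le> indicator {R..} y * ew y" using ew_nonneg by auto
  have "p \<noteq> 0"
  proof
    assume "p = 0"
    then have "AE y in hl. indicator {R..} y * ew y = 0"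
      using integral_nonneg_eq_0_iff_AE[OF i nn] by (simp add: p_def)
    then have "AE y in lborel. y \<in> {0<..} \<longrightarrow> indicator {R..} y * ew y = 0"
      by (simp add: AE_restrict_space_iff)
    then have "AE y in lborel. y \<notin> {R..R+1}"
    proof eventually_elim
      case (elim y)
      show ?case
      proof
        assume "y \<in> {R..R+1}"
        then show False using elim R ew_pos[of y] by (auto simp: indicator_def)
      qed
    qed
    then have "{R..R+1} \<in> null_sets lborel" by (subst (asm) AE_iff_null_sets[symmetric]) auto
    then show False by (simp add: null_sets_def)
  qed
  moreover have "p \<ge> 0" unfolding p_def by (rule integral_nonneg_AE[OF nn])
  ultimately have p: "p > 0" by simp
  have "R ^ k * p \<le> moment k" for k
  proof -
    have "R ^ k * p = (LINT y|hl. R ^ k * (indicator {R..} y * ew y))" by (simp add: p_def)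
    also have "\<dots> \<le> (LINT y|hl. y ^ k * ew y)"
      using i R ew_nonneg ew_moment(1)
      by (intro integral_mono_AE AE_hl_I) (auto simp: indicator_def intro!: mult_right_mono power_mono)
    finally show ?thesis by (simp add: ew_moment)
  qed
  then have "1 / moment k \<le> (1 / p) / R ^ k" for k
    using moment_pos[of k] p R by (simp add: field_simps)
  then show ?thesis using p by (intro exI[of _ "1 / p"]) auto
qed

definition cP :: "nat \<Rightarrow> complex \<Rightarrow> complex" where
  "cP n z = (\<Sum>k\<le>n. of_real ((-1) ^ k * real (n choose k) / moment k) * z ^ k)"

lemma cP_of_real: "cP n (of_real x) = of_real (P n x)"
  by (simp add: cP_def P_eq)

lemma cP_holomorphic: "cP n holomorphic_on S"
  unfolding cP_def[abs_def] by (intro holomorphic_intros)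

text \<open>
  With \<open>1/m\<^sub>k \<le> C (\<epsilon>/R)\<^sup>k\<close> the sum is dominated by the binomial expansion of \<open>(1 + \<epsilon>)\<^sup>n\<close>.
\<close>

lemma cP_bound:
  assumes "R > 0" "\<epsilon> > 0"
  shows "\<exists>C\<ge>0. \<forall>n z. cmod z \<le> R \<longrightarrow> cmod (cP n z) \<le> C * (1 + \<epsilon>) ^ n"
proof -
  obtain C where C: "C > 0" "\<And>k. 1 / moment k \<le> C / (R / \<epsilon>) ^ k"
    using inverse_moment_superexponential[of "R / \<epsilon>"] assms by auto
  have "cmod (cP n z) \<le> C * (1 + \<epsilon>) ^ n" if z: "cmod z \<le> R" for n z
  proof -
    have "cmod (cP n z) \<le> (\<Sum>k\<le>n. real (n choose k) * (1 / moment k) * cmod z ^ k)"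
      unfolding cP_def using moment_pos
      by (intro order_trans[OF norm_sum] sum_mono) (auto simp: norm_mult norm_power norm_divide less_imp_le)
    also have "\<dots> \<le> (\<Sum>k\<le>n. real (n choose k) * (C / (R / \<epsilon>) ^ k) * R ^ k)"
      using C z moment_pos assms by (intro sum_mono mult_mono power_mono) (auto intro!: mult_nonneg_nonneg divide_nonneg_nonneg less_imp_le[OF moment_pos])
    also have "\<dots> = C * (\<Sum>k\<le>n. real (n choose k) * \<epsilon> ^ k * 1 ^ (n - k))"
      using assms by (simp add: sum_distrib_left field_simps power_divide)
    also have "\<dots> = C * (\<epsilon> + 1) ^ n" by (simp only: binomial_ring)
    finally show ?thesis by (simp add: add.commute)
  qed
  then show ?thesis using C(1) by (intro exI[of _ C]) auto
qed

lemma P_has_deriv: "((deriv ^^ k) (P n) has_real_derivative (deriv ^^ Suc k) (P n) x) (at x)"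
  and P_deriv_of_real: "(deriv ^^ k) (cP n) (of_real x) = of_real ((deriv ^^ k) (P n) x)"
  using higher_deriv_complex_of_real[OF cP_holomorphic[of n UNIV] open_UNIV open_UNIV, of "P n" x k]
  by (simp_all add: cP_of_real)

text \<open>
  Cauchy's inequality on discs of radius \<open>1\<close>.
\<close>

lemma P_deriv_bound:
  assumes R: "R > 0" and \<epsilon>: "\<epsilon> > 0"
  shows "\<exists>C\<ge>0. \<forall>n x. \<bar>x\<bar> \<le> R \<longrightarrow> \<bar>(deriv ^^ k) (P n) x\<bar> \<le> C * (1 + \<epsilon>) ^ n"
proof -
  obtain C where C: "C \<ge> 0" "\<And>n z. cmod z \<le> R + 1 \<Longrightarrow> cmod (cP n z) \<le> C * (1 + \<epsilon>) ^ n"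
    using cP_bound[of "R + 1" \<epsilon>] assms by auto
  have "\<bar>(deriv ^^ k) (P n) x\<bar> \<le> fact k * C * (1 + \<epsilon>) ^ n" if x: "\<bar>x\<bar> \<le> R" for n x
  proof -
    have "cmod ((deriv ^^ k) (cP n) (of_real x)) \<le> fact k * (C * (1 + \<epsilon>) ^ n) / 1 ^ k"
    proof (rule Cauchy_inequality)
      fix z assume z: "cmod (of_real x - z) = 1"
      have "cmod z \<le> cmod (of_real x) + cmod (of_real x - z)"
        by (metis norm_minus_commute norm_triangle_sub)
      then show "cmod (cP n z) \<le> C * (1 + \<epsilon>) ^ n" using C(2) z x by simp
    qed (auto intro!: cP_holomorphic holomorphic_on_imp_continuous_on)
    then show ?thesis by (simp add: P_deriv_of_real)
  qed
  then show ?thesis using C(1) by (intro exI[of _ "fact k * C"]) auto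
qed

lemma P_bound: "R > 0 \<Longrightarrow> \<epsilon> > 0 \<Longrightarrow> \<exists>C\<ge>0. \<forall>n x. \<bar>x\<bar> \<le> R \<longrightarrow> \<bar>P n x\<bar> \<le> C * (1 + \<epsilon>) ^ n"
  using P_deriv_bound[of R \<epsilon> 0] by simp

lemma P_deriv_zero: "n < k \<Longrightarrow> (deriv ^^ k) (P n) x = 0"
proof -
  assume nk: "n < k"
  define p where "p = (\<Sum>k\<le>n. monom ((-1) ^ k * real (n choose k) / moment k) k)"
  have Pp: "P n = poly p" by (simp add: fun_eq_iff P_eq p_def poly_sum poly_monom)
  have "(deriv ^^ k) (poly q) = poly ((pderiv ^^ k) q)" for q :: "real poly"
  proof (induction k arbitrary: q)
    case (Suc k)
    have "deriv (poly q) = poly (pderiv q)" for q :: "real poly"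
      by (rule ext) (rule DERIV_imp_deriv, rule poly_DERIV)
    then show ?case using Suc by simp
  qed simp
  moreover have "degree p \<le> n" unfolding p_def
    by (rule degree_sum_le) (auto intro: order_trans[OF degree_monom_le])
  then have "(pderiv ^^ k) p = 0"
    using nk
  proof (induction k arbitrary: p n)
    case (Suc k)
    show ?case
    proof (cases "degree p")
      case 0
      then have "pderiv p = 0" using pderiv_eq_0_iff by blast
      then show ?thesis by (simp only: funpow_Suc_right o_apply) (induction k, auto)
    next
      case (Suc d)
      then have "degree (pderiv p) \<le> d" by (simp add: degree_pderiv)
      moreover have "d < k" using Suc \<open>degree p \<le> n\<close> \<open>n < Suc k\<close> by simp
      ultimately have "(pderiv ^^ k) (pderiv p) = 0" by (rule Suc.IH)
      then show ?thesis by (simp only: funpow_Suc_right o_apply)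
    qed
  qed simp
  ultimately show ?thesis by (simp add: Pp)
qed

end

section \<open>The action of the generator on polynomials\<close>

lemma unit_interval_integral:
  fixes f :: "real \<Rightarrow> real"
  assumes [measurable]: "f \<in> borel_measurable borel" and nn: "\<And>x. f x \<ge> 0" and i: "(f has_integral r) {0..1}"
  shows "integrable (restrict_space lborel {0<..<1}) f" "integral\<^sup>L (restrict_space lborel {0<..<1}) f = r"
proof -
  have r: "r \<ge> 0" by (rule has_integral_nonneg[OF i]) (use nn in auto)
  have "(\<integral>\<^sup>+x. f x \<partial>restrict_space lborel {0<..<1}) = (\<integral>\<^sup>+x. ennreal (f x) * indicator {0<..<1} x \<partial>lborel)"
    by (simp add: nn_integral_restrict_space)
  also have "\<dots> = (\<integral>\<^sup>+x. ennreal (f x) * indicator {0..1} x \<partial>lborel)"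
    by (rule nn_integral_cong_AE)
       (use AE_lborel_singleton[of 0] AE_lborel_singleton[of "1::real"] in \<open>eventually_elim, auto simp: indicator_def\<close>)
  also have "\<dots> = ennreal r" by (rule nn_integral_has_integral_lebesgue'[OF _ i]) (use nn in auto)
  finally have "(\<integral>\<^sup>+x. f x \<partial>restrict_space lborel {0<..<1}) = ennreal r" .
  moreover have "f \<in> borel_measurable (restrict_space lborel {0<..<1})" by (intro measurable_restrict_space1) simp
  ultimately show "integrable (restrict_space lborel {0<..<1}) f" "integral\<^sup>L (restrict_space lborel {0<..<1}) f = r"
    using nn_integral_eq_integrable[of f "restrict_space lborel {0<..<1}" r] nn r by auto
qed

lemma unit_interval_powr:
  assumes "s > (-1::real)"
  shows "integrable (restrict_space lborel {0<..<1}) (\<lambda>y. y powr s)" "integral\<^sup>L (restrict_space lborel {0<..<1}) (\<lambda>y. y powr s) = 1 / (s + 1)"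
  using unit_interval_integral[of "\<lambda>y. y powr s" "1 / (s + 1)"] has_integral_powr_from_0[OF assms, of 1] by auto

lemma binomial_series_pochhammer:
  fixes t b :: real
  assumes "\<bar>t\<bar> < 1"
  shows "(\<lambda>j. pochhammer b j / fact j * t ^ j) sums (1 - t) powr (- b)"
proof -
  have "(\<lambda>j. ((- b) gchoose j) * (- t) ^ j) sums (1 + (- t)) powr (- b)"
    by (rule gen_binomial_real) (use assms in auto)
  moreover have "((- b) gchoose j) * (- t) ^ j = pochhammer b j / fact j * t ^ j" for j
  proof -
    have "(-1) ^ j * (-1::real) ^ j = 1" by (simp flip: power_mult_distrib)
    then have "(-1) ^ j * p / f * ((-1) ^ j * u) = p / f * u" for p f u :: real
      by (metis mult.assoc mult.left_commute mult_1 times_divide_eq_left)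
    then show ?thesis unfolding gbinomial_pochhammer power_minus[of t j] by simp
  qed
  ultimately show ?thesis by simp
qed

text \<open>
  Expand \<open>(1 - y)\<^bsup>-\<alpha>\<^esup>\<close> in Euler's integral for \<open>B(x, 1 - \<alpha>)\<close> and integrate term by term; all terms
  are nonnegative.
\<close>

lemma Beta_series:
  fixes x \<alpha> :: real
  assumes x: "x > 0" and \<alpha>: "0 < \<alpha>" "\<alpha> < 1"
  shows "(\<lambda>j. pochhammer \<alpha> j / fact j / (x + real j)) sums (Gamma x * Gamma (1 - \<alpha>) / Gamma (x + 1 - \<alpha>))"
proof -
  let ?M = "restrict_space lborel {0<..<1::real}"
  let ?t = "\<lambda>j. pochhammer \<alpha> j / fact j / (x + real j)"
  have poch: "pochhammer \<alpha> j \<ge> 0" for j using \<alpha> by (simp add: pochhammer_nonneg)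
  have tn: "?t j \<ge> 0" for j using poch x by simp
  have "(\<integral>\<^sup>+y. (\<Sum>j. ennreal (pochhammer \<alpha> j / fact j * y powr (x - 1 + real j))) \<partial>?M) =
        (\<Sum>j. \<integral>\<^sup>+y. ennreal (pochhammer \<alpha> j / fact j * y powr (x - 1 + real j)) \<partial>?M)"
    by (rule nn_integral_suminf) (intro measurable_restrict_space1, simp)
  also have "\<dots> = (\<Sum>j. ennreal (?t j))"
  proof (rule arg_cong[where f=suminf], rule ext)
    fix j
    have "(\<integral>\<^sup>+y. ennreal (pochhammer \<alpha> j / fact j * y powr (x - 1 + real j)) \<partial>?M) =
        ennreal (LINT y|?M. pochhammer \<alpha> j / fact j * y powr (x - 1 + real j))"
      using unit_interval_powr[of "x - 1 + real j"] x poch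
      by (intro nn_integral_eq_integral) auto
    then show "(\<integral>\<^sup>+y. ennreal (pochhammer \<alpha> j / fact j * y powr (x - 1 + real j)) \<partial>?M) = ennreal (?t j)"
      using unit_interval_powr(2)[of "x - 1 + real j"] x by (simp add: mult.commute)
  qed
  also have "(\<integral>\<^sup>+y. (\<Sum>j. ennreal (pochhammer \<alpha> j / fact j * y powr (x - 1 + real j))) \<partial>?M) =
     (\<integral>\<^sup>+y. ennreal (y powr (x - 1) * (1 - y) powr (- \<alpha>)) \<partial>?M)"
  proof (rule nn_integral_cong)
    fix y assume "y \<in> space ?M"
    then have y: "0 < y" "y < 1" by (auto simp: space_restrict_space)
    have "(\<lambda>j. y powr (x - 1) * (pochhammer \<alpha> j / fact j * y ^ j)) sums (y powr (x - 1) * (1 - y) powr (- \<alpha>))"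
      by (rule sums_mult[OF binomial_series_pochhammer]) (use y in auto)
    moreover have "(\<lambda>j. y powr (x - 1) * (pochhammer \<alpha> j / fact j * y ^ j)) = (\<lambda>j. pochhammer \<alpha> j / fact j * y powr (x - 1 + real j))"
      using y by (simp add: powr_add powr_realpow mult_ac)
    ultimately have "(\<lambda>j. pochhammer \<alpha> j / fact j * y powr (x - 1 + real j)) sums (y powr (x - 1) * (1 - y) powr (- \<alpha>))"
      by (simp only:)
    then have "(\<lambda>j. ennreal (pochhammer \<alpha> j / fact j * y powr (x - 1 + real j))) sums ennreal (y powr (x - 1) * (1 - y) powr (- \<alpha>))"
      by (subst sums_ennreal) (use poch in auto)
    then show "(\<Sum>j. ennreal (pochhammer \<alpha> j / fact j * y powr (x - 1 + real j))) = ennreal (y powr (x - 1) * (1 - y) powr (- \<alpha>))"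
      by (simp add: sums_iff)
  qed
  also have "\<dots> = ennreal (Beta x (1 - \<alpha>))"
  proof -
    have "((\<lambda>t. t powr (x - 1) * (1 - t) powr (1 - \<alpha> - 1)) has_integral Beta x (1 - \<alpha>)) {0..1}"
      by (rule has_integral_Beta_real) (use x \<alpha> in auto)
    then have h: "((\<lambda>t. t powr (x - 1) * (1 - t) powr (- \<alpha>)) has_integral Beta x (1 - \<alpha>)) {0..1}" by simp
    note i = unit_interval_integral[OF _ _ h]
    show ?thesis using i by (subst nn_integral_eq_integral) auto
  qed
  finally have s: "(\<Sum>j. ennreal (?t j)) = ennreal (Beta x (1 - \<alpha>))" ..
  have B: "Beta x (1 - \<alpha>) = Gamma x * Gamma (1 - \<alpha>) / Gamma (x + 1 - \<alpha>)"
    by (simp add: Beta_def add_diff_eq)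
  have Bn: "Beta x (1 - \<alpha>) \<ge> 0" unfolding Beta_def using x \<alpha> by (intro divide_nonneg_nonneg mult_nonneg_nonneg) (auto simp: Gamma_real_nonneg)
  have "(\<lambda>j. ennreal (?t j)) sums ennreal (Beta x (1 - \<alpha>))"
    using s by (metis summableI summable_sums)
  then have "?t sums Beta x (1 - \<alpha>)" by (subst (asm) sums_ennreal) (use tn Bn in auto)
  then show ?thesis using B by simp
qed

lemma Gamma_reflection_real: "Gamma x * Gamma (1 - x) = pi / sin (pi * x)" for x :: real
proof -
  have "complex_of_real (Gamma x * Gamma (1 - x)) = of_real (pi / sin (pi * x))"
    using Gamma_reflection_complex[of "of_real x"] Gamma_complex_of_real[of x] Gamma_complex_of_real[of "1 - x"]
    by (simp flip: sin_of_real of_real_mult)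
  then show ?thesis by (simp only: of_real_eq_iff)
qed

text \<open>
  The two halves diverge separately, but \<open>(\<alpha> + 1)\<^sub>j = (\<alpha>)\<^sub>j (\<alpha> + j) / \<alpha>\<close> and
  \<open>(\<alpha> + j) / (x + j) = 1 - (x - \<alpha>) / (x + j)\<close> turn each term into a difference of terms of
  convergent Beta series.
\<close>

lemma Beta_difference_series:
  fixes x x' \<alpha> :: real
  assumes x: "x > \<alpha>" "x' > \<alpha>" and \<alpha>: "0 < \<alpha>" "\<alpha> < 1"
  shows "(\<lambda>j. pochhammer (\<alpha> + 1) j / fact j * (1 / (x + real j) - 1 / (x' + real j))) sums
     (Gamma (1 - \<alpha>) / \<alpha> * (Gamma x' / Gamma (x' - \<alpha>) - Gamma x / Gamma (x - \<alpha>)))"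
proof -
  have term_eq: "pochhammer (\<alpha> + 1) j / fact j * (1 / (x + real j) - 1 / (x' + real j)) =
     ((x' - \<alpha>) / \<alpha>) * (pochhammer \<alpha> j / fact j / (x' + real j)) - ((x - \<alpha>) / \<alpha>) * (pochhammer \<alpha> j / fact j / (x + real j))" for j
  proof -
    have p: "pochhammer (\<alpha> + 1) j = pochhammer \<alpha> j * (\<alpha> + real j) / \<alpha>"
      using pochhammer_rec[of \<alpha> j] pochhammer_Suc[of \<alpha> j] \<alpha> by (simp add: field_simps)
    have nz: "x + real j \<noteq> 0" "x' + real j \<noteq> 0" using x \<alpha> by auto
    have "(\<alpha> + real j) * (1 / (x + real j) - 1 / (x' + real j)) = (x' - \<alpha>) / (x' + real j) - (x - \<alpha>) / (x + real j)"
      using nz by (simp add: field_simps)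
    moreover have "q * s / \<alpha> / f * A = X' / \<alpha> * (q / f / d') - X / \<alpha> * (q / f / d)"
      if "s * A = X' / d' - X / d" for q s f A X X' d d' :: real
    proof -
      have "q * s / \<alpha> / f * A = q / \<alpha> / f * (s * A)" by simp
      then show ?thesis unfolding that by (simp add: right_diff_distrib mult_ac)
    qed
    ultimately show ?thesis unfolding p by blast
  qed
  have val: "(y - \<alpha>) / \<alpha> * (Gamma y * Gamma (1 - \<alpha>) / Gamma (y + 1 - \<alpha>)) = Gamma (1 - \<alpha>) / \<alpha> * (Gamma y / Gamma (y - \<alpha>))" if "y > \<alpha>" for y
  proof -
    have "Gamma (y - \<alpha> + 1) = (y - \<alpha>) * Gamma (y - \<alpha>)" by (rule Gamma_plus1) (use that in \<open>auto simp: nonpos_Ints_def\<close>)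
    then have G: "Gamma (y + 1 - \<alpha>) = (y - \<alpha>) * Gamma (y - \<alpha>)" by (simp add: algebra_simps)
    have "s / \<alpha> * (A * B / (s * C)) = B / \<alpha> * (A / C)" if "s \<noteq> 0" for s A B C
      using that by simp
    then show ?thesis unfolding G using that by simp
  qed
  have "(\<lambda>j. ((x' - \<alpha>) / \<alpha>) * (pochhammer \<alpha> j / fact j / (x' + real j)) - ((x - \<alpha>) / \<alpha>) * (pochhammer \<alpha> j / fact j / (x + real j))) sums
      ((x' - \<alpha>) / \<alpha> * (Gamma x' * Gamma (1 - \<alpha>) / Gamma (x' + 1 - \<alpha>)) - (x - \<alpha>) / \<alpha> * (Gamma x * Gamma (1 - \<alpha>) / Gamma (x + 1 - \<alpha>)))"
    by (intro sums_diff sums_mult Beta_series) (use x \<alpha> in auto)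
  then show ?thesis unfolding term_eq val[OF x(1)] val[OF x(2)] by (simp add: right_diff_distrib)
qed

context gauss_laguerre_weight
begin

text \<open>
  The first and the third parameter of the hypergeometric function differ by one, so their Pochhammer
  symbols leave the single quotient \<open>a / (a + j)\<close>.
\<close>

lemma g_GL_series:
  assumes y: "0 < y" "y < 1"
  defines "a \<equiv> \<alpha> * \<beta> + \<alpha> + 1"
  shows "(\<lambda>j. \<alpha> * Gamma \<alpha> * (pochhammer (\<alpha> + 1) j / fact j / (a + real j)) * y powr ((a + real j) / \<alpha>)) sums g_GL \<alpha> \<beta> y"
    and "summable (\<lambda>j. norm (\<alpha> * Gamma \<alpha> * (pochhammer (\<alpha> + 1) j / fact j / (a + real j)) * y powr ((a + real j) / \<alpha>)))"
proof -
  have a: "a > 0" using shape_pos \<alpha>_pos by (simp add: a_def)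
  define z where "z = y powr (1/\<alpha>)"
  have z: "0 < z" "z < 1" using y \<alpha>_pos powr_less_mono2[of "1/\<alpha>" y 1] by (auto simp: z_def)
  define c where "c = (\<lambda>j. pochhammer (\<alpha> + 1) j / fact j / (a + real j) * z ^ j)"
  have cn: "c j \<ge> 0" for j using \<alpha>_pos a z by (simp add: c_def pochhammer_nonneg)
  have sc: "summable c"
  proof (rule summable_comparison_test)
    show "summable (\<lambda>j. (1 / a) * (pochhammer (\<alpha> + 1) j / fact j * z ^ j))"
      using binomial_series_pochhammer[of z "\<alpha> + 1"] z by (intro summable_mult) (auto simp: sums_iff)
    have "c j \<le> (1 / a) * (pochhammer (\<alpha> + 1) j / fact j * z ^ j)" for j
    proof -
      have "pochhammer (\<alpha> + 1) j / fact j * z ^ j / (a + real j) \<le> pochhammer (\<alpha> + 1) j / fact j * z ^ j / a"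
        using a \<alpha>_pos z by (intro divide_left_mono mult_nonneg_nonneg) (auto simp: pochhammer_nonneg)
      then show ?thesis by (simp add: c_def mult.commute)
    qed
    then show "\<exists>N. \<forall>n\<ge>N. norm (c n) \<le> (1 / a) * (pochhammer (\<alpha> + 1) n / fact n * z ^ n)"
      using cn by auto
  qed
  have term_eq: "\<alpha> * Gamma \<alpha> * (pochhammer (\<alpha> + 1) j / fact j / (a + real j)) * y powr ((a + real j) / \<alpha>) = \<alpha> * Gamma \<alpha> * y powr (a / \<alpha>) * c j" for j
  proof -
    have "y powr ((a + real j) / \<alpha>) = y powr (a / \<alpha>) * z ^ j"
      using y z by (simp add: z_def add_divide_distrib powr_add powr_powr flip: powr_realpow)
    then show ?thesis by (simp add: c_def)
  qed
  have ha: "a / \<alpha> = \<beta> + 1/\<alpha> + 1" using \<alpha>_pos by (simp add: a_def field_simps)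
  have hyp: "hyp2F1 (\<alpha> * (\<beta> + 1) + 1) (\<alpha> + 1) (\<alpha> * (\<beta> + 1) + 2) z = a * (\<Sum>j. c j)"
  proof -
    have e: "\<alpha> * (\<beta> + 1) + 1 = a" "\<alpha> * (\<beta> + 1) + 2 = a + 1" by (simp_all add: a_def algebra_simps)
    have co: "pochhammer a j * pochhammer (\<alpha> + 1) j / (pochhammer (a + 1) j * fact j) * z ^ j = a * c j" for j
    proof -
      have "a * pochhammer (a + 1) j = pochhammer a j * (a + real j)"
        using pochhammer_rec[of a j] pochhammer_Suc[of a j] by simp
      moreover have "pochhammer (a + 1) j > 0" "pochhammer a j > 0" using a by (auto intro: pochhammer_pos)
      ultimately have "pochhammer a j / pochhammer (a + 1) j = a / (a + real j)"
        using a by (simp add: field_simps)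
      then have "pochhammer a j / pochhammer (a + 1) j * (pochhammer (\<alpha> + 1) j / fact j * z ^ j) = a / (a + real j) * (pochhammer (\<alpha> + 1) j / fact j * z ^ j)" by simp
      then show ?thesis by (simp add: c_def mult_ac)
    qed
    have "hyp2F1 (\<alpha> * (\<beta> + 1) + 1) (\<alpha> + 1) (\<alpha> * (\<beta> + 1) + 2) z = (\<Sum>j. a * c j)"
      unfolding e hyp2F1_def eval_fps_def co[symmetric] by simp
    then show ?thesis using sc by (simp add: suminf_mult)
  qed
  have g: "g_GL \<alpha> \<beta> y = \<alpha> * Gamma \<alpha> * y powr (a / \<alpha>) * (\<Sum>j. c j)"
  proof -
    have "g_GL \<alpha> \<beta> y = Gamma \<alpha> / (a / \<alpha>) * y powr (a / \<alpha>) * (a * (\<Sum>j. c j))"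
      unfolding g_GL_def ha hyp[unfolded z_def] ..
    then show ?thesis using a \<alpha>_pos by simp
  qed
  show "(\<lambda>j. \<alpha> * Gamma \<alpha> * (pochhammer (\<alpha> + 1) j / fact j / (a + real j)) * y powr ((a + real j) / \<alpha>)) sums g_GL \<alpha> \<beta> y"
    unfolding term_eq g using sc by (intro sums_mult summable_sums)
  show "summable (\<lambda>j. norm (\<alpha> * Gamma \<alpha> * (pochhammer (\<alpha> + 1) j / fact j / (a + real j)) * y powr ((a + real j) / \<alpha>)))"
    unfolding term_eq norm_mult using sc cn by (intro summable_mult) simp
qed

text \<open>
  By partial fractions the integrated terms are differences \<open>1 / (a + j) - 1 / (a' + j)\<close>, so the sum
  is a Beta difference series. The reflection formula for \<open>\<Gamma>(\<alpha>) \<Gamma>(1 - \<alpha>)\<close> absorbs the sine.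
\<close>

lemma g_GL_moment:
  assumes \<alpha>1: "\<alpha> < 1" and u: "u \<ge> 1"
  shows "integrable (restrict_space lborel {0<..<1}) (\<lambda>y. y ^ (u - 1) * g_GL \<alpha> \<beta> y)"
    and "sin (\<alpha> * pi) / pi * real u * (LINT y|restrict_space lborel {0<..<1}. y ^ (u - 1) * g_GL \<alpha> \<beta> y) =
           moment (Suc u) / moment u - moment 1"
proof -
  let ?M = "restrict_space lborel {0<..<1::real}"
  define a where "a = \<alpha> * \<beta> + \<alpha> + 1"
  define a' where "a' = \<alpha> * real u + a"
  have a: "a > \<alpha>" using shape_pos by (simp add: a_def)
  have a': "a' > \<alpha>" 
  proof -
    have "0 \<le> \<alpha> * real u" using \<alpha>_pos by simp
    then show ?thesis using a unfolding a'_def by linarith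
  qed
  define f where "f = (\<lambda>j y. y ^ (u - 1) * (\<alpha> * Gamma \<alpha> * (pochhammer (\<alpha> + 1) j / fact j / (a + real j)) * y powr ((a + real j) / \<alpha>)))"
  define C where "C = (\<lambda>j. \<alpha> * Gamma \<alpha> * (pochhammer (\<alpha> + 1) j / fact j / (a + real j)))"
  have Cn: "C j \<ge> 0" for j unfolding C_def using \<alpha>_pos a
    by (intro mult_nonneg_nonneg divide_nonneg_nonneg) (auto simp: pochhammer_nonneg Gamma_real_nonneg)
  have f_eq: "f j y = C j * y powr (real u - 1 + (a + real j) / \<alpha>)" if "y > 0" for j y
  proof -
    have "y ^ (u - 1) = y powr (real u - 1)" using that u by (simp add: of_nat_diff flip: powr_realpow)
    then show ?thesis by (simp add: f_def C_def powr_add)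
  qed
  have s: "real u - 1 + (a + real j) / \<alpha> > -1" for j
  proof -
    have "(a + real j) / \<alpha> > 0" using a \<alpha>_pos by simp
    then show ?thesis using u by simp
  qed
  note pw = unit_interval_powr[OF s]
  have cong: "integral\<^sup>L ?M (f j) = integral\<^sup>L ?M (\<lambda>y. C j * y powr (real u - 1 + (a + real j) / \<alpha>))" for j
    by (rule Bochner_Integration.integral_cong) (auto simp: space_restrict_space f_eq)
  have fi: "integrable ?M (f j)" for j
  proof -
    have "integrable ?M (\<lambda>y. C j * y powr (real u - 1 + (a + real j) / \<alpha>))" using pw by simp
    then show ?thesis by (subst Bochner_Integration.integrable_cong[OF refl]) (auto simp: space_restrict_space f_eq)
  qed
  have sq: "1 / (real u - 1 + (a + real j) / \<alpha> + 1) = \<alpha> / (a' + real j)" for j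
    using \<alpha>_pos by (simp add: a'_def field_simps)
  have fv: "integral\<^sup>L ?M (f j) = C j * (\<alpha> / (a' + real j))" for j
    unfolding cong using pw(2)[of j] sq[of j] by simp
  have key: "real u * (C j * (\<alpha> / (a' + real j))) = \<alpha> * Gamma \<alpha> * (pochhammer (\<alpha> + 1) j / fact j * (1 / (a + real j) - 1 / (a' + real j)))" for j
  proof -
    have nz: "a + real j \<noteq> 0" "a' + real j \<noteq> 0" using a a' \<alpha>_pos by auto
    have "real u * \<alpha> / ((a + real j) * (a' + real j)) = 1 / (a + real j) - 1 / (a' + real j)"
      using nz by (simp add: a'_def field_simps)
    moreover have "U * (\<alpha> * Gm * (p / f / d) * (\<alpha> / d')) = \<alpha> * Gm * (p / f * D)" if "U * \<alpha> / (d * d') = D" for U Gm p f d d' D :: real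
      unfolding that[symmetric] by (simp add: mult_ac)
    ultimately show ?thesis unfolding C_def by blast
  qed
  have ser: "(\<lambda>j. real u * integral\<^sup>L ?M (f j)) sums
     (\<alpha> * Gamma \<alpha> * (Gamma (1 - \<alpha>) / \<alpha> * (Gamma a' / Gamma (a' - \<alpha>) - Gamma a / Gamma (a - \<alpha>))))"
    unfolding fv key by (rule sums_mult[OF Beta_difference_series[OF a a' \<alpha>_pos \<alpha>1]])
  have sm: "summable (\<lambda>j. integral\<^sup>L ?M (f j))"
    using summable_mult[OF sums_summable[OF ser], of "1 / real u"] u by simp
  have fn: "norm (f j y) = f j y" if "y \<in> space ?M" for j y
    using that Cn[of j] f_eq by (auto simp: space_restrict_space)
  have AEs: "AE y in ?M. summable (\<lambda>j. norm (f j y))"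
  proof (rule AE_I2)
    fix y assume "y \<in> space ?M"
    then show "summable (\<lambda>j. norm (f j y))"
      unfolding f_def norm_mult[of "y ^ (u - 1)"] a_def by (intro summable_mult g_GL_series(2)) (auto simp: space_restrict_space)
  qed
  have sm': "summable (\<lambda>j. LINT y|?M. norm (f j y))"
  proof -
    have "(LINT y|?M. norm (f j y)) = integral\<^sup>L ?M (f j)" for j
      by (rule Bochner_Integration.integral_cong[OF refl fn])
    then show ?thesis using sm by (simp only:)
  qed
  have sf: "(\<Sum>j. f j y) = y ^ (u - 1) * g_GL \<alpha> \<beta> y" if "y \<in> space ?M" for y
    using sums_mult[OF g_GL_series(1), of y "y ^ (u - 1)"] that unfolding f_def a_def
    by (auto simp: space_restrict_space sums_iff)
  show int: "integrable ?M (\<lambda>y. y ^ (u - 1) * g_GL \<alpha> \<beta> y)"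
    by (rule iffD1[OF Bochner_Integration.integrable_cong[OF refl sf] integrable_suminf[OF fi AEs sm']])
  have "(\<lambda>j. integral\<^sup>L ?M (f j)) sums (LINT y|?M. y ^ (u - 1) * g_GL \<alpha> \<beta> y)"
    using sums_integral[OF fi AEs sm'] Bochner_Integration.integral_cong[OF refl sf, of ?M "\<lambda>y. y"] by simp
  from sums_mult[OF this, of "real u"] ser
  have "real u * (LINT y|?M. y ^ (u - 1) * g_GL \<alpha> \<beta> y) =
      \<alpha> * Gamma \<alpha> * (Gamma (1 - \<alpha>) / \<alpha> * (Gamma a' / Gamma (a' - \<alpha>) - Gamma a / Gamma (a - \<alpha>)))"
    by (rule sums_unique2)
  also have "\<dots> = (Gamma \<alpha> * Gamma (1 - \<alpha>)) * (Gamma a' / Gamma (a' - \<alpha>) - Gamma a / Gamma (a - \<alpha>))"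
    using \<alpha>_pos by simp
  also have "\<dots> = pi / sin (\<alpha> * pi) * (Gamma a' / Gamma (a' - \<alpha>) - Gamma a / Gamma (a - \<alpha>))"
    unfolding Gamma_reflection_real by (simp add: mult.commute)
  finally have "sin (\<alpha> * pi) / pi * (real u * (LINT y|?M. y ^ (u - 1) * g_GL \<alpha> \<beta> y)) =
      sin (\<alpha> * pi) / pi * (pi / sin (\<alpha> * pi) * (Gamma a' / Gamma (a' - \<alpha>) - Gamma a / Gamma (a - \<alpha>)))" by simp
  also have "\<dots> = Gamma a' / Gamma (a' - \<alpha>) - Gamma a / Gamma (a - \<alpha>)"
  proof -
    have "sin (\<alpha> * pi) > 0" using \<alpha>_pos \<alpha>1 by (intro sin_gt_zero) auto
    then show ?thesis by simp
  qed
  also have "Gamma a' / Gamma (a' - \<alpha>) = moment (Suc u) / moment u"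
  proof -
    have 1: "a' = \<alpha> * real (Suc u) + \<alpha> * \<beta> + 1" and 2: "a' - \<alpha> = \<alpha> * real u + \<alpha> * \<beta> + 1"
      by (simp_all add: a'_def a_def algebra_simps)
    have "moment (Suc u) = Gamma a' / Gamma (\<alpha> * \<beta> + 1)" unfolding moment_def 1 ..
    moreover have "moment u = Gamma (a' - \<alpha>) / Gamma (\<alpha> * \<beta> + 1)" unfolding moment_def 2 ..
    ultimately show ?thesis using Gamma_real_pos[OF shape_pos] by simp
  qed
  also have "Gamma a / Gamma (a - \<alpha>) = moment 1"
  proof -
    have 1: "a = \<alpha> * real 1 + \<alpha> * \<beta> + 1" and 2: "a - \<alpha> = \<alpha> * \<beta> + 1" by (simp_all add: a_def algebra_simps)
    show ?thesis unfolding moment_def 2 using 1 by simp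
  qed
  finally show "sin (\<alpha> * pi) / pi * real u * (LINT y|?M. y ^ (u - 1) * g_GL \<alpha> \<beta> y) =
           moment (Suc u) / moment u - moment 1" by (simp add: mult.assoc)
qed

definition P_pol :: "nat \<Rightarrow> real poly" where
  "P_pol n = (\<Sum>k\<le>n. monom ((-1) ^ k * real (n choose k) / moment k) k)"

lemma poly_P_pol: "poly (P_pol n) = P n"
  by (simp add: fun_eq_iff P_eq P_pol_def poly_sum poly_monom)

text \<open>
  Applied to \<open>x ^ k\<close>, the drift term contributes the factor \<open>m\<^sub>1\<close> and the integral term, by the moments
  of \<open>g_GL\<close>, the excess of \<open>m\<^sub>k / m\<^bsub>k-1\<^esub>\<close> over it, each multiplied by \<open>k x\<^bsup>k-1\<^esup>\<close>.
\<close>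

lemma L_GL_poly_sum:
  assumes \<alpha>1: "\<alpha> < 1"
  defines "\<phi> \<equiv> \<lambda>k. moment k / moment (k - 1)"
  shows "L_GL \<alpha> \<beta> (\<lambda>x. \<Sum>k\<le>n. c k * x ^ k) x = (\<Sum>k\<le>n. c k * (real k * \<phi> k * x ^ (k - 1) - real k * x ^ k))"
proof -
  let ?M = "restrict_space lborel {0<..<1::real}"
  let ?f = "\<lambda>x::real. \<Sum>k\<le>n. c k * x ^ k"
  let ?f1 = "\<lambda>x. \<Sum>k\<le>n. c k * (real k * x ^ (k - 1))"
  let ?f2 = "\<lambda>x. \<Sum>k\<le>n. c k * (real k * (real (k - 1) * x ^ (k - 2)))"
  have d1: "deriv ?f = ?f1"
    by (rule ext, rule DERIV_imp_deriv) (auto intro!: derivative_eq_intros sum.cong)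
  have "deriv ?f1 = ?f2"
    by (rule ext, rule DERIV_imp_deriv) (auto intro!: derivative_eq_intros sum.cong simp: diff_diff_left numeral_2_eq_2)
  then have d2: "(deriv ^^ 2) ?f = ?f2" by (simp add: numeral_2_eq_2 d1)
  define G where "G = (\<lambda>u. LINT y|?M. y ^ (u - 1) * g_GL \<alpha> \<beta> y)"
  have int_eq: "(LBINT y:{0<..<1}. ?f2 (x * y) * g_GL \<alpha> \<beta> y) = (\<Sum>k\<le>n. c k * (real k * (real (k - 1) * x ^ (k - 2))) * G (k - 1))"
  proof -
    have "(LBINT y:{0<..<1}. ?f2 (x * y) * g_GL \<alpha> \<beta> y) = (LINT y|?M. ?f2 (x * y) * g_GL \<alpha> \<beta> y)"
      using integral_restrict_space[of "{0<..<1}" lborel "\<lambda>y. ?f2 (x * y) * g_GL \<alpha> \<beta> y"] by (simp add: set_lebesgue_integral_def)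
    also have "\<dots> = (LINT y|?M. (\<Sum>k\<le>n. c k * (real k * (real (k - 1) * x ^ (k - 2))) * (y ^ (k - 1 - 1) * g_GL \<alpha> \<beta> y)))"
      by (rule Bochner_Integration.integral_cong)
         (auto simp: sum_distrib_right power_mult_distrib diff_diff_left numeral_2_eq_2 intro!: sum.cong)
    also have "\<dots> = (\<Sum>k\<le>n. c k * (real k * (real (k - 1) * x ^ (k - 2))) * G (k - 1))"
      unfolding G_def
    proof (subst Bochner_Integration.integral_sum)
      fix k
      show "integrable ?M (\<lambda>y. c k * (real k * (real (k - 1) * x ^ (k - 2))) * (y ^ (k - 1 - 1) * g_GL \<alpha> \<beta> y))"
      proof (cases "k - 1 \<ge> 1")
        case True
        then show ?thesis by (intro integrable_mult_right g_GL_moment(1)[OF \<alpha>1])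
      next
        case False
        then have "real (k - 1) = 0" by simp
        then show ?thesis by simp
      qed
    qed simp
    finally show ?thesis .
  qed
  have d: "d_GL \<alpha> \<beta> = moment 1" by (simp add: d_GL_def moment_def algebra_simps)
  have key: "(moment 1 - x) * (c k * (real k * x ^ (k - 1))) + sin (\<alpha> * pi) / pi * x * (c k * (real k * (real (k - 1) * x ^ (k - 2))) * G (k - 1)) =
      c k * (real k * \<phi> k * x ^ (k - 1) - real k * x ^ k)" for k
  proof -
    consider "k = 0" | "k = 1" | "k \<ge> 2" by linarith
    then show ?thesis
    proof cases
      case 3
      define u where "u = k - 1"
      have u: "u \<ge> 1" "k = Suc u" using 3 by (auto simp: u_def)
      have xx: "x * x ^ (k - 2) = x ^ u" using u by (cases u) auto
      have "sin (\<alpha> * pi) / pi * x * (c k * (real k * (real (k - 1) * x ^ (k - 2))) * G (k - 1)) =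
          c k * real k * (x * x ^ (k - 2)) * (sin (\<alpha> * pi) / pi * real u * G u)"
        by (simp add: u_def)
      also have "\<dots> = c k * real k * x ^ u * (\<phi> k - moment 1)"
        unfolding xx G_def g_GL_moment(2)[OF \<alpha>1 u(1)] by (simp add: \<phi>_def u(2))
      finally show ?thesis using u by (simp add: algebra_simps)
    qed (auto simp: \<phi>_def algebra_simps)
  qed
  have "L_GL \<alpha> \<beta> ?f x = (\<Sum>k\<le>n. (moment 1 - x) * (c k * (real k * x ^ (k - 1))) + sin (\<alpha> * pi) / pi * x * (c k * (real k * (real (k - 1) * x ^ (k - 2))) * G (k - 1)))"
    unfolding L_GL_def d d2 int_eq by (simp add: d1 sum.distrib sum_distrib_left)
  then show ?thesis unfolding key .
qed

text \<open>
  The quotients of moments cancel against the coefficients of \<open>P n\<close>; there remains the identity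
  \<open>(k + 1) (n choose (k + 1)) = (n - k) (n choose k)\<close>.
\<close>

lemma L_GL_P:
  assumes \<alpha>1: "\<alpha> < 1"
  shows "L_GL \<alpha> \<beta> (P n) x = - real n * P n x"
proof -
  let ?c = "\<lambda>k. (-1) ^ k * real (n choose k) / moment k"
  have "L_GL \<alpha> \<beta> (P n) x = (\<Sum>k\<le>n. ?c k * (real k * (moment k / moment (k - 1)) * x ^ (k - 1) - real k * x ^ k))"
    unfolding P_eq[abs_def] by (rule L_GL_poly_sum[OF \<alpha>1])
  also have "\<dots> = (\<Sum>k\<le>n. (-1) ^ k * real (n choose k) * real k / moment (k - 1) * x ^ (k - 1)) - (\<Sum>k\<le>n. real k * (?c k * x ^ k))"
    unfolding sum_subtractf[symmetric] using moment_pos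
    by (intro sum.cong refl) (auto simp: right_diff_distrib less_imp_neq[symmetric] mult_ac)
  also have "(\<Sum>k\<le>n. (-1) ^ k * real (n choose k) * real k / moment (k - 1) * x ^ (k - 1)) =
      (\<Sum>k<n. (-1) ^ Suc k * real (n choose Suc k) * real (Suc k) / moment k * x ^ k)"
    by (simp add: lessThan_Suc_atMost[symmetric] sum.lessThan_Suc_shift del: sum.lessThan_Suc)
  also have "\<dots> = (\<Sum>k<n. - real (n - k) * (?c k * x ^ k))"
  proof (rule sum.cong[OF refl])
    fix k assume "k \<in> {..<n}"
    have "real (n choose Suc k) * real (Suc k) = real (n choose k) * real (n - k)"
      using binomial_absorb_comp[of n k] binomial_absorption[of k n]
      by (metis mult.commute of_nat_mult)
    then show "(-1) ^ Suc k * real (n choose Suc k) * real (Suc k) / moment k * x ^ k = - real (n - k) * (?c k * x ^ k)"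
      by (simp add: mult.assoc)
  qed
  also have "\<dots> = (\<Sum>k\<le>n. - real (n - k) * (?c k * x ^ k))"
    by (simp add: lessThan_Suc_atMost[symmetric])
  also have "\<dots> - (\<Sum>k\<le>n. real k * (?c k * x ^ k)) = (\<Sum>k\<le>n. - real n * (?c k * x ^ k))"
  proof -
    have "- (N - K) * T - K * T = - N * T" for N K T :: real by (simp add: algebra_simps)
    then show ?thesis
      unfolding sum_subtractf[symmetric] by (intro sum.cong refl) (simp only: of_nat_diff atMost_iff)
  qed
  also have "\<dots> = - real n * P n x" by (simp add: P_eq sum_distrib_left)
  finally show ?thesis .
qed

end

section \<open>The Laguerre case and the operator \<open>\<Lambda>\<close>\<close>

interpretation laguerre: gauss_laguerre_weight 1 0
  by unfold_locales auto

lemma laguerre_ew: "x > 0 \<Longrightarrow> e_w 1 0 x = exp (- x)"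
  by (simp add: e_w_def)

lemma laguerre_moment: "laguerre.moment k = fact k"
  by (simp add: laguerre.moment_def Gamma_fact add.commute)

lemma e_lag_measurable [measurable]: "e_lag \<in> borel_measurable borel"
  unfolding e_lag_def[abs_def] by measurable

lemma L2_e_lag_iff: "f \<in> L2 e_lag \<longleftrightarrow> f \<in> L2 (e_w 1 0)"
  unfolding laguerre.L2_ew_iff by (subst L2_iff) (auto simp: e_lag_def laguerre_ew cong: hl_integrable_cong)

lemma higher_deriv_exp_uminus: "(deriv ^^ n) (\<lambda>w. exp (- w)) = (\<lambda>w. (-1) ^ n * exp (- w :: complex))"
proof (induction n)
  case (Suc n)
  have "deriv (\<lambda>w. (-1) ^ n * exp (- w)) = (\<lambda>w::complex. (-1) ^ Suc n * exp (- w))"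
    by (rule ext, rule DERIV_imp_deriv) (auto intro!: derivative_eq_intros)
  then show ?case using Suc by simp
qed simp

text \<open>
  Rodrigues' formula for the Laguerre polynomials, by the Leibniz rule. It turns biorthogonality into
  orthonormality.
\<close>

lemma laguerre_W: 
  assumes x: "x > 0"
  shows "W_fun 1 0 n x = exp (- x) * P_poly 1 0 n x"
proof -
  have cew: "laguerre.cew w = exp (- w)" if "w \<in> {z. Re z > 0}" for w
    using that by (auto simp: laguerre.cew_def)
  let ?z = "complex_of_real x"
  have z: "?z \<in> {z. Re z > 0}" using x by simp
  have hol: "(\<lambda>w. w ^ n * exp (- w)) holomorphic_on {z. Re z > 0}" "(\<lambda>w. w ^ n) holomorphic_on {z::complex. Re z > 0}" "(\<lambda>w. exp (- w)) holomorphic_on {z::complex. Re z > 0}"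
    by (intro holomorphic_intros)+
  have hol': "(\<lambda>w. w ^ n * laguerre.cew w) holomorphic_on {z. Re z > 0}"
    by (rule holomorphic_transform[OF hol(1)]) (simp add: cew)
  have pw: "(deriv ^^ i) (\<lambda>w. w ^ n) ?z = fact n / fact (n - i) * ?z ^ (n - i)" if "i \<le> n" for i
  proof -
    have "(deriv ^^ i) (\<lambda>w. (w - 0) ^ n) ?z = pochhammer (of_nat (Suc n - i)) i * (?z - 0) ^ (n - i)"
      by (rule higher_deriv_power)
    moreover have "pochhammer (of_nat (Suc n - i)) i = (fact n / fact (n - i) :: complex)"
    proof -
      have "fact (n - i) * pochhammer (1 + of_nat (n - i)) i = pochhammer (1::complex) (n - i + i)"
        by (simp add: pochhammer_fact pochhammer_product')
      moreover have "pochhammer (1::complex) (n - i + i) = fact n" using that by (simp add: pochhammer_fact)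
      moreover have "of_nat (Suc n - i) = (1 + of_nat (n - i) :: complex)" using that by (simp add: Suc_diff_le)
      ultimately show ?thesis by (simp add: field_simps)
    qed
    ultimately show ?thesis by simp
  qed
  have "laguerre.cW n ?z = (deriv ^^ n) (\<lambda>w. w ^ n * exp (- w)) ?z / fact n"
    unfolding laguerre.cW_def
    by (subst higher_deriv_transform_within_open[OF hol' hol(1) laguerre.open_right_half z]) (auto simp: cew)
  also have "(deriv ^^ n) (\<lambda>w. w ^ n * exp (- w)) ?z =
      (\<Sum>i = 0..n. of_nat (n choose i) * (deriv ^^ i) (\<lambda>w. w ^ n) ?z * (deriv ^^ (n - i)) (\<lambda>w. exp (- w)) ?z)"
    by (rule higher_deriv_mult[OF hol(2,3) laguerre.open_right_half z])
  also have "\<dots> = (\<Sum>i = 0..n. of_nat (n choose (n - i)) * (fact n / fact (n - i) * ?z ^ (n - i)) * ((-1) ^ (n - i) * exp (- ?z)))"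
    by (intro sum.cong refl) (auto simp: pw higher_deriv_exp_uminus binomial_symmetric[symmetric])
  also have "\<dots> = (\<Sum>k = 0..n. of_nat (n choose k) * (fact n / fact k * ?z ^ k) * ((-1) ^ k * exp (- ?z)))"
    by (rule sum.reindex_bij_witness[of _ "\<lambda>k. n - k" "\<lambda>k. n - k"]) auto
  also have "\<dots> / fact n = (\<Sum>k = 0..n. of_nat (n choose k) / fact k * ?z ^ k * ((-1) ^ k * exp (- ?z)))"
    by (simp add: sum_divide_distrib mult_ac)
  also have "\<dots> = of_real (exp (- x) * P_poly 1 0 n x)"
    unfolding laguerre.P_eq laguerre_moment
    by (simp add: sum_distrib_left exp_of_real[symmetric] atMost_atLeast0 mult_ac)
  finally show ?thesis using laguerre.W_of_real[OF x, of n] by (metis of_real_eq_iff)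
qed

lemma laguerre_orthonormal: "(LINT x|hl. exp (- x) * (P_poly 1 0 n x)\<^sup>2) = 1"
  and laguerre_sq_integrable: "integrable hl (\<lambda>x. exp (- x) * (P_poly 1 0 n x)\<^sup>2)"
proof -
  have eq: "W_fun 1 0 n x * P_poly 1 0 n x = exp (- x) * (P_poly 1 0 n x)\<^sup>2" if "x > 0" for x
    using laguerre_W[OF that] by (simp add: power2_eq_square)
  show "(LINT x|hl. exp (- x) * (P_poly 1 0 n x)\<^sup>2) = 1"
    using laguerre.P_W_biorthogonal[of n n] by (simp add: hl_cong[OF eq])
  show "integrable hl (\<lambda>x. exp (- x) * (P_poly 1 0 n x)\<^sup>2)"
    using laguerre.W_P_integrable[of n n] by (simp add: hl_integrable_cong[OF eq])
qed

lemma laguerre_L2_imp_exp_integrable: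
  fixes g :: "real \<Rightarrow> real"
  assumes g: "g \<in> L2 (e_w 1 0)"
  shows "integrable hl (\<lambda>z. exp (- z) * g z)"
proof -
  obtain C where "\<forall>n. \<forall>f\<in>L2 (e_w 1 0). integrable hl (\<lambda>y. W_fun 1 0 n y *\<^sub>R (f y :: real)) \<and>
           (LINT y|hl. norm (W_fun 1 0 n y *\<^sub>R f y)) \<le> C / laguerre.rate (1/2) ^ n * L2_norm (e_w 1 0) f"
    using laguerre.W_L2[of "1/2", where 'b=real] by auto
  then have "integrable hl (\<lambda>y. W_fun 1 0 0 y *\<^sub>R g y)" using g by blast
  moreover have e: "W_fun 1 0 0 y *\<^sub>R g y = exp (- y) * g y" if "y > 0" for y
    using laguerre_W[OF that, of 0] by (simp add: laguerre.P_eq)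
  ultimately show ?thesis by (simp only: hl_integrable_cong[OF e])
qed

locale lambda_density = gauss_laguerre_weight +
  fixes lam :: "real \<Rightarrow> real"
  assumes lam: "is_lambda_density \<alpha> \<beta> lam"
begin

lemma hl_top [simp]: "{0<..} \<in> sets hl"
  using sets.top[of hl] by simp

lemma lam_nonneg: "y > 0 \<Longrightarrow> lam y \<ge> 0"
  using lam by (simp add: is_lambda_density_def)

lemma lam_integrable: "integrable hl lam"
  using lam by (simp add: is_lambda_density_def set_integrable_hl)

lemma lam_measurable [measurable]: "lam \<in> borel_measurable hl"
  using lam_integrable by auto

lemma lam_moment:
  shows "integrable hl (\<lambda>y. y ^ k * lam y)" "(LINT y|hl. y ^ k * lam y) = fact k / moment k"
proof -
  let ?s = "of_nat k :: complex"
  have l: "set_integrable lborel {0<..} (\<lambda>y. complex_of_real y powr ?s * complex_of_real (lam y))"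
    "(LBINT y:{0<..}. complex_of_real y powr ?s * complex_of_real (lam y)) =
          Gamma (?s + 1) * Gamma (of_real (\<alpha> * \<beta> + 1)) / Gamma (of_real \<alpha> * ?s + of_real (\<alpha> * \<beta> + 1))"
    using lam unfolding is_lambda_density_def by auto
  have eq: "complex_of_real y powr ?s * complex_of_real (lam y) = of_real (y ^ k * lam y)" if "y > 0" for y
    using that by (simp add: powr_nat')
  have i: "integrable hl (\<lambda>y. complex_of_real (y ^ k * lam y))"
    using l(1) unfolding set_integrable_hl by (simp only: hl_integrable_cong[OF eq])
  then show "integrable hl (\<lambda>y. y ^ k * lam y)" by (simp only: complex_of_real_integrable_eq)
  have "complex_of_real (LINT y|hl. y ^ k * lam y) = Gamma (?s + 1) * Gamma (of_real (\<alpha> * \<beta> + 1)) / Gamma (of_real \<alpha> * ?s + of_real (\<alpha> * \<beta> + 1))"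
    using l(2) unfolding set_integral_hl by (simp only: hl_cong[OF eq] integral_complex_of_real)
  also have "of_real \<alpha> * ?s + of_real (\<alpha> * \<beta> + 1) = complex_of_real (\<alpha> * real k + \<alpha> * \<beta> + 1)" by simp
  also have "Gamma (?s + 1) * Gamma (of_real (\<alpha> * \<beta> + 1)) / Gamma (complex_of_real (\<alpha> * real k + \<alpha> * \<beta> + 1)) = of_real (fact k / moment k)"
    unfolding Gamma_complex_of_real by (simp add: moment_def Gamma_fact add.commute)
  finally show "(LINT y|hl. y ^ k * lam y) = fact k / moment k" by (simp only: of_real_eq_iff)
qed

text \<open>
  The laws of two independent variables: \<open>X\<close> is distributed according to the weight and \<open>Y\<close> according
  to \<open>lam\<close>. The measure \<open>NXY\<close> below is the law of their product.
\<close>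

definition MX :: "real measure" where "MX = density hl (\<lambda>x. ennreal (ew x))"
definition MY :: "real measure" where "MY = density hl (\<lambda>x. ennreal (lam x))"

lemma sets_MX [measurable_cong]: "sets MX = sets hl" and sets_MY [measurable_cong]: "sets MY = sets hl"
  by (simp_all add: MX_def MY_def)

lemma space_MX [simp]: "space MX = {0<..}" and space_MY [simp]: "space MY = {0<..}"
  by (simp_all add: MX_def MY_def)

lemma prob_MX: "prob_space MX"
proof (rule prob_spaceI)
  have "emeasure MX (space MX) = (\<integral>\<^sup>+x. ennreal (ew x) \<partial>hl)"
    unfolding MX_def by (subst emeasure_density) (auto intro!: nn_integral_cong)
  also have "\<dots> = ennreal (LINT x|hl. ew x)"
    using ew_moment(1)[of 0] ew_nonneg by (intro nn_integral_eq_integral) auto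
  finally show "emeasure MX (space MX) = 1" using ew_moment(2)[of 0] by simp
qed

lemma prob_MY: "prob_space MY"
proof (rule prob_spaceI)
  have "emeasure MY (space MY) = (\<integral>\<^sup>+x. ennreal (lam x) \<partial>hl)"
    unfolding MY_def by (subst emeasure_density) (auto intro!: nn_integral_cong)
  also have "\<dots> = ennreal (LINT x|hl. lam x)"
    using lam_integrable lam_nonneg by (intro nn_integral_eq_integral AE_hl_I) auto
  finally show "emeasure MY (space MY) = 1" using lam_moment(2)[of 0] by simp
qed

sublocale XY: pair_prob_space MX MY
  using prob_MX prob_MY by (simp add: pair_prob_space_def pair_sigma_finite_def prob_space_imp_sigma_finite)

lemma nn_MX: "f \<in> borel_measurable hl \<Longrightarrow> (\<integral>\<^sup>+x. f x \<partial>MX) = (\<integral>\<^sup>+x. ennreal (ew x) * f x \<partial>hl)"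
  unfolding MX_def by (rule nn_integral_density) auto

lemma nn_MY: "f \<in> borel_measurable hl \<Longrightarrow> (\<integral>\<^sup>+x. f x \<partial>MY) = (\<integral>\<^sup>+x. ennreal (lam x) * f x \<partial>hl)"
  unfolding MY_def by (rule nn_integral_density) auto

lemma lint_MX: 
  fixes f :: "real \<Rightarrow> real"
  assumes [measurable]: "f \<in> borel_measurable hl"
  shows "integral\<^sup>L MX f = (LINT x|hl. ew x * f x)" "integrable MX f \<longleftrightarrow> integrable hl (\<lambda>x. ew x * f x)"
  unfolding MX_def using ew_nonneg by (auto simp: integral_real_density integrable_real_density)

lemma lint_MY: 
  fixes f :: "real \<Rightarrow> real"
  assumes [measurable]: "f \<in> borel_measurable hl"
  shows "integral\<^sup>L MY f = (LINT x|hl. lam x * f x)" "integrable MY f \<longleftrightarrow> integrable hl (\<lambda>x. lam x * f x)"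
proof -
  have "AE x in hl. 0 \<le> lam x" by (rule AE_hl_I) (rule lam_nonneg)
  then show "integral\<^sup>L MY f = (LINT x|hl. lam x * f x)" "integrable MY f \<longleftrightarrow> integrable hl (\<lambda>x. lam x * f x)"
    unfolding MY_def by (simp_all add: integral_real_density integrable_real_density)
qed

definition NXY :: "real measure" where
  "NXY = distr (MX \<Otimes>\<^sub>M MY) borel (\<lambda>(x, y). x * y)"

lemma hl_to_borel [measurable]: "(\<lambda>x. x) \<in> hl \<rightarrow>\<^sub>M borel"
  by (rule borel_measurable_hl) simp

lemma mult_meas [measurable]: "(\<lambda>(x, y). x * y) \<in> MX \<Otimes>\<^sub>M MY \<rightarrow>\<^sub>M (borel :: real measure)"
proof -
  have [measurable]: "fst \<in> MX \<Otimes>\<^sub>M MY \<rightarrow>\<^sub>M (borel :: real measure)" "snd \<in> MX \<Otimes>\<^sub>M MY \<rightarrow>\<^sub>M (borel :: real measure)"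
    using measurable_compose[OF measurable_fst, of "\<lambda>x. x" MX borel MY] measurable_compose[OF measurable_snd, of "\<lambda>x. x" MY borel MX] hl_to_borel
    by (auto simp: measurable_cong_sets[OF sets_MX refl] measurable_cong_sets[OF sets_MY refl] comp_def)
  show ?thesis by measurable
qed

lemma nn_NXY:
  assumes [measurable]: "f \<in> borel_measurable borel"
  shows "(\<integral>\<^sup>+z. f z \<partial>NXY) = (\<integral>\<^sup>+x. \<integral>\<^sup>+y. f (x * y) \<partial>MY \<partial>MX)"
  unfolding NXY_def by (subst nn_integral_distr) (auto simp: case_prod_beta' XY.M2.nn_integral_fst[symmetric])

lemma nn_NXY_power: "(\<integral>\<^sup>+z. ennreal (z ^ k) \<partial>NXY) = ennreal (fact k)"
proof -
  have in1: "(\<integral>\<^sup>+y. ennreal ((x * y) ^ k) \<partial>MY) = ennreal (x ^ k) * ennreal (fact k / moment k)" if x: "x > 0" for x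
  proof -
    have "(\<integral>\<^sup>+y. ennreal ((x * y) ^ k) \<partial>MY) = (\<integral>\<^sup>+y. ennreal (lam y) * ennreal ((x * y) ^ k) \<partial>hl)"
      by (rule nn_MY) measurable
    also have "\<dots> = (\<integral>\<^sup>+y. ennreal (x ^ k * (y ^ k * lam y)) \<partial>hl)"
      using x lam_nonneg by (intro nn_integral_cong) (simp add: ennreal_mult[symmetric] power_mult_distrib mult_ac)
    also have "\<dots> = ennreal (LINT y|hl. x ^ k * (y ^ k * lam y))"
      using lam_moment(1) x lam_nonneg by (intro nn_integral_eq_integral AE_hl_I) auto
    finally show ?thesis using x moment_pos[of k]
      by (subst ennreal_mult[symmetric]) (auto simp: lam_moment less_imp_le)
  qed
  have "(\<integral>\<^sup>+z. ennreal (z ^ k) \<partial>NXY) = (\<integral>\<^sup>+x. ennreal (x ^ k) * ennreal (fact k / moment k) \<partial>MX)"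
    by (subst nn_NXY) (auto intro!: nn_integral_cong simp: in1)
  also have "\<dots> = (\<integral>\<^sup>+x. ennreal (ew x) * (ennreal (x ^ k) * ennreal (fact k / moment k)) \<partial>hl)"
    by (rule nn_MX) measurable
  also have "\<dots> = (\<integral>\<^sup>+x. ennreal (fact k / moment k * (x ^ k * ew x)) \<partial>hl)"
    using ew_nonneg moment_pos[of k] by (intro nn_integral_cong) (simp add: ennreal_mult[symmetric] mult_ac less_imp_le)
  also have "\<dots> = ennreal (LINT x|hl. fact k / moment k * (x ^ k * ew x))"
    using ew_moment(1) ew_nonneg moment_pos[of k] by (intro nn_integral_eq_integral AE_hl_I integrable_mult_right) (auto simp: less_imp_le)
  also have "(LINT x|hl. fact k / moment k * (x ^ k * ew x)) = fact k"
    using moment_pos[of k] ew_moment(2)[of k] by (subst integral_mult_right_zero) simp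
  finally show ?thesis .
qed

lemma AE_NXY: "AE z in NXY. z > 0"
  unfolding NXY_def by (subst AE_distr_iff) (auto intro!: AE_I2 simp: space_pair_measure)

text \<open>
  The moments of \<open>X Y\<close> are \<open>m\<^sub>k * (k! / m\<^sub>k) = k!\<close>, those of the standard exponential law, and
  \<open>X Y\<close> has an exponential moment.
\<close>

lemma NXY_exponential: "NXY = density lborel (\<lambda>z. ennreal (indicator {0<..} z * exp (- z)))"
proof (rule moments_determine_density(2)[where e="1/2"])
  show "prob_space NXY" unfolding NXY_def by (rule XY.prob_space_distr) measurable
  show sN: "sets NXY = sets borel" by (simp add: NXY_def)
  note [measurable_cong] = sN
  have nn: "(\<integral>\<^sup>+z. ennreal (exp (1/2 * \<bar>z\<bar>)) \<partial>NXY) = (\<integral>\<^sup>+z. (\<Sum>k. ennreal ((1/2) ^ k / fact k) * ennreal (z ^ k)) \<partial>NXY)"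
    using AE_NXY
  proof (intro nn_integral_cong_AE, eventually_elim)
    case (elim z)
    have "(\<lambda>k. (1/2 * z) ^ k /\<^sub>R fact k) sums exp (1/2 * z)" by (rule exp_converges)
    then have "(\<lambda>k. (1/2) ^ k / fact k * z ^ k) sums exp (1/2 * z)"
      by (simp only: power_mult_distrib scaleR_conv_of_real divide_inverse mult_ac of_real_inverse of_real_fact)
    then have "(\<lambda>k. ennreal ((1/2) ^ k / fact k * z ^ k)) sums ennreal (exp (1/2 * z))"
      using elim by (subst sums_ennreal) auto
    moreover have "ennreal ((1/2) ^ k / fact k) * ennreal (z ^ k) = ennreal ((1/2) ^ k / fact k * z ^ k)" for k
      using elim by (subst ennreal_mult[symmetric]) auto
    ultimately show ?case using elim by (simp only: sums_iff abs_of_pos)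
  qed
  also have "\<dots> = (\<Sum>k. ennreal ((1/2) ^ k / fact k) * ennreal (fact k))"
  proof -
    have [measurable]: "(\<lambda>z. ennreal (z ^ i)) \<in> borel_measurable NXY" for i
      by (subst measurable_cong_sets[OF sN refl]) measurable
    show ?thesis by (subst nn_integral_suminf) (auto simp: nn_integral_cmult nn_NXY_power)
  qed
  also have "\<dots> = (\<Sum>k. ennreal ((1/2) ^ k))"
    by (simp flip: ennreal_mult')
  also have "\<dots> < \<infinity>" using suminf_ennreal_eq[of "\<lambda>k. (1/2::real) ^ k"] geometric_sums[of "1/2::real"] by (simp add: suminf_ennreal2)
  finally show "integrable NXY (\<lambda>z. exp (1/2 * \<bar>z\<bar>))"
    by (intro integrableI_bounded) (auto simp: measurable_cong_sets[OF sN refl])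
  have "integrable hl (\<lambda>y. y powr 0 * exp (- (1/2 * y powr (1/1))))"
    by (rule powr_exp_hl(1)) auto
  then have "integrable hl (\<lambda>y. exp (1/2 * \<bar>y\<bar>) * exp (- y))"
    by (subst hl_integrable_cong[of _ "\<lambda>y. y powr 0 * exp (- (1/2 * y powr (1/1)))"]) (auto simp flip: exp_add)
  then have "integrable lborel (\<lambda>y::real. indicator {0<..} y *\<^sub>R (exp (1/2 * \<bar>y\<bar>) * exp (- y)))"
    using integrable_restrict_space[of "{0<..}" lborel "\<lambda>y::real. exp (1/2 * \<bar>y\<bar>) * exp (- y)"] by simp
  then show "integrable lborel (\<lambda>y::real. exp (1/2 * \<bar>y\<bar>) * (indicator {0<..} y * exp (- y)))"
    by (simp add: mult_ac)
  fix k
  have "(LINT y|NXY. y ^ k) = fact k"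
  proof -
    have "(LINT y|NXY. y ^ k) = enn2real (\<integral>\<^sup>+y. ennreal (y ^ k) \<partial>NXY)"
      by (rule integral_eq_nn_integral) (use AE_NXY in \<open>auto elim!: eventually_mono simp: measurable_cong_sets[OF sN refl]\<close>)
    then show ?thesis by (simp add: nn_NXY_power)
  qed
  also have "fact k = (LINT y|hl. y ^ k * e_w 1 0 y)" by (simp add: laguerre.ew_moment laguerre_moment)
  also have "\<dots> = (LINT y|hl. y ^ k * exp (- y))" by (rule hl_cong) (simp add: laguerre_ew)
  also have "\<dots> = (LINT y|lborel. y ^ k * (indicator {0<..} y * exp (- y)))"
    by (subst integral_restrict_space) (auto simp: mult_ac)
  finally show "(LINT y|NXY. y ^ k) = (LINT y|lborel. y ^ k * (indicator {0<..} y * exp (- y)))" .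
qed auto

text \<open>
  The inner integral is \<open>\<Lambda> g\<close>; integrated against the weight it depends on \<open>g\<close> only through the law
  of \<open>X Y\<close>.
\<close>

lemma exp_law:
  fixes g :: "real \<Rightarrow> real"
  assumes g[measurable]: "g \<in> borel_measurable hl" and i: "integrable hl (\<lambda>z. exp (- z) * g z)"
  shows "AE x in hl. integrable MY (\<lambda>y. g (x * y))"
    and "(LINT x|hl. ew x * (LINT y|MY. g (x * y))) = (LINT z|hl. exp (- z) * g z)"
    and "integrable hl (\<lambda>x. ew x * (LINT y|MY. g (x * y)))"
    and "(\<lambda>x. LINT y|MY. g (x * y)) \<in> borel_measurable hl"
proof -
  define g' where "g' = (\<lambda>z. indicator {0<..} z * g z)"
  have [measurable]: "g' \<in> borel_measurable borel" using g by (simp add: g'_def borel_measurable_hl_iff)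
  have eqg: "(LINT y|MY. g' (x * y)) = (LINT y|MY. g (x * y))" if "x > 0" for x
    using that by (intro Bochner_Integration.integral_cong) (auto simp: g'_def)
  have eqi: "integrable MY (\<lambda>y. g' (x * y)) \<longleftrightarrow> integrable MY (\<lambda>y. g (x * y))" if "x > 0" for x
    using that by (intro Bochner_Integration.integrable_cong) (auto simp: g'_def)
  have dens: "integrable NXY g'" "(LINT z|NXY. g' z) = (LINT z|hl. exp (- z) * g z)"
  proof -
    have e: "indicator {0<..} z * exp (- z) * g' z = indicator {0<..} z *\<^sub>R (exp (- z) * g z)" for z
      by (auto simp: g'_def indicator_def)
    show "integrable NXY g'" unfolding NXY_exponential
      using i integrable_restrict_space[of "{0<..}" lborel "\<lambda>z. exp (- z) * g z"]
      by (subst integrable_real_density) (auto simp only: e, auto)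
    show "(LINT z|NXY. g' z) = (LINT z|hl. exp (- z) * g z)" unfolding NXY_exponential
      using integral_restrict_space[of "{0<..}" lborel "\<lambda>z. exp (- z) * g z"]
      by (subst integral_real_density) (auto simp only: e, auto)
  qed
  have pi: "integrable (MX \<Otimes>\<^sub>M MY) (\<lambda>(x, y). g' (x * y))"
    using dens(1) unfolding NXY_def by (subst (asm) integrable_distr_eq) (auto simp: case_prod_beta')
  have pl: "(LINT p|(MX \<Otimes>\<^sub>M MY). (\<lambda>(x, y). g' (x * y)) p) = (LINT z|hl. exp (- z) * g z)"
    using dens(2) unfolding NXY_def by (subst (asm) integral_distr) (auto simp: case_prod_beta')
  have AEX: "(AE x in MX. Q x) \<longleftrightarrow> (AE x in hl. Q x)" for Q
  proof -
    have "MX = wmeas ew" by (simp add: MX_def wmeas_def)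
    then show ?thesis using AE_ew[of Q] by (simp only:)
  qed
  show "AE x in hl. integrable MY (\<lambda>y. g (x * y))"
    using XY.AE_integrable_fst'[OF pi] unfolding AEX
    by (rule AE_mp) (auto intro!: AE_hl_I simp: eqi)
  have iX: "integrable MX (\<lambda>x. LINT y|MY. g' (x * y))" using XY.integrable_fst'[OF pi] by simp
  then have "(\<lambda>x. LINT y|MY. g' (x * y)) \<in> borel_measurable MX" by auto
  then have m': "(\<lambda>x. LINT y|MY. g' (x * y)) \<in> borel_measurable hl"
    by (simp add: measurable_cong_sets[OF sets_MX refl])
  show m[measurable]: "(\<lambda>x. LINT y|MY. g (x * y)) \<in> borel_measurable hl"
    by (rule measurable_cong[THEN iffD1, OF _ m']) (simp add: eqg)
  have iX': "integrable MX (\<lambda>x. LINT y|MY. g (x * y))"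
    by (rule iffD1[OF Bochner_Integration.integrable_cong[OF refl] iX]) (simp add: eqg)
  then show "integrable hl (\<lambda>x. ew x * (LINT y|MY. g (x * y)))" by (simp add: lint_MX)
  have "(LINT x|hl. ew x * (LINT y|MY. g (x * y))) = (LINT x|MX. (LINT y|MY. g (x * y)))" by (simp add: lint_MX)
  also have "\<dots> = (LINT x|MX. (LINT y|MY. g' (x * y)))" by (rule Bochner_Integration.integral_cong) (auto simp: eqg)
  also have "\<dots> = (LINT z|hl. exp (- z) * g z)" using XY.integral_fst'[OF pi] pl by simp
  finally show "(LINT x|hl. ew x * (LINT y|MY. g (x * y))) = (LINT z|hl. exp (- z) * g z)" .
qed

lemma Lambda_op_eq:
  assumes [measurable]: "g \<in> borel_measurable hl" and x: "x > 0"
  shows "Lambda_op lam g x = (LINT y|MY. g (x * y))"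
proof -
  have "(\<lambda>z. indicator {0<..} z * g z) \<in> borel_measurable borel" using assms by (simp add: borel_measurable_hl_iff)
  then have "(\<lambda>y. indicator {0<..} (x * y) * g (x * y)) \<in> borel_measurable borel" by measurable
  then have "(\<lambda>y. indicator {0<..} (x * y) * g (x * y)) \<in> borel_measurable hl" by measurable
  then have [measurable]: "(\<lambda>y. g (x * y)) \<in> borel_measurable hl"
    by (rule measurable_cong[THEN iffD1, rotated]) (use x in auto)
  have "(\<lambda>y. g (x * y)) \<in> borel_measurable hl" by measurable
  then show ?thesis unfolding Lambda_op_def set_integral_hl by (simp only: lint_MY mult.commute)
qed

text \<open>
  Averaging over \<open>Y\<close> multiplies the \<open>k\<close>-th coefficient of the Laguerre polynomial by \<open>k! / m\<^sub>k\<close>.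
\<close>

lemma P_as_mean: "integrable MY (\<lambda>y. P_poly 1 0 n (x * y))" "(LINT y|MY. P_poly 1 0 n (x * y)) = P n x"
proof -
  have e: "P_poly 1 0 n (x * y) = (\<Sum>k\<le>n. (-1) ^ k * real (n choose k) / fact k * x ^ k * y ^ k)" for y
    by (simp add: laguerre.P_eq laguerre_moment power_mult_distrib mult_ac)
  have i: "integrable MY (\<lambda>y. y ^ k)" and l: "(LINT y|MY. y ^ k) = fact k / moment k" for k
    using lam_moment[of k] by (auto simp: lint_MY mult.commute)
  show "integrable MY (\<lambda>y. P_poly 1 0 n (x * y))" unfolding e using i by auto
  show "(LINT y|MY. P_poly 1 0 n (x * y)) = P n x"
    unfolding e using i by (subst Bochner_Integration.integral_sum) (auto simp: l P_eq)
qed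

text \<open>
  Conditional variances are nonnegative, so the square of the mean \<open>P n x\<close> is at most the mean of
  the square; averaged over \<open>X\<close>, the latter is the norm of a Laguerre polynomial.
\<close>

lemma P_norm_le_1: "integrable hl (\<lambda>x. ew x * (P n x)\<^sup>2)" "(LINT x|hl. ew x * (P n x)\<^sup>2) \<le> 1"
proof -
  let ?g = "\<lambda>z. (P_poly 1 0 n z)\<^sup>2"
  have g: "?g \<in> borel_measurable hl" by measurable
  note el = exp_law[OF g laguerre_sq_integrable]
  have le: "AE x in hl. ew x * (P n x)\<^sup>2 \<le> ew x * (LINT y|MY. ?g (x * y))"
    using el(1)
  proof eventually_elim
    case (elim x)
    have "0 \<le> (LINT y|MY. (P_poly 1 0 n (x * y) - P n x)\<^sup>2)" by simp
    also have "\<dots> = (LINT y|MY. ?g (x * y) - 2 * P n x * P_poly 1 0 n (x * y) + (P n x)\<^sup>2)"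
      by (simp add: power2_diff algebra_simps)
    also have "\<dots> = (LINT y|MY. ?g (x * y)) - 2 * P n x * P n x + (P n x)\<^sup>2"
      using elim P_as_mean[of n x] XY.M2.prob_space by simp
    finally have "(P n x)\<^sup>2 \<le> (LINT y|MY. ?g (x * y))" by (simp add: power2_eq_square[of "P n x"])
    then show ?case using ew_nonneg by (rule mult_left_mono)
  qed
  show i: "integrable hl (\<lambda>x. ew x * (P n x)\<^sup>2)"
    by (rule Bochner_Integration.integrable_bound[OF el(3)])
       (use le ew_nonneg in \<open>auto elim!: eventually_mono simp: abs_mult\<close>)
  have "(LINT x|hl. ew x * (P n x)\<^sup>2) \<le> (LINT x|hl. ew x * (LINT y|MY. ?g (x * y)))"
    by (rule integral_mono_AE[OF i el(3) le])
  then show "(LINT x|hl. ew x * (P n x)\<^sup>2) \<le> 1" using el(2) by (simp add: laguerre_orthonormal)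
qed


text \<open>
  Both sides are the Taylor coefficients of one function of \<open>q\<close>: the operator \<open>\<Lambda>\<close> commutes with the
  dilation by \<open>1 - q\<close>, and the law of \<open>X Y\<close> turns an integral of \<open>\<Lambda> g\<close> against the weight into an
  integral of \<open>g\<close> against \<open>exp(- z)\<close>.
\<close>

lemma Lambda_coefficient:
  assumes g: "g \<in> L2 e_lag" and f: "f \<in> L2 ew" and fg: "AE x in hl. f x = Lambda_op lam g x"
  shows "(LINT x|hl. W n x * f x) = (LINT z|hl. W_fun 1 0 n z * g z)"
proof -
  have g': "g \<in> L2 (e_w 1 0)" using g by (simp add: L2_e_lag_iff)
  have [measurable]: "g \<in> borel_measurable hl" "f \<in> borel_measurable hl"
    using laguerre.L2_measurable[OF g'] L2_measurable[OF f] by auto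
  have r: "(0::real) < 1/2" "(1/2::real) < 1" by auto
  have i1: "integrable hl (\<lambda>y. majorant (1/2) y * norm (f y))" using majorant_L2[OF r] f by blast
  have i2: "integrable hl (\<lambda>y. laguerre.majorant (1/2) y * norm (g y))" using laguerre.majorant_L2[OF r] g' by blast
  define R where "R = min (1/2) (min (rate (1/2)) (laguerre.rate (1/2)))"
  have R: "R > 0" using rate[OF r] laguerre.rate[OF r] by (simp add: R_def)
  show ?thesis
  proof (rule powser_coeffs_unique[OF R])
    fix q :: real assume q: "\<bar>q\<bar> < R"
    then have q': "\<bar>q\<bar> < rate (1/2)" "\<bar>q\<bar> < laguerre.rate (1/2)" "\<bar>q\<bar> < 1/2" by (auto simp: R_def)
    have c: "1 - q > 0" using q' by simp
    show "(\<lambda>n. (LINT x|hl. W n x * f x) * q ^ n) sums (LINT y|hl. ew (y / (1 - q)) / (1 - q) * f y)"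
      by (rule W_genfun_integral[OF r _ i1 q'(1)]) measurable
    have "(\<lambda>n. (LINT z|hl. W_fun 1 0 n z * g z) * q ^ n) sums (LINT y|hl. e_w 1 0 (y / (1 - q)) / (1 - q) * g y)"
      by (rule laguerre.W_genfun_integral[OF r _ i2 q'(2)]) measurable
    moreover have "(LINT y|hl. ew (y / (1 - q)) / (1 - q) * f y) = (LINT y|hl. e_w 1 0 (y / (1 - q)) / (1 - q) * g y)"
    proof -
      let ?g = "\<lambda>z. g ((1 - q) * z)"
      have ie: "integrable hl (\<lambda>z. exp (- (z / (1 - q))) * g z)"
      proof (rule Bochner_Integration.integrable_bound[OF integrable_mult_right[OF i2, of "1/2"]])
        show "AE z in hl. norm (exp (- (z / (1 - q))) * g z) \<le> norm (1/2 * (laguerre.majorant (1/2) z * norm (g z)))"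
        proof (rule AE_hl_I)
          fix z :: real assume z: "z > 0"
          have "z / (3/2) \<le> z / (1 - q)" using z q' c by (intro divide_left_mono) auto
          then have "exp (- (z / (1 - q))) \<le> exp (- (z / (1 + 1/2)))" by simp
          also have "\<dots> = 1/2 * laguerre.majorant (1/2) z"
            using z by (simp add: laguerre.majorant_def laguerre.rate_def)
          finally have "exp (- (z / (1 - q))) * \<bar>g z\<bar> \<le> 1/2 * laguerre.majorant (1/2) z * \<bar>g z\<bar>"
            by (rule mult_right_mono) simp
          then show "norm (exp (- (z / (1 - q))) * g z) \<le> norm (1/2 * (laguerre.majorant (1/2) z * norm (g z)))"
            using laguerre.majorant_nonneg[OF r, of z] by (simp add: abs_mult)
        qed
      qed measurable
      have igq: "integrable hl (\<lambda>z. exp (- z) * ?g z)"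
        using ie c hl_dilate(1)[OF c, of "\<lambda>z. exp (- (z / (1 - q))) * g z"] by simp
      have mgq[measurable]: "?g \<in> borel_measurable hl"
      proof -
        have "(\<lambda>z. indicator {0<..} z * g z) \<in> borel_measurable borel" by (simp flip: borel_measurable_hl_iff real_scaleR_def)
        then have "(\<lambda>y. indicator {0<..} ((1 - q) * y) * g ((1 - q) * y)) \<in> borel_measurable borel" by measurable
        then have "(\<lambda>y. indicator {0<..} ((1 - q) * y) * g ((1 - q) * y)) \<in> borel_measurable hl" by measurable
        then show ?thesis by (rule measurable_cong[THEN iffD1, rotated]) (use c in auto)
      qed
      have "(LINT y|hl. ew (y / (1 - q)) / (1 - q) * f y) = (LINT y|hl. ew (y / (1 - q)) / (1 - q) * Lambda_op lam g y)"
      proof (rule integral_cong_AE)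
        have "(\<lambda>x. LINT y|MY. g (x * y)) \<in> borel_measurable hl"
          by (rule exp_law(4)) (use g' in \<open>auto intro!: laguerre_L2_imp_exp_integrable\<close>)
        then have [measurable]: "Lambda_op lam g \<in> borel_measurable hl"
          by (rule measurable_cong[THEN iffD1, rotated]) (simp add: Lambda_op_eq)
        show "(\<lambda>y. ew (y / (1 - q)) / (1 - q) * Lambda_op lam g y) \<in> borel_measurable hl" by measurable
        show "AE y in hl. ew (y / (1 - q)) / (1 - q) * f y = ew (y / (1 - q)) / (1 - q) * Lambda_op lam g y"
          using fg by eventually_elim simp
      qed measurable
      also have "\<dots> = (1 - q) * (LINT y|hl. ew ((1 - q) * y / (1 - q)) / (1 - q) * Lambda_op lam g ((1 - q) * y))"
        using hl_dilate(2)[OF c, of "\<lambda>y. ew (y / (1 - q)) / (1 - q) * Lambda_op lam g y"] by simp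
      also have "\<dots> = (LINT y|hl. ew y * Lambda_op lam g ((1 - q) * y))"
        using c by simp
      also have "\<dots> = (LINT x|hl. ew x * (LINT y|MY. ?g (x * y)))"
        using c by (intro hl_cong) (simp add: Lambda_op_eq mult.assoc)
      also have "\<dots> = (LINT z|hl. exp (- z) * ?g z)"
        by (rule exp_law(2)[OF mgq igq])
      also have "\<dots> = (LINT z|hl. exp (- (z / (1 - q))) / (1 - q) * g z)"
        using c hl_dilate(2)[OF c, of "\<lambda>z. exp (- (z / (1 - q))) / (1 - q) * g z"] by simp
      also have "\<dots> = (LINT y|hl. e_w 1 0 (y / (1 - q)) / (1 - q) * g y)"
        using c by (intro hl_cong) (simp add: laguerre_ew)
      finally show ?thesis .
    qed
    ultimately show "(\<lambda>n. (LINT z|hl. W_fun 1 0 n z * g z) * q ^ n) sums (LINT y|hl. ew (y / (1 - q)) / (1 - q) * f y)" by (simp only:)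
  qed
qed

text \<open>
  Cauchy-Schwarz, the Laguerre polynomials having norm \<open>1\<close>.
\<close>

lemma Lambda_coefficient_bounded:
  assumes g: "g \<in> L2 e_lag" and f: "f \<in> L2 ew" and fg: "AE x in hl. f x = Lambda_op lam g x"
  shows "\<bar>LINT x|hl. W n x * f x\<bar> \<le> L2_norm e_lag g"
proof -
  have g': "g \<in> L2 (e_w 1 0)" using g by (simp add: L2_e_lag_iff)
  have [measurable]: "g \<in> borel_measurable hl" using laguerre.L2_measurable[OF g'] by auto
  let ?F = "\<lambda>z. exp (- z / 2) * P_poly 1 0 n z" and ?G = "\<lambda>z. exp (- z / 2) * g z"
  have ee: "exp (- z / 2) ^ 2 = exp (- z)" "exp (- z / 2) * exp (- z / 2) = exp (- z)" for z :: real
    by (simp_all add: power2_eq_square flip: exp_add)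
  have F2: "(?F z)\<^sup>2 = exp (- z) * (P_poly 1 0 n z)\<^sup>2" and G2: "(?G z)\<^sup>2 = e_lag z * (norm (g z))\<^sup>2" for z
    by (simp_all only: power_mult_distrib ee e_lag_def real_norm_def power2_abs)
  have i: "integrable hl (\<lambda>z. (?F z)\<^sup>2)" "integrable hl (\<lambda>z. (?G z)\<^sup>2)"
    unfolding F2 G2 using laguerre_sq_integrable g by (auto simp: L2_iff e_lag_def)
  have [measurable]: "?F \<in> borel_measurable hl" "?G \<in> borel_measurable hl" by measurable
  note cs = cauchy_schwarz_integral[OF _ _ i]
  have "(LINT x|hl. W n x * f x) = (LINT z|hl. W_fun 1 0 n z * g z)" by (rule Lambda_coefficient[OF assms])
  also have "\<dots> = (LINT z|hl. ?F z * ?G z)"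
  proof (rule hl_cong)
    fix z :: real assume "z > 0"
    then have "W_fun 1 0 n z * g z = (exp (- z / 2) * exp (- z / 2)) * P_poly 1 0 n z * g z"
      by (simp only: laguerre_W ee(2))
    then show "W_fun 1 0 n z * g z = ?F z * ?G z" by (simp only: mult_ac)
  qed
  finally have "\<bar>LINT x|hl. W n x * f x\<bar> \<le> (LINT z|hl. \<bar>?F z * ?G z\<bar>)"
    using integral_abs_bound[of hl "\<lambda>z. ?F z * ?G z"] by simp
  also have "\<dots> \<le> sqrt (LINT z|hl. (?F z)\<^sup>2) * sqrt (LINT z|hl. (?G z)\<^sup>2)" by (rule cs(2)) measurable
  also have "(LINT z|hl. (?F z)\<^sup>2) = 1" unfolding F2 by (rule laguerre_orthonormal)
  also have "sqrt (LINT z|hl. (?G z)\<^sup>2) = L2_norm e_lag g"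
    unfolding G2 by (subst L2_norm_eq) (auto simp: e_lag_def)
  finally show ?thesis by simp
qed

end

section \<open>The semigroup on the weighted space\<close>

text \<open>
  Tonelli's theorem, applied to the positive and the negative part of \<open>f\<close>.
\<close>

lemma integral_bind_integrable:
  fixes f :: "'b \<Rightarrow> real"
  assumes N: "N \<in> M \<rightarrow>\<^sub>M subprob_algebra B" and f[measurable]: "f \<in> borel_measurable B"
    and int: "integrable (M \<bind> N) f" and ne: "space M \<noteq> {}"
  shows "(LINT y|(M \<bind> N). f y) = (LINT x|M. (LINT y|N x. f y))"
proof -
  have sN: "sets (N x) = sets B" if "x \<in> space M" for x using N that by (rule sets_kernel)
  have sb: "sets (M \<bind> N) = sets B" by (rule sets_bind[OF sN ne])
  define h where "h = (\<lambda>\<sigma> x. \<integral>\<^sup>+y. ennreal (\<sigma> * f y) \<partial>N x)"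
  have hm[measurable]: "h \<sigma> \<in> borel_measurable M" for \<sigma>
    unfolding h_def by (rule measurable_compose[OF N nn_integral_measurable_subprob_algebra]) measurable
  have hb: "(\<integral>\<^sup>+y. ennreal (\<sigma> * f y) \<partial>(M \<bind> N)) = (\<integral>\<^sup>+x. h \<sigma> x \<partial>M)" for \<sigma>
    unfolding h_def by (rule nn_integral_bind[OF _ N]) measurable
  have fin: "(\<integral>\<^sup>+x. h \<sigma> x \<partial>M) \<noteq> \<infinity>" if "\<sigma> = 1 \<or> \<sigma> = -1" for \<sigma>
    using int that unfolding hb[symmetric] by (auto simp: real_integrable_def)
  have AEfin: "AE x in M. h \<sigma> x \<noteq> \<infinity>" if "\<sigma> = 1 \<or> \<sigma> = -1" for \<sigma>
    by (rule nn_integral_PInf_AE[OF hm fin[OF that]])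
  have inner: "AE x in M. (LINT y|N x. f y) = enn2real (h 1 x) - enn2real (h (-1) x)"
    using AEfin[of 1, simplified] AEfin[of "-1", simplified] AE_space
  proof eventually_elim
    case (elim x)
    have "f \<in> borel_measurable (N x)" by (simp add: measurable_cong_sets[OF sN[OF elim(3)] refl])
    then have "integrable (N x) f" using elim by (simp add: real_integrable_def h_def)
    then show ?case by (simp add: real_lebesgue_integral_def h_def)
  qed
  have e: "integrable M (\<lambda>x. enn2real (h \<sigma> x))" "(LINT x|M. enn2real (h \<sigma> x)) = enn2real (\<integral>\<^sup>+x. h \<sigma> x \<partial>M)"
    if s: "\<sigma> = 1 \<or> \<sigma> = -1" for \<sigma>
  proof -
    have eq: "(\<integral>\<^sup>+x. ennreal (enn2real (h \<sigma> x)) \<partial>M) = (\<integral>\<^sup>+x. h \<sigma> x \<partial>M)"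
      by (rule nn_integral_cong_AE) (use AEfin[OF s] in \<open>auto elim!: eventually_mono simp: less_top\<close>)
    show "integrable M (\<lambda>x. enn2real (h \<sigma> x))"
      by (rule integrableI_bounded) (use fin[OF s] eq in \<open>auto simp: less_top\<close>)
    show "(LINT x|M. enn2real (h \<sigma> x)) = enn2real (\<integral>\<^sup>+x. h \<sigma> x \<partial>M)"
      by (subst integral_eq_nn_integral) (auto simp: eq)
  qed
  have "(LINT x|M. (LINT y|N x. f y)) = (LINT x|M. enn2real (h 1 x) - enn2real (h (-1) x))"
  proof (rule integral_cong_AE[OF _ _ inner])
    show "(\<lambda>x. LINT y|N x. f y) \<in> borel_measurable M"
      by (rule measurable_compose[OF N integral_measurable_subprob_algebra]) measurable
  qed measurable
  also have "\<dots> = enn2real (\<integral>\<^sup>+x. h 1 x \<partial>M) - enn2real (\<integral>\<^sup>+x. h (-1) x \<partial>M)"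
    by (subst Bochner_Integration.integral_diff) (auto simp: e)
  also have "\<dots> = (LINT y|(M \<bind> N). f y)"
    using int by (simp add: real_lebesgue_integral_def hb[symmetric])
  finally show ?thesis ..
qed

lemma hl_measurable_half_line:
  fixes f :: "real \<Rightarrow> 'b :: {second_countable_topology, real_normed_vector}"
  assumes "f \<in> borel_measurable hl"
  shows "f \<in> borel_measurable half_line"
proof -
  have [measurable]: "(\<lambda>x. indicator {0<..} x *\<^sub>R f x) \<in> borel_measurable borel"
    using assms by (simp add: borel_measurable_hl_iff)
  have "(\<lambda>x. indicator {0..} x *\<^sub>R f x) = (\<lambda>x. indicator {0<..} x *\<^sub>R f x + indicator {0} x *\<^sub>R f 0)"
    by (auto simp: fun_eq_iff indicator_def)
  moreover have "(\<lambda>x. indicator {0<..} x *\<^sub>R f x + indicator {0} x *\<^sub>R f 0) \<in> borel_measurable borel" by measurable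
  ultimately show ?thesis by (subst borel_measurable_restrict_space_iff) auto
qed

context gauss_laguerre_weight
begin

lemma L2_cmult: "f \<in> L2 ew \<Longrightarrow> (\<lambda>x. a * f x :: real) \<in> L2 ew"
  unfolding L2_ew_iff by (auto simp: power_mult_distrib mult.left_commute[of _ "_\<^sup>2"])

lemma L2_add:
  fixes f g :: "real \<Rightarrow> real"
  assumes "f \<in> L2 ew" "g \<in> L2 ew"
  shows "(\<lambda>x. f x + g x) \<in> L2 ew"
proof -
  have [measurable]: "f \<in> borel_measurable hl" "g \<in> borel_measurable hl" using assms by (auto simp: L2_ew_iff)
  have "integrable hl (\<lambda>x. ew x * (norm (f x + g x))\<^sup>2)"
  proof (rule Bochner_Integration.integrable_bound)
    show "integrable hl (\<lambda>x. 2 * (ew x * (norm (f x))\<^sup>2) + 2 * (ew x * (norm (g x))\<^sup>2))"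
      using assms by (auto simp: L2_ew_iff)
    show "AE x in hl. norm (ew x * (norm (f x + g x))\<^sup>2) \<le> norm (2 * (ew x * (norm (f x))\<^sup>2) + 2 * (ew x * (norm (g x))\<^sup>2))"
    proof (rule AE_I2)
      fix x
      have "(f x + g x)\<^sup>2 \<le> 2 * (f x)\<^sup>2 + 2 * (g x)\<^sup>2" using sum_squares_bound[of "f x" "g x"] by (simp add: power2_sum)
      then have "ew x * (f x + g x)\<^sup>2 \<le> ew x * (2 * (f x)\<^sup>2 + 2 * (g x)\<^sup>2)" using ew_nonneg by (rule mult_left_mono)
      then show "norm (ew x * (norm (f x + g x))\<^sup>2) \<le> norm (2 * (ew x * (norm (f x))\<^sup>2) + 2 * (ew x * (norm (g x))\<^sup>2))"
        using ew_nonneg[of x] by (simp add: abs_mult algebra_simps)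
    qed
  qed measurable
  then show ?thesis by (simp add: L2_ew_iff)
qed

lemma L2_diff: "f \<in> L2 ew \<Longrightarrow> g \<in> L2 ew \<Longrightarrow> (\<lambda>x. f x - g x :: real) \<in> L2 ew"
  using L2_add[OF _ L2_cmult[of g "-1"], of f] by simp

lemma L2_sum: "finite I \<Longrightarrow> (\<And>i. i \<in> I \<Longrightarrow> f i \<in> L2 ew) \<Longrightarrow> (\<lambda>x. \<Sum>i\<in>I. f i x :: real) \<in> L2 ew"
proof (induction I rule: finite_induct)
  case empty
  then show ?case by (simp add: L2_ew_iff)
next
  case (insert i I)
  then show ?case using L2_add[of "f i" "\<lambda>x. \<Sum>i\<in>I. f i x"] by simp
qed

lemma L2_norm_nonneg: "L2_norm ew f \<ge> 0"
  by (simp add: L2_norm_def)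

lemma L2_norm_cmult: 
  fixes f :: "real \<Rightarrow> real"
  assumes "f \<in> L2 ew"
  shows "L2_norm ew (\<lambda>x. a * f x) = \<bar>a\<bar> * L2_norm ew f"
proof -
  have "(LINT x|wmeas ew. (norm (a * f x))\<^sup>2) = a\<^sup>2 * (LINT x|wmeas ew. (norm (f x))\<^sup>2)"
    by (simp add: power_mult_distrib)
  then show ?thesis by (simp add: L2_norm_def real_sqrt_mult)
qed

lemma L2_norm_triangle:
  fixes f g :: "real \<Rightarrow> real"
  assumes f: "f \<in> L2 ew" and g: "g \<in> L2 ew"
  shows "L2_norm ew (\<lambda>x. f x + g x) \<le> L2_norm ew f + L2_norm ew g"
proof -
  let ?M = "wmeas ew"
  have m: "f \<in> borel_measurable ?M" "g \<in> borel_measurable ?M" and i: "integrable ?M (\<lambda>x. (f x)\<^sup>2)" "integrable ?M (\<lambda>x. (g x)\<^sup>2)"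
    using f g by (auto simp: L2_def)
  note cs = cauchy_schwarz_integral[OF m i]
  have "(LINT x|?M. (f x + g x)\<^sup>2) = (LINT x|?M. (f x)\<^sup>2) + (LINT x|?M. (g x)\<^sup>2) + 2 * (LINT x|?M. f x * g x)"
    using i cs(1) by (simp add: power2_sum mult.assoc)
  also have "(LINT x|?M. f x * g x) \<le> (LINT x|?M. \<bar>f x * g x\<bar>)"
    using integral_abs_bound[of ?M "\<lambda>x. f x * g x"] by linarith
  also have "\<dots> \<le> L2_norm ew f * L2_norm ew g" using cs(2) by (simp add: L2_norm_def)
  finally have "(LINT x|?M. (f x + g x)\<^sup>2) \<le> (LINT x|?M. (f x)\<^sup>2) + (LINT x|?M. (g x)\<^sup>2) + 2 * (L2_norm ew f * L2_norm ew g)"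
    by simp
  moreover have "(LINT x|?M. (f x)\<^sup>2) = (L2_norm ew f)\<^sup>2" "(LINT x|?M. (g x)\<^sup>2) = (L2_norm ew g)\<^sup>2" by (simp_all add: L2_norm_def)
  ultimately have "(LINT x|?M. (f x + g x)\<^sup>2) \<le> (L2_norm ew f + L2_norm ew g)\<^sup>2" by (simp add: power2_sum)
  then show ?thesis using L2_norm_nonneg[of f] L2_norm_nonneg[of g] unfolding L2_norm_def[of ew "\<lambda>x. f x + g x"]
    by (intro real_le_lsqrt) auto
qed

lemma L2_norm_cong_AE:
  fixes f g :: "real \<Rightarrow> real"
  assumes "f \<in> borel_measurable hl" "g \<in> borel_measurable hl" "AE x in hl. f x = g x"
  shows "L2_norm ew f = L2_norm ew g"
proof -
  have "(LINT x|hl. ew x * (norm (f x))\<^sup>2) = (LINT x|hl. ew x * (norm (g x))\<^sup>2)"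
    by (rule integral_cong_AE) (use assms in \<open>auto elim!: eventually_mono\<close>)
  then show ?thesis using assms by (simp add: L2_norm_ew)
qed

lemma L2_norm_zero_imp:
  fixes f :: "real \<Rightarrow> real"
  assumes f: "f \<in> L2 ew" and z: "L2_norm ew f = 0"
  shows "AE x in hl. f x = 0"
proof -
  have i: "integrable hl (\<lambda>x. ew x * (norm (f x))\<^sup>2)" using f by (simp add: L2_ew_iff)
  have "(LINT x|hl. ew x * (norm (f x))\<^sup>2) = 0" using z f by (simp add: L2_norm_ew L2_ew_iff)
  then have ae: "AE x in hl. ew x * (norm (f x))\<^sup>2 = 0"
    using integral_nonneg_eq_0_iff_AE[OF i] ew_nonneg by auto
  have sp: "AE x in hl. x > 0" by (rule AE_hl_I)
  show ?thesis using ae sp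
  proof eventually_elim
    case (elim x)
    then show ?case using ew_pos[of x] by auto
  qed
qed

text \<open>
  Through this function the \<open>L\<^sup>2\<close> theory supplies exponential moments of almost all kernels.
\<close>

lemma exp_in_L2: "(\<lambda>y. exp (\<bar>y\<bar> / 8)) \<in> L2 ew"
proof -
  have r: "(0::real) < 1/2" "(1/2::real) < 1" by auto
  have "integrable hl (\<lambda>y. ew y * (norm (exp (\<bar>y\<bar> / 8)))\<^sup>2)"
  proof (rule Bochner_Integration.integrable_bound[OF majorant_exp_integrable[OF r]])
    show "AE y in hl. norm (ew y * (norm (exp (\<bar>y\<bar> / 8)))\<^sup>2) \<le> norm (exp (\<bar>y\<bar> / 4) * majorant (1/2) y)"
    proof (rule AE_hl_I)
      fix y :: real assume y: "y > 0"
      have "\<bar>W 0 y\<bar> \<le> majorant (1/2) y" using W_le_majorant[OF r y, of 0] by simp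
      moreover have "W 0 y = ew y" using y by (simp add: W_eq)
      ultimately have "ew y \<le> majorant (1/2) y" by simp
      then have "ew y * exp (\<bar>y\<bar> / 4) \<le> majorant (1/2) y * exp (\<bar>y\<bar> / 4)" by (rule mult_right_mono) simp
      moreover have "(exp (\<bar>y\<bar> / 8))\<^sup>2 = exp (\<bar>y\<bar> / 4)" by (simp add: power2_eq_square flip: exp_add)
      ultimately show "norm (ew y * (norm (exp (\<bar>y\<bar> / 8)))\<^sup>2) \<le> norm (exp (\<bar>y\<bar> / 4) * majorant (1/2) y)"
        using ew_nonneg[of y] majorant_nonneg[OF r, of y] by (simp add: abs_mult mult.commute)
    qed
  qed measurable
  then show ?thesis by (simp add: L2_ew_iff)
qed

lemma power_in_L2: "(\<lambda>y. y ^ k) \<in> L2 ew"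
proof -
  have "integrable hl (\<lambda>y. ew y * (norm (y ^ k))\<^sup>2)"
    using ew_moment(1)[of "2 * k"] by (simp add: mult.commute power_mult[symmetric] power_even_abs)
  then show ?thesis by (simp add: L2_ew_iff)
qed

lemma P_L2: "P n \<in> L2 ew"
  unfolding P_eq[abs_def] by (intro L2_sum L2_cmult power_in_L2) auto

text \<open>A series in the co-eigenfunctions with coefficients decaying faster than \<open>rate r ^ n\<close>.\<close>

definition W_series :: "(nat \<Rightarrow> real) \<Rightarrow> real \<Rightarrow> real" where
  "W_series c y = (\<Sum>n. c n * W n y)"

lemma W_series_measurable [measurable]: "W_series c \<in> borel_measurable hl"
  unfolding W_series_def[abs_def] by measurable

context
  fixes r :: real and c :: "nat \<Rightarrow> real"
  assumes r: "0 < r" "r < 1" and c: "summable (\<lambda>n. \<bar>c n\<bar> / rate r ^ n)"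
begin

lemma W_series_term: "y > 0 \<Longrightarrow> \<bar>c n * W n y\<bar> \<le> \<bar>c n\<bar> / rate r ^ n * majorant r y"
  using mult_left_mono[OF W_le_majorant[OF r, of y n], of "\<bar>c n\<bar>"] by (simp add: abs_mult)

lemma W_series_summable: "y > 0 \<Longrightarrow> summable (\<lambda>n. \<bar>c n * W n y\<bar>)"
  by (rule summable_comparison_test[OF _ summable_mult2[OF c, of "majorant r y"]]) (use W_series_term in auto)


lemma W_series_integral:
  fixes f :: "real \<Rightarrow> 'b :: {banach, second_countable_topology}"
  assumes [measurable]: "f \<in> borel_measurable hl" and i: "integrable hl (\<lambda>y. majorant r y * norm (f y))"
  shows "integrable hl (\<lambda>y. W_series c y *\<^sub>R f y)"
    and "(\<lambda>n. c n *\<^sub>R (LINT y|hl. W n y *\<^sub>R f y)) sums (LINT y|hl. W_series c y *\<^sub>R f y)"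
proof -
  note W = W_integrable_majorized[OF r _ i]
  have iF: "integrable hl (\<lambda>y. (c n * W n y) *\<^sub>R f y)" for n
    using integrable_scaleR_right[OF W(1), of "c n" n] by simp
  have AEs: "AE y in hl. summable (\<lambda>n. norm ((c n * W n y) *\<^sub>R f y))"
    by (rule AE_hl_I) (use summable_mult2[OF W_series_summable, of _ "norm (f _)"] in simp)
  have sm: "summable (\<lambda>n. LINT y|hl. norm ((c n * W n y) *\<^sub>R f y))"
  proof (rule summable_comparison_test)
    show "summable (\<lambda>n. \<bar>c n\<bar> / rate r ^ n * (LINT y|hl. majorant r y * norm (f y)))"
      using c by (rule summable_mult2)
    have "(LINT y|hl. norm ((c n * W n y) *\<^sub>R f y)) \<le> \<bar>c n\<bar> / rate r ^ n * (LINT y|hl. majorant r y * norm (f y))" for n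
    proof -
      have "(LINT y|hl. norm ((c n * W n y) *\<^sub>R f y)) = \<bar>c n\<bar> * (LINT y|hl. norm (W n y *\<^sub>R f y))"
        by (simp add: abs_mult mult.assoc)
      also have "\<dots> \<le> \<bar>c n\<bar> * ((LINT y|hl. majorant r y * norm (f y)) / rate r ^ n)"
        by (rule mult_left_mono[OF W(2)]) auto
      finally show ?thesis by simp
    qed
    then show "\<exists>N. \<forall>n\<ge>N. norm (LINT y|hl. norm ((c n * W n y) *\<^sub>R f y)) \<le> \<bar>c n\<bar> / rate r ^ n * (LINT y|hl. majorant r y * norm (f y))"
      by auto
  qed
  have eq: "(\<Sum>n. (c n * W n y) *\<^sub>R f y) = W_series c y *\<^sub>R f y" if "y > 0" for y
  proof -
    have "summable (\<lambda>n. c n * W n y)" by (rule summable_rabs_cancel[OF W_series_summable[OF that]])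
    from bounded_linear.suminf[OF bounded_linear_scaleR_left this, of "f y"]
    show ?thesis unfolding W_series_def by (rule sym)
  qed
  show "integrable hl (\<lambda>y. W_series c y *\<^sub>R f y)"
    using integrable_suminf[OF iF AEs sm] by (simp only: hl_integrable_cong[OF eq])
  have "(\<lambda>n. LINT y|hl. (c n * W n y) *\<^sub>R f y) sums (LINT y|hl. (\<Sum>n. (c n * W n y) *\<^sub>R f y))"
    by (rule sums_integral[OF iF AEs sm])
  moreover have "(LINT y|hl. (c n * W n y) *\<^sub>R f y) = c n *\<^sub>R (LINT y|hl. W n y *\<^sub>R f y)" for n
    by (simp flip: scaleR_scaleR)
  ultimately show "(\<lambda>n. c n *\<^sub>R (LINT y|hl. W n y *\<^sub>R f y)) sums (LINT y|hl. W_series c y *\<^sub>R f y)"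
    by (simp only: hl_cong[OF eq])
qed

end

text \<open>
  Solve \<open>rate r = \<rho>\<close> for the midpoint \<open>\<rho>\<close> of \<open>s\<close> and \<open>2 powr \<alpha> - 1\<close>.
\<close>

lemma rate_exceeds:
  assumes "0 < s" "s < 2 powr \<alpha> - 1"
  shows "\<exists>r. 0 < r \<and> r < 1 \<and> s < rate r"
proof -
  define \<rho> where "\<rho> = (s + (2 powr \<alpha> - 1)) / 2"
  have \<rho>: "s < \<rho>" "\<rho> < 2 powr \<alpha> - 1" "0 < \<rho>" using assms by (auto simp: \<rho>_def)
  define r where "r = (1 + \<rho>) powr (1/\<alpha>) - 1"
  have "1 < (1 + \<rho>) powr (1/\<alpha>)" using \<rho> \<alpha>_pos by (intro gr_one_powr) auto
  moreover have "(1 + \<rho>) powr (1/\<alpha>) < (2 powr \<alpha>) powr (1/\<alpha>)" using \<rho> \<alpha>_pos by (intro powr_less_mono2) auto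
  moreover have "(2 powr \<alpha>) powr (1/\<alpha>) = 2" using \<alpha>_pos by (simp add: powr_powr)
  moreover have "rate r = \<rho>" using \<rho> \<alpha>_pos by (simp add: rate_def r_def powr_powr)
  ultimately show ?thesis using \<rho> by (intro exI[of _ r]) (auto simp: r_def)
qed

end

locale gauss_laguerre_kernel = gauss_laguerre_weight +
  fixes K :: "real \<Rightarrow> real \<Rightarrow> real measure"
  assumes \<alpha>_less_1: "\<alpha> < 1" and GL: "gauss_laguerre_semigroup \<alpha> \<beta> K"
begin

lemma feller: "feller_semigroup K"
  using GL by (simp add: gauss_laguerre_semigroup_def)

lemma K_measurable: "t \<ge> 0 \<Longrightarrow> K t \<in> half_line \<rightarrow>\<^sub>M prob_algebra half_line"
  using feller by (simp add: feller_semigroup_def)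

lemma K_subprob: "t \<ge> 0 \<Longrightarrow> K t \<in> half_line \<rightarrow>\<^sub>M subprob_algebra half_line"
  using K_measurable by (rule measurable_prob_algebraD)

lemma space_half_line: "space half_line = {0..}"
  by (simp add: space_restrict_space)

lemma K_prob: "t \<ge> 0 \<Longrightarrow> x \<ge> 0 \<Longrightarrow> prob_space (K t x)"
  and K_sets: "t \<ge> 0 \<Longrightarrow> x \<ge> 0 \<Longrightarrow> sets (K t x) = sets half_line"
  using measurable_space[OF K_measurable, of t x] by (auto simp: space_half_line space_prob_algebra)

lemma K_space: "t \<ge> 0 \<Longrightarrow> x \<ge> 0 \<Longrightarrow> space (K t x) = {0..}"
  using sets_eq_imp_space_eq[OF K_sets] by (simp add: space_half_line)

lemma K_bind: "s \<ge> 0 \<Longrightarrow> t \<ge> 0 \<Longrightarrow> x \<ge> 0 \<Longrightarrow> K (s + t) x = K s x \<bind> K t"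
  using feller by (simp add: feller_semigroup_def)

lemma
  fixes f :: "real \<Rightarrow> real"
  assumes f: "f \<in> L2 ew" and t: "t \<ge> 0"
  shows sg_integrable: "AE x in hl. integrable (K t x) f"
    and sg_L2: "sg K t f \<in> L2 ew" and sg_contraction: "L2_norm ew (sg K t f) \<le> L2_norm ew f"
  using GL f t by (auto simp: gauss_laguerre_semigroup_def L2_contraction_semigroup_def AE_ew)

lemma sg_lincomb:
  fixes f g :: "real \<Rightarrow> real"
  assumes f: "f \<in> L2 ew" and g: "g \<in> L2 ew" and t: "t \<ge> 0"
  shows "AE x in hl. sg K t (\<lambda>y. a * f y + b * g y) x = a * sg K t f x + b * sg K t g x"
  using sg_integrable[OF f t] sg_integrable[OF g t]
  by eventually_elim (simp add: sg_def)

lemma sg_semigroup: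
  fixes f :: "real \<Rightarrow> real"
  assumes f: "f \<in> L2 ew" and s: "s \<ge> 0" and t: "t \<ge> 0"
  shows "AE x in hl. sg K (s + t) f x = sg K s (sg K t f) x"
proof -
  have "AE x in hl. integrable (K (s + t) x) f" using s t by (intro sg_integrable[OF f]) simp
  moreover have "AE x in hl. x > 0" by (rule AE_hl_I)
  ultimately show ?thesis
  proof eventually_elim
    case (elim x)
    have b: "K (s + t) x = K s x \<bind> K t" using K_bind s t elim by simp
    have "(LINT y|(K s x \<bind> K t). f y) = (LINT z|K s x. (LINT y|K t z. f y))"
    proof (rule integral_bind_integrable)
      show "K t \<in> K s x \<rightarrow>\<^sub>M subprob_algebra half_line"
        using K_subprob[OF t] K_sets[OF s, of x] elim by (simp cong: measurable_cong_sets)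
      show "f \<in> borel_measurable half_line" using L2_measurable[OF f] by (rule hl_measurable_half_line)
      show "integrable (K s x \<bind> K t) f" using elim b by simp
      show "space (K s x) \<noteq> {}" using K_space[OF s, of x] elim by auto
    qed
    then show ?case by (simp add: sg_def b)
  qed
qed


section \<open>Eigenfunctions\<close>

text \<open>
  Let \<open>\<psi> h\<close> be the distance between \<open>P\<^sub>h P\<^sub>n\<close> and \<open>exp(- n h) P\<^sub>n\<close>. The generator gives
  \<open>\<psi> h = o(h)\<close>, and the contraction property gives \<open>\<psi> (j h) \<le> j \<psi> h\<close>. Taking \<open>h = t/N\<close> with
  \<open>N \<rightarrow> \<infinity>\<close> forces \<open>\<psi> t = 0\<close>.
\<close>

lemma sg_P:
  assumes t: "t \<ge> 0"
  shows "AE x in hl. sg K t (P n) x = exp (- real n * t) * P n x"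
proof (cases "t = 0")
  case True
  have "sg K 0 (P n) x = P n x" if "x > 0" for x
  proof -
    have "K 0 x = return half_line x" using feller that by (simp add: feller_semigroup_def)
    moreover have "P n \<in> borel_measurable half_line" by (intro measurable_restrict_space1) measurable
    ultimately show ?thesis using that by (simp add: sg_def integral_return space_half_line)
  qed
  then show ?thesis using True by (auto intro: AE_hl_I)
next
  case False
  then have t: "t > 0" using t by simp
  let ?f = "P n"
  note f = P_L2[of n]
  define \<psi> where "\<psi> = (\<lambda>h. L2_norm ew (\<lambda>x. sg K h ?f x - exp (- real n * h) * ?f x))"
  have \<psi>0: "\<psi> h \<ge> 0" for h by (simp add: \<psi>_def L2_norm_nonneg)
  have dL: "(\<lambda>x. sg K h ?f x - c * ?f x) \<in> L2 ew" if "h \<ge> 0" for h c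
    by (intro L2_diff L2_cmult sg_L2 f that)
  have gen: "((\<lambda>h. L2_norm ew (\<lambda>x. (sg K h ?f x - ?f x) / h - (- real n * ?f x))) \<longlongrightarrow> 0) (at_right 0)"
  proof -
    have "L2_generator ew K (poly (P_pol n)) (L_GL \<alpha> \<beta> (poly (P_pol n)))"
      using GL by (simp add: gauss_laguerre_semigroup_def)
    then show ?thesis by (simp add: L2_generator_def L2_tendsto_def poly_P_pol L_GL_P[OF \<alpha>_less_1])
  qed
  have small: "((\<lambda>h. \<psi> h / h) \<longlongrightarrow> 0) (at_right 0)"
  proof (rule tendsto_sandwich[OF _ _ tendsto_const])
    have "((\<lambda>h. exp (- real n * h)) has_real_derivative - real n) (at 0)"
      by (auto intro!: derivative_eq_intros)
    then have "((\<lambda>h. (exp (- real n * (0 + h)) - exp (- real n * 0)) / h) \<longlongrightarrow> - real n) (at 0)"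
      by (simp only: DERIV_def)
    then have "((\<lambda>h. \<bar>(exp (- real n * h) - 1) / h - (- real n)\<bar>) \<longlongrightarrow> 0) (at 0)"
      by (intro tendsto_rabs_zero LIM_zero) simp
    then have d0: "((\<lambda>h. \<bar>(exp (- real n * h) - 1) / h - (- real n)\<bar>) \<longlongrightarrow> 0) (at_right 0)"
      by (rule tendsto_mono[rotated]) (simp add: at_le)
    from tendsto_add[OF gen tendsto_mult[OF d0 tendsto_const[of "L2_norm ew ?f"]]]
    show "((\<lambda>h. L2_norm ew (\<lambda>x. (sg K h ?f x - ?f x) / h - (- real n * ?f x)) +
        \<bar>(exp (- real n * h) - 1) / h - (- real n)\<bar> * L2_norm ew ?f) \<longlongrightarrow> 0) (at_right 0)"
      by simp
    show "\<forall>\<^sub>F h in at_right 0. 0 \<le> \<psi> h / h"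
      by (intro eventually_at_rightI[of 0 1]) (auto simp: \<psi>0)
    have "\<psi> h / h \<le> L2_norm ew (\<lambda>x. (sg K h ?f x - ?f x) / h - (- real n * ?f x)) +
        \<bar>(exp (- real n * h) - 1) / h - (- real n)\<bar> * L2_norm ew ?f" if h: "h > 0" for h
    proof -
      let ?e = "(exp (- real n * h) - 1) / h - (- real n)"
      have A: "(\<lambda>x. (sg K h ?f x - ?f x) / h - (- real n * ?f x)) \<in> L2 ew"
      proof -
        have "(\<lambda>x. (1/h) * (sg K h ?f x - 1 * ?f x) - (- real n * ?f x)) \<in> L2 ew"
          using h by (intro L2_diff L2_cmult dL f) auto
        then show ?thesis by simp
      qed
      have B: "(\<lambda>x. (- ?e) * ?f x) \<in> L2 ew" by (intro L2_cmult f)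
      have "(1/h) * \<psi> h = L2_norm ew (\<lambda>x. (1/h) * (sg K h ?f x - exp (- real n * h) * ?f x))"
        unfolding \<psi>_def using h by (subst L2_norm_cmult[OF dL]) auto
      also have "(\<lambda>x. (1/h) * (sg K h ?f x - exp (- real n * h) * ?f x)) =
         (\<lambda>x. ((sg K h ?f x - ?f x) / h - (- real n * ?f x)) + (- ?e) * ?f x)"
        using h by (simp add: fun_eq_iff field_simps)
      also have "L2_norm ew \<dots> \<le> L2_norm ew (\<lambda>x. (sg K h ?f x - ?f x) / h - (- real n * ?f x)) + L2_norm ew (\<lambda>x. (- ?e) * ?f x)"
        by (rule L2_norm_triangle[OF A B])
      also have "L2_norm ew (\<lambda>x. (- ?e) * ?f x) = \<bar>?e\<bar> * L2_norm ew ?f"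
        by (subst L2_norm_cmult[OF f]) (simp only: abs_minus_cancel)
      finally show ?thesis by simp
    qed
    then show "\<forall>\<^sub>F h in at_right 0. \<psi> h / h \<le> L2_norm ew (\<lambda>x. (sg K h ?f x - ?f x) / h - (- real n * ?f x)) +
        \<bar>(exp (- real n * h) - 1) / h - (- real n)\<bar> * L2_norm ew ?f"
      by (intro eventually_at_rightI[of 0 1]) auto
  qed
  have steps: "\<psi> (real j * h) \<le> real j * \<psi> h" if h: "h > 0" for j h
  proof (induction j)
    case 0
    have "sg K 0 (P n) x = P n x" if "x > 0" for x
    proof -
      have "K 0 x = return half_line x" using feller that by (simp add: feller_semigroup_def)
      moreover have "P n \<in> borel_measurable half_line" by (intro measurable_restrict_space1) measurable
      ultimately show ?thesis using that by (simp add: sg_def integral_return space_half_line)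
    qed
    then have "\<psi> 0 = L2_norm ew (\<lambda>x. 0::real)"
      unfolding \<psi>_def using L2_measurable[OF dL[of 0 1]] by (intro L2_norm_cong_AE AE_hl_I) auto
    then show ?case by (simp add: L2_norm_def)
  next
    case (Suc j)
    let ?s = "real j * h" and ?c = "exp (- real n * h)"
    have s: "?s \<ge> 0" using h by simp
    have hs: "h \<ge> 0" using h by simp
    let ?g = "\<lambda>x. 1 * sg K h ?f x + (- ?c) * ?f x"
    have g: "?g \<in> L2 ew" using L2_add[OF L2_cmult L2_cmult, OF sg_L2[OF f hs] f] .
    have A: "AE x in hl. sg K (real (Suc j) * h) ?f x - exp (- real n * (real (Suc j) * h)) * ?f x =
        sg K ?s ?g x + ?c * (sg K ?s ?f x - exp (- real n * ?s) * ?f x)"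
      using sg_semigroup[OF f s hs] sg_lincomb[OF sg_L2[OF f hs] f s, of 1 "- ?c"]
    proof eventually_elim
      case (elim x)
      have "real (Suc j) * h = ?s + h" by (simp add: algebra_simps)
      moreover have "exp (- real n * (?s + h)) = ?c * exp (- real n * ?s)" by (simp add: algebra_simps flip: exp_add)
      ultimately show ?case using elim by (simp add: algebra_simps)
    qed
    have B: "sg K ?s ?g \<in> L2 ew" by (rule sg_L2[OF g s])
    have C: "(\<lambda>x. ?c * (sg K ?s ?f x - exp (- real n * ?s) * ?f x)) \<in> L2 ew" by (intro L2_cmult dL s)
    have "0 \<le> real (Suc j) * h" using h by simp
    then have "\<psi> (real (Suc j) * h) = L2_norm ew (\<lambda>x. sg K ?s ?g x + ?c * (sg K ?s ?f x - exp (- real n * ?s) * ?f x))"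
      unfolding \<psi>_def by (intro L2_norm_cong_AE A L2_measurable[OF dL] L2_measurable[OF L2_add[OF B C]])
    also have "\<dots> \<le> L2_norm ew (sg K ?s ?g) + L2_norm ew (\<lambda>x. ?c * (sg K ?s ?f x - exp (- real n * ?s) * ?f x))"
      by (rule L2_norm_triangle[OF B C])
    also have "L2_norm ew (sg K ?s ?g) \<le> L2_norm ew ?g" by (rule sg_contraction[OF g s])
    also have "L2_norm ew ?g = \<psi> h" by (simp add: \<psi>_def)
    also have "L2_norm ew (\<lambda>x. ?c * (sg K ?s ?f x - exp (- real n * ?s) * ?f x)) = ?c * \<psi> ?s"
      unfolding \<psi>_def by (subst L2_norm_cmult[OF dL[OF s]]) simp
    also have "?c * \<psi> ?s \<le> 1 * \<psi> ?s" using \<psi>0 h by (intro mult_right_mono) auto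
    finally show ?case using Suc by (simp add: algebra_simps)
  qed
  have "\<psi> t \<le> t * (\<psi> (t / real N) / (t / real N))" if "N > 0" for N
    using steps[of "t / real N" N] t that by (simp add: mult.commute)
  moreover have "(\<lambda>N. t * (\<psi> (t / real N) / (t / real N))) \<longlonglongrightarrow> t * 0"
  proof (intro tendsto_mult tendsto_const filterlim_compose[OF small])
    have "filterlim (\<lambda>N. t / real N) (nhds 0) sequentially"
      by (rule real_tendsto_divide_at_top[OF tendsto_const filterlim_real_sequentially])
    then show "filterlim (\<lambda>N. t / real N) (at_right 0) sequentially"
      using t by (auto simp: filterlim_at eventually_sequentially intro!: exI[of _ 1])
  qed
  ultimately have "\<psi> t \<le> 0"
    by (intro tendsto_lowerbound[of _ "t * 0" sequentially "\<psi> t", simplified]) (auto simp: eventually_sequentially intro!: exI[of _ 1])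
  then have "L2_norm ew (\<lambda>x. sg K t ?f x - exp (- real n * t) * ?f x) = 0" using \<psi>0[of t] by (simp add: \<psi>_def)
  from L2_norm_zero_imp[OF dL this] t show ?thesis by (auto elim!: eventually_mono)
qed

end

section \<open>Expansions of the semigroup\<close>

lemma exp_T_crit:
  assumes "0 < \<alpha>" "\<tau> > T_crit \<alpha>"
  shows "exp (- \<tau>) < 2 powr \<alpha> - 1"
proof -
  have "1 < 2 powr \<alpha>" using assms by (intro gr_one_powr) auto
  moreover have "exp (- \<tau>) < exp (ln (2 powr \<alpha> - 1))" using assms(2) by (simp add: T_crit_def)
  ultimately show ?thesis by simp
qed

lemma triangular_system_unique:
  fixes u v :: "nat \<Rightarrow> real" and a :: "nat \<Rightarrow> nat \<Rightarrow> real"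
  assumes "\<And>n. (\<Sum>k\<le>n. a n k * u k) = (\<Sum>k\<le>n. a n k * v k)" and nz: "\<And>n. a n n \<noteq> 0"
  shows "u n = v n"
proof (induction n rule: less_induct)
  case (less n)
  have "(\<Sum>k<n. a n k * u k) = (\<Sum>k<n. a n k * v k)" using less by simp
  then have "a n n * u n = a n n * v n" using assms(1)[of n] by (simp add: lessThan_Suc_atMost[symmetric])
  then show ?case using nz by simp
qed

context gauss_laguerre_weight
begin

text \<open>
  The pairing \<open>\<langle>f, R\<^sub>n\<rangle>\<close> in the weighted space, where the weight cancels; see \<open>coeff_L2_inner\<close>. It is
  needed for real functions and, in the holomorphic extension, for complex ones.
\<close>

definition coeff :: "(real \<Rightarrow> 'b :: {banach, second_countable_topology}) \<Rightarrow> nat \<Rightarrow> 'b" where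
  "coeff f n = (LINT y|hl. W n y *\<^sub>R f y)"

text \<open>
  The \<open>P n x\<close> grow more slowly than \<open>(1 + \<epsilon>) ^ n\<close> for each \<open>\<epsilon> > 0\<close>.
\<close>

lemma P_geometric_summable:
  assumes s: "0 \<le> s" "s < 1"
  shows "summable (\<lambda>n. s ^ n * \<bar>P n x\<bar>)"
proof -
  define \<epsilon> where "\<epsilon> = (1 - s) / 2"
  have e: "\<epsilon> > 0" using s by (simp add: \<epsilon>_def)
  have "s * (1 - s) \<le> 1 * (1 - s)" using s by (intro mult_right_mono) auto
  moreover have "s * (1 + \<epsilon>) = s + s * (1 - s) / 2" by (simp add: \<epsilon>_def algebra_simps)
  moreover have "s + u / 2 < 1" if "u \<le> 1 - s" for u using s that by linarith
  ultimately have se: "s * (1 + \<epsilon>) < 1" by (metis mult_1)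
  obtain C where C: "C \<ge> 0" "\<And>n y. \<bar>y\<bar> \<le> \<bar>x\<bar> + 1 \<Longrightarrow> \<bar>P n y\<bar> \<le> C * (1 + \<epsilon>) ^ n"
    using P_bound[OF add_nonneg_pos[OF abs_ge_zero zero_less_one] e, of x] by blast
  show ?thesis
  proof (rule summable_comparison_test)
    show "summable (\<lambda>n. C * (s * (1 + \<epsilon>)) ^ n)"
      using se s e by (intro summable_mult summable_geometric) simp
    have "s ^ n * \<bar>P n x\<bar> \<le> s ^ n * (C * (1 + \<epsilon>) ^ n)" for n
      by (rule mult_left_mono) (use C(2)[of x n] s in auto)
    then show "\<exists>N. \<forall>n\<ge>N. norm (s ^ n * \<bar>P n x\<bar>) \<le> C * (s * (1 + \<epsilon>)) ^ n"
      using s by (auto simp: power_mult_distrib mult_ac)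
  qed
qed

text \<open>
  The condition \<open>\<tau> > T_crit \<alpha>\<close> means \<open>exp (- \<tau>) < 2 powr \<alpha> - 1\<close>, and this leaves room for an
  \<open>r < 1\<close> with \<open>exp (- \<tau>) < rate r\<close>.
\<close>

lemma coeff_L2_bound:
  assumes \<tau>: "\<tau> > T_crit \<alpha>"
  shows "\<exists>C\<ge>0. \<forall>n. \<forall>f\<in>L2 ew. integrable hl (\<lambda>y. W n y *\<^sub>R (f y :: 'b :: {banach, second_countable_topology})) \<and>
           norm (coeff f n) \<le> C * exp (\<tau> * real n) * L2_norm ew f"
proof -
  obtain r where r: "0 < r" "r < 1" "exp (- \<tau>) < rate r"
    using rate_exceeds[OF _ exp_T_crit[OF \<alpha>_pos \<tau>]] by auto
  obtain C where C: "C \<ge> 0" "\<And>n f. f \<in> L2 ew \<Longrightarrow> integrable hl (\<lambda>y. W n y *\<^sub>R (f y :: 'b)) \<and>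
           (LINT y|hl. norm (W n y *\<^sub>R f y)) \<le> C / rate r ^ n * L2_norm ew f"
    using W_L2[OF r(1,2), where 'b='b] by blast
  have "norm (coeff f n) \<le> C * exp (\<tau> * real n) * L2_norm ew f" if f: "f \<in> L2 ew" for n and f :: "real \<Rightarrow> 'b"
  proof -
    have "norm (coeff f n) \<le> (LINT y|hl. norm (W n y *\<^sub>R f y))" unfolding coeff_def by (rule integral_norm_bound)
    also have "\<dots> \<le> C / rate r ^ n * L2_norm ew f" using C(2)[OF f] by blast
    also have "\<dots> \<le> C * exp (\<tau> * real n) * L2_norm ew f"
    proof (rule mult_right_mono)
      have "exp (- \<tau>) ^ n \<le> rate r ^ n" using r by (intro power_mono) auto
      then have "C / rate r ^ n \<le> C / exp (- \<tau>) ^ n" using C(1) rate[OF r(1,2)] by (intro divide_left_mono) auto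
      then show "C / rate r ^ n \<le> C * exp (\<tau> * real n)"
        by (simp add: exp_minus divide_inverse power_inverse exp_of_nat_mult[symmetric] mult.commute[of \<tau>])
      show "0 \<le> L2_norm ew f" by (simp add: L2_norm_def)
    qed
    finally show ?thesis .
  qed
  then show ?thesis using C by blast
qed

text \<open>
  By the generating function, orthogonality to all co-eigenfunctions makes the integrals of \<open>h\<close>
  against all dilated weights vanish. In the variable \<open>V = y\<^bsup>1/\<alpha>\<^esup>\<close>, dilations of the weight are
  exponential factors \<open>exp(s V)\<close>, so the moment generating function of \<open>V\<close> under the signed density
  \<open>ew * h\<close> vanishes near \<open>0\<close>.
\<close>

lemma coeff_complete:
  fixes h :: "real \<Rightarrow> real"
  assumes h: "h \<in> L2 ew" and z: "\<And>n. coeff h n = 0"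
  shows "AE x in hl. h x = 0"
proof -
  have r: "(0::real) < 1/2" "(1/2::real) < 1" by auto
  note [measurable] = L2_measurable[OF h]
  have i: "integrable hl (\<lambda>y. majorant (1/2) y * norm (h y))" using majorant_L2[OF r] h by blast
  let ?V = "\<lambda>y::real. y powr (1/\<alpha>)" and ?g = "\<lambda>y. ew y * h y"
  have [measurable]: "?V \<in> borel_measurable hl" by measurable
  have gen: "(LINT y|hl. ew (y / (1 - q)) * h y) = 0" if q: "\<bar>q\<bar> < rate (1/2)" for q
  proof -
    have "(\<lambda>n. 0) sums (LINT y|hl. ew (y / (1 - q)) / (1 - q) * h y)"
      using W_genfun_integral[OF r _ i q] z by (simp add: coeff_def)
    then have "(LINT y|hl. ew (y / (1 - q)) * h y) / (1 - q) = 0" by (simp add: sums_iff)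
    moreover have "1 - q \<noteq> 0" using q rate[OF r] by auto
    ultimately show ?thesis by simp
  qed
  have dom: "integrable hl (\<lambda>y. exp (1/4 * \<bar>?V y\<bar>) * ?g y)"
  proof (rule Bochner_Integration.integrable_bound)
    let ?C = "(1 - rate (1/2)) powr \<delta> * (1 - rate (1/2))"
    show "integrable hl (\<lambda>y. ?C * (majorant (1/2) y * norm (h y)))" using i by simp
    show "AE y in hl. norm (exp (1/4 * \<bar>?V y\<bar>) * ?g y) \<le> norm (?C * (majorant (1/2) y * norm (h y)))"
    proof (rule AE_hl_I)
      fix y :: real assume y: "y > 0"
      have rp: "1 - rate (1/2) > 0" using rate[OF r] by simp
      have "exp (1/4 * ?V y) * exp (- ?V y) \<le> exp (- (?V y / (1 + 1/2)))" by (simp flip: exp_add)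
      then have "exp (1/4 * ?V y) * exp (- ?V y) * (y powr \<delta> / c\<^sub>0) \<le> exp (- (?V y / (1 + 1/2))) * (y powr \<delta> / c\<^sub>0)"
        using c\<^sub>0_pos by (intro mult_right_mono divide_nonneg_pos) auto
      also have "\<dots> = ?C * majorant (1/2) y"
      proof -
        have "E * (Y / c) = Z * R * (Y / Z * E / (c * R))" if "Z \<noteq> 0" "R \<noteq> 0" for E Y Z R c :: real
          using that by simp
        moreover have "(y / (1 - rate (1/2))) powr \<delta> = y powr \<delta> / (1 - rate (1/2)) powr \<delta>" by (simp add: powr_divide)
        ultimately show ?thesis using rp unfolding majorant_def by simp
      qed
      finally have "exp (1/4 * \<bar>?V y\<bar>) * ew y \<le> ?C * majorant (1/2) y"
        by (simp add: e_w_def mult_ac)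
      then have "exp (1/4 * \<bar>?V y\<bar>) * ew y * \<bar>h y\<bar> \<le> ?C * majorant (1/2) y * \<bar>h y\<bar>" by (rule mult_right_mono) simp
      then show "norm (exp (1/4 * \<bar>?V y\<bar>) * ?g y) \<le> norm (?C * (majorant (1/2) y * norm (h y)))"
        using ew_nonneg[of y] majorant_nonneg[OF r, of y] rp by (simp add: abs_mult mult.assoc)
    qed
  qed measurable
  obtain e' where e': "e' > 0" "e' < 1" "\<And>s. \<bar>s\<bar> < e' \<Longrightarrow> \<bar>1 - (1 - s) powr (- \<alpha>)\<bar> < rate (1/2)"
  proof -
    have "((\<lambda>s. 1 - (1 - s) powr (- \<alpha>)) \<longlongrightarrow> 1 - (1 - 0) powr (- \<alpha>)) (at 0)"
      by (intro tendsto_intros) auto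
    then have "((\<lambda>s. 1 - (1 - s) powr (- \<alpha>)) \<longlongrightarrow> 0) (at 0)" by simp
    then have "\<forall>\<^sub>F s in at 0. dist (1 - (1 - s) powr (- \<alpha>)) 0 < rate (1/2)"
      using rate[OF r] by (intro tendstoD) auto
    then obtain d where d: "d > 0" "\<And>s. s \<noteq> 0 \<Longrightarrow> \<bar>s\<bar> < d \<Longrightarrow> \<bar>1 - (1 - s) powr (- \<alpha>)\<bar> < rate (1/2)"
      unfolding eventually_at by (auto simp: dist_real_def)
    show thesis
    proof (rule that[of "min d (1/2)"])
      fix s assume "\<bar>s\<bar> < min d (1/2)"
      then show "\<bar>1 - (1 - s) powr (- \<alpha>)\<bar> < rate (1/2)" using d(2)[of s] rate[OF r] by (cases "s = 0") auto
    qed (use d in auto)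
  qed
  have mgf: "(LINT y|hl. exp (s * ?V y) * ?g y) = 0" if s: "\<bar>s\<bar> < e'" for s
  proof -
    (* This q solves (1 - q) powr (- 1/\<alpha>) = 1 - s, so the dilated exponent is - (1 - s) V. *)
    define q where "q = 1 - (1 - s) powr (- \<alpha>)"
    have s1: "1 - s > 0" using s e' by simp
    have q: "1 - q = (1 - s) powr (- \<alpha>)" by (simp add: q_def)
    have qp: "1 - q > 0" using s1 q by simp
    have e: "ew (y / (1 - q)) * h y = (1 / (1 - q)) powr \<delta> * (exp (s * ?V y) * ?g y)" if y: "y > 0" for y
    proof -
      have "(y / (1 - q)) powr (1/\<alpha>) = ?V y / (1 - q) powr (1/\<alpha>)" using y qp by (subst powr_divide) auto
      also have "(1 - q) powr (1/\<alpha>) = inverse (1 - s)" unfolding q powr_powr using s1 \<alpha>_pos by (simp add: powr_minus)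
      finally have 1: "(y / (1 - q)) powr (1/\<alpha>) = ?V y - s * ?V y" by (simp add: divide_inverse algebra_simps)
      have 2: "(y / (1 - q)) powr \<delta> = (1 / (1 - q)) powr \<delta> * y powr \<delta>"
        using y qp by (subst powr_mult[symmetric]) auto
      have "exp (- (?V y - s * ?V y)) = exp (s * ?V y) * exp (- ?V y)" by (simp flip: exp_add)
      then show ?thesis unfolding e_w_def 1 2 by simp
    qed
    have "0 = (LINT y|hl. ew (y / (1 - q)) * h y)" using gen[of q] e'(3)[OF s] by (simp add: q_def)
    also have "\<dots> = (1 / (1 - q)) powr \<delta> * (LINT y|hl. exp (s * ?V y) * ?g y)"
      by (simp only: hl_cong[OF e] integral_mult_right_zero)
    finally show ?thesis using qp by simp
  qed
  have mom: "(LINT y|hl. ?V y ^ k * ?g y) = 0" for k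
    by (rule signed_mgf_zero_imp_moments_zero[OF _ _ _ e'(1) dom mgf]) auto
  have ind: "(LINT y|hl. indicator A (?V y) * ?g y) = 0" if "A \<in> sets borel" for A
    by (rule signed_moments_zero_imp_zero[OF _ _ _ dom mom that]) auto
  have ig: "integrable hl ?g"
  proof (rule Bochner_Integration.integrable_bound[OF dom])
    have "norm (?g y) \<le> norm (exp (1/4 * \<bar>?V y\<bar>) * ?g y)" for y
      using mult_right_mono[of 1 "exp (1/4 * \<bar>?V y\<bar>)" "\<bar>?g y\<bar>"] by (simp add: abs_mult)
    then show "AE y in hl. norm (?g y) \<le> norm (exp (1/4 * \<bar>?V y\<bar>) * ?g y)" by auto
  qed measurable
  have "AE x in hl. ?g x = 0"
  proof (rule density_unique_real[OF ig])
    fix B assume "B \<in> sets hl"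
    then obtain B' where B': "B = B' \<inter> {0<..}" "B' \<in> sets borel" by (auto simp: sets_restrict_space)
    define A where "A = (\<lambda>u. u powr \<alpha>) -` B'"
    have "(\<lambda>u::real. u powr \<alpha>) \<in> borel \<rightarrow>\<^sub>M borel" by measurable
    from measurable_sets[OF this B'(2)] have A: "A \<in> sets borel" by (simp add: A_def)
    have "(LINT y:B|hl. ?g y) = (LINT y|hl. indicator A (?V y) * ?g y)"
      unfolding set_lebesgue_integral_def
      using \<alpha>_pos by (intro hl_cong) (auto simp: indicator_def A_def B' powr_powr)
    then show "(LINT y:B|hl. ?g y) = (LINT y:B|hl. 0)" using ind[OF A] by simp
  qed simp
  moreover have "AE x in hl. x > 0" by (rule AE_hl_I)
  ultimately show ?thesis
  proof eventually_elim
    case (elim x)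
    then show ?case using ew_pos[of x] by auto
  qed
qed

end

definition geometric_decay :: "(nat \<Rightarrow> 'b :: real_normed_vector) \<Rightarrow> bool" where
  "geometric_decay b \<longleftrightarrow> (\<exists>C s. 0 \<le> s \<and> s < 1 \<and> (\<forall>n. norm (b n) \<le> C * s ^ n))"

lemma geometric_decay_summable: "geometric_decay b \<Longrightarrow> summable (\<lambda>n. norm (b n))"
proof -
  assume "geometric_decay b"
  then obtain C s where "0 \<le> s" "s < 1" "\<And>n. norm (b n) \<le> C * s ^ n" by (auto simp: geometric_decay_def)
  then show ?thesis
    by (intro summable_comparison_test[OF _ summable_mult[OF summable_geometric[of s]]]) auto
qed

lemma geometric_decay_le: "geometric_decay b \<Longrightarrow> (\<And>n. norm (b' n) \<le> norm (b n)) \<Longrightarrow> geometric_decay b'"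
  unfolding geometric_decay_def by (meson order_trans)

lemma geometric_decay_diff:
  assumes "geometric_decay b" "geometric_decay b'"
  shows "geometric_decay (\<lambda>n. b n - b' n)"
proof -
  obtain C s C' s' where s: "0 \<le> s" "s < 1" "\<And>n. norm (b n) \<le> C * s ^ n" "0 \<le> s'" "s' < 1" "\<And>n. norm (b' n) \<le> C' * s' ^ n"
    using assms by (auto simp: geometric_decay_def)
  have C: "C \<ge> 0" "C' \<ge> 0" using s(3)[of 0] s(6)[of 0] norm_ge_zero[of "b 0"] norm_ge_zero[of "b' 0"] by (simp_all del: norm_ge_zero)
  let ?m = "max s s'"
  have "norm (b n - b' n) \<le> (C + C') * ?m ^ n" for n
  proof -
    have "norm (b n - b' n) \<le> C * s ^ n + C' * s' ^ n" using norm_triangle_ineq4[of "b n" "b' n"] s(3)[of n] s(6)[of n] by linarith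
    also have "\<dots> \<le> C * ?m ^ n + C' * ?m ^ n" using C s by (intro add_mono mult_left_mono power_mono) auto
    finally show ?thesis by (simp add: algebra_simps)
  qed
  then show ?thesis unfolding geometric_decay_def using s by - (rule exI[of _ "C + C'"], rule exI[of _ ?m], auto)
qed

lemma geometric_decay_exp:
  assumes "\<And>n. norm (a n) \<le> C * exp (\<tau> * real n)" "\<tau> < t"
  shows "geometric_decay (\<lambda>n. exp (- real n * t) *\<^sub>R a n)"
  unfolding geometric_decay_def
proof (rule exI[of _ C], rule exI[of _ "exp (\<tau> - t)"], intro conjI allI)
  fix n
  have "norm (exp (- real n * t) *\<^sub>R a n) \<le> exp (- real n * t) * (C * exp (\<tau> * real n))"
    using assms(1)[of n] by simp
  also have "\<dots> = C * exp (\<tau> - t) ^ n"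
    by (simp add: exp_of_nat_mult[symmetric] algebra_simps flip: exp_add)
  finally show "norm (exp (- real n * t) *\<^sub>R a n) \<le> C * exp (\<tau> - t) ^ n" .
qed (use assms in auto)

context lambda_density
begin

definition P_series :: "(nat \<Rightarrow> 'b :: {banach, second_countable_topology}) \<Rightarrow> real \<Rightarrow> 'b" where
  "P_series b x = (\<Sum>n. P n x *\<^sub>R b n)"

lemma P_series_abs_summable:
  assumes "geometric_decay b"
  shows "summable (\<lambda>n. norm (P n x *\<^sub>R b n))"
proof -
  obtain C s where s: "0 \<le> s" "s < 1" "\<And>n. norm (b n) \<le> C * s ^ n" using assms by (auto simp: geometric_decay_def)
  show ?thesis
  proof (rule summable_comparison_test[OF _ summable_mult[OF P_geometric_summable[OF s(1,2)], of C x]])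
    have "norm (norm (P n x *\<^sub>R b n)) \<le> C * (s ^ n * \<bar>P n x\<bar>)" for n
      using mult_left_mono[OF s(3)[of n], of "\<bar>P n x\<bar>"] by (simp add: mult_ac)
    then show "\<exists>N. \<forall>n\<ge>N. norm (norm (P n x *\<^sub>R b n)) \<le> C * (s ^ n * \<bar>P n x\<bar>)" by blast
  qed
qed

lemma P_series_sums: "geometric_decay b \<Longrightarrow> (\<lambda>n. P n x *\<^sub>R b n) sums P_series b x"
  unfolding P_series_def by (rule summable_sums[OF summable_norm_cancel[OF P_series_abs_summable]])

lemma P_series_measurable [measurable]: "P_series b \<in> borel_measurable borel"
  unfolding P_series_def[abs_def] by measurable

text \<open>
  Cauchy-Schwarz with the weights \<open>norm (b n)\<close> gives pointwise
  \<open>(norm (\<Sum>n. P n x b\<^sub>n))\<^sup>2 \<le> (\<Sum>n. norm b\<^sub>n) (\<Sum>n. norm b\<^sub>n (P n x)\<^sup>2)\<close>; then integrate, using that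
  each \<open>P n\<close> has norm at most \<open>1\<close>.
\<close>

lemma P_series_L2:
  fixes b :: "nat \<Rightarrow> 'b :: {banach, second_countable_topology}"
  assumes b: "geometric_decay b"
  shows "P_series b \<in> L2 ew" and "L2_norm ew (P_series b) \<le> (\<Sum>n. norm (b n))"
proof -
  define B where "B = (\<Sum>n. norm (b n))"
  note sb = geometric_decay_summable[OF b]
  have B0: "B \<ge> 0" unfolding B_def by (rule suminf_nonneg[OF sb]) simp
  have pt: "ennreal (ew x * (norm (P_series b x))\<^sup>2) \<le> ennreal B * (\<Sum>n. ennreal (norm (b n)) * ennreal (ew x * (P n x)\<^sup>2))" for x
  proof (rule LIMSEQ_le_const2)
    have "(\<lambda>N. \<Sum>n<N. P n x *\<^sub>R b n) \<longlonglongrightarrow> P_series b x" using P_series_sums[OF b] by (simp add: sums_def)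
    then show "(\<lambda>N. ennreal (ew x * (norm (\<Sum>n<N. P n x *\<^sub>R b n))\<^sup>2)) \<longlonglongrightarrow> ennreal (ew x * (norm (P_series b x))\<^sup>2)"
      by (intro tendsto_ennrealI tendsto_intros)
    have "ennreal (ew x * (norm (\<Sum>n<N. P n x *\<^sub>R b n))\<^sup>2) \<le> ennreal B * (\<Sum>n. ennreal (norm (b n)) * ennreal (ew x * (P n x)\<^sup>2))" for N
    proof -
      have "(norm (\<Sum>n<N. P n x *\<^sub>R b n))\<^sup>2 \<le> (\<Sum>n<N. sqrt (norm (b n)) * (sqrt (norm (b n)) * \<bar>P n x\<bar>))\<^sup>2"
        by (intro power_mono order_trans[OF norm_sum] sum_mono) (auto simp: mult.assoc[symmetric])
      also have "\<dots> \<le> (\<Sum>n<N. (sqrt (norm (b n)))\<^sup>2) * (\<Sum>n<N. (sqrt (norm (b n)) * \<bar>P n x\<bar>)\<^sup>2)"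
        by (rule Cauchy_Schwarz_ineq_sum)
      also have "\<dots> = (\<Sum>n<N. norm (b n)) * (\<Sum>n<N. norm (b n) * (P n x)\<^sup>2)" by (simp add: power_mult_distrib)
      also have "\<dots> \<le> B * (\<Sum>n<N. norm (b n) * (P n x)\<^sup>2)"
        unfolding B_def by (intro mult_right_mono sum_le_suminf[OF sb] sum_nonneg) auto
      finally have "ew x * (norm (\<Sum>n<N. P n x *\<^sub>R b n))\<^sup>2 \<le> ew x * (B * (\<Sum>n<N. norm (b n) * (P n x)\<^sup>2))"
        using ew_nonneg by (rule mult_left_mono)
      also have "\<dots> = B * (\<Sum>n<N. norm (b n) * (ew x * (P n x)\<^sup>2))" by (simp add: sum_distrib_left mult_ac)
      finally have "ennreal (ew x * (norm (\<Sum>n<N. P n x *\<^sub>R b n))\<^sup>2) \<le> ennreal (B * (\<Sum>n<N. norm (b n) * (ew x * (P n x)\<^sup>2)))"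
        by (rule ennreal_leI)
      also have "\<dots> = ennreal B * (\<Sum>n<N. ennreal (norm (b n)) * ennreal (ew x * (P n x)\<^sup>2))"
      proof -
        have "ennreal (norm (b n)) * ennreal (ew x * (P n x)\<^sup>2) = ennreal (norm (b n) * (ew x * (P n x)\<^sup>2))" for n
          using ew_nonneg[of x] by (intro ennreal_mult[symmetric]) auto
        then have "(\<Sum>n<N. ennreal (norm (b n)) * ennreal (ew x * (P n x)\<^sup>2)) = ennreal (\<Sum>n<N. norm (b n) * (ew x * (P n x)\<^sup>2))"
          using ew_nonneg[of x] by (simp add: sum_ennreal)
        then show ?thesis using B0 ew_nonneg[of x] by (simp add: ennreal_mult sum_nonneg)
      qed
      also have "\<dots> \<le> ennreal B * (\<Sum>n. ennreal (norm (b n)) * ennreal (ew x * (P n x)\<^sup>2))"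
        by (intro mult_left_mono sum_le_suminf) auto
      finally show ?thesis .
    qed
    then show "\<exists>N. \<forall>n\<ge>N. ennreal (ew x * (norm (\<Sum>i<n. P i x *\<^sub>R b i))\<^sup>2) \<le> ennreal B * (\<Sum>n. ennreal (norm (b n)) * ennreal (ew x * (P n x)\<^sup>2))" by blast
  qed
  have "(\<integral>\<^sup>+x. ennreal (ew x * (norm (P_series b x))\<^sup>2) \<partial>hl) \<le> (\<integral>\<^sup>+x. ennreal B * (\<Sum>n. ennreal (norm (b n)) * ennreal (ew x * (P n x)\<^sup>2)) \<partial>hl)"
    by (rule nn_integral_mono) (rule pt)
  also have "\<dots> = ennreal B * (\<Sum>n. ennreal (norm (b n)) * (\<integral>\<^sup>+x. ennreal (ew x * (P n x)\<^sup>2) \<partial>hl))"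
    by (simp add: nn_integral_cmult nn_integral_suminf)
  also have "\<dots> \<le> ennreal B * (\<Sum>n. ennreal (norm (b n)) * 1)"
  proof (intro mult_left_mono suminf_le summableI)
    fix n
    have "(\<integral>\<^sup>+x. ennreal (ew x * (P n x)\<^sup>2) \<partial>hl) = ennreal (LINT x|hl. ew x * (P n x)\<^sup>2)"
      using P_norm_le_1(1)[of n] ew_nonneg by (intro nn_integral_eq_integral) auto
    also have "\<dots> \<le> 1" using P_norm_le_1(2)[of n] by simp
    finally show "(\<integral>\<^sup>+x. ennreal (ew x * (P n x)\<^sup>2) \<partial>hl) \<le> 1" .
  qed auto
  also have "\<dots> = ennreal (B\<^sup>2)"
    using sb B0 by (simp add: suminf_ennreal2 B_def[symmetric] ennreal_mult power2_eq_square)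
  finally have fin: "(\<integral>\<^sup>+x. ennreal (ew x * (norm (P_series b x))\<^sup>2) \<partial>hl) \<le> ennreal (B\<^sup>2)" .
  have i: "integrable hl (\<lambda>x. ew x * (norm (P_series b x))\<^sup>2)"
    by (rule integrableI_bounded) (use fin ew_nonneg in \<open>auto simp: abs_mult intro: le_less_trans\<close>)
  then show L: "P_series b \<in> L2 ew" by (simp add: L2_ew_iff)
  have "ennreal (LINT x|hl. ew x * (norm (P_series b x))\<^sup>2) \<le> ennreal (B\<^sup>2)"
    using fin i ew_nonneg by (subst (asm) nn_integral_eq_integral) auto
  then have "(LINT x|hl. ew x * (norm (P_series b x))\<^sup>2) \<le> B\<^sup>2" by (simp add: ennreal_le_iff)
  then show "L2_norm ew (P_series b) \<le> (\<Sum>n. norm (b n))"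
    unfolding L2_norm_ew[OF L2_measurable[OF L]] B_def[symmetric] using B0 by (intro real_le_lsqrt) auto
qed

lemma P_series_tail:
  assumes b: "geometric_decay b"
  shows "P_series b x - (\<Sum>n<N. P n x *\<^sub>R b n) = P_series (\<lambda>n. if n < N then 0 else b n) x"
    and "geometric_decay (\<lambda>n. if n < N then 0 else b n)"
    and "(\<lambda>N. \<Sum>n. norm (if n < N then 0 else b n)) \<longlonglongrightarrow> 0"
proof -
  show d: "geometric_decay (\<lambda>n. if n < N then 0 else b n)" by (rule geometric_decay_le[OF b]) simp
  have "(\<lambda>n. if n \<in> {..<N} then P n x *\<^sub>R b n else 0) sums (\<Sum>n<N. P n x *\<^sub>R b n)" by (rule sums_If_finite_set) simp
  from sums_diff[OF P_series_sums[OF b, of x] this]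
  have "(\<lambda>n. P n x *\<^sub>R (if n < N then 0 else b n)) sums (P_series b x - (\<Sum>n<N. P n x *\<^sub>R b n))"
    by (rule sums_cong[THEN iffD1, rotated]) auto
  then show "P_series b x - (\<Sum>n<N. P n x *\<^sub>R b n) = P_series (\<lambda>n. if n < N then 0 else b n) x"
    using P_series_sums[OF d] by (rule sums_unique2)
  note sb = geometric_decay_summable[OF b]
  have e: "(\<Sum>n. norm (if n < N then 0 else b n)) = (\<Sum>n. norm (b n)) - (\<Sum>n<N. norm (b n))" for N
  proof -
    have "(\<lambda>n. if n \<in> {..<N} then norm (b n) else 0) sums (\<Sum>n<N. norm (b n))" by (rule sums_If_finite_set) simp
    from sums_diff[OF summable_sums[OF sb] this]
    have "(\<lambda>n. norm (if n < N then 0 else b n)) sums ((\<Sum>n. norm (b n)) - (\<Sum>n<N. norm (b n)))"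
      by (rule sums_cong[THEN iffD1, rotated]) auto
    then show ?thesis by (simp add: sums_iff)
  qed
  have "(\<lambda>N. (\<Sum>n. norm (b n)) - (\<Sum>n<N. norm (b n))) \<longlonglongrightarrow> (\<Sum>n. norm (b n)) - (\<Sum>n. norm (b n))"
    by (intro tendsto_diff tendsto_const summable_LIMSEQ[OF sb])
  then show "(\<lambda>N. \<Sum>n. norm (if n < N then 0 else b n)) \<longlonglongrightarrow> 0" by (simp add: e)
qed

text \<open>
  By biorthogonality the \<open>m\<close>-th coefficient of a partial sum is \<open>b m\<close>, and the coefficient functional
  is continuous on the weighted space.
\<close>

lemma coeff_P_series:
  fixes b :: "nat \<Rightarrow> real"
  assumes b: "geometric_decay b"
  shows "coeff (P_series b) m = b m"
proof -
  let ?F = "P_series b" and ?T = "\<lambda>N. P_series (\<lambda>n. if n < N then 0 else b n)"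
  define \<tau> where "\<tau> = T_crit \<alpha> + 1"
  obtain C where C: "C \<ge> 0" "\<And>f. f \<in> L2 ew \<Longrightarrow> integrable hl (\<lambda>y. W m y * f y) \<and> \<bar>coeff f m\<bar> \<le> C * exp (\<tau> * real m) * L2_norm ew f"
    using coeff_L2_bound[of \<tau>, where 'b=real] by (fastforce simp: \<tau>_def)
  have eq: "coeff ?F m - b m = coeff (?T N) m" if N: "m < N" for N
  proof -
    have "coeff (?T N) m = (LINT y|hl. W m y * ?F y - (\<Sum>n<N. b n * (W m y * P n y)))"
      unfolding coeff_def P_series_tail(1)[OF b, symmetric] by (simp add: right_diff_distrib sum_distrib_left mult_ac)
    also have "\<dots> = coeff ?F m - (\<Sum>n<N. b n * (LINT y|hl. W m y * P n y))"
      using C(2)[OF P_series_L2(1)[OF b]] W_P_integrable[of m]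
      by (subst Bochner_Integration.integral_diff) (auto simp: coeff_def)
    also have "(\<Sum>n<N. b n * (LINT y|hl. W m y * P n y)) = b m"
      using N by (simp add: P_W_biorthogonal if_distrib[of "\<lambda>x. _ * x"] cong: if_cong)
    finally show ?thesis by simp
  qed
  have lim: "(\<lambda>N. C * exp (\<tau> * real m) * (\<Sum>n. norm (if n < N then 0 else b n))) \<longlonglongrightarrow> C * exp (\<tau> * real m) * 0"
    by (intro tendsto_mult tendsto_const P_series_tail(3)[OF b])
  have "\<bar>coeff ?F m - b m\<bar> \<le> C * exp (\<tau> * real m) * 0"
  proof (rule tendsto_lowerbound[OF lim])
    show "\<forall>\<^sub>F N in sequentially. \<bar>coeff ?F m - b m\<bar> \<le> C * exp (\<tau> * real m) * (\<Sum>n. norm (if n < N then 0 else b n))"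
      using eventually_gt_at_top[of m]
    proof eventually_elim
      case (elim N)
      have "\<bar>coeff (?T N) m\<bar> \<le> C * exp (\<tau> * real m) * L2_norm ew (?T N)" using C(2)[OF P_series_L2(1)[OF P_series_tail(2)[OF b]]] by blast
      also have "\<dots> \<le> C * exp (\<tau> * real m) * (\<Sum>n. norm (if n < N then 0 else b n))"
        using C(1) by (intro mult_left_mono P_series_L2(2)[OF P_series_tail(2)[OF b]]) auto
      finally show ?case by (simp only: eq[OF elim])
    qed
  qed simp
  then show ?thesis by simp
qed

lemma P_series_tendsto:
  fixes b :: "nat \<Rightarrow> real"
  assumes b: "geometric_decay b" and g: "g \<in> L2 ew" and eq: "AE x in hl. g x = P_series b x"
  shows "L2_tendsto ew (\<lambda>N x. \<Sum>n\<le>N. b n * P n x) g sequentially"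
  unfolding L2_tendsto_def
proof (intro conjI)
  show "\<forall>\<^sub>F N in sequentially. (\<lambda>x. \<Sum>n\<le>N. b n * P n x) \<in> L2 ew"
    by (intro always_eventually allI L2_sum L2_cmult P_L2) auto
  have "L2_norm ew (\<lambda>x. (\<Sum>n\<le>N. b n * P n x) - g x) \<le> (\<Sum>n. norm (if n < Suc N then 0 else b n))" for N
  proof -
    have "L2_norm ew (\<lambda>x. (\<Sum>n\<le>N. b n * P n x) - g x) = L2_norm ew (\<lambda>x. (-1) * P_series (\<lambda>n. if n < Suc N then 0 else b n) x)"
    proof (rule L2_norm_cong_AE)
      show "AE x in hl. (\<Sum>n\<le>N. b n * P n x) - g x = (-1) * P_series (\<lambda>n. if n < Suc N then 0 else b n) x"
        using eq
      proof eventually_elim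
        case (elim x)
        show ?case unfolding P_series_tail(1)[OF b, symmetric] elim by (simp add: lessThan_Suc_atMost mult.commute del: sum.lessThan_Suc)
      qed
    qed (use L2_measurable[OF g] in measurable)
    also have "\<dots> = L2_norm ew (P_series (\<lambda>n. if n < Suc N then 0 else b n))"
      by (subst L2_norm_cmult[OF P_series_L2(1)[OF P_series_tail(2)[OF b]]]) simp
    also have "\<dots> \<le> (\<Sum>n. norm (if n < Suc N then 0 else b n))" by (rule P_series_L2(2)[OF P_series_tail(2)[OF b]])
    finally show ?thesis .
  qed
  then show "(\<lambda>N. L2_norm ew (\<lambda>x. (\<Sum>n\<le>N. b n * P n x) - g x)) \<longlonglongrightarrow> 0"
    by (intro tendsto_sandwich[OF _ _ tendsto_const LIMSEQ_Suc[OF P_series_tail(3)[OF b]]])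
       (auto simp: L2_norm_nonneg)
qed (rule g)

end

locale gauss_laguerre = gauss_laguerre_kernel + lambda_density
begin

lemma K_ident_measurable: "t \<ge> 0 \<Longrightarrow> x \<ge> 0 \<Longrightarrow> (\<lambda>y. y) \<in> K t x \<rightarrow>\<^sub>M (borel :: real measure)"
  by (subst measurable_cong_sets[OF K_sets refl]) (auto intro: measurable_restrict_space1)

lemma kernel_integral_hl:
  fixes f :: "real \<Rightarrow> real"
  assumes t: "t \<ge> 0" and x: "x \<ge> 0"
    and N: "distr (K t x) borel (\<lambda>y. y) = density lborel (\<lambda>y. ennreal (indicator {0<..} y * p y))"
    and nn: "AE y in lborel. 0 \<le> indicator {0<..} y * p y"
    and p: "p \<in> borel_measurable hl" and f: "f \<in> borel_measurable hl" and i: "integrable hl (\<lambda>y. p y * f y)"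
  shows "integrable (K t x) f" and "sg K t f x = (LINT y|hl. p y * f y)"
proof -
  let ?N = "distr (K t x) borel (\<lambda>y. y)"
  note idm[measurable] = K_ident_measurable[OF t x]
  define f' where "f' = (\<lambda>y. indicator {0<..} y * f y)"
  have [measurable]: "f' \<in> borel_measurable borel" and pm[measurable]: "(\<lambda>y. indicator {0<..} y * p y) \<in> borel_measurable borel"
    using f p by (auto simp: f'_def borel_measurable_hl_iff)
  have fK[measurable]: "f \<in> borel_measurable (K t x)"
    using hl_measurable_half_line[OF f] by (simp add: measurable_cong_sets[OF K_sets[OF t x] refl])
  have e: "indicator {0<..} y * p y * f' y = indicator {0<..} y *\<^sub>R (p y * f y)" for y
    by (auto simp: f'_def indicator_def)
  have iN: "integrable ?N f'" unfolding N
    using i integrable_restrict_space[of "{0<..}" lborel "\<lambda>y. p y * f y"]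
    by (subst integrable_real_density[OF _ nn]) (auto simp only: e, auto)
  have lN: "(LINT y|?N. f' y) = (LINT y|hl. p y * f y)" unfolding N
    using integral_restrict_space[of "{0<..}" lborel "\<lambda>y. p y * f y"]
    by (subst integral_real_density[OF _ nn]) (auto simp only: e, auto)
  have "AE y in ?N. y > 0" unfolding N
  proof (subst AE_density)
    show "(\<lambda>y. ennreal (indicator {0<..} y * p y)) \<in> borel_measurable lborel"
      by (rule measurable_compose[OF _ measurable_ennreal]) (use pm in simp)
  qed (auto simp: indicator_def)
  then have "AE y in K t x. y > 0" by (subst (asm) AE_distr_iff) auto
  then have ae: "AE y in K t x. f' y = f y" by eventually_elim (simp add: f'_def)
  have f'K: "f' \<in> borel_measurable (K t x)" using measurable_compose[OF idm, of f' borel] by simp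
  have iK: "integrable (K t x) f'" using iN by (subst (asm) integrable_distr_eq) auto
  show "integrable (K t x) f" using iK by (rule integrable_cong_AE[THEN iffD1, OF f'K fK ae])
  have "sg K t f x = (LINT y|K t x. f' y)" unfolding sg_def by (rule integral_cong_AE[OF fK f'K]) (use ae in auto)
  also have "\<dots> = (LINT y|?N. f' y)" by (subst integral_distr) auto
  finally show "sg K t f x = (LINT y|hl. p y * f y)" by (simp add: lN)
qed

text \<open>
  The kernel \<open>K t x\<close> and the signed density \<open>\<Sum>n. exp(- n t) P\<^sub>n(x) W\<^sub>n\<close> give each \<open>P\<^sub>n\<close> the same
  integral, the one by the eigenvalue equation, the other by biorthogonality. Hence their moments
  agree; as both have exponential moments, the kernel has that density. The exceptional set of \<open>x\<close>
  comes from countably many functions, so it does not depend on \<open>f\<close>.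
\<close>

lemma sg_large_t:
  assumes t: "t > T_crit \<alpha>" and t0: "t \<ge> 0"
  shows "AE x in hl. \<forall>f\<in>L2 ew. (\<lambda>n. exp (- real n * t) * coeff f n * P n x) sums sg K t (f :: real \<Rightarrow> real) x"
proof -
  obtain r where r: "0 < r" "r < 1" "exp (- t) < rate r" using rate_exceeds[OF _ exp_T_crit[OF \<alpha>_pos t]] by auto
  have A1: "AE x in hl. integrable (K t x) (\<lambda>y. exp (\<bar>y\<bar> / 8))" by (rule sg_integrable[OF exp_in_L2 t0])
  have A2: "AE x in hl. \<forall>n. integrable (K t x) (P n)" using sg_integrable[OF P_L2 t0] by (simp add: AE_all_countable)
  have A3: "AE x in hl. \<forall>n. sg K t (P n) x = exp (- real n * t) * P n x" using sg_P[OF t0] by (simp add: AE_all_countable)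
  have A4: "AE x in hl. x > 0" by (rule AE_hl_I)
  show ?thesis using A1 A2 A3 A4
  proof eventually_elim
    case (elim x)
    then have x: "x \<ge> 0" by simp
    define c where "c = (\<lambda>n. exp (- real n * t) * P n x)"
    have c: "summable (\<lambda>n. \<bar>c n\<bar> / rate r ^ n)"
    proof -
      have "summable (\<lambda>n. (exp (- t) / rate r) ^ n * \<bar>P n x\<bar>)"
        using r rate[OF r(1,2)] by (intro P_geometric_summable) auto
      moreover have "(exp (- t) / rate r) ^ n * \<bar>P n x\<bar> = \<bar>c n\<bar> / rate r ^ n" for n
        by (simp add: c_def abs_mult power_divide exp_of_nat_mult[symmetric])
      ultimately show ?thesis by simp
    qed
    define p where "p = W_series c"
    have pm[measurable]: "p \<in> borel_measurable hl" by (simp add: p_def)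
    have iL2: "integrable hl (\<lambda>y. majorant r y * norm (f y))" if "f \<in> L2 ew" for f :: "real \<Rightarrow> real"
      using majorant_L2[OF r(1,2), where 'b=real] that by blast
    note WS = W_series_integral[OF r(1,2) c L2_measurable iL2, folded p_def]
    let ?N = "distr (K t x) borel (\<lambda>y. y)" and ?h = "\<lambda>y. indicator {0<..} y * p y"
    note idm[measurable] = K_ident_measurable[OF t0 x]
    have hm[measurable]: "?h \<in> borel_measurable borel" using pm by (simp add: borel_measurable_hl_iff)
    have N: "prob_space ?N" using K_prob[OF t0 x] by (rule prob_space.prob_space_distr) simp
    have iN: "integrable ?N (\<lambda>y. exp (1/8 * \<bar>y\<bar>))" using elim(1) by (subst integrable_distr_eq) auto
    have lb: "integrable lborel (\<lambda>y. f y * ?h y) \<longleftrightarrow> integrable hl (\<lambda>y. p y * f y)"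
      "(LINT y|lborel. f y * ?h y) = (LINT y|hl. p y * f y)" for f :: "real \<Rightarrow> real"
      using integrable_restrict_space[of "{0<..}" lborel "\<lambda>y. p y * f y"] integral_restrict_space[of "{0<..}" lborel "\<lambda>y. p y * f y"]
      by (simp_all add: mult_ac)
    have ih: "integrable lborel (\<lambda>y. exp (1/8 * \<bar>y\<bar>) * ?h y)"
      unfolding lb using WS(1)[OF exp_in_L2] exp_in_L2 by simp
    have iNk: "integrable ?N (\<lambda>y. y ^ k)" for k
    proof -
      have "integrable ?N (\<lambda>y. exp (0 * \<bar>y\<bar>) * \<bar>y\<bar> ^ k * \<bar>1\<bar>)"
        by (rule exp_moment_absorb[where V="\<lambda>y. y" and e="1/8"]) (use iN in auto)
      then show ?thesis by (rule Bochner_Integration.integrable_bound) (auto simp: power_abs)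
    qed
    have ipk: "integrable hl (\<lambda>y. p y * y ^ k)" for k using WS(1)[OF power_in_L2 power_in_L2] by simp
    let ?a = "\<lambda>n k. (-1) ^ k * real (n choose k) / moment k"
    have mom: "(LINT y|?N. y ^ k) = (LINT y|lborel. y ^ k * ?h y)" for k
    proof (rule triangular_system_unique[where a="?a"])
      fix n
      have "(\<Sum>k\<le>n. ?a n k * (LINT y|?N. y ^ k)) = (LINT y|?N. P n y)"
        unfolding P_eq using iNk by (subst Bochner_Integration.integral_sum) auto
      also have "\<dots> = sg K t (P n) x" unfolding sg_def by (subst integral_distr) auto
      also have "\<dots> = c n" using elim(3) by (simp add: c_def)
      also have "\<dots> = (LINT y|hl. p y * P n y)"
      proof -
        have "(\<lambda>m. c m * (LINT y|hl. W m y * P n y)) sums (LINT y|hl. p y * P n y)"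
          using WS(2)[OF P_L2 P_L2] by simp
        moreover have "(\<lambda>m. c m * (LINT y|hl. W m y * P n y)) sums c n"
          using sums_single[of n c] by (simp add: P_W_biorthogonal if_distrib[of "\<lambda>x. _ * x"] eq_commute cong: if_cong)
        ultimately show ?thesis by (rule sums_unique2[symmetric])
      qed
      also have "\<dots> = (LINT y|hl. (\<Sum>k\<le>n. ?a n k * (p y * y ^ k)))" by (simp add: P_eq sum_distrib_left mult_ac)
      also have "\<dots> = (\<Sum>k\<le>n. ?a n k * (LINT y|lborel. y ^ k * ?h y))"
        unfolding lb using ipk by (subst Bochner_Integration.integral_sum) auto
      finally show "(\<Sum>k\<le>n. ?a n k * (LINT y|?N. y ^ k)) = (\<Sum>k\<le>n. ?a n k * (LINT y|lborel. y ^ k * ?h y))" .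
      show "?a n n \<noteq> 0" using moment_pos[of n] by simp
    qed
    note det = moments_determine_density[OF N _ hm _ iN ih mom, simplified]
    show ?case
    proof
      fix f :: "real \<Rightarrow> real" assume f: "f \<in> L2 ew"
      have "sg K t f x = (LINT y|hl. p y * f y)"
        using det WS(1)[OF f f] L2_measurable[OF f] by (intro kernel_integral_hl t0 x) auto
      moreover have "(\<lambda>n. c n * coeff f n) sums (LINT y|hl. p y * f y)" using WS(2)[OF f f] by (simp add: coeff_def)
      ultimately show "(\<lambda>n. exp (- real n * t) * coeff f n * P n x) sums sg K t f x" by (simp add: c_def mult_ac)
    qed
  qed
qed

lemma coeff_bound_real:
  fixes f :: "real \<Rightarrow> real"
  assumes "f \<in> L2 ew" "\<tau> > T_crit \<alpha>"
  shows "\<exists>C. \<forall>n. norm (coeff f n) \<le> C * exp (\<tau> * real n)" and "integrable hl (\<lambda>y. W n y * f y)"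
proof -
  obtain C where C: "\<forall>n. \<forall>f\<in>L2 ew. integrable hl (\<lambda>y. W n y *\<^sub>R (f y :: real)) \<and>
           norm (coeff f n) \<le> C * exp (\<tau> * real n) * L2_norm ew f"
    using coeff_L2_bound[OF assms(2), where 'b=real] by blast
  then have "norm (coeff f n) \<le> C * L2_norm ew f * exp (\<tau> * real n)" for n using assms(1) by (simp add: mult_ac)
  then show "\<exists>C. \<forall>n. norm (coeff f n) \<le> C * exp (\<tau> * real n)" by blast
  show "integrable hl (\<lambda>y. W n y * f y)" using C assms(1) by auto
qed

lemma T_crit_nonneg: "T_crit \<alpha> \<ge> 0"
proof -
  have "1 < 2 powr \<alpha>" using \<alpha>_pos by (intro gr_one_powr) auto
  moreover have "2 powr \<alpha> \<le> 2 powr 1" using \<alpha>_le_1 by (intro powr_mono) auto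
  ultimately have "ln (2 powr \<alpha> - 1) \<le> 0" by (subst ln_le_zero_iff) auto
  then show ?thesis by (simp add: T_crit_def)
qed

text \<open>
  For \<open>t\<close> beyond the critical time both \<open>P\<^bsub>t+s\<^esub> f\<close> and \<open>P\<^sub>t (P\<^sub>s f)\<close> can be expanded; the
  coefficients of the two expansions agree.
\<close>

lemma coeff_sg:
  fixes f :: "real \<Rightarrow> real"
  assumes f: "f \<in> L2 ew" and s: "s \<ge> 0"
  shows "coeff (sg K s f) m = exp (- real m * s) * coeff f m"
proof -
  define t where "t = T_crit \<alpha> + 1"
  have t: "t > T_crit \<alpha>" "t \<ge> 0" "t + s > T_crit \<alpha>" "t + s \<ge> 0" using s T_crit_nonneg by (auto simp: t_def)
  note g = sg_L2[OF f s]
  define \<tau> where "\<tau> = T_crit \<alpha> + 1/2"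
  have \<tau>: "\<tau> > T_crit \<alpha>" "\<tau> < t" "\<tau> < t + s" using s by (auto simp: \<tau>_def t_def)
  define b where "b = (\<lambda>n. exp (- real n * (t + s)) * coeff f n - exp (- real n * t) * coeff (sg K s f) n)"
  have b: "geometric_decay b"
  proof -
    obtain C C' where "\<And>n. norm (coeff f n) \<le> C * exp (\<tau> * real n)" "\<And>n. norm (coeff (sg K s f) n) \<le> C' * exp (\<tau> * real n)"
      using coeff_bound_real(1)[OF f \<tau>(1)] coeff_bound_real(1)[OF g \<tau>(1)] by blast
    from geometric_decay_diff[OF geometric_decay_exp[OF this(1) \<tau>(3)] geometric_decay_exp[OF this(2) \<tau>(2)]]
    show ?thesis by (simp add: b_def)
  qed
  have "AE x in hl. P_series b x = 0"
    using sg_large_t[OF t(3,4)] sg_large_t[OF t(1,2)] sg_semigroup[OF f t(2) s]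
  proof eventually_elim
    case (elim x)
    have e: "(\<lambda>n. exp (- real n * (t + s)) * coeff f n * P n x - exp (- real n * t) * coeff (sg K s f) n * P n x) = (\<lambda>n. P n x *\<^sub>R b n)"
      by (simp add: b_def fun_eq_iff left_diff_distrib right_diff_distrib mult_ac)
    from sums_diff[OF bspec[OF elim(1) f] bspec[OF elim(2) g]]
    have "(\<lambda>n. P n x *\<^sub>R b n) sums 0" by (simp only: e elim(3) diff_self)
    then show ?case using P_series_sums[OF b] sums_unique2 by blast
  qed
  then have "AE x in hl. W m x *\<^sub>R P_series b x = 0" by eventually_elim simp
  then have "coeff (P_series b) m = 0" unfolding coeff_def by (rule integral_eq_zero_AE)
  then have "exp (- real m * (t + s)) * coeff f m = exp (- real m * t) * coeff (sg K s f) m"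
    using coeff_P_series[OF b] by (simp add: b_def)
  moreover have "exp (- real m * (t + s)) = exp (- real m * t) * exp (- real m * s)" by (simp add: algebra_simps flip: exp_add)
  ultimately show ?thesis by simp
qed

text \<open>
  Both sides have the same coefficients, and the co-eigenfunctions are complete.
\<close>

lemma sg_expansion:
  fixes f :: "real \<Rightarrow> real"
  assumes f: "f \<in> L2 ew" and s: "s \<ge> 0" and d: "geometric_decay (\<lambda>n. exp (- real n * s) * coeff f n)"
  shows "AE x in hl. sg K s f x = P_series (\<lambda>n. exp (- real n * s) * coeff f n) x"
proof -
  let ?S = "P_series (\<lambda>n. exp (- real n * s) * coeff f n)"
  note g = sg_L2[OF f s] and S = P_series_L2(1)[OF d]
  have "T_crit \<alpha> + 1 > T_crit \<alpha>" by simp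
  note cb = coeff_bound_real(2)[OF _ this]
  have "coeff (\<lambda>x. F x - G x) n = coeff F n - coeff G n" if "F \<in> L2 ew" "G \<in> L2 ew" for n F and G :: "real \<Rightarrow> real"
    unfolding coeff_def using cb[OF that(1), of n] cb[OF that(2), of n]
    by (simp add: right_diff_distrib)
  from this[OF g S] have "coeff (\<lambda>x. sg K s f x - ?S x) n = coeff (sg K s f) n - coeff ?S n" for n .
  then have "coeff (\<lambda>x. sg K s f x - ?S x) n = 0" for n
    by (simp only: coeff_sg[OF f s] coeff_P_series[OF d] diff_self)
  from coeff_complete[OF L2_diff[OF g S] this] show ?thesis by eventually_elim simp
qed

section \<open>Growth of the coefficients\<close>

text \<open>
  The growth of the coefficients under which the expansion holds at all times \<open>t > T\<close>.
\<close>

definition admissible :: "(real \<Rightarrow> real) \<Rightarrow> real \<Rightarrow> bool" where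
  "admissible f T \<longleftrightarrow> T \<ge> 0 \<and> f \<in> L2 ew \<and> (\<forall>\<tau>>T. \<exists>C. \<forall>n. \<bar>coeff f n\<bar> \<le> C * exp (\<tau> * real n))"

lemma admissible_L2: "f \<in> L2 ew \<Longrightarrow> admissible f (T_crit \<alpha>)"
  using coeff_bound_real(1)[of f] T_crit_nonneg by (simp add: admissible_def)

lemma admissible_Ran_Lambda:
  assumes "f \<in> Ran_Lambda \<alpha> \<beta> lam"
  shows "admissible f 0"
proof -
  obtain g where f: "f \<in> L2 ew" and g: "g \<in> L2 e_lag" and fg: "AE x in hl. f x = Lambda_op lam g x"
    using assms by (auto simp: Ran_Lambda_def AE_ew)
  have b: "\<bar>coeff f n\<bar> \<le> L2_norm e_lag g" for n
    using Lambda_coefficient_bounded[OF g f fg, of n] by (simp add: coeff_def)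
  have "\<bar>coeff f n\<bar> \<le> L2_norm e_lag g * exp (\<tau> * real n)" if "\<tau> > 0" for \<tau> n
  proof -
    have "L2_norm e_lag g * 1 \<le> L2_norm e_lag g * exp (\<tau> * real n)" using that by (intro mult_left_mono) (auto simp: L2_norm_def)
    then show ?thesis using b[of n] by linarith
  qed
  then show ?thesis using f by (auto simp: admissible_def)
qed

lemma superlinear_bound:
  fixes A \<eta> p q :: real
  assumes "0 < p" "p < q" "\<eta> > 0" "A \<ge> 0"
  shows "\<exists>B. \<forall>y>0. A * y powr p - \<eta> * y powr q \<le> B"
proof -
  define Y where "Y = (A / \<eta>) powr (1 / (q - p))"
  have "A * y powr p - \<eta> * y powr q \<le> A * Y powr p" if y: "y > 0" for y
  proof (cases "y \<le> Y")
    case True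
    then have "A * y powr p \<le> A * Y powr p" using y assms by (intro mult_left_mono powr_mono2) auto
    moreover have "\<eta> * y powr q \<ge> 0" using assms by simp
    ultimately show ?thesis by linarith
  next
    case False
    then have "Y powr (q - p) \<le> y powr (q - p)" using assms by (intro powr_mono2) (auto simp: Y_def)
    moreover have "Y powr (q - p) = A / \<eta>" using assms by (simp add: Y_def powr_powr)
    ultimately have "A \<le> \<eta> * y powr (q - p)" using assms by (simp add: field_simps)
    then have "A * y powr p \<le> \<eta> * y powr (q - p) * y powr p" by (intro mult_right_mono) auto
    also have "\<dots> = \<eta> * y powr q" by (simp add: mult.assoc flip: powr_add)
    finally have "A * y powr p - \<eta> * y powr q \<le> 0" by simp
    also have "0 \<le> A * Y powr p" using assms by simp
    finally show ?thesis .
  qed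
  then show ?thesis by blast
qed

text \<open>
  Since \<open>1/\<gamma> > 1/\<alpha>\<close>, the heavy weight makes \<open>f\<close> decay faster than \<open>exp(- A y\<^bsup>1/\<alpha>\<^esup>)\<close> for each \<open>A\<close>, in
  the mean-square sense. This outweighs the growth in \<open>y\<close> of the bound of \<open>W\<^sub>n\<close> that holds with
  the rate \<open>r\<^bsup>-n\<^esup>\<close> for every \<open>r < 1\<close>.
\<close>

lemma admissible_e_bar:
  assumes \<gamma>: "0 < \<gamma>" "\<gamma> < \<alpha>" and \<eta>: "\<eta> > 0" and f: "f \<in> L2 (e_bar \<eta> \<gamma> \<beta> \<alpha>)"
  shows "admissible f 0"
proof -
  let ?w = "e_bar \<eta> \<gamma> \<beta> \<alpha>"
  have wm[measurable]: "?w \<in> borel_measurable borel" unfolding e_bar_def[abs_def] by measurable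
  have wn: "?w x \<ge> 0" for x by (simp add: e_bar_def)
  have fm[measurable]: "f \<in> borel_measurable hl" and fi: "integrable hl (\<lambda>x. ?w x * (norm (f x))\<^sup>2)"
    using f by (auto simp: L2_iff[OF wm wn])
  have "integrable hl (\<lambda>x. ew x * (norm (f x))\<^sup>2)"
  proof (rule Bochner_Integration.integrable_bound)
    show "integrable hl (\<lambda>x. inverse c\<^sub>0 * (?w x * (norm (f x))\<^sup>2))" using fi by simp
    have "ew x \<le> inverse c\<^sub>0 * ?w x" for x
    proof -
      have "exp (- (x powr (1/\<alpha>))) \<le> 1" by simp
      also have "1 \<le> exp (\<eta> * x powr (1/\<gamma>))" using \<eta> by simp
      finally have "x powr \<delta> * exp (- (x powr (1/\<alpha>))) \<le> x powr \<delta> * exp (\<eta> * x powr (1/\<gamma>))" by (rule mult_left_mono) simp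
      then have "x powr \<delta> * exp (- (x powr (1/\<alpha>))) / c\<^sub>0 \<le> x powr \<delta> * exp (\<eta> * x powr (1/\<gamma>)) / c\<^sub>0"
        using c\<^sub>0_pos by (intro divide_right_mono) auto
      then show ?thesis unfolding e_w_def e_bar_def by (simp add: divide_inverse mult_ac)
    qed
    then have le: "ew x * (norm (f x))\<^sup>2 \<le> inverse c\<^sub>0 * ?w x * (norm (f x))\<^sup>2" for x by (rule mult_right_mono) simp
    show "AE x in hl. norm (ew x * (norm (f x))\<^sup>2) \<le> norm (inverse c\<^sub>0 * (?w x * (norm (f x))\<^sup>2))"
    proof (rule AE_I2)
      fix x
      have "0 \<le> ew x * (norm (f x))\<^sup>2" using ew_nonneg by simp
      then show "norm (ew x * (norm (f x))\<^sup>2) \<le> norm (inverse c\<^sub>0 * (?w x * (norm (f x))\<^sup>2))"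
        using le[of x] unfolding real_norm_def mult.assoc by linarith
    qed
  qed measurable
  then have fL2: "f \<in> L2 ew" by (simp add: L2_ew_iff)
  have "\<exists>C. \<forall>n. \<bar>coeff f n\<bar> \<le> C * exp (\<tau> * real n)" if \<tau>: "\<tau> > 0" for \<tau>
  proof -
    define r where "r = exp (- \<tau>)"
    have r: "0 < r" "r < 1" using \<tau> by (auto simp: r_def)
    let ?M = "cW_majorant r"
    have Mm[measurable]: "?M \<in> borel_measurable borel" unfolding cW_majorant_def[abs_def] by measurable
    (* The first summand is the growth of the squared majorant; the second
       leaves a factor exp (- y powr (1/\<alpha>)), which is integrable. *)
    define A where "A = 2 * (1 / (1 - r)) powr (1/\<alpha>) + 1"
    have A: "A \<ge> 0" by (simp add: A_def)
    obtain B where B: "\<And>y. y > 0 \<Longrightarrow> A * y powr (1/\<alpha>) - \<eta> * y powr (1/\<gamma>) \<le> B"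
      using superlinear_bound[of "1/\<alpha>" "1/\<gamma>" \<eta> A] \<gamma> \<eta> A \<alpha>_pos by (auto simp: frac_less2)
    let ?K = "((1 / (1 - r)) powr \<delta> / (c\<^sub>0 * (1 - r)))\<^sup>2"
    have sq: "(?M y)\<^sup>2 / ?w y \<le> ?K * exp B * (y powr \<delta> * exp (- (1 * y powr (1/\<alpha>))))" if y: "y > 0" for y
    proof -
      let ?u = "y powr (1/\<alpha>)"
      have r1: "y / (1 - r) = (1 / (1 - r)) * y" by simp
      have d: "(y / (1 - r)) powr a = (1 / (1 - r)) powr a * y powr a" for a
        unfolding r1 by (rule powr_mult)
      have "(?M y)\<^sup>2 / ?w y = ?K * (y powr \<delta> * (exp (2 * ((1 / (1 - r)) powr (1/\<alpha>) * ?u)) / exp (\<eta> * y powr (1/\<gamma>))))"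
      proof -
        have gen: "(a * Y * E / c)\<^sup>2 / (Y * G) = (a / c)\<^sup>2 * (Y * (E\<^sup>2 / G))" if "Y \<noteq> 0" for a Y E c G :: real
          using that by (simp add: power2_eq_square mult_ac)
        have "(exp z)\<^sup>2 = exp (2 * z)" for z :: real by (simp add: power2_eq_square flip: exp_add)
        then show ?thesis using y unfolding cW_majorant_def e_bar_def d by (subst gen) auto
      qed
      also have "exp (2 * ((1 / (1 - r)) powr (1/\<alpha>) * ?u)) / exp (\<eta> * y powr (1/\<gamma>)) = exp (A * ?u - \<eta> * y powr (1/\<gamma>)) * exp (- ?u)"
        by (simp add: A_def algebra_simps flip: exp_add exp_diff)
      also have "?K * (y powr \<delta> * (exp (A * ?u - \<eta> * y powr (1/\<gamma>)) * exp (- ?u))) \<le> ?K * (y powr \<delta> * (exp B * exp (- ?u)))"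
        using B[OF y] by (intro mult_left_mono mult_right_mono) auto
      finally show ?thesis by (simp add: mult_ac)
    qed
    have iM: "integrable hl (\<lambda>y. (?M y)\<^sup>2 / ?w y)"
    proof (rule Bochner_Integration.integrable_bound)
      show "integrable hl (\<lambda>y. ?K * exp B * (y powr \<delta> * exp (- (1 * y powr (1/\<alpha>)))))"
        by (rule integrable_mult_right, rule powr_exp_hl(1)[OF \<alpha>_pos]) (use \<delta>_nonneg in auto)
      show "AE y in hl. norm ((?M y)\<^sup>2 / ?w y) \<le> norm (?K * exp B * (y powr \<delta> * exp (- (1 * y powr (1/\<alpha>)))))"
      proof (rule AE_hl_I)
        fix y :: real assume y: "y > 0"
        have "0 \<le> (?M y)\<^sup>2 / ?w y" using wn by simp
        then show "norm ((?M y)\<^sup>2 / ?w y) \<le> norm (?K * exp B * (y powr \<delta> * exp (- (1 * y powr (1/\<alpha>)))))"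
          using sq[OF y] unfolding real_norm_def by linarith
      qed
    qed measurable
    let ?F = "\<lambda>y. ?M y / sqrt (?w y)" and ?G = "\<lambda>y. sqrt (?w y) * norm (f y)"
    have F2: "(?F y)\<^sup>2 = (?M y)\<^sup>2 / ?w y" and G2: "(?G y)\<^sup>2 = ?w y * (norm (f y))\<^sup>2" for y
      using wn[of y] by (auto simp: power_divide power_mult_distrib)
    have "integrable hl (\<lambda>y. ?F y * ?G y)"
      by (rule cauchy_schwarz_integral(1)) (unfold F2 G2, use iM fi in measurable)
    moreover have FG: "?F y * ?G y = ?M y * norm (f y)" if "y > 0" for y
    proof -
      have "?w y > 0" using that by (simp add: e_bar_def)
      then show ?thesis by simp
    qed
    ultimately have iMf: "integrable hl (\<lambda>y. ?M y * norm (f y))" by (simp only: hl_integrable_cong[OF FG])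
    have "\<bar>coeff f n\<bar> \<le> (LINT y|hl. ?M y * norm (f y)) * exp (\<tau> * real n)" for n
    proof -
      have le: "norm (W n y *\<^sub>R f y) \<le> ?M y * norm (f y) * exp (\<tau> * real n)" if "y > 0" for y
      proof -
        have "\<bar>W n y\<bar> \<le> ?M y / r ^ n" by (rule W_bound[OF r that])
        also have "\<dots> = ?M y * exp (\<tau> * real n)"
          by (simp add: r_def exp_minus divide_inverse power_inverse exp_of_nat_mult[symmetric] mult.commute[of \<tau>])
        finally have "\<bar>W n y\<bar> * \<bar>f y\<bar> \<le> ?M y * exp (\<tau> * real n) * \<bar>f y\<bar>" by (rule mult_right_mono) simp
        then show ?thesis by (simp add: abs_mult mult_ac)
      qed
      have i2: "integrable hl (\<lambda>y. ?M y * norm (f y) * exp (\<tau> * real n))" using iMf by simp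
      have "\<bar>coeff f n\<bar> \<le> (LINT y|hl. norm (W n y *\<^sub>R f y))" unfolding coeff_def real_norm_def[symmetric] by (rule integral_norm_bound)
      also have "\<dots> \<le> (LINT y|hl. ?M y * norm (f y) * exp (\<tau> * real n))"
        by (rule integral_mono_AE'[OF i2]) (use le order_trans[OF norm_ge_zero le] in \<open>auto intro!: AE_hl_I\<close>)
      finally show ?thesis by simp
    qed
    then show ?thesis by blast
  qed
  then show ?thesis using fL2 by (simp add: admissible_def)
qed

lemma admissible_decay:
  assumes "admissible f T" "t > T"
  shows "geometric_decay (\<lambda>n. exp (- real n * t) * coeff f n)"
proof -
  define \<tau> where "\<tau> = (T + t) / 2"
  have \<tau>: "\<tau> > T" "\<tau> < t" using assms(2) by (auto simp: \<tau>_def)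
  obtain C where "\<And>n. norm (coeff f n) \<le> C * exp (\<tau> * real n)"
    using assms(1) \<tau>(1) unfolding admissible_def real_norm_def by blast
  from geometric_decay_exp[OF this \<tau>(2)] show ?thesis by simp
qed

lemma admissible_expansion:
  assumes f: "admissible f T" and t: "t > T"
  shows "AE x in hl. sg K t f x = P_series (\<lambda>n. exp (- real n * t) * coeff f n) x"
    and "L2_tendsto ew (\<lambda>N x. \<Sum>n\<le>N. exp (- real n * t) * coeff f n * P n x) (sg K t f) sequentially"
proof -
  have fL: "f \<in> L2 ew" and t0: "t \<ge> 0" using f t by (auto simp: admissible_def)
  show "AE x in hl. sg K t f x = P_series (\<lambda>n. exp (- real n * t) * coeff f n) x"
    by (rule sg_expansion[OF fL t0 admissible_decay[OF f t]])
  then show "L2_tendsto ew (\<lambda>N x. \<Sum>n\<le>N. exp (- real n * t) * coeff f n * P n x) (sg K t f) sequentially"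
    by (rule P_series_tendsto[OF admissible_decay[OF f t] sg_L2[OF fL t0]])
qed

lemma coeff_L2_inner: "L2_inner ew f (R_fun \<alpha> \<beta> n) = coeff f n"
  unfolding L2_inner_def set_integral_hl coeff_def W_fun_def by (simp add: mult_ac)

end

section \<open>Smoothness of series of products\<close>

lemma Ck_on_add: "Ck_on k f S \<Longrightarrow> Ck_on k g S \<Longrightarrow> Ck_on k (\<lambda>x. f x + g x) S"
proof (induction k arbitrary: f g)
  case (Suc k)
  from Suc.prems obtain f' g' where
    "\<And>x. x \<in> S \<Longrightarrow> (f has_derivative f' x) (at x within S)" "\<And>v. Ck_on k (\<lambda>x. f' x v) S"
    "\<And>x. x \<in> S \<Longrightarrow> (g has_derivative g' x) (at x within S)" "\<And>v. Ck_on k (\<lambda>x. g' x v) S"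
    unfolding Ck_on.simps by blast
  then show ?case using Suc.IH
    by (auto intro!: exI[of _ "\<lambda>x v. f' x v + g' x v"] has_derivative_add)
qed (simp add: continuous_on_add)

lemma Ck_on_mult_const: "Ck_on k f S \<Longrightarrow> Ck_on k (\<lambda>x. f x * c) S"
proof (induction k arbitrary: f)
  case (Suc k)
  from Suc.prems obtain f' where
    "\<And>x. x \<in> S \<Longrightarrow> (f has_derivative f' x) (at x within S)" "\<And>v. Ck_on k (\<lambda>x. f' x v) S"
    unfolding Ck_on.simps by blast
  then show ?case using Suc.IH
    by (auto intro!: exI[of _ "\<lambda>x v. f' x v * c"] has_derivative_mult_left)
qed (simp add: continuous_on_mult_right)

lemma Ck_on_compose_affine:
  assumes A: "\<And>x. (A has_derivative L) (at x)" and sub: "A ` S' \<subseteq> S" and f: "Ck_on k f S"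
  shows "Ck_on k (\<lambda>x. f (A x)) S'"
  using f
proof (induction k arbitrary: f)
  case 0
  have "continuous_on S' A" using A by (meson continuous_at_imp_continuous_on has_derivative_continuous)
  then show ?case using 0 sub by (auto intro: continuous_on_compose2)
next
  case (Suc k)
  from Suc.prems obtain f' where
    f': "\<And>x. x \<in> S \<Longrightarrow> (f has_derivative f' x) (at x within S)" "\<And>v. Ck_on k (\<lambda>x. f' x v) S"
    unfolding Ck_on.simps by blast
  have "((\<lambda>x. f (A x)) has_derivative (\<lambda>v. f' (A x) (L v))) (at x within S')" if "x \<in> S'" for x
  proof (rule has_derivative_in_compose[of A L x S' f "f' (A x)"])
    show "(A has_derivative L) (at x within S')" using A by (rule has_derivative_at_withinI)
    show "(f has_derivative f' (A x)) (at (A x) within A ` S')"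
      using f'(1)[of "A x"] that sub by (intro has_derivative_subset[OF _ sub]) auto
  qed
  then show ?case using Suc.IH[OF f'(2)] by (auto intro!: exI[of _ "\<lambda>x v. f' (A x) (L v)"])
qed

text \<open>
  Iterated one-sided derivatives are computed by exhibiting the whole sequence \<open>F\<close> of derivatives;
  nontriviality of the filters makes these derivatives unique.
\<close>

lemma iter_deriv_within_eq:
  assumes nb: "\<And>x. x \<in> A \<Longrightarrow> at x within A \<noteq> bot"
    and d: "\<And>n x. x \<in> A \<Longrightarrow> (F n has_real_derivative F (Suc n) x) (at x within A)"
    and g: "\<And>x. x \<in> A \<Longrightarrow> g x = F 0 x" and x: "x \<in> A"
  shows "iter_deriv_within A n g x = F n x"
  using x
proof (induction n arbitrary: x)
  case 0
  then show ?case by (simp add: iter_deriv_within_def g)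
next
  case (Suc n)
  have "(F n has_vector_derivative F (Suc n) x) (at x within A)"
    using d[OF Suc.prems] by (simp add: has_real_derivative_iff_has_vector_derivative)
  then have "(iter_deriv_within A n g has_vector_derivative F (Suc n) x) (at x within A)"
    by (rule has_vector_derivative_transform[OF Suc.prems, rotated]) (rule Suc.IH)
  then have "vector_derivative (iter_deriv_within A n g) (at x within A) = F (Suc n) x"
    by (rule vector_derivative_within[OF nb[OF Suc.prems]])
  then show ?case by (simp add: iter_deriv_within_def)
qed

lemma at_within_atLeast_nontrivial: "x \<in> {a..} \<Longrightarrow> at x within {a::real..} \<noteq> bot"
proof
  assume x: "x \<in> {a..}" and b: "at x within {a..} = bot"
  have "at_right x \<le> at x within {a..}" using x by (intro at_le) auto
  then show False using b trivial_limit_at_right_real[of x] by (simp add: bot_unique)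
qed

lemma at_within_greaterThan_nontrivial: "x \<in> {a<..} \<Longrightarrow> at x within {a::real<..} \<noteq> bot"
  by (subst at_within_open) auto

lemma locally_uniform_limit_on_cong:
  assumes "locally_uniform_limit_on S F g" "\<And>N x. x \<in> S \<Longrightarrow> F N x = F' N x" "\<And>x. x \<in> S \<Longrightarrow> g x = g' x"
  shows "locally_uniform_limit_on S F' g'"
proof -
  have "uniform_limit (S \<inter> ball a r) F' g' sequentially" if "uniform_limit (S \<inter> ball a r) F g sequentially" for a r
    by (rule uniform_limit_cong'[THEN iffD1, OF _ _ that]) (use assms in auto)
  then show ?thesis using assms(1) unfolding locally_uniform_limit_on_def by meson
qed

lemma summable_power_exp:
  assumes "\<epsilon> > 0"
  shows "summable (\<lambda>n. real n ^ k * exp (- \<epsilon> * real n))"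
proof (rule summable_comparison_test)
  show "summable (\<lambda>n. fact k / (\<epsilon>/2) ^ k * exp (- \<epsilon>/2) ^ n)"
    using assms by (intro summable_mult summable_geometric) auto
  have "real n ^ k * exp (- \<epsilon> * real n) \<le> fact k / (\<epsilon>/2) ^ k * exp (- \<epsilon>/2) ^ n" for n
  proof -
    have "real n ^ k * exp (- \<epsilon> * real n) \<le> fact k / (\<epsilon>/2) ^ k * exp (\<epsilon>/2 * real n) * exp (- \<epsilon> * real n)"
      using power_le_exp_scaled[of "\<epsilon>/2" "real n" k] assms by (intro mult_right_mono) auto
    also have "\<dots> = fact k / (\<epsilon>/2) ^ k * exp (- \<epsilon>/2 * real n)"
      by (simp add: mult.assoc flip: exp_add)
    finally show ?thesis by (simp add: exp_of_nat_mult[symmetric] mult.commute)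
  qed
  then show "\<exists>N. \<forall>n\<ge>N. norm (real n ^ k * exp (- \<epsilon> * real n)) \<le> fact k / (\<epsilon>/2) ^ k * exp (- \<epsilon>/2) ^ n" by simp
qed

lemma linear_form_bound:
  fixes a b c :: real
  assumes "\<bar>a\<bar> \<le> e/3" "\<bar>b\<bar> \<le> e/3" "\<bar>c\<bar> \<le> e/3" "\<bar>u\<bar> \<le> r" "\<bar>v\<bar> \<le> r" "\<bar>w\<bar> \<le> r"
  shows "\<bar>a * u + b * v + c * w\<bar> \<le> e * r"
proof -
  have "\<bar>a * u\<bar> \<le> e/3 * r" "\<bar>b * v\<bar> \<le> e/3 * r" "\<bar>c * w\<bar> \<le> e/3 * r"
    using mult_mono[OF assms(1,4)] mult_mono[OF assms(2,5)] mult_mono[OF assms(3,6)] assms abs_ge_zero[of a]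
    unfolding abs_mult by (simp_all del: abs_ge_zero)
  then show ?thesis by linarith
qed

text \<open>
  Series \<open>\<Sum>n. exp(- n t) w\<^sub>n(y) p\<^sub>n(x)\<close>, where \<open>p i n\<close> and \<open>w q n\<close> stand for the derivatives of
  order \<open>i\<close> and \<open>q\<close> of \<open>p\<^sub>n\<close> and \<open>w\<^sub>n\<close>. The \<open>p\<^sub>n\<close> grow subexponentially in \<open>n\<close> and the \<open>w\<^sub>n\<close> at most at
  the exponential rate \<open>T\<close>. The heat kernel is of this form with \<open>T = 0\<close>; so is the expansion of a
  single function, whose coefficients are regarded as constant functions of \<open>y\<close>.
\<close>

locale product_series =
  fixes p w :: "nat \<Rightarrow> nat \<Rightarrow> real \<Rightarrow> real" and Y :: "real set" and T :: real
  assumes dp: "\<And>i n x. (p i n has_real_derivative p (Suc i) n x) (at x)"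
    and bp: "\<And>i R \<epsilon>. R > 0 \<Longrightarrow> \<epsilon> > 0 \<Longrightarrow> \<exists>C\<ge>0. \<forall>n x. \<bar>x\<bar> \<le> R \<longrightarrow> \<bar>p i n x\<bar> \<le> C * exp (\<epsilon> * real n)"
    and dw: "\<And>q n y. y \<in> Y \<Longrightarrow> (w q n has_real_derivative w (Suc q) n y) (at y)"
    and bw: "\<And>q y0 \<tau>. y0 \<in> Y \<Longrightarrow> \<tau> > T \<Longrightarrow> \<exists>d>0. \<exists>C\<ge>0. \<forall>n y. \<bar>y - y0\<bar> < d \<longrightarrow> y \<in> Y \<and> \<bar>w q n y\<bar> \<le> C * exp (\<tau> * real n)"
begin

definition tm :: "nat \<Rightarrow> nat \<Rightarrow> nat \<Rightarrow> nat \<Rightarrow> real \<times> real \<times> real \<Rightarrow> real" where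
  "tm k i q n = (\<lambda>(t, x, y). (- real n) ^ k * exp (- real n * t) * w q n y * p i n x)"

definition S :: "nat \<Rightarrow> nat \<Rightarrow> nat \<Rightarrow> real \<times> real \<times> real \<Rightarrow> real" where
  "S k i q z = (\<Sum>n. tm k i q n z)"

text \<open>
  Boxes rather than balls, so that the constraints on the three variables are independent.
\<close>

definition box3 :: "real \<times> real \<times> real \<Rightarrow> real \<Rightarrow> (real \<times> real \<times> real) set" where
  "box3 z d = {fst z - d<..<fst z + d} \<times> {fst (snd z) - d<..<fst (snd z) + d} \<times> {snd (snd z) - d<..<snd (snd z) + d}"

abbreviation "Dom \<equiv> {T<..} \<times> (UNIV :: real set) \<times> Y"

lemma box3_mono: "d \<le> d' \<Longrightarrow> box3 z d \<subseteq> box3 z d'"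
  by (auto simp: box3_def)

lemma open_box3: "open (box3 z d)" and convex_box3: "convex (box3 z d)" and center_box3: "d > 0 \<Longrightarrow> z \<in> box3 z d"
  by (auto simp: box3_def mem_Times_iff intro!: open_Times convex_Times)

lemma local_bound:
  assumes z: "z \<in> Dom"
  shows "\<exists>d>0. \<exists>M. summable M \<and> box3 z d \<subseteq> Dom \<and> (\<forall>n. \<forall>z'\<in>box3 z d. \<bar>tm k i q n z'\<bar> \<le> M n)"
proof -
  obtain t0 x0 y0 where zz: "z = (t0, x0, y0)" by (metis prod.exhaust)
  have t0: "t0 > T" and y0: "y0 \<in> Y" using z zz by auto
  (* One quarter of the gap each for the variation of t, the excess growth of w,
     the growth of p, and the decay that remains. *)
  define \<epsilon> where "\<epsilon> = (t0 - T) / 4"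
  have e: "\<epsilon> > 0" using t0 by (simp add: \<epsilon>_def)
  obtain C1 where C1: "C1 \<ge> 0" "\<And>n x. \<bar>x\<bar> \<le> \<bar>x0\<bar> + 1 \<Longrightarrow> \<bar>p i n x\<bar> \<le> C1 * exp (\<epsilon> * real n)"
    using bp[OF add_nonneg_pos[OF abs_ge_zero zero_less_one] e, of x0 i] by blast
  have "T + \<epsilon> > T" using e by simp
  from bw[OF y0 this, of q]
  obtain d2 C2 where d2: "d2 > 0" "C2 \<ge> 0" "\<And>n y. \<bar>y - y0\<bar> < d2 \<Longrightarrow> y \<in> Y \<and> \<bar>w q n y\<bar> \<le> C2 * exp ((T + \<epsilon>) * real n)"
    by blast
  define d where "d = min \<epsilon> (min 1 d2)"
  have d: "d > 0" "d \<le> \<epsilon>" "d \<le> 1" "d \<le> d2" using e d2 by (auto simp: d_def)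
  define M where "M = (\<lambda>n. C2 * C1 * (real n ^ k * exp (- \<epsilon> * real n)))"
  have "summable M" unfolding M_def by (intro summable_mult summable_power_exp e)
  moreover have inb: "t > T + 3 * \<epsilon> \<and> \<bar>x\<bar> \<le> \<bar>x0\<bar> + 1 \<and> \<bar>y - y0\<bar> < d2" if "(t, x, y) \<in> box3 z d" for t x y
    using that d e unfolding box3_def zz by (auto simp: \<epsilon>_def abs_if field_simps)
  then have "box3 z d \<subseteq> Dom" using d2(3) e by fastforce
  moreover have "\<bar>tm k i q n z'\<bar> \<le> M n" if "z' \<in> box3 z d" for n z'
  proof -
    obtain t x y where z': "z' = (t, x, y)" by (metis prod.exhaust)
    have b: "t > T + 3 * \<epsilon>" "\<bar>x\<bar> \<le> \<bar>x0\<bar> + 1" "\<bar>y - y0\<bar> < d2" using inb that z' by auto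
    have "\<bar>tm k i q n z'\<bar> = real n ^ k * exp (- real n * t) * \<bar>w q n y\<bar> * \<bar>p i n x\<bar>"
      by (simp add: tm_def z' abs_mult power_abs)
    also have "\<dots> \<le> real n ^ k * exp (- real n * (T + 3 * \<epsilon>)) * (C2 * exp ((T + \<epsilon>) * real n)) * (C1 * exp (\<epsilon> * real n))"
    proof (intro mult_mono)
      show "exp (- real n * t) \<le> exp (- real n * (T + 3 * \<epsilon>))" using b(1) by (simp add: mult_left_mono)
    qed (use d2 C1 b in auto)
    also have "\<dots> = C2 * C1 * (real n ^ k * (exp (- real n * (T + 3 * \<epsilon>)) * exp ((T + \<epsilon>) * real n) * exp (\<epsilon> * real n)))"
      by (simp add: mult_ac)
    also have "exp (- real n * (T + 3 * \<epsilon>)) * exp ((T + \<epsilon>) * real n) * exp (\<epsilon> * real n) = exp (- \<epsilon> * real n)"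
      unfolding exp_add[symmetric] by (rule arg_cong[where f=exp]) (simp add: algebra_simps)
    finally show ?thesis by (simp add: M_def)
  qed
  ultimately show ?thesis using d(1) by blast
qed

lemma uniform_local:
  assumes z: "z \<in> Dom"
  shows "\<exists>d>0. box3 z d \<subseteq> Dom \<and> uniform_limit (box3 z d) (\<lambda>N z. \<Sum>n<N. tm k i q n z) (S k i q) sequentially
     \<and> (\<forall>z'\<in>box3 z d. (\<lambda>n. tm k i q n z') sums S k i q z')"
proof -
  from local_bound[OF z, of k i q]
  obtain d M where d: "d > 0" "summable M" "box3 z d \<subseteq> Dom" "\<And>n z'. z' \<in> box3 z d \<Longrightarrow> \<bar>tm k i q n z'\<bar> \<le> M n"
    by blast
  have "uniform_limit (box3 z d) (\<lambda>N z. \<Sum>n<N. tm k i q n z) (S k i q) sequentially"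
    unfolding S_def[abs_def] by (rule Weierstrass_m_test[OF _ d(2)]) (use d(4) in auto)
  moreover have "(\<lambda>n. tm k i q n z') sums S k i q z'" if "z' \<in> box3 z d" for z'
    unfolding S_def by (rule summable_sums, rule summable_comparison_test[OF _ d(2)]) (use d(4)[OF that] in auto)
  ultimately show ?thesis using d by blast
qed

lemma S_sums: "z \<in> Dom \<Longrightarrow> (\<lambda>n. tm k i q n z) sums S k i q z"
  using uniform_local[of z k i q] center_box3 by blast

lemma tm_has_derivative:
  assumes "z \<in> Dom"
  shows "(tm k i q n has_derivative
     (\<lambda>h. tm (Suc k) i q n z * fst h + tm k (Suc i) q n z * fst (snd h) + tm k i (Suc q) n z * snd (snd h))) (at z)"
proof -
  obtain t x y where z: "z = (t, x, y)" by (metis prod.exhaust)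
  have y: "y \<in> Y" using assms z by simp
  have s2: "((\<lambda>z :: real \<times> real \<times> real. snd (snd z)) has_derivative (\<lambda>h. snd (snd h))) (at z)"
    and f2: "((\<lambda>z :: real \<times> real \<times> real. fst (snd z)) has_derivative (\<lambda>h. fst (snd h))) (at z)"
    by (intro has_derivative_fst has_derivative_snd has_derivative_ident)+
  have "(w q n has_derivative (\<lambda>h. h * w (Suc q) n y)) (at (snd (snd z)))"
    using dw[OF y, of q n] by (simp add: z has_field_derivative_def mult_commute_abs)
  note 1 = has_derivative_compose[OF s2 this]
  have "(p i n has_derivative (\<lambda>h. h * p (Suc i) n x)) (at (fst (snd z)))"
    using dp[of i n x] by (simp add: z has_field_derivative_def mult_commute_abs)
  note 2 = has_derivative_compose[OF f2 this]
  have 3: "((\<lambda>z. (- real n) ^ k * exp (- real n * fst z)) has_derivative (\<lambda>h. fst h * ((- real n) ^ Suc k * exp (- real n * t)))) (at z)"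
    by (auto intro!: derivative_eq_intros simp: z)
  have "((\<lambda>z. (- real n) ^ k * exp (- real n * fst z) * w q n (snd (snd z)) * p i n (fst (snd z))) has_derivative
     (\<lambda>h. tm (Suc k) i q n z * fst h + tm k (Suc i) q n z * fst (snd h) + tm k i (Suc q) n z * snd (snd h))) (at z)"
    by (rule has_derivative_eq_rhs[OF has_derivative_mult[OF has_derivative_mult[OF 3 1] 2]])
       (simp add: fun_eq_iff tm_def z algebra_simps)
  then show ?thesis by (simp add: tm_def case_prod_beta')
qed

text \<open>
  Termwise differentiation: the three series of partial derivatives are again of the form \<open>S\<close> and
  converge uniformly near \<open>z\<close>.
\<close>

lemma S_has_derivative:
  assumes z: "z \<in> Dom"
  shows "(S k i q has_derivative
     (\<lambda>h. S (Suc k) i q z * fst h + S k (Suc i) q z * fst (snd h) + S k i (Suc q) z * snd (snd h))) (at z)"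
proof -
  obtain d0 where d0: "d0 > 0" "box3 z d0 \<subseteq> Dom" "\<And>z'. z' \<in> box3 z d0 \<Longrightarrow> (\<lambda>n. tm k i q n z') sums S k i q z'"
    using uniform_local[OF z, of k i q] by blast
  obtain d1 where d1: "d1 > 0" "uniform_limit (box3 z d1) (\<lambda>N z. \<Sum>n<N. tm (Suc k) i q n z) (S (Suc k) i q) sequentially"
    using uniform_local[OF z, of "Suc k" i q] by blast
  obtain d2 where d2: "d2 > 0" "uniform_limit (box3 z d2) (\<lambda>N z. \<Sum>n<N. tm k (Suc i) q n z) (S k (Suc i) q) sequentially"
    using uniform_local[OF z, of k "Suc i" q] by blast
  obtain d3 where d3: "d3 > 0" "uniform_limit (box3 z d3) (\<lambda>N z. \<Sum>n<N. tm k i (Suc q) n z) (S k i (Suc q)) sequentially"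
    using uniform_local[OF z, of k i "Suc q"] by blast
  define d where "d = min (min d0 d1) (min d2 d3)"
  have d: "d > 0" "d \<le> d0" "d \<le> d1" "d \<le> d2" "d \<le> d3" using d0 d1 d2 d3 by (auto simp: d_def)
  let ?B = "box3 z d"
  let ?f' = "\<lambda>n z h. tm (Suc k) i q n z * fst h + tm k (Suc i) q n z * fst (snd h) + tm k i (Suc q) n z * snd (snd h)"
  let ?g' = "\<lambda>z h. S (Suc k) i q z * fst h + S k (Suc i) q z * fst (snd h) + S k i (Suc q) z * snd (snd h)"
  have ul: "uniform_limit ?B (\<lambda>N z. \<Sum>n<N. tm (Suc k) i q n z) (S (Suc k) i q) sequentially"
    "uniform_limit ?B (\<lambda>N z. \<Sum>n<N. tm k (Suc i) q n z) (S k (Suc i) q) sequentially"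
    "uniform_limit ?B (\<lambda>N z. \<Sum>n<N. tm k i (Suc q) n z) (S k i (Suc q)) sequentially"
    using uniform_limit_on_subset[OF d1(2) box3_mono[OF d(3)]] uniform_limit_on_subset[OF d2(2) box3_mono[OF d(4)]]
      uniform_limit_on_subset[OF d3(2) box3_mono[OF d(5)]] .
  have "\<exists>g. \<forall>z'\<in>?B. (\<lambda>n. tm k i q n z') sums g z' \<and> (g has_derivative ?g' z') (at z' within ?B)"
  proof (rule has_derivative_series[OF convex_box3])
    show "(tm k i q n has_derivative ?f' n z') (at z' within ?B)" if "z' \<in> ?B" for n z'
      by (rule has_derivative_at_withinI[OF tm_has_derivative[OF subsetD[OF d0(2) subsetD[OF box3_mono[OF d(2)] that]]]])
    show "z \<in> ?B" by (rule center_box3[OF d(1)])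
    show "(\<lambda>n. tm k i q n z) sums S k i q z" by (rule S_sums[OF z])
    fix e :: real assume e: "e > 0"
    then have "e / 3 > 0" by simp
    from uniform_limitD[OF ul(1) this] uniform_limitD[OF ul(2) this] uniform_limitD[OF ul(3) this]
    show "\<forall>\<^sub>F N in sequentially. \<forall>z'\<in>?B. \<forall>h. norm (sum (\<lambda>n. ?f' n z' h) {..<N} - ?g' z' h) \<le> e * norm h"
    proof eventually_elim
      case (elim N)
      show ?case
      proof (intro ballI allI)
        fix z' and h :: "real \<times> real \<times> real" assume z': "z' \<in> ?B"
        let ?a = "(\<Sum>n<N. tm (Suc k) i q n z') - S (Suc k) i q z'" and ?b = "(\<Sum>n<N. tm k (Suc i) q n z') - S k (Suc i) q z'"
          and ?c = "(\<Sum>n<N. tm k i (Suc q) n z') - S k i (Suc q) z'"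
        have abc: "\<bar>?a\<bar> \<le> e/3" "\<bar>?b\<bar> \<le> e/3" "\<bar>?c\<bar> \<le> e/3"
          using elim z' by (auto simp: dist_real_def less_imp_le)
        have hh: "\<bar>fst h\<bar> \<le> norm h" "\<bar>fst (snd h)\<bar> \<le> norm h" "\<bar>snd (snd h)\<bar> \<le> norm h"
          using norm_fst_le[of "fst h" "snd h"] norm_snd_le[of "snd h" "fst h"]
            norm_fst_le[of "fst (snd h)" "snd (snd h)"] norm_snd_le[of "snd (snd h)" "fst (snd h)"] by auto
        have eq: "sum (\<lambda>n. ?f' n z' h) {..<N} - ?g' z' h = ?a * fst h + ?b * fst (snd h) + ?c * snd (snd h)"
          by (simp add: sum.distrib left_diff_distrib flip: sum_distrib_right)
        show "norm (sum (\<lambda>n. ?f' n z' h) {..<N} - ?g' z' h) \<le> e * norm h"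
          unfolding eq real_norm_def by (rule linear_form_bound[OF abc hh])
      qed
    qed
  qed
  then obtain g where g: "\<And>z'. z' \<in> ?B \<Longrightarrow> (\<lambda>n. tm k i q n z') sums g z'"
     "\<And>z'. z' \<in> ?B \<Longrightarrow> (g has_derivative ?g' z') (at z' within ?B)" by blast
  have gS: "g z' = S k i q z'" if "z' \<in> ?B" for z'
    by (rule sums_unique2[OF g(1)[OF that] d0(3)[OF subsetD[OF box3_mono[OF d(2)] that]]])
  have zB: "z \<in> ?B" by (rule center_box3[OF d(1)])
  have "(g has_derivative ?g' z) (at z)" using g(2)[OF zB] at_within_open[OF zB open_box3] by simp
  then show ?thesis by (rule has_derivative_transform_within_open[OF _ open_box3 zB]) (rule gS)
qed

text \<open>
  The partial derivatives of \<open>S k i q\<close> are series of the same family, so one induction treats all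
  indices at once.
\<close>

lemma S_Ck_on: "A \<subseteq> Dom \<Longrightarrow> Ck_on m (S k i q) A"
proof (induction m arbitrary: k i q)
  case 0
  have "continuous_on A (S k i q)"
    using 0 S_has_derivative by (intro continuous_at_imp_continuous_on) (meson has_derivative_continuous subsetD)
  then show ?case by simp
next
  case (Suc m)
  have "\<forall>z\<in>A. (S k i q has_derivative (\<lambda>h. S (Suc k) i q z * fst h + S k (Suc i) q z * fst (snd h) + S k i (Suc q) z * snd (snd h))) (at z within A)"
    using Suc.prems S_has_derivative has_derivative_at_withinI by blast
  moreover have "Ck_on m (\<lambda>z. S (Suc k) i q z * fst h + S k (Suc i) q z * fst (snd h) + S k i (Suc q) z * snd (snd h)) A" for h
    by (intro Ck_on_add Ck_on_mult_const Suc.IH Suc.prems)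
  ultimately show ?case by auto
qed

lemma S_smooth_on: "A \<subseteq> Dom \<Longrightarrow> smooth_on (S k i q) A"
  by (simp add: smooth_on_def S_Ck_on)

lemma S_partial:
  assumes "t > T" "y \<in> Y"
  shows "((\<lambda>t. S k i q (t, x, y)) has_real_derivative S (Suc k) i q (t, x, y)) (at t)"
    and "((\<lambda>x. S k i q (t, x, y)) has_real_derivative S k (Suc i) q (t, x, y)) (at x)"
    and "((\<lambda>y. S k i q (t, x, y)) has_real_derivative S k i (Suc q) (t, x, y)) (at y)"
proof -
  have z: "(t, x, y) \<in> Dom" using assms by simp
  note D = S_has_derivative[OF z, of k i q]
  have "((\<lambda>t. (t, x, y)) has_derivative (\<lambda>h. (h, 0, 0))) (at t)" by (intro has_derivative_Pair has_derivative_ident has_derivative_const)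
  from has_derivative_compose[OF this D]
  show "((\<lambda>t. S k i q (t, x, y)) has_real_derivative S (Suc k) i q (t, x, y)) (at t)"
    by (simp add: has_field_derivative_def)
  have "((\<lambda>x. (t, x, y)) has_derivative (\<lambda>h. (0, h, 0))) (at x)" by (intro has_derivative_Pair has_derivative_ident has_derivative_const)
  from has_derivative_compose[OF this D]
  show "((\<lambda>x. S k i q (t, x, y)) has_real_derivative S k (Suc i) q (t, x, y)) (at x)"
    by (simp add: has_field_derivative_def)
  have "((\<lambda>y. (t, x, y)) has_derivative (\<lambda>h. (0, 0, h))) (at y)" by (intro has_derivative_Pair has_derivative_ident has_derivative_const)
  from has_derivative_compose[OF this D]
  show "((\<lambda>y. S k i q (t, x, y)) has_real_derivative S k i (Suc q) (t, x, y)) (at y)"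
    by (simp add: has_field_derivative_def)
qed

lemma S_iter_x:
  assumes "t > T" "y \<in> Y" "x \<in> {0..}"
  shows "iter_deriv_within {0..} i (\<lambda>x. S k 0 q (t, x, y)) x = S k i q (t, x, y)"
proof (rule iter_deriv_within_eq[where F="\<lambda>i x. S k i q (t, x, y)"])
  show "((\<lambda>x. S k n q (t, x, y)) has_real_derivative S k (Suc n) q (t, x, y)) (at x within {0..})" for n x
    by (rule has_field_derivative_at_within[OF S_partial(2)[OF assms(1,2)]])
  show "at x within {0..} \<noteq> bot" if "x \<in> {0..}" for x :: real by (rule at_within_atLeast_nontrivial[OF that])
qed (use assms(3) in auto)

lemma S_iter_t:
  assumes "t > T" "y \<in> Y" "\<And>t. t > T \<Longrightarrow> g t = S 0 i q (t, x, y)"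
  shows "iter_deriv_within {T<..} k g t = S k i q (t, x, y)"
proof (rule iter_deriv_within_eq[where F="\<lambda>k t. S k i q (t, x, y)"])
  show "((\<lambda>t. S n i q (t, x, y)) has_real_derivative S (Suc n) i q (t, x, y)) (at t within {T<..})" if "t \<in> {T<..}" for n t
    by (rule has_field_derivative_at_within[OF S_partial(1)[OF _ assms(2)]]) (use that in simp)
  show "at t within {T<..} \<noteq> bot" if "t \<in> {T<..}" for t by (rule at_within_greaterThan_nontrivial[OF that])
qed (use assms in auto)

lemma S_locally_uniform:
  assumes A: "A \<subseteq> Dom"
  shows "locally_uniform_limit_on A (\<lambda>N z. \<Sum>n\<le>N. tm k i q n z) (S k i q)"
  unfolding locally_uniform_limit_on_def
proof
  fix z assume "z \<in> A"
  then have z: "z \<in> Dom" using A by blast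
  obtain d where d: "d > 0" "uniform_limit (box3 z d) (\<lambda>N z. \<Sum>n<N. tm k i q n z) (S k i q) sequentially"
    using uniform_local[OF z, of k i q] by blast
  have sub: "A \<inter> ball z d \<subseteq> box3 z d"
  proof
    fix z' assume "z' \<in> A \<inter> ball z d"
    then have dz: "dist z z' < d" by simp
    have "dist (fst z) (fst z') < d" "dist (fst (snd z)) (fst (snd z')) < d" "dist (snd (snd z)) (snd (snd z')) < d"
      using dz dist_fst_le[of z z'] dist_snd_le[of z z'] dist_fst_le[of "snd z" "snd z'"] dist_snd_le[of "snd z" "snd z'"] by linarith+
    then show "z' \<in> box3 z d" by (auto simp: box3_def mem_Times_iff dist_real_def abs_less_iff)
  qed
  have "uniform_limit (A \<inter> ball z d) (\<lambda>N z. \<Sum>n<N. tm k i q n z) (S k i q) sequentially"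
    by (rule uniform_limit_on_subset[OF d(2) sub])
  then have "uniform_limit (A \<inter> ball z d) (\<lambda>N z. \<Sum>n<Suc N. tm k i q n z) (S k i q) sequentially"
    by (rule filterlim_compose[OF _ filterlim_Suc])
  then show "\<exists>r>0. uniform_limit (A \<inter> ball z r) (\<lambda>N z. \<Sum>n\<le>N. tm k i q n z) (S k i q) sequentially"
    using d(1) by (auto simp: lessThan_Suc_atMost simp del: sum.lessThan_Suc)
qed

end

section \<open>The heat kernel\<close>

lemma AE_hl_continuous_eq:
  fixes f g :: "real \<Rightarrow> real"
  assumes f: "continuous_on {0..} f" and g: "continuous_on {0..} g" and ae: "AE x in hl. f x = g x" and x: "x \<ge> 0"
  shows "f x = g x"
proof (rule ccontr)
  assume ne: "f x \<noteq> g x"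
  have "continuous_on {0..} (\<lambda>x. f x - g x)" using f g by (intro continuous_intros)
  then have "\<forall>e>0. \<exists>d>0. \<forall>y\<in>{0..}. dist y x < d \<longrightarrow> dist (f y - g y) (f x - g x) < e"
    using x unfolding continuous_on_iff by auto
  moreover have "\<bar>f x - g x\<bar> > 0" using ne by simp
  ultimately obtain d where d: "d > 0" "\<And>y. y \<in> {0..} \<Longrightarrow> dist y x < d \<Longrightarrow> dist (f y - g y) (f x - g x) < \<bar>f x - g x\<bar>" by blast
  have "AE y in lborel. y \<in> {0<..} \<longrightarrow> f y = g y" using ae by (simp add: AE_restrict_space_iff)
  then have "AE y in lborel. y \<notin> {x<..<x+d}"
  proof eventually_elim
    case (elim y)
    show ?case
    proof
      assume y: "y \<in> {x<..<x+d}"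
      then have "dist (f y - g y) (f x - g x) < \<bar>f x - g x\<bar>" using d(2)[of y] x by (auto simp: dist_real_def)
      moreover have "f y = g y" using elim y x by auto
      ultimately show False by (simp add: dist_real_def)
    qed
  qed
  then have "{x<..<x+d} \<in> null_sets lborel" by (subst (asm) AE_iff_null_sets[symmetric]) auto
  then show False using d(1) by (simp add: null_sets_def)
qed

lemma one_plus_power_le_exp: "\<epsilon> > 0 \<Longrightarrow> (1 + \<epsilon>) ^ n \<le> exp (\<epsilon> * real n)"
  using power_mono[OF exp_ge_add_one_self[of \<epsilon>], of n] by (simp add: exp_of_nat_mult[symmetric] mult.commute)

context gauss_laguerre_weight
begin

lemma P_deriv_bound_exp:
  assumes "R > 0" "\<epsilon> > 0"
  shows "\<exists>C\<ge>0. \<forall>n x. \<bar>x\<bar> \<le> R \<longrightarrow> \<bar>(deriv ^^ i) (P n) x\<bar> \<le> C * exp (\<epsilon> * real n)"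
proof -
  obtain C where C: "C \<ge> 0" "\<And>n x. \<bar>x\<bar> \<le> R \<Longrightarrow> \<bar>(deriv ^^ i) (P n) x\<bar> \<le> C * (1 + \<epsilon>) ^ n"
    using P_deriv_bound[OF assms, of i] by blast
  have "\<bar>(deriv ^^ i) (P n) x\<bar> \<le> C * exp (\<epsilon> * real n)" if "\<bar>x\<bar> \<le> R" for n x
    using C(2)[OF that, of n] mult_left_mono[OF one_plus_power_le_exp[OF assms(2), of n] C(1)] by linarith
  then show ?thesis using C(1) by blast
qed

lemma W_deriv_bound_exp:
  assumes y0: "y0 \<in> {0<..}" and \<tau>: "\<tau> > 0"
  shows "\<exists>d>0. \<exists>C\<ge>0. \<forall>n y. \<bar>y - y0\<bar> < d \<longrightarrow> y \<in> {0<..} \<and> \<bar>(deriv ^^ q) (W n) y\<bar> \<le> C * exp (\<tau> * real n)"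
proof -
  have y0': "y0 > 0" using y0 by simp
  obtain C where C: "C \<ge> 0" "\<And>n y. y \<in> ball y0 (y0/4) \<Longrightarrow> \<bar>(deriv ^^ q) (W n) y\<bar> \<le> C / exp (- \<tau>) ^ n"
    using W_deriv_bound[OF y0', of "exp (- \<tau>)" q] \<tau> by auto
  have e: "C / exp (- \<tau>) ^ n = C * exp (\<tau> * real n)" for n
    by (simp add: exp_minus divide_inverse power_inverse exp_of_nat_mult[symmetric] mult.commute[of \<tau>])
  have "y \<in> {0<..} \<and> \<bar>(deriv ^^ q) (W n) y\<bar> \<le> C * exp (\<tau> * real n)" if "\<bar>y - y0\<bar> < y0/4" for n y
  proof -
    have "y \<in> ball y0 (y0/4)" using that by (simp add: dist_real_def abs_minus_commute)
    moreover have "y > 0" using that y0' by linarith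
    ultimately show ?thesis using C(2)[of y n] e by simp
  qed
  then show ?thesis using C(1) y0' by (intro exI[of _ "y0/4"]) auto
qed

sublocale ker: product_series "\<lambda>i n. (deriv ^^ i) (P n)" "\<lambda>q n. (deriv ^^ q) (W n)" "{0<..}" 0
  by unfold_locales (use P_has_deriv P_deriv_bound_exp W_has_deriv W_deriv_bound_exp in auto)

definition heat :: "real \<Rightarrow> real \<Rightarrow> real \<Rightarrow> real" where
  "heat t x y = ker.S 0 0 0 (t, x, y)"

lemma heat_sums: "t > 0 \<Longrightarrow> y > 0 \<Longrightarrow> (\<lambda>n. exp (- real n * t) * P n x * W n y) sums heat t x y"
  using ker.S_sums[of "(t, x, y)" 0 0 0] by (simp add: heat_def ker.tm_def mult_ac)

lemma heat_continuous:
  assumes "t > 0" "y > 0"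
  shows "isCont (\<lambda>x. heat t x y) x" "isCont (heat t x) y"
  using ker.S_partial(2,3)[of t y 0 0 0 x] assms
  by (auto simp: heat_def[abs_def] intro: DERIV_isCont)

lemma heat_measurable [measurable]: "heat t x \<in> borel_measurable hl" if "t > 0"
proof -
  have "continuous_on {0<..} (heat t x)"
    using heat_continuous(2)[OF that] by (intro continuous_at_imp_continuous_on) auto
  then have "(\<lambda>y. indicator {0<..} y *\<^sub>R heat t x y) \<in> borel_measurable borel"
    by (intro borel_measurable_continuous_on_indicator) auto
  then show ?thesis by (simp add: borel_measurable_hl_iff)
qed

text \<open>
  On a bounded set the growth of the crude bound of \<open>W n\<close> in \<open>y\<close> is harmless. That bound has the rate
  \<open>r ^ n\<close> with \<open>r\<close> arbitrarily close to \<open>1\<close>, so termwise integration is possible for every \<open>t > 0\<close>.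
\<close>

lemma bounded_support_heat:
  assumes t: "t > 0" and [measurable]: "\<phi> \<in> borel_measurable borel" and b: "b > 0"
    and \<phi>: "\<And>y. \<bar>\<phi> y\<bar> \<le> 1" "\<And>y. y > b \<Longrightarrow> \<phi> y = (0::real)"
  shows "integrable hl (\<lambda>y. heat t x y * \<phi> y)"
    and "(\<lambda>n. exp (- real n * t) * coeff \<phi> n * P n x) sums (LINT y|hl. heat t x y * \<phi> y)"
    and "\<tau> > 0 \<Longrightarrow> \<exists>C. \<forall>n. \<bar>coeff \<phi> n\<bar> \<le> C * exp (\<tau> * real n)"
proof -
  have ib: "integrable hl (indicator {0<..b} :: real \<Rightarrow> real)" "(LINT y|hl. indicator {0<..b} y) = b"
  proof -
    have e: "indicator {0<..} y *\<^sub>R indicator {0<..b} y = (indicator {0<..b} y :: real)" for y :: real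
      by (auto simp: indicator_def)
    show "integrable hl (indicator {0<..b} :: real \<Rightarrow> real)"
      using b by (subst integrable_restrict_space) (auto simp only: e, auto)
    show "(LINT y|hl. indicator {0<..b} y) = b"
      using b by (subst integral_restrict_space) (auto simp only: e, auto)
  qed
  define M where "M = (\<lambda>r n. cW_majorant r b / r ^ n)"
  have bound: "\<bar>W n y * \<phi> y\<bar> \<le> M r n * indicator {0<..b} y" if r: "0 < r" "r < 1" and y: "y > 0" for r n y
  proof (cases "y \<le> b")
    case True
    have "\<bar>W n y\<bar> \<le> cW_majorant r y / r ^ n" by (rule W_bound[OF r y])
    also have "\<dots> \<le> M r n" unfolding M_def using True y r by (intro divide_right_mono cW_majorant_mono) auto
    finally have "\<bar>W n y\<bar> * \<bar>\<phi> y\<bar> \<le> M r n * 1" using \<phi>(1)[of y] by (intro mult_mono) auto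
    then show ?thesis using True y by (simp add: abs_mult)
  qed (simp add: \<phi>(2))
  have iW: "integrable hl (\<lambda>y. W n y * \<phi> y)" and nW: "(LINT y|hl. \<bar>W n y * \<phi> y\<bar>) \<le> M r n * b" if r: "0 < r" "r < 1" for r n
  proof -
    have iM: "integrable hl (\<lambda>y. M r n * indicator {0<..b} y)" using ib by simp
    show i: "integrable hl (\<lambda>y. W n y * \<phi> y)"
      by (rule Bochner_Integration.integrable_bound[OF iM])
         (use bound[OF r] order_trans[OF bound[OF r] abs_ge_self] in \<open>auto intro!: AE_hl_I\<close>)
    have "(LINT y|hl. \<bar>W n y * \<phi> y\<bar>) \<le> (LINT y|hl. M r n * indicator {0<..b} y)"
      by (rule integral_mono_AE[OF integrable_abs[OF i] iM]) (use bound[OF r] in \<open>auto intro!: AE_hl_I\<close>)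
    then show "(LINT y|hl. \<bar>W n y * \<phi> y\<bar>) \<le> M r n * b" using ib by simp
  qed
  have cb: "\<bar>coeff \<phi> n\<bar> \<le> M r n * b" if r: "0 < r" "r < 1" for r n
    unfolding coeff_def real_scaleR_def by (rule order_trans[OF integral_abs_bound nW[OF r]])
  show "\<exists>C. \<forall>n. \<bar>coeff \<phi> n\<bar> \<le> C * exp (\<tau> * real n)" if "\<tau> > 0"
  proof (intro exI allI)
    fix n
    have "M (exp (- \<tau>)) n = cW_majorant (exp (- \<tau>)) b * exp (\<tau> * real n)"
      by (simp add: M_def exp_minus divide_inverse power_inverse exp_of_nat_mult[symmetric] mult.commute[of \<tau>])
    then show "\<bar>coeff \<phi> n\<bar> \<le> cW_majorant (exp (- \<tau>)) b * b * exp (\<tau> * real n)"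
      using cb[of "exp (- \<tau>)" n] that by (simp add: mult_ac)
  qed
  define r where "r = exp (- t / 2)"
  have r: "0 < r" "r < 1" using t by (auto simp: r_def)
  define c where "c = (\<lambda>n. exp (- real n * t) * P n x)"
  have sc: "summable (\<lambda>n. \<bar>c n\<bar> * M r n)"
  proof -
    have "exp (- t) / r < 1" using t by (simp add: r_def flip: exp_diff)
    then have "summable (\<lambda>n. cW_majorant r b * ((exp (- t) / r) ^ n * \<bar>P n x\<bar>))"
      using r by (intro summable_mult P_geometric_summable) auto
    moreover have "cW_majorant r b * ((exp (- t) / r) ^ n * \<bar>P n x\<bar>) = \<bar>c n\<bar> * M r n" for n
      by (simp add: c_def M_def abs_mult power_divide exp_of_nat_mult[symmetric] mult_ac)
    ultimately show ?thesis by simp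
  qed
  have Mn: "M r n \<ge> 0" for n using r c\<^sub>0_pos by (simp add: M_def cW_majorant_def)
  have i: "integrable hl (\<lambda>y. c n * (W n y * \<phi> y))" for n using iW[OF r] by simp
  have s1: "AE y in hl. summable (\<lambda>n. norm (c n * (W n y * \<phi> y)))"
  proof (rule AE_hl_I)
    fix y :: real assume y: "y > 0"
    show "summable (\<lambda>n. norm (c n * (W n y * \<phi> y)))"
    proof (rule summable_comparison_test[OF _ sc])
      have "norm (c n * (W n y * \<phi> y)) \<le> \<bar>c n\<bar> * M r n" for n
      proof -
        have "\<bar>W n y * \<phi> y\<bar> \<le> M r n * 1"
          by (rule order_trans[OF bound[OF r y] mult_left_mono[OF _ Mn]]) (simp add: indicator_def)
        then show ?thesis by (simp add: abs_mult[of "c n"] mult_left_mono)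
      qed
      then show "\<exists>N. \<forall>n\<ge>N. norm (norm (c n * (W n y * \<phi> y))) \<le> \<bar>c n\<bar> * M r n" by auto
    qed
  qed
  have s2: "summable (\<lambda>n. LINT y|hl. norm (c n * (W n y * \<phi> y)))"
  proof (rule summable_comparison_test[OF _ summable_mult2[OF sc, of b]])
    have "(LINT y|hl. norm (c n * (W n y * \<phi> y))) \<le> \<bar>c n\<bar> * M r n * b" for n
    proof -
      have "(LINT y|hl. norm (c n * (W n y * \<phi> y))) = \<bar>c n\<bar> * (LINT y|hl. \<bar>W n y * \<phi> y\<bar>)"
        by (simp add: abs_mult[of "c n"])
      also have "\<dots> \<le> \<bar>c n\<bar> * (M r n * b)" by (rule mult_left_mono[OF nW[OF r]]) simp
      finally show ?thesis by simp
    qed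
    then show "\<exists>N. \<forall>n\<ge>N. norm (LINT y|hl. norm (c n * (W n y * \<phi> y))) \<le> \<bar>c n\<bar> * M r n * b" by auto
  qed
  have eq: "(\<Sum>n. c n * (W n y * \<phi> y)) = heat t x y * \<phi> y" if "y > 0" for y
    using sums_mult2[OF heat_sums[OF t that, of x], of "\<phi> y"] by (simp add: sums_iff c_def mult.assoc)
  show "integrable hl (\<lambda>y. heat t x y * \<phi> y)"
    using integrable_suminf[OF i s1 s2] by (simp only: hl_integrable_cong[OF eq])
  have "(\<lambda>n. LINT y|hl. c n * (W n y * \<phi> y)) sums (LINT y|hl. heat t x y * \<phi> y)"
    using sums_integral[OF i s1 s2] by (simp only: hl_cong[OF eq])
  moreover have "(LINT y|hl. c n * (W n y * \<phi> y)) = exp (- real n * t) * coeff \<phi> n * P n x" for n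
    unfolding integral_mult_right_zero coeff_def c_def real_scaleR_def by (simp only: mult_ac)
  ultimately show "(\<lambda>n. exp (- real n * t) * coeff \<phi> n * P n x) sums (LINT y|hl. heat t x y * \<phi> y)"
    by simp
qed

end

context gauss_laguerre
begin

text \<open>
  The expansion of a single function as a smooth function of time and space; the third variable is
  a dummy.
\<close>

lemma admissible_product_series:
  assumes "admissible f T"
  shows "product_series (\<lambda>i n. (deriv ^^ i) (P n)) (\<lambda>q n y. if q = 0 then coeff f n else 0) UNIV T"
proof
  fix q :: nat and y0 \<tau> :: real assume \<tau>: "\<tau> > T"
  obtain C where C: "\<And>n. \<bar>coeff f n\<bar> \<le> C * exp (\<tau> * real n)" using assms \<tau> by (auto simp: admissible_def)
  have "C \<ge> 0" using C[of 0] by simp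
  then show "\<exists>d>0. \<exists>C\<ge>0. \<forall>n y. \<bar>y - y0\<bar> < d \<longrightarrow> y \<in> UNIV \<and> \<bar>if q = 0 then coeff f n else 0\<bar> \<le> C * exp (\<tau> * real n)"
    using C by (intro exI[of _ 1] conjI exI[of _ C]) auto
qed (use P_has_deriv P_deriv_bound_exp in auto)

lemma P_series_continuous:
  assumes f: "admissible f T" and t: "t > T"
  shows "continuous_on A (P_series (\<lambda>n. exp (- real n * t) * coeff f n))"
proof -
  interpret ps: product_series "\<lambda>i n. (deriv ^^ i) (P n)" "\<lambda>q n y. if q = 0 then coeff f n else 0" UNIV T
    by (rule admissible_product_series[OF f])
  have "ps.S 0 0 0 (t, x, 1) = P_series (\<lambda>n. exp (- real n * t) * coeff f n) x" for x
    by (simp add: ps.S_def ps.tm_def P_series_def mult_ac)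
  moreover have "isCont (\<lambda>x. ps.S 0 0 0 (t, x, 1)) x" for x
    using ps.S_partial(2)[of t 1 0 0 0 x] t by (auto intro: DERIV_isCont)
  ultimately show ?thesis by (intro continuous_at_imp_continuous_on) auto
qed

text \<open>
  The expansion of \<open>P\<^sub>t \<phi>\<close> holds for almost every \<open>x > 0\<close>. By the Feller property both sides are
  continuous on \<open>[0, \<infinity>)\<close>, so they agree everywhere, also at \<open>x = 0\<close>.
\<close>

lemma sg_heat_continuous_test:
  assumes t: "t > 0" and x: "x \<ge> 0" and b: "b > 0" and \<phi>: "continuous_on UNIV \<phi>" "\<And>y. \<bar>\<phi> y\<bar> \<le> 1" "\<And>y. y > b \<Longrightarrow> \<phi> y = (0::real)"
  shows "sg K t \<phi> x = (LINT y|hl. heat t x y * \<phi> y)"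
proof -
  have m[measurable]: "\<phi> \<in> borel_measurable borel" using \<phi>(1) by (rule borel_measurable_continuous_onI)
  note bs = bounded_support_heat[OF t m b \<phi>(2,3)]
  have "integrable hl (\<lambda>x. ew x * (norm (\<phi> x))\<^sup>2)"
  proof (rule Bochner_Integration.integrable_bound)
    show "integrable hl ew" using ew_moment(1)[of 0] by simp
    show "AE x in hl. norm (ew x * (norm (\<phi> x))\<^sup>2) \<le> norm (ew x)"
    proof (rule AE_I2)
      fix x
      have "(norm (\<phi> x))\<^sup>2 \<le> 1\<^sup>2" using \<phi>(2)[of x] by (intro power_mono) auto
      then have "ew x * (norm (\<phi> x))\<^sup>2 \<le> ew x * 1" using ew_nonneg by (intro mult_left_mono) auto
      then show "norm (ew x * (norm (\<phi> x))\<^sup>2) \<le> norm (ew x)" using ew_nonneg[of x] by (simp add: abs_mult)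
    qed
  qed measurable
  then have "\<phi> \<in> L2 ew" by (simp add: L2_ew_iff)
  then have ad: "admissible \<phi> 0" using bs(3) by (simp add: admissible_def)
  have C0: "\<phi> \<in> C0"
  proof -
    have "\<forall>\<^sub>F y in at_top. \<phi> y = 0" using eventually_gt_at_top[of b] by eventually_elim (rule \<phi>(3))
    then have "(\<phi> \<longlongrightarrow> 0) at_top" by (rule tendsto_eventually)
    then show ?thesis using \<phi>(1) by (auto simp: C0_def intro: continuous_on_subset)
  qed
  have "sg K t \<phi> \<in> C0" using feller C0 t by (simp add: feller_semigroup_def)
  then have "continuous_on {0..} (sg K t \<phi>)" by (simp add: C0_def)
  from AE_hl_continuous_eq[OF this P_series_continuous[OF ad t] admissible_expansion(1)[OF ad t] x]
  have "sg K t \<phi> x = P_series (\<lambda>n. exp (- real n * t) * coeff \<phi> n) x" .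
  also have "\<dots> = (LINT y|hl. heat t x y * \<phi> y)"
    using bs(2)[where x=x] by (simp add: P_series_def sums_iff mult_ac)
  finally show ?thesis .
qed

text \<open>
  The indicator of \<open>(- \<infinity>, b]\<close> is the decreasing limit of continuous functions that vanish beyond
  \<open>b + 1\<close>.
\<close>

lemma K_cdf_heat:
  assumes t: "t > 0" and x: "x \<ge> 0" and b: "b \<ge> 0"
  shows "measure (K t x) {0..b} = (LINT y|hl. heat t x y * indicator {..b} y)"
proof -
  have t0: "t \<ge> 0" using t by simp
  interpret Kx: prob_space "K t x" by (rule K_prob[OF t0 x])
  note sK = K_sets[OF t0 x]
  define \<phi> where "\<phi> = (\<lambda>j y. max 0 (min 1 (1 - real (Suc j) * (y - b))))"
  have c: "continuous_on UNIV (\<phi> j)" for j unfolding \<phi>_def by (intro continuous_intros)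
  have m[measurable]: "\<phi> j \<in> borel_measurable borel" for j using c by (rule borel_measurable_continuous_onI)
  have b1: "\<bar>\<phi> j y\<bar> \<le> 1" for j y by (simp add: \<phi>_def)
  have z: "\<phi> j y = 0" if "y > b + 1" for j y
  proof -
    have "real (Suc j) * (y - b) \<ge> 1 * 1" using that by (intro mult_mono) auto
    then show ?thesis by (simp add: \<phi>_def)
  qed
  have lim: "(\<lambda>j. \<phi> j y) \<longlonglongrightarrow> indicator {..b} y" for y
  proof (cases "y \<le> b")
    case True
    have "\<phi> j y = 1" for j
    proof -
      have "real (Suc j) * (y - b) \<le> 0" using True by (intro mult_nonneg_nonpos) auto
      then show ?thesis by (simp add: \<phi>_def)
    qed
    then show ?thesis using True by simp
  next
    case False
    obtain J where J: "1 / (y - b) \<le> real J" using real_arch_simple by blast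
    have "\<phi> j y = 0" if "j \<ge> J" for j
    proof -
      have "1 / (y - b) \<le> real (Suc j)" using J that by simp
      then have "1 \<le> real (Suc j) * (y - b)" using False by (simp add: field_simps)
      then show ?thesis by (simp add: \<phi>_def)
    qed
    then have "\<forall>\<^sub>F j in sequentially. \<phi> j y = 0" by (auto simp: eventually_sequentially)
    then show ?thesis using False by (simp add: tendsto_eventually)
  qed
  have idm: "(\<lambda>y. y) \<in> K t x \<rightarrow>\<^sub>M (borel :: real measure)" by (rule K_ident_measurable[OF t0 x])
  have mK: "f \<in> borel_measurable (K t x)" if "f \<in> borel_measurable borel" for f :: "real \<Rightarrow> real"
    using measurable_compose[OF idm that] by simp
  have "(\<lambda>j. LINT y|K t x. \<phi> j y) \<longlonglongrightarrow> (LINT y|K t x. indicator {..b} y)"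
  proof (rule integral_dominated_convergence[where w="\<lambda>_. 1"])
    show "(\<lambda>y. indicator {..b} y :: real) \<in> borel_measurable (K t x)" by (rule mK) simp
    show "\<phi> j \<in> borel_measurable (K t x)" for j by (rule mK[OF m])
    show "integrable (K t x) (\<lambda>_. 1 :: real)" by simp
    show "AE y in K t x. (\<lambda>j. \<phi> j y) \<longlonglongrightarrow> indicator {..b} y" by (rule AE_I2[OF lim])
    show "AE y in K t x. norm (\<phi> j y) \<le> 1" for j by (rule AE_I2) (use b1 in simp)
  qed
  also have "(\<lambda>j. LINT y|K t x. \<phi> j y) = (\<lambda>j. LINT y|hl. heat t x y * \<phi> j y)"
  proof
    fix j
    show "(LINT y|K t x. \<phi> j y) = (LINT y|hl. heat t x y * \<phi> j y)"
      using sg_heat_continuous_test[OF t x _ c[of j] b1[of j], of "b + 1"] z[of _ j] b by (simp add: sg_def)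
  qed
  finally have 1: "(\<lambda>j. LINT y|hl. heat t x y * \<phi> j y) \<longlonglongrightarrow> (LINT y|K t x. indicator {..b} y)" .
  have ind1: "integrable hl (\<lambda>y. heat t x y * indicator {..b+1} y)"
    by (rule bounded_support_heat(1)[OF t, where b="b + 1"]) (use b in auto)
  have 2: "(\<lambda>j. LINT y|hl. heat t x y * \<phi> j y) \<longlonglongrightarrow> (LINT y|hl. heat t x y * indicator {..b} y)"
  proof (rule integral_dominated_convergence[where w="\<lambda>y. \<bar>heat t x y * indicator {..b+1} y\<bar>"])
    show "integrable hl (\<lambda>y. \<bar>heat t x y * indicator {..b+1} y\<bar>)" using ind1 by (rule integrable_abs)
    show "AE y in hl. (\<lambda>j. heat t x y * \<phi> j y) \<longlonglongrightarrow> heat t x y * indicator {..b} y"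
      by (intro AE_I2 tendsto_mult tendsto_const lim)
    have "\<bar>heat t x y * \<phi> j y\<bar> \<le> \<bar>heat t x y * indicator {..b+1} y\<bar>" for j y
    proof (cases "y \<le> b + 1")
      case True
      then show ?thesis using mult_left_mono[OF b1[of j y], of "\<bar>heat t x y\<bar>"] by (simp add: abs_mult)
    qed (use z[of y j] in simp)
    then show "AE y in hl. norm (heat t x y * \<phi> j y) \<le> \<bar>heat t x y * indicator {..b+1} y\<bar>" for j by auto
  qed (use heat_measurable[OF t] in measurable)
  have "(LINT y|K t x. indicator {..b} y) = (LINT y|K t x. indicator {0..b} y :: real)"
    by (rule Bochner_Integration.integral_cong) (auto simp: K_space[OF t0 x] indicator_def)
  also have "\<dots> = measure (K t x) {0..b}"
  proof -
    have "{0..b} \<in> sets (K t x)" unfolding sK by (auto simp: sets_restrict_space intro!: image_eqI[of _ _ "{..b}"])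
    then show ?thesis by simp
  qed
  finally show ?thesis using LIMSEQ_unique[OF 1 2] by simp
qed

text \<open>
  Where the continuous function \<open>heat t x\<close> is negative, its integral, a distribution function, would be
  strictly decreasing.
\<close>

lemma heat_nonneg:
  assumes t: "t > 0" and x: "x \<ge> 0" and y: "y > 0"
  shows "heat t x y \<ge> 0"
proof (rule ccontr)
  assume "\<not> heat t x y \<ge> 0"
  then have neg: "heat t x y < 0" by simp
  have t0: "t \<ge> 0" using t by simp
  interpret Kx: prob_space "K t x" by (rule K_prob[OF t0 x])
  have "isCont (heat t x) y" by (rule heat_continuous(2)[OF t y])
  moreover have "heat t x y < heat t x y / 2" using neg by simp
  ultimately have "\<forall>\<^sub>F z in nhds y. heat t x z < heat t x y / 2"
    by (intro order_tendstoD(2)[where y="heat t x y"]) (simp_all add: isCont_def tendsto_at_iff_tendsto_nhds)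
  then obtain d where d: "d > 0" "\<And>z. dist z y < d \<Longrightarrow> heat t x z < heat t x y / 2"
    unfolding eventually_nhds_metric by blast
  define c where "c = y + d / 2"
  have yc: "y < c" using d by (simp add: c_def)
  have ib: "integrable hl (\<lambda>z. heat t x z * indicator {..a} z)" if "a > 0" for a
    by (rule bounded_support_heat(1)[OF t, where b=a]) (use that in auto)
  have "measure (K t x) {0..y} \<le> measure (K t x) {0..c}"
  proof (rule Kx.finite_measure_mono)
    show "{0..c} \<in> sets (K t x)" by (simp add: K_sets[OF t0 x] sets_restrict_space_iff)
  qed (use yc in simp)
  then have "0 \<le> (LINT z|hl. heat t x z * indicator {..c} z) - (LINT z|hl. heat t x z * indicator {..y} z)"
    using K_cdf_heat[OF t x, of y] K_cdf_heat[OF t x, of c] y yc by simp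
  also have "\<dots> = (LINT z|hl. heat t x z * indicator {..c} z - heat t x z * indicator {..y} z)"
    using ib[of c] ib[of y] y yc by simp
  also have "\<dots> \<le> (LINT z|hl. heat t x y / 2 * indicator {y<..c} z)"
  proof (rule integral_mono_AE)
    show "integrable hl (\<lambda>z. heat t x z * indicator {..c} z - heat t x z * indicator {..y} z)" using ib[of c] ib[of y] y yc by simp
    have "integrable lborel (\<lambda>z. indicator {0<..} z *\<^sub>R (heat t x y / 2 * indicator {y<..c} z :: real))"
    proof -
      have "indicator {0<..} z *\<^sub>R (heat t x y / 2 * indicator {y<..c} z) = heat t x y / 2 * (indicator {y<..c} z :: real)" for z
        using y by (auto simp: indicator_def)
      moreover have "integrable lborel (\<lambda>z. heat t x y / 2 * indicator {y<..c} z :: real)"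
        by (intro integrable_mult_right integrable_real_indicator) (use yc in simp_all)
      ultimately show ?thesis by (simp only:)
    qed
    then show "integrable hl (\<lambda>z. heat t x y / 2 * indicator {y<..c} z :: real)" by (subst integrable_restrict_space) auto
    show "AE z in hl. heat t x z * indicator {..c} z - heat t x z * indicator {..y} z \<le> heat t x y / 2 * indicator {y<..c} z"
    proof (rule AE_I2)
      fix z
      show "heat t x z * indicator {..c} z - heat t x z * indicator {..y} z \<le> heat t x y / 2 * indicator {y<..c} z"
        using d(2)[of z] yc d(1) by (auto simp: indicator_def c_def dist_real_def)
    qed
  qed
  also have "\<dots> = heat t x y / 2 * (c - y)"
  proof -
    have "(LINT z|hl. indicator {y<..c} z :: real) = (LINT z|lborel. indicator {y<..c} z)"
    proof -
      have "indicator {0<..} z *\<^sub>R (indicator {y<..c} z :: real) = indicator {y<..c} z" for z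
        using y by (auto simp: indicator_def)
      then show ?thesis by (subst integral_restrict_space) (auto simp only:, auto)
    qed
    then show ?thesis using yc by simp
  qed
  also have "\<dots> < 0" using neg yc by (simp add: mult_neg_pos)
  finally show False by simp
qed

lemma K_distr_heat:
  assumes t: "t > 0" and x: "x \<ge> 0"
  shows "distr (K t x) borel (\<lambda>y. y) = density lborel (\<lambda>y. ennreal (indicator {0<..} y * heat t x y))"
proof -
  have t0: "t \<ge> 0" using t by simp
  interpret Kx: prob_space "K t x" by (rule K_prob[OF t0 x])
  have idm[measurable]: "(\<lambda>y. y) \<in> K t x \<rightarrow>\<^sub>M (borel :: real measure)" by (rule K_ident_measurable[OF t0 x])
  let ?N = "distr (K t x) borel (\<lambda>y. y)" and ?D = "density lborel (\<lambda>y. ennreal (indicator {0<..} y * heat t x y))"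
  have hm: "(\<lambda>y. indicator {0<..} y * heat t x y) \<in> borel_measurable borel"
    using heat_measurable[OF t, of x] by (simp add: borel_measurable_hl_iff)
  then have hm'[measurable]: "(\<lambda>y. ennreal (indicator {0<..} y * heat t x y)) \<in> borel_measurable borel"
    by (rule measurable_compose[OF _ measurable_ennreal])
  have hn: "indicator {0<..} y * heat t x y \<ge> 0" for y using heat_nonneg[OF t x, of y] by (auto simp: indicator_def)
  have Nb: "measure ?N {..b} = measure (K t x) ({..b} \<inter> {0..})" for b
    by (subst measure_distr) (auto simp: K_space[OF t0 x] vimage_def Int_def)
  have Db: "emeasure ?D {..b} = ennreal (measure ?N {..b})" for b
  proof (cases "b > 0")
    case False
    have "emeasure ?D {..b} = (\<integral>\<^sup>+y. ennreal (indicator {0<..} y * heat t x y) * indicator {..b} y \<partial>lborel)"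
      by (subst emeasure_density) auto
    also have "\<dots> = (\<integral>\<^sup>+(y::real). 0 \<partial>lborel)" using False by (intro nn_integral_cong) (auto simp: indicator_def)
    finally have "emeasure ?D {..b} = 0" by simp
    moreover have "measure ?N {..b} = 0"
    proof (cases "b = 0")
      case True
      have "{..b} \<inter> {0..} = {0..b}" by auto
      then have "measure ?N {..b} = (LINT y|hl. heat t x y * indicator {..0} y)" using Nb K_cdf_heat[OF t x, of 0] True by simp
      also have "\<dots> = (LINT y|hl. 0)" by (rule hl_cong) auto
      finally show ?thesis by simp
    next
      case F: False
      then have "{..b} \<inter> {0..} = {}" using False by auto
      then show ?thesis using Nb by simp
    qed
    ultimately show ?thesis by simp
  next
    case True
    have i: "integrable hl (\<lambda>y. heat t x y * indicator {..b} y)"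
      by (rule bounded_support_heat(1)[OF t, where b=b]) (use True in auto)
    have e: "indicator {0<..} y *\<^sub>R (heat t x y * indicator {..b} y) = indicator {0<..} y * heat t x y * indicator {..b} y" for y
      by simp
    have i': "integrable lborel (\<lambda>y. indicator {0<..} y * heat t x y * indicator {..b} y)"
      using i by (subst (asm) integrable_restrict_space) (auto simp only: e, auto)
    have "{..b} \<inter> {0..} = {0..b}" by auto
    then have "measure ?N {..b} = (LINT y|hl. heat t x y * indicator {..b} y)" using Nb K_cdf_heat[OF t x, of b] True by simp
    also have "\<dots> = (LINT y|lborel. indicator {0<..} y * heat t x y * indicator {..b} y)"
      by (subst integral_restrict_space) (auto simp only: e, auto)
    finally have "ennreal (measure ?N {..b}) = (\<integral>\<^sup>+y. ennreal (indicator {0<..} y * heat t x y * indicator {..b} y) \<partial>lborel)"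
      using hn by (subst nn_integral_eq_integral[OF i']) auto
    also have "\<dots> = (\<integral>\<^sup>+y. ennreal (indicator {0<..} y * heat t x y) * indicator {..b} y \<partial>lborel)"
      by (intro nn_integral_cong) (simp split: split_indicator)
    also have "\<dots> = emeasure ?D {..b}"
      by (rule emeasure_density[symmetric]) (use hm' in simp_all)
    finally show ?thesis by simp
  qed
  have Nprob: "prob_space ?N" by (rule Kx.prob_space_distr) measurable
  interpret N: prob_space ?N by (rule Nprob)
  have "emeasure ?D UNIV = (SUP n::nat. emeasure ?D {..real n})"
  proof -
    have "(\<Union>n::nat. {..real n}) = (UNIV :: real set)" using real_arch_simple by (auto simp: UNIV_eq_I)
    then show ?thesis by (subst SUP_emeasure_incseq) (auto simp: incseq_def)
  qed
  also have "\<dots> \<le> 1" unfolding Db by (intro SUP_least) (auto simp: N.prob_le_1)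
  finally have Dfin: "finite_measure ?D" by (intro finite_measureI) (auto simp: top_unique)
  show ?thesis
  proof (rule cdf_unique')
    show "finite_borel_measure ?N" by (simp add: finite_borel_measure_def finite_borel_measure_axioms_def N.finite_measure_axioms)
    show "finite_borel_measure ?D" using Dfin by (simp add: finite_borel_measure_def finite_borel_measure_axioms_def)
    show "cdf ?N = cdf ?D" by (rule ext) (simp add: cdf_def measure_def[of ?D] Db)
  qed
qed

lemma K_eq_heat_density:
  assumes t: "t > 0" and x: "x \<ge> 0"
  shows "K t x = density (restrict_space lborel {0..}) (\<lambda>y. ennreal (heat t x y))"
proof (rule measure_eqI)
  have t0: "t \<ge> 0" using t by simp
  note sK = K_sets[OF t0 x]
  have "sets (restrict_space lborel {0..}) = sets (half_line)" by (simp add: sets_restrict_space)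
  then show "sets (K t x) = sets (density (restrict_space lborel {0..}) (\<lambda>y. ennreal (heat t x y)))" by (simp add: sK)
  fix A assume "A \<in> sets (K t x)"
  then have A: "A \<in> sets borel" "A \<subseteq> {0..}" unfolding sK by (auto simp: sets_restrict_space)
  have Ar: "A \<in> sets (restrict_space lborel {0..})" using A by (auto simp: sets_restrict_space intro!: image_eqI[of _ _ A])
  have hm: "(\<lambda>y. indicator {0<..} y * heat t x y) \<in> borel_measurable borel"
    using heat_measurable[OF t, of x] by (simp add: borel_measurable_hl_iff)
  then have hm'[measurable]: "(\<lambda>y. ennreal (indicator {0<..} y * heat t x y)) \<in> borel_measurable borel"
    by (rule measurable_compose[OF _ measurable_ennreal])
  have hr: "heat t x \<in> borel_measurable (restrict_space lborel {0..})"
    using hl_measurable_half_line[OF heat_measurable[OF t]] by (simp add: measurable_def space_restrict_space sets_restrict_space)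
  then have hr': "(\<lambda>y. ennreal (heat t x y)) \<in> borel_measurable (restrict_space lborel {0..})"
    by (rule measurable_compose[OF _ measurable_ennreal])
  have "emeasure (K t x) A = emeasure (distr (K t x) borel (\<lambda>y. y)) A"
    using A K_ident_measurable[OF t0 x] by (subst emeasure_distr) (auto simp: K_space[OF t0 x] Int_absorb2)
  also have "\<dots> = (\<integral>\<^sup>+y. ennreal (indicator {0<..} y * heat t x y) * indicator A y \<partial>lborel)"
    unfolding K_distr_heat[OF t x] using A by (subst emeasure_density) auto
  also have "\<dots> = (\<integral>\<^sup>+y. ennreal (heat t x y) * indicator A y * indicator {0..} y \<partial>lborel)"
    by (rule nn_integral_cong_AE) (use AE_lborel_singleton[of "0::real"] in \<open>eventually_elim, auto simp: indicator_def\<close>)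
  also have "\<dots> = (\<integral>\<^sup>+y. ennreal (heat t x y) * indicator A y \<partial>restrict_space lborel {0..})"
    by (subst nn_integral_restrict_space) auto
  also have "\<dots> = emeasure (density (restrict_space lborel {0..}) (\<lambda>y. ennreal (heat t x y))) A"
    by (rule emeasure_density[OF hr' Ar, symmetric])
  finally show "emeasure (K t x) A = emeasure (density (restrict_space lborel {0..}) (\<lambda>y. ennreal (heat t x y))) A" .
qed

lemma heat_total:
  assumes t: "t > 0" and x: "x \<ge> 0"
  shows "integrable hl (heat t x)" "(\<integral>\<^sup>+y. ennreal (norm (heat t x y)) \<partial>hl) = 1"
proof -
  have t0: "t \<ge> 0" using t by simp
  interpret Kx: prob_space "K t x" by (rule K_prob[OF t0 x])
  have hm: "(\<lambda>y. indicator {0<..} y * heat t x y) \<in> borel_measurable borel"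
    using heat_measurable[OF t, of x] by (simp add: borel_measurable_hl_iff)
  then have hm'[measurable]: "(\<lambda>y. ennreal (indicator {0<..} y * heat t x y)) \<in> borel_measurable borel"
    by (rule measurable_compose[OF _ measurable_ennreal])
  have "prob_space (distr (K t x) borel (\<lambda>y. y))"
    by (rule Kx.prob_space_distr[OF K_ident_measurable[OF t0 x]])
  then have "emeasure (distr (K t x) borel (\<lambda>y. y)) UNIV = 1" using prob_space.emeasure_space_1 by fastforce
  then have "(\<integral>\<^sup>+y. ennreal (indicator {0<..} y * heat t x y) \<partial>lborel) = 1"
    unfolding K_distr_heat[OF t x] by (subst (asm) emeasure_density) auto
  moreover have "(\<integral>\<^sup>+y. ennreal (norm (heat t x y)) \<partial>hl) = (\<integral>\<^sup>+y. ennreal (indicator {0<..} y * heat t x y) \<partial>lborel)"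
    using heat_nonneg[OF t x]
    by (subst nn_integral_restrict_space) (auto intro!: nn_integral_cong simp: indicator_def)
  ultimately show n: "(\<integral>\<^sup>+y. ennreal (norm (heat t x y)) \<partial>hl) = 1" by simp
  show "integrable hl (heat t x)" by (rule integrableI_bounded[OF heat_measurable[OF t]]) (use n in simp)
qed

lemma sg_heat:
  fixes f :: "real \<Rightarrow> real"
  assumes t: "t > 0" and x: "x \<ge> 0" and f: "f \<in> borel_measurable hl" and i: "integrable hl (\<lambda>y. heat t x y * f y)"
  shows "sg K t f x = (LINT y|hl. heat t x y * f y)"
  by (rule kernel_integral_hl(2)[OF _ x K_distr_heat[OF t x] _ heat_measurable[OF t] f i])
     (use t heat_nonneg[OF t x] in \<open>auto simp: indicator_def\<close>)

text \<open>
  If \<open>x\<^sub>n \<rightarrow> x\<close>, the probability densities \<open>heat t x\<^sub>n\<close> converge pointwise to the probability density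
  \<open>heat t x\<close>, hence in \<open>L\<^sup>1\<close> by Scheffe's lemma.
\<close>

lemma strong_feller:
  fixes f :: "real \<Rightarrow> real"
  assumes t: "t > 0" and f: "f \<in> borel_measurable half_line" and bd: "bounded (f ` {0..})"
  shows "bounded (sg K t f ` {0..})" "continuous_on {0..} (sg K t f)"
proof -
  obtain M where M: "\<And>y. y \<ge> 0 \<Longrightarrow> \<bar>f y\<bar> \<le> M" using bd by (auto simp: bounded_iff)
  have M0: "M \<ge> 0" using M[of 0] by simp
  have fm[measurable]: "f \<in> borel_measurable hl"
  proof -
    have 1: "(\<lambda>x. indicator {0..} x *\<^sub>R f x) \<in> borel_measurable borel"
      using f by (subst (asm) borel_measurable_restrict_space_iff) auto
    have "(\<lambda>x. indicator {0<..} x *\<^sub>R (indicator {0..} x *\<^sub>R f x)) \<in> borel_measurable borel" using 1 by measurable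
    moreover have "(\<lambda>x. indicator {0<..} x *\<^sub>R (indicator {0..} x *\<^sub>R f x)) = (\<lambda>x. indicator {0<..} x *\<^sub>R f x)"
      by (auto simp: fun_eq_iff indicator_def)
    ultimately show ?thesis by (simp add: borel_measurable_hl_iff)
  qed
  note hm[measurable] = heat_measurable[OF t]
  have i: "integrable hl (\<lambda>y. g y * f y)" if g: "integrable hl g" for g
  proof (rule Bochner_Integration.integrable_bound[OF integrable_mult_right[OF g, of M]])
    show "AE y in hl. norm (g y * f y) \<le> norm (M * g y)"
      using M M0 by (intro AE_hl_I) (auto simp: abs_mult mult.commute[of "\<bar>g _\<bar>"] intro!: mult_right_mono)
  qed (use g in measurable)
  have eq: "sg K t f x = (LINT y|hl. heat t x y * f y)" if "x \<ge> 0" for x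
    by (rule sg_heat[OF t that fm i[OF heat_total(1)[OF t that]]])
  have bnd: "\<bar>LINT y|hl. g y * f y\<bar> \<le> M * (LINT y|hl. \<bar>g y\<bar>)" if g: "integrable hl g" for g
  proof -
    have "\<bar>LINT y|hl. g y * f y\<bar> \<le> (LINT y|hl. \<bar>g y * f y\<bar>)" by (rule integral_abs_bound)
    also have "\<dots> \<le> (LINT y|hl. M * \<bar>g y\<bar>)"
      by (rule integral_mono_AE[OF integrable_abs[OF i[OF g]] integrable_mult_right[OF integrable_abs[OF g]]]) (use M M0 in \<open>auto intro!: AE_hl_I mult_right_mono simp: abs_mult mult.commute[of "\<bar>g _\<bar>"]\<close>)
    finally show ?thesis by simp
  qed
  have one: "(LINT y|hl. \<bar>heat t x y\<bar>) = 1" if "x \<ge> 0" for x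
  proof -
    have "ennreal (LINT y|hl. \<bar>heat t x y\<bar>) = 1"
      using heat_total[OF t that] by (subst nn_integral_eq_integral[symmetric]) auto
    then show ?thesis by simp
  qed
  show "bounded (sg K t f ` {0..})"
    unfolding bounded_iff
  proof (intro exI ballI)
    fix v assume "v \<in> sg K t f ` {0..}"
    then obtain x where x: "x \<ge> 0" "v = sg K t f x" by auto
    show "norm v \<le> M" using bnd[OF heat_total(1)[OF t x(1)]] one[OF x(1)] eq[OF x(1)] x(2) by simp
  qed
  show "continuous_on {0..} (sg K t f)"
    unfolding continuous_on_sequentially o_def
  proof (intro allI ballI impI)
    fix X :: "nat \<Rightarrow> real" and x assume x: "x \<in> {0..}" and X: "(\<forall>n. X n \<in> {0..}) \<and> X \<longlonglongrightarrow> x"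
    then have x0: "x \<ge> 0" and X0: "\<And>n. X n \<ge> 0" and Xl: "X \<longlonglongrightarrow> x" by auto
    note ix = heat_total[OF t x0] and iX = heat_total[OF t X0]
    have "(\<lambda>n. \<integral>\<^sup>+y. norm (heat t (X n) y - heat t x y) \<partial>hl) \<longlonglongrightarrow> 0"
    proof (rule Scheffe_lemma2)
      show "AE y in hl. (\<lambda>n. heat t (X n) y) \<longlonglongrightarrow> heat t x y"
        using heat_continuous(1)[OF t] Xl by (intro AE_hl_I) (auto intro: isCont_tendsto_compose)
    qed (use ix iX in auto)
    moreover have "(\<integral>\<^sup>+y. norm (heat t (X n) y - heat t x y) \<partial>hl) = ennreal (LINT y|hl. \<bar>heat t (X n) y - heat t x y\<bar>)" for n
      using ix iX by (subst nn_integral_eq_integral) auto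
    ultimately have "(\<lambda>n. ennreal (LINT y|hl. \<bar>heat t (X n) y - heat t x y\<bar>)) \<longlonglongrightarrow> ennreal 0" by simp
    then have l1: "(\<lambda>n. LINT y|hl. \<bar>heat t (X n) y - heat t x y\<bar>) \<longlonglongrightarrow> 0"
      by (subst (asm) tendsto_ennreal_iff) auto
    have bd: "\<bar>sg K t f (X n) - sg K t f x\<bar> \<le> M * (LINT y|hl. \<bar>heat t (X n) y - heat t x y\<bar>)" for n
    proof -
      have "sg K t f (X n) - sg K t f x = (LINT y|hl. (heat t (X n) y - heat t x y) * f y)"
        unfolding eq[OF X0] eq[OF x0] using i[OF iX(1)] i[OF ix(1)] by (simp add: left_diff_distrib)
      then show ?thesis using bnd[of "\<lambda>y. heat t (X n) y - heat t x y"] ix iX by simp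
    qed
    have "(\<lambda>n. sg K t f (X n) - sg K t f x) \<longlonglongrightarrow> 0"
    proof (rule Lim_null_comparison)
      show "\<forall>\<^sub>F n in sequentially. norm (sg K t f (X n) - sg K t f x) \<le> M * (LINT y|hl. \<bar>heat t (X n) y - heat t x y\<bar>)"
        unfolding real_norm_def by (rule always_eventually[OF allI[OF bd]])
      show "(\<lambda>n. M * (LINT y|hl. \<bar>heat t (X n) y - heat t x y\<bar>)) \<longlonglongrightarrow> 0"
        by (rule tendsto_mult_right_zero[OF l1])
    qed
    then show "(\<lambda>n. sg K t f (X n)) \<longlonglongrightarrow> sg K t f x" by (rule LIM_zero_cancel)
  qed
qed

end

section \<open>Holomorphy in the time parameter\<close>

text \<open>Exponential decay strictly faster than the rate \<open>exp (- \<tau> n)\<close>, which is what compensates the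
  growth of the coefficients of a square-integrable function.\<close>

definition decays_beyond :: "real \<Rightarrow> (nat \<Rightarrow> complex) \<Rightarrow> bool" where
  "decays_beyond \<tau> m \<longleftrightarrow> (\<exists>M \<sigma>. \<sigma> > \<tau> \<and> (\<forall>n. norm (m n) \<le> M * exp (- \<sigma> * real n)))"

lemma decays_beyond_power:
  assumes m: "\<And>n. norm (m n) \<le> M * (real n ^ k * exp (- \<sigma> * real n))" and \<sigma>: "\<sigma> > \<tau>" and M: "M \<ge> 0"
  shows "decays_beyond \<tau> m"
proof -
  define \<epsilon> where "\<epsilon> = (\<sigma> - \<tau>) / 2"
  have \<epsilon>: "\<epsilon> > 0" using \<sigma> by (simp add: \<epsilon>_def)
  have "norm (m n) \<le> M * (fact k / \<epsilon> ^ k) * exp (- (\<sigma> - \<epsilon>) * real n)" for n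
  proof -
    have "real n ^ k * exp (- \<sigma> * real n) \<le> fact k / \<epsilon> ^ k * exp (\<epsilon> * real n) * exp (- \<sigma> * real n)"
      using power_le_exp_scaled[OF \<epsilon>, of "real n" k] by (intro mult_right_mono) auto
    also have "\<dots> = fact k / \<epsilon> ^ k * exp (- (\<sigma> - \<epsilon>) * real n)" by (simp add: algebra_simps flip: exp_add)
    finally have le: "real n ^ k * exp (- \<sigma> * real n) \<le> fact k / \<epsilon> ^ k * exp (- (\<sigma> - \<epsilon>) * real n)" .
    show ?thesis using order_trans[OF m mult_left_mono[OF le M]] by (simp only: mult.assoc)
  qed
  moreover have "\<sigma> - \<epsilon> > \<tau>" using \<sigma> by (simp add: \<epsilon>_def field_simps)
  ultimately show ?thesis unfolding decays_beyond_def by blast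
qed

lemma decays_beyond_summable:
  assumes "decays_beyond \<tau> m"
  shows "summable (\<lambda>n. norm (m n) * exp (\<tau> * real n))"
proof -
  obtain M \<sigma> where \<sigma>: "\<sigma> > \<tau>" and m: "\<And>n. norm (m n) \<le> M * exp (- \<sigma> * real n)"
    using assms by (auto simp: decays_beyond_def)
  show ?thesis
  proof (rule summable_comparison_test)
    show "summable (\<lambda>n. M * exp (- (\<sigma> - \<tau>)) ^ n)" using \<sigma> by (intro summable_mult summable_geometric) auto
    have "norm (m n) * exp (\<tau> * real n) \<le> M * exp (- \<sigma> * real n) * exp (\<tau> * real n)" for n
      using m by (intro mult_right_mono) auto
    also have "M * exp (- \<sigma> * real n) * exp (\<tau> * real n) = M * exp (- (\<sigma> - \<tau>)) ^ n" for n
      by (simp add: exp_of_nat_mult[symmetric] algebra_simps flip: exp_add)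
    finally show "\<exists>N. \<forall>n\<ge>N. norm (norm (m n) * exp (\<tau> * real n)) \<le> M * exp (- (\<sigma> - \<tau>)) ^ n" by auto
  qed
qed

text \<open>
  Taylor's formula of first order on the half-plane \<open>Re \<ge> \<sigma>\<close>, on which the second derivative of
  \<open>exp(- n z)\<close> is bounded by \<open>n\<^sup>2 exp(- n \<sigma>)\<close>.
\<close>

lemma exp_difference_quotient:
  fixes z w :: complex
  assumes "Re z \<ge> \<sigma>" "Re w \<ge> \<sigma>" "z \<noteq> w"
  shows "cmod ((exp (- of_nat n * z) - exp (- of_nat n * w)) / (z - w) - (- of_nat n * exp (- of_nat n * w)))
      \<le> cmod (z - w) * (real n ^ 2 * exp (- \<sigma> * real n))"
proof -
  let ?f = "\<lambda>i z. (- of_nat n) ^ i * exp (- of_nat n * z) :: complex"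
  have "cmod (?f 0 z - (\<Sum>i\<le>1. ?f i w * (z - w) ^ i / fact i)) \<le> (real n ^ 2 * exp (- \<sigma> * real n)) * cmod (z - w) ^ Suc 1 / fact 1"
  proof (rule complex_Taylor[of "{z. Re z \<ge> \<sigma>}"])
    show "convex {z. Re z \<ge> \<sigma>}" by (rule convex_halfspace_Re_ge)
    show "(?f i has_field_derivative ?f (Suc i) x) (at x within {z. Re z \<ge> \<sigma>})" for i x
      by (auto intro!: derivative_eq_intros)
    show "cmod (?f (Suc 1) x) \<le> real n ^ 2 * exp (- \<sigma> * real n)" if "x \<in> {z. Re z \<ge> \<sigma>}" for x
      using that by (auto simp: norm_mult norm_power power2_eq_square mult.commute[of \<sigma>] intro!: mult_left_mono)
  qed (use assms in auto)
  then have le: "cmod (exp (- of_nat n * z) - exp (- of_nat n * w) - (- of_nat n * exp (- of_nat n * w)) * (z - w))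
      \<le> (cmod (z - w) * (real n ^ 2 * exp (- \<sigma> * real n))) * cmod (z - w)"
    by (simp add: power2_eq_square algebra_simps)
  have nz: "cmod (z - w) > 0" using assms by simp
  have alg: "(a - b) / d - c = (a - b - c * d) / d" if "d \<noteq> 0" for a b c d :: complex
    using that by (simp add: diff_divide_distrib)
  have "(exp (- of_nat n * z) - exp (- of_nat n * w)) / (z - w) - (- of_nat n * exp (- of_nat n * w))
      = (exp (- of_nat n * z) - exp (- of_nat n * w) - (- of_nat n * exp (- of_nat n * w)) * (z - w)) / (z - w)"
    by (rule alg) (use assms in simp)
  then show ?thesis using le nz by (simp only: norm_divide pos_divide_le_eq)
qed

context gauss_laguerre
begin

text \<open>
  Differences and limits of these operators correspond to those of the sequences \<open>m\<close>; by the bound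
  below, convergence in operator norm follows from convergence of \<open>\<Sum>n. |m n| exp(\<tau> n)\<close>.
\<close>

definition multiplier_op :: "(nat \<Rightarrow> complex) \<Rightarrow> (real \<Rightarrow> complex) \<Rightarrow> real \<Rightarrow> complex" where
  "multiplier_op m f = P_series (\<lambda>n. m n * coeff f n)"

lemma multiplier_op_bound:
  assumes \<tau>: "\<tau> > T_crit \<alpha>"
  shows "\<exists>C\<ge>0. \<forall>m. \<forall>f\<in>L2 ew. decays_beyond \<tau> m \<longrightarrow> geometric_decay (\<lambda>n. m n * coeff f n) \<and> multiplier_op m f \<in> L2 ew \<and>
      L2_norm ew (multiplier_op m f) \<le> C * (\<Sum>n. norm (m n) * exp (\<tau> * real n)) * L2_norm ew f"
proof -
  obtain C where C: "C \<ge> 0" "\<And>n (f :: real \<Rightarrow> complex). f \<in> L2 ew \<Longrightarrow> norm (coeff f n) \<le> C * exp (\<tau> * real n) * L2_norm ew f"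
    using coeff_L2_bound[OF \<tau>, where 'b=complex] by blast
  have "geometric_decay (\<lambda>n. m n * coeff f n) \<and> multiplier_op m f \<in> L2 ew \<and>
      L2_norm ew (multiplier_op m f) \<le> C * (\<Sum>n. norm (m n) * exp (\<tau> * real n)) * L2_norm ew f"
    if f: "f \<in> L2 ew" and m: "decays_beyond \<tau> m" for m f
  proof (intro conjI)
    let ?L = "L2_norm ew f"
    have L0: "?L \<ge> 0" by (simp add: L2_norm_def)
    have le: "norm (m n * coeff f n) \<le> C * ?L * (norm (m n) * exp (\<tau> * real n))" for n
      using mult_left_mono[OF C(2)[OF f, of n], of "norm (m n)"] by (simp add: norm_mult mult_ac)
    show g: "geometric_decay (\<lambda>n. m n * coeff f n)"
    proof -
      obtain M \<sigma> where \<sigma>: "\<sigma> > \<tau>" and M: "\<And>n. norm (m n) \<le> M * exp (- \<sigma> * real n)"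
        using m by (auto simp: decays_beyond_def)
      have "norm (m n * coeff f n) \<le> C * ?L * M * exp (\<tau> - \<sigma>) ^ n" for n
      proof -
        have "C * ?L * (norm (m n) * exp (\<tau> * real n)) \<le> C * ?L * (M * exp (- \<sigma> * real n) * exp (\<tau> * real n))"
          using M C(1) L0 by (intro mult_left_mono mult_right_mono) auto
        also have "\<dots> = C * ?L * M * exp (\<tau> - \<sigma>) ^ n"
          by (simp add: exp_of_nat_mult[symmetric] algebra_simps flip: exp_add)
        finally show ?thesis using le[of n] by simp
      qed
      then show ?thesis using \<sigma> unfolding geometric_decay_def
        by (intro exI[of _ "C * ?L * M"] exI[of _ "exp (\<tau> - \<sigma>)"]) auto
    qed
    show "multiplier_op m f \<in> L2 ew" unfolding multiplier_op_def by (rule P_series_L2(1)[OF g])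
    have "L2_norm ew (multiplier_op m f) \<le> (\<Sum>n. norm (m n * coeff f n))"
      unfolding multiplier_op_def by (rule P_series_L2(2)[OF g])
    also have "\<dots> \<le> (\<Sum>n. C * ?L * (norm (m n) * exp (\<tau> * real n)))"
      by (rule suminf_le[OF le geometric_decay_summable[OF g] summable_mult[OF decays_beyond_summable[OF m]]])
    also have "\<dots> = C * ?L * (\<Sum>n. norm (m n) * exp (\<tau> * real n))"
      by (rule suminf_mult[OF decays_beyond_summable[OF m]])
    finally show "L2_norm ew (multiplier_op m f) \<le> C * (\<Sum>n. norm (m n) * exp (\<tau> * real n)) * ?L"
      by (simp only: mult_ac)
  qed
  then show ?thesis using C(1) by blast
qed

lemma multiplier_op_sums:
  assumes "\<tau> > T_crit \<alpha>" "decays_beyond \<tau> m" "f \<in> L2 ew"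
  shows "(\<lambda>n. P n x *\<^sub>R (m n * coeff f n)) sums multiplier_op m f x"
  using multiplier_op_bound[OF assms(1)] assms(2,3) P_series_sums unfolding multiplier_op_def by blast

lemma multiplier_op_bounded_op:
  assumes \<tau>: "\<tau> > T_crit \<alpha>" and m: "decays_beyond \<tau> m"
  shows "bounded_op ew (multiplier_op m)"
  unfolding bounded_op_def
proof (intro conjI ballI allI)
  obtain C where C: "\<And>m f. decays_beyond \<tau> m \<Longrightarrow> f \<in> L2 ew \<Longrightarrow> multiplier_op m f \<in> L2 ew \<and>
      L2_norm ew (multiplier_op m f) \<le> C * (\<Sum>n. norm (m n) * exp (\<tau> * real n)) * L2_norm ew f"
    using multiplier_op_bound[OF \<tau>] by blast
  show "multiplier_op m f \<in> L2 ew" if "f \<in> L2 ew" for f using C[OF m that] by simp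
  show "\<exists>C. \<forall>f\<in>L2 ew. L2_norm ew (multiplier_op m f) \<le> C * L2_norm ew f" using C[OF m] by blast
  fix f g :: "real \<Rightarrow> complex" and a b assume f: "f \<in> L2 ew" and g: "g \<in> L2 ew"
  obtain C' where i: "\<And>n f. f \<in> L2 ew \<Longrightarrow> integrable hl (\<lambda>y. W n y *\<^sub>R (f y :: complex))"
    using coeff_L2_bound[OF \<tau>, where 'b=complex] by blast
  have c: "coeff (\<lambda>y. a * f y + b * g y) n = a * coeff f n + b * coeff g n" for n
  proof -
    have "W n y *\<^sub>R (a * f y + b * g y) = a * (W n y *\<^sub>R f y) + b * (W n y *\<^sub>R g y)" for y
      by (simp add: scaleR_add_right mult_scaleR_right)
    then have "coeff (\<lambda>y. a * f y + b * g y) n = (LINT y|hl. a * (W n y *\<^sub>R f y) + b * (W n y *\<^sub>R g y))"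
      by (simp only: coeff_def)
    also have "\<dots> = (LINT y|hl. a * (W n y *\<^sub>R f y)) + (LINT y|hl. b * (W n y *\<^sub>R g y))"
      by (intro Bochner_Integration.integral_add integrable_mult_right i f g)
    finally show ?thesis by (simp only: coeff_def integral_mult_right_zero)
  qed
  have "multiplier_op m (\<lambda>y. a * f y + b * g y) x = a * multiplier_op m f x + b * multiplier_op m g x" for x
  proof -
    have "(\<lambda>n. a * (P n x *\<^sub>R (m n * coeff f n)) + b * (P n x *\<^sub>R (m n * coeff g n))) sums (a * multiplier_op m f x + b * multiplier_op m g x)"
      by (intro sums_add sums_mult multiplier_op_sums[OF \<tau> m] f g)
    moreover have "a * (P n x *\<^sub>R (m n * coeff f n)) + b * (P n x *\<^sub>R (m n * coeff g n)) = P n x *\<^sub>R (m n * coeff (\<lambda>y. a * f y + b * g y) n)" for n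
      unfolding c by (simp add: scaleR_conv_of_real algebra_simps)
    ultimately show ?thesis by (simp add: multiplier_op_def P_series_def sums_iff)
  qed
  then show "AE x in wmeas ew. multiplier_op m (\<lambda>y. a * f y + b * g y) x = a * multiplier_op m f x + b * multiplier_op m g x" by simp
qed

definition complex_sg :: "complex \<Rightarrow> (real \<Rightarrow> complex) \<Rightarrow> real \<Rightarrow> complex" where
  "complex_sg z = multiplier_op (\<lambda>n. exp (- of_nat n * z))"

lemma exp_decays_beyond: "Re z > \<tau> \<Longrightarrow> decays_beyond \<tau> (\<lambda>n. exp (- of_nat n * z))"
  by (rule decays_beyond_power[where M=1 and k=0 and \<sigma>="Re z"]) (auto simp: mult.commute)

text \<open>
  The derivative at \<open>w\<close> multiplies the \<open>n\<close>-th coefficient by \<open>- n exp(- n w)\<close>. The distance from \<open>w\<close>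
  to the critical line is divided into four parts of length \<open>\<rho>\<close>: the points \<open>z\<close> considered lie within
  \<open>\<rho>\<close> of \<open>w\<close>, and between \<open>\<sigma>\<close>, the rate of decay of the error of the difference quotient, and \<open>\<tau>\<close>,
  the rate of growth of the coefficients, there remains a gap.
\<close>

lemma complex_sg_holomorphic: "op_holomorphic_on ew complex_sg {z. Re z > T_crit \<alpha>}"
  unfolding op_holomorphic_on_def
proof (intro conjI ballI)
  fix z :: complex assume "z \<in> {z. Re z > T_crit \<alpha>}"
  then have \<tau>: "(T_crit \<alpha> + Re z) / 2 > T_crit \<alpha>" "Re z > (T_crit \<alpha> + Re z) / 2" by auto
  show "bounded_op ew (complex_sg z)" unfolding complex_sg_def
    by (rule multiplier_op_bounded_op[OF \<tau>(1) exp_decays_beyond[OF \<tau>(2)]])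
next
  fix w :: complex assume "w \<in> {z. Re z > T_crit \<alpha>}"
  define \<rho> where "\<rho> = (Re w - T_crit \<alpha>) / 4"
  have \<rho>: "\<rho> > 0" using \<open>w \<in> _\<close> by (simp add: \<rho>_def)
  define \<tau> \<sigma> where "\<tau> = T_crit \<alpha> + \<rho>" and "\<sigma> = T_crit \<alpha> + 3 * \<rho>"
  have \<tau>: "\<tau> > T_crit \<alpha>" and \<sigma>\<tau>: "\<sigma> > \<tau>" and w\<sigma>: "Re w = \<sigma> + \<rho>" using \<rho> by (auto simp: \<tau>_def \<sigma>_def \<rho>_def field_simps)
  define d :: "nat \<Rightarrow> complex" where "d = (\<lambda>n. - of_nat n * exp (- of_nat n * w))"
  have d: "decays_beyond \<tau> d"
    by (rule decays_beyond_power[where M=1 and k=1 and \<sigma>="Re w"]) (use w\<sigma> \<sigma>\<tau> \<rho> in \<open>auto simp: d_def norm_mult algebra_simps\<close>)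
  obtain C where C: "C \<ge> 0" "\<And>m f. decays_beyond \<tau> m \<Longrightarrow> f \<in> L2 ew \<Longrightarrow>
      L2_norm ew (multiplier_op m f) \<le> C * (\<Sum>n. norm (m n) * exp (\<tau> * real n)) * L2_norm ew f"
    using multiplier_op_bound[OF \<tau>] by blast
  define S where "S = (\<Sum>n. real n ^ 2 * exp (- (\<sigma> - \<tau>) * real n))"
  have sS: "summable (\<lambda>n. real n ^ 2 * exp (- (\<sigma> - \<tau>) * real n))" using \<sigma>\<tau> by (intro summable_power_exp) simp
  have S0: "S \<ge> 0" unfolding S_def by (rule suminf_nonneg[OF sS]) simp
  have key: "L2_norm ew (\<lambda>x. (complex_sg z f x - complex_sg w f x) / (z - w) - multiplier_op d f x) \<le> C * (cmod (z - w) * S) * L2_norm ew f"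
    if zw: "z \<noteq> w" "cmod (z - w) < \<rho>" and f: "f \<in> L2 ew" for z f
  proof -
    have "\<bar>Re z - Re w\<bar> \<le> cmod (z - w)" using abs_Re_le_cmod[of "z - w"] by simp
    then have rz: "Re z \<ge> \<sigma>" and rw: "Re w \<ge> \<sigma>" using zw(2) w\<sigma> \<rho> by auto
    define q where "q = (\<lambda>n. (exp (- of_nat n * z) - exp (- of_nat n * w)) / (z - w) - d n)"
    have qb: "norm (q n) \<le> cmod (z - w) * (real n ^ 2 * exp (- \<sigma> * real n))" for n
      unfolding q_def d_def by (rule exp_difference_quotient[OF rz rw zw(1)])
    have q: "decays_beyond \<tau> q" by (rule decays_beyond_power[OF qb \<sigma>\<tau>]) simp
    have "(\<lambda>x. (complex_sg z f x - complex_sg w f x) / (z - w) - multiplier_op d f x) = multiplier_op q f"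
    proof
      fix x
      have dz: "decays_beyond \<tau> (\<lambda>n. exp (- of_nat n * z))" "decays_beyond \<tau> (\<lambda>n. exp (- of_nat n * w))"
        by (rule exp_decays_beyond, use rz rw \<sigma>\<tau> in linarith)+
      have "(\<lambda>n. (P n x *\<^sub>R (exp (- of_nat n * z) * coeff f n) - P n x *\<^sub>R (exp (- of_nat n * w) * coeff f n)) / (z - w) - P n x *\<^sub>R (d n * coeff f n))
          sums ((complex_sg z f x - complex_sg w f x) / (z - w) - multiplier_op d f x)"
        unfolding complex_sg_def by (intro sums_diff sums_divide multiplier_op_sums[OF \<tau>] dz d f)
      moreover have "(P n x *\<^sub>R (exp (- of_nat n * z) * coeff f n) - P n x *\<^sub>R (exp (- of_nat n * w) * coeff f n)) / (z - w) - P n x *\<^sub>R (d n * coeff f n)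
          = P n x *\<^sub>R (q n * coeff f n)" for n
        by (simp add: q_def scaleR_conv_of_real diff_divide_distrib algebra_simps)
      ultimately show "(complex_sg z f x - complex_sg w f x) / (z - w) - multiplier_op d f x = multiplier_op q f x"
        by (simp add: multiplier_op_def[of q] P_series_def sums_iff)
    qed
    then have "L2_norm ew (\<lambda>x. (complex_sg z f x - complex_sg w f x) / (z - w) - multiplier_op d f x)
        \<le> C * (\<Sum>n. norm (q n) * exp (\<tau> * real n)) * L2_norm ew f" using C(2)[OF q f] by simp
    also have "\<dots> \<le> C * (cmod (z - w) * S) * L2_norm ew f"
    proof -
      have "norm (q n) * exp (\<tau> * real n) \<le> cmod (z - w) * (real n ^ 2 * exp (- (\<sigma> - \<tau>) * real n))" for n
      proof -
        have "norm (q n) * exp (\<tau> * real n) \<le> cmod (z - w) * (real n ^ 2 * exp (- \<sigma> * real n)) * exp (\<tau> * real n)"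
          by (rule mult_right_mono[OF qb]) simp
        also have "\<dots> = cmod (z - w) * (real n ^ 2 * exp (- (\<sigma> - \<tau>) * real n))"
          by (simp add: mult.assoc exp_add[symmetric] algebra_simps)
        finally show ?thesis .
      qed
      then have "(\<Sum>n. norm (q n) * exp (\<tau> * real n)) \<le> (\<Sum>n. cmod (z - w) * (real n ^ 2 * exp (- (\<sigma> - \<tau>) * real n)))"
        by (intro suminf_le decays_beyond_summable[OF q] summable_mult sS)
      also have "\<dots> = cmod (z - w) * S" unfolding S_def by (rule suminf_mult[OF sS])
      finally show ?thesis using C(1) by (intro mult_right_mono mult_left_mono) (auto simp: L2_norm_def)
    qed
    finally show ?thesis .
  qed
  show "\<exists>D. bounded_op ew D \<and> (\<forall>\<epsilon>>0. \<forall>\<^sub>F z in at w within {z. Re z > T_crit \<alpha>}. \<forall>f\<in>L2 ew.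
      L2_norm ew (\<lambda>x. (complex_sg z f x - complex_sg w f x) / (z - w) - D f x) \<le> \<epsilon> * L2_norm ew f)"
  proof (intro exI[of _ "multiplier_op d"] conjI allI impI)
    show "bounded_op ew (multiplier_op d)" by (rule multiplier_op_bounded_op[OF \<tau> d])
    fix \<epsilon> :: real assume \<epsilon>: "\<epsilon> > 0"
    define r where "r = min \<rho> (\<epsilon> / (C * S + 1))"
    have CS: "C * S + 1 > 0" using C(1) S0 by (simp add: add_nonneg_pos)
    have r: "r > 0" using \<rho> \<epsilon> CS by (simp add: r_def)
    show "\<forall>\<^sub>F z in at w within {z. Re z > T_crit \<alpha>}. \<forall>f\<in>L2 ew.
      L2_norm ew (\<lambda>x. (complex_sg z f x - complex_sg w f x) / (z - w) - multiplier_op d f x) \<le> \<epsilon> * L2_norm ew f"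
      unfolding eventually_at
    proof (intro exI[of _ r] conjI ballI impI r)
      fix z and f :: "real \<Rightarrow> complex" assume z: "z \<noteq> w \<and> dist z w < r" and f: "f \<in> L2 ew"
      then have zr: "cmod (z - w) < \<rho>" "cmod (z - w) \<le> \<epsilon> / (C * S + 1)" by (auto simp: dist_norm r_def)
      have "C * (cmod (z - w) * S) \<le> cmod (z - w) * (C * S + 1)" by (simp add: algebra_simps)
      also have "\<dots> \<le> \<epsilon>" using zr(2) CS by (simp add: pos_le_divide_eq)
      finally show "L2_norm ew (\<lambda>x. (complex_sg z f x - complex_sg w f x) / (z - w) - multiplier_op d f x) \<le> \<epsilon> * L2_norm ew f"
        using z by (intro order_trans[OF key[OF _ zr(1) f]] mult_right_mono) (auto simp: L2_norm_def)
    qed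
  qed
qed

text \<open>
  Real and imaginary part are expanded separately.
\<close>

lemma complex_sg_of_real:
  assumes t: "t > T_crit \<alpha>" and f: "f \<in> L2 ew"
  shows "AE x in hl. complex_sg (complex_of_real t) f x = sg K t f x"
proof -
  let ?R = "\<lambda>y. Re (f y)" and ?I = "\<lambda>y. Im (f y)"
  have [measurable]: "f \<in> borel_measurable hl" and if2: "integrable hl (\<lambda>x. ew x * (norm (f x))\<^sup>2)"
    using f by (auto simp: L2_ew_iff)
  have part: "g \<in> L2 ew" if [measurable]: "g \<in> borel_measurable hl" and le: "\<And>y. \<bar>g y\<bar> \<le> cmod (f y)" for g :: "real \<Rightarrow> real"
  proof -
    have "integrable hl (\<lambda>x. ew x * (norm (g x))\<^sup>2)"
    proof (rule Bochner_Integration.integrable_bound[OF if2])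
      have "ew x * (norm (g x))\<^sup>2 \<le> ew x * (norm (f x))\<^sup>2" for x
        using le[of x] ew_nonneg[of x] by (intro mult_left_mono power_mono) auto
      then show "AE x in hl. norm (ew x * (norm (g x))\<^sup>2) \<le> norm (ew x * (norm (f x))\<^sup>2)"
        using ew_nonneg by (simp add: abs_mult)
    qed measurable
    then show ?thesis by (simp add: L2_ew_iff)
  qed
  have RL: "?R \<in> L2 ew" and IL: "?I \<in> L2 ew" by (intro part; simp add: abs_Re_le_cmod abs_Im_le_cmod)+
  have t0: "t \<ge> 0" using t T_crit_nonneg by simp
  have split: "of_real (Re z) + \<i> * of_real (Im z) = z" for z by (simp add: complex_eq_iff)
  have c: "coeff f n = of_real (coeff ?R n) + \<i> * of_real (coeff ?I n)" for n
  proof -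
    have iR: "integrable hl (\<lambda>y. complex_of_real (W n y * ?R y))" and iI: "integrable hl (\<lambda>y. \<i> * complex_of_real (W n y * ?I y))"
      using coeff_bound_real(2)[OF RL t] coeff_bound_real(2)[OF IL t] by (auto intro!: integrable_mult_right integrable_of_real simp del: of_real_mult)
    have "W n y *\<^sub>R f y = complex_of_real (W n y * ?R y) + \<i> * complex_of_real (W n y * ?I y)" for y
      by (simp add: complex_eq_iff)
    then have "coeff f n = (LINT y|hl. complex_of_real (W n y * ?R y)) + (LINT y|hl. \<i> * complex_of_real (W n y * ?I y))"
      unfolding coeff_def using Bochner_Integration.integral_add[OF iR iI] by simp
    then show ?thesis by (simp only: coeff_def real_scaleR_def integral_mult_right_zero integral_complex_of_real)
  qed
  have "AE x in hl. integrable (K t x) ?R" "AE x in hl. integrable (K t x) ?I"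
    using sg_integrable[OF RL t0] sg_integrable[OF IL t0] by auto
  with admissible_expansion(1)[OF admissible_L2[OF RL] t] admissible_expansion(1)[OF admissible_L2[OF IL] t]
  show ?thesis
  proof eventually_elim
    case (elim x)
    have gd: "geometric_decay (\<lambda>n. exp (- real n * t) * coeff g n)" if "g \<in> L2 ew" for g
      by (rule admissible_decay[OF admissible_L2[OF that] t])
    have iR: "integrable (K t x) (\<lambda>y. complex_of_real (?R y))" and iI: "integrable (K t x) (\<lambda>y. \<i> * complex_of_real (?I y))"
      using elim by (auto intro!: integrable_mult_right integrable_of_real)
    have "sg K t f x = (LINT y|K t x. complex_of_real (?R y) + \<i> * complex_of_real (?I y))" unfolding sg_def split ..
    also have "\<dots> = of_real (sg K t ?R x) + \<i> * of_real (sg K t ?I x)"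
      using Bochner_Integration.integral_add[OF iR iI] by (simp only: sg_def integral_mult_right_zero integral_complex_of_real)
    finally have s: "sg K t f x = of_real (sg K t ?R x) + \<i> * of_real (sg K t ?I x)" .
    have "(\<lambda>n. of_real (P n x *\<^sub>R (exp (- real n * t) * coeff ?R n)) + \<i> * of_real (P n x *\<^sub>R (exp (- real n * t) * coeff ?I n))) sums sg K t f x"
      unfolding s elim(1,2) by (intro sums_add sums_mult sums_of_real P_series_sums gd RL IL)
    moreover have "of_real (P n x *\<^sub>R (exp (- real n * t) * coeff ?R n)) + \<i> * of_real (P n x *\<^sub>R (exp (- real n * t) * coeff ?I n))
        = P n x *\<^sub>R (exp (- of_nat n * complex_of_real t) * coeff f n)" for n
    proof -
      have "exp (- of_nat n * complex_of_real t) = of_real (exp (- real n * t))" by (simp flip: exp_of_real)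
      then show ?thesis unfolding c by (simp add: scaleR_conv_of_real algebra_simps)
    qed
    ultimately show ?case by (simp add: complex_sg_def multiplier_op_def P_series_def sums_iff)
  qed
qed

end

section \<open>Regularity of the expansions\<close>

lemma locally_uniform_limit_on_compose_isometry:
  assumes "locally_uniform_limit_on S F g" "h ` S' \<subseteq> S" "\<And>x y. dist (h x) (h y) = dist x y"
  shows "locally_uniform_limit_on S' (\<lambda>N x. F N (h x)) (\<lambda>x. g (h x))"
  unfolding locally_uniform_limit_on_def
proof
  fix a assume "a \<in> S'"
  then obtain r where r: "r > 0" "uniform_limit (S \<inter> ball (h a) r) F g sequentially"
    using assms(1,2) unfolding locally_uniform_limit_on_def by blast
  have "h \<in> S' \<inter> ball a r \<rightarrow> S \<inter> ball (h a) r" using assms(2,3) by auto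
  from uniform_limit_compose'[OF r(2) this] r(1)
  show "\<exists>r>0. uniform_limit (S' \<inter> ball a r) (\<lambda>N x. F N (h x)) (\<lambda>x. g (h x)) sequentially" by blast
qed

context gauss_laguerre
begin

lemma P_deriv_sum_from: "(\<Sum>n=p..N. a n * (deriv ^^ p) (P n) x) = (\<Sum>n\<le>N. a n * (deriv ^^ p) (P n) x)"
  by (rule sum.mono_neutral_left) (auto simp: P_deriv_zero)

text \<open>
  The three-variable series restricted to \<open>y = 1\<close>; as its coefficients do not depend on \<open>y\<close>, any other
  value would do.
\<close>

lemma admissible_smooth:
  assumes f: "admissible f T"
  shows "\<exists>u :: real \<Rightarrow> real \<Rightarrow> real.
           (\<forall>t>T. AE x in wmeas ew. sg K t f x = u t x) \<and>
           smooth_on (\<lambda>(t, x). u t x) ({T<..} \<times> {0..}) \<and>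
           (\<forall>k p. \<forall>t>T. locally_uniform_limit_on {0..}
              (\<lambda>N x. \<Sum>n=p..N. (- real n) ^ k * exp (- real n * t) * coeff f n * (deriv ^^ p) (P n) x)
              (\<lambda>x. iter_deriv_within {T<..} k (\<lambda>s. iter_deriv_within {0..} p (u s) x) t))"
proof -
  interpret ps: product_series "\<lambda>i n. (deriv ^^ i) (P n)" "\<lambda>q n y. if q = 0 then coeff f n else 0" UNIV T
    by (rule admissible_product_series[OF f])
  define u where "u = (\<lambda>t x. ps.S 0 0 0 (t, x, 1))"
  have "AE x in wmeas ew. sg K t f x = u t x" if t: "t > T" for t
  proof -
    have "P_series (\<lambda>n. exp (- real n * t) * coeff f n) x = u t x" for x
      by (simp add: u_def ps.S_def ps.tm_def P_series_def mult_ac)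
    then show ?thesis using admissible_expansion(1)[OF f t] by (simp add: AE_ew)
  qed
  moreover have "smooth_on (\<lambda>(t, x). u t x) ({T<..} \<times> {0..})"
    unfolding smooth_on_def
  proof
    fix k
    have "Ck_on k (\<lambda>z. ps.S 0 0 0 (fst z, snd z, 1)) ({T<..} \<times> {0..})"
    proof (rule Ck_on_compose_affine[where A="\<lambda>z. (fst z, snd z, 1)" and L="\<lambda>z. (fst z, snd z, 0)"])
      show "((\<lambda>z :: real \<times> real. (fst z, snd z, 1 :: real)) has_derivative (\<lambda>z. (fst z, snd z, 0))) (at z)" for z
        by (auto intro!: derivative_eq_intros)
      show "Ck_on k (ps.S 0 0 0) ({T<..} \<times> UNIV \<times> UNIV)" by (rule ps.S_Ck_on) simp
    qed auto
    then show "Ck_on k (\<lambda>(t, x). u t x) ({T<..} \<times> {0..})" by (simp add: u_def case_prod_unfold)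
  qed
  moreover have "locally_uniform_limit_on {0..}
      (\<lambda>N x. \<Sum>n=p..N. (- real n) ^ k * exp (- real n * t) * coeff f n * (deriv ^^ p) (P n) x)
      (\<lambda>x. iter_deriv_within {T<..} k (\<lambda>s. iter_deriv_within {0..} p (u s) x) t)" if t: "t > T" for k p t
  proof (rule locally_uniform_limit_on_cong)
    show "locally_uniform_limit_on {0..} (\<lambda>N x. \<Sum>n\<le>N. ps.tm k p 0 n (t, x, 1)) (\<lambda>x. ps.S k p 0 (t, x, 1))"
      by (rule locally_uniform_limit_on_compose_isometry[OF ps.S_locally_uniform[where A="{T<..} \<times> UNIV \<times> UNIV"]])
         (use t in \<open>auto simp: dist_Pair_Pair\<close>)
    show "(\<Sum>n\<le>N. ps.tm k p 0 n (t, x, 1)) = (\<Sum>n=p..N. (- real n) ^ k * exp (- real n * t) * coeff f n * (deriv ^^ p) (P n) x)" for N x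
      unfolding P_deriv_sum_from by (simp add: ps.tm_def)
    fix x :: real assume x: "x \<in> {0..}"
    show "ps.S k p 0 (t, x, 1) = iter_deriv_within {T<..} k (\<lambda>s. iter_deriv_within {0..} p (u s) x) t"
    proof (rule ps.S_iter_t[OF t UNIV_I, symmetric])
      show "iter_deriv_within {0..} p (u s) x = ps.S 0 p 0 (s, x, 1)" if "s > T" for s
        unfolding u_def by (rule ps.S_iter_x[OF that UNIV_I x])
    qed
  qed
  ultimately show ?thesis by blast
qed

lemma heat_smooth: "smooth_on (\<lambda>(t, x, y). heat t x y) ({0<..} \<times> {0..} \<times> {0<..})"
proof -
  have "(\<lambda>(t, x, y). heat t x y) = ker.S 0 0 0" by (auto simp: heat_def fun_eq_iff)
  then show ?thesis by (simp only:) (rule ker.S_smooth_on, auto)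
qed

lemma heat_derivatives:
  assumes t: "t > 0" and x: "x \<ge> 0" and y: "y > 0"
  shows "iter_deriv_within {0<..} k (\<lambda>s. iter_deriv_within {0..} p (\<lambda>x'. iter_deriv_within {0<..} q (heat s x') y) x) t
    = ker.S k p q (t, x, y)"
proof (rule ker.S_iter_t[OF t])
  fix s :: real assume s: "s > 0"
  have "iter_deriv_within {0<..} q (heat s x') y = ker.S 0 0 q (s, x', y)" for x'
  proof (rule iter_deriv_within_eq[where F="\<lambda>q y. ker.S 0 0 q (s, x', y)"])
    show "((\<lambda>y. ker.S 0 0 n (s, x', y)) has_real_derivative ker.S 0 0 (Suc n) (s, x', y)) (at y within {0<..})"
      if "y \<in> {0<..}" for n y
      by (rule has_field_derivative_at_within[OF ker.S_partial(3)[OF s that]])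
    show "at y within {0<..} \<noteq> bot" if "y \<in> {0<..}" for y :: real by (rule at_within_greaterThan_nontrivial[OF that])
  qed (use y in \<open>auto simp: heat_def\<close>)
  then show "iter_deriv_within {0..} p (\<lambda>x'. iter_deriv_within {0<..} q (heat s x') y) x = ker.S 0 p q (s, x, y)"
    using ker.S_iter_x[OF s, of y x p 0 q] x y by simp
qed (use y in simp)

lemma heat_locally_uniform:
  "locally_uniform_limit_on ({0<..} \<times> {0..} \<times> {0<..})
     (\<lambda>N (t, x, y). \<Sum>n=p..N. (- real n) ^ k * exp (- real n * t) * (deriv ^^ q) (W n) y * (deriv ^^ p) (P n) x)
     (\<lambda>(t, x, y). iter_deriv_within {0<..} k (\<lambda>s. iter_deriv_within {0..} p (\<lambda>x'.
        iter_deriv_within {0<..} q (heat s x') y) x) t)"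
proof (rule locally_uniform_limit_on_cong[OF ker.S_locally_uniform])
  show "{0<..} \<times> {0..} \<times> {0<..} \<subseteq> {0<..} \<times> (UNIV :: real set) \<times> {0::real<..}" by auto
  show "(\<Sum>n\<le>N. ker.tm k p q n z) = (\<lambda>(t, x, y). \<Sum>n=p..N. (- real n) ^ k * exp (- real n * t) * (deriv ^^ q) (W n) y * (deriv ^^ p) (P n) x) z" for N z
    by (cases z) (simp only: prod.case P_deriv_sum_from ker.tm_def)
qed (auto simp: heat_derivatives)

end

theorem theorem1p4:
  fixes \<alpha> \<beta> \<gamma> \<eta> :: real
    and K :: "real \<Rightarrow> real \<Rightarrow> real measure"
    and lam :: "real \<Rightarrow> real"
  assumes "0 < \<alpha>" "\<alpha> < 1" "1 - 1/\<alpha> \<le> \<beta>" "0 < \<gamma>" "\<gamma> < \<alpha>" "0 < \<eta>"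
    and "is_lambda_density \<alpha> \<beta> lam"
    and "gauss_laguerre_semigroup \<alpha> \<beta> K"
  shows
    "(\<forall>f T. (f \<in> L2 (e_w \<alpha> \<beta>) \<and> T = T_crit \<alpha>) \<or>
            (f \<in> Ran_Lambda \<alpha> \<beta> lam \<union> L2 (e_bar \<eta> \<gamma> \<beta> \<alpha>) \<and> T = 0) \<longrightarrow>
        (\<forall>t>T. L2_tendsto (e_w \<alpha> \<beta>)
           (\<lambda>N x. \<Sum>n\<le>N. exp (- real n * t) * L2_inner (e_w \<alpha> \<beta>) f (R_fun \<alpha> \<beta> n) * P_poly \<alpha> \<beta> n x)
           (sg K t f) sequentially)) \<and>
     (\<exists>A. op_holomorphic_on (e_w \<alpha> \<beta>) A {z. Re z > T_crit \<alpha>} \<and>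
        (\<forall>t>T_crit \<alpha>. \<forall>f\<in>L2 (e_w \<alpha> \<beta>).
           AE x in wmeas (e_w \<alpha> \<beta>). A (complex_of_real t) f x = sg K t f x)) \<and>
     (\<forall>f T. (f \<in> L2 (e_w \<alpha> \<beta>) \<and> T = T_crit \<alpha>) \<or>
            (f \<in> Ran_Lambda \<alpha> \<beta> lam \<union> L2 (e_bar \<eta> \<gamma> \<beta> \<alpha>) \<and> T = 0) \<longrightarrow>
        (\<exists>u :: real \<Rightarrow> real \<Rightarrow> real.
           (\<forall>t>T. AE x in wmeas (e_w \<alpha> \<beta>). sg K t f x = u t x) \<and>
           smooth_on (\<lambda>(t, x). u t x) ({T<..} \<times> {0..}) \<and>
           (\<forall>k p. \<forall>t>T. locally_uniform_limit_on {0..}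
              (\<lambda>N x. \<Sum>n=p..N. (- real n) ^ k * exp (- real n * t) *
                 L2_inner (e_w \<alpha> \<beta>) f (R_fun \<alpha> \<beta> n) * (deriv ^^ p) (P_poly \<alpha> \<beta> n) x)
              (\<lambda>x. iter_deriv_within {T<..} k (\<lambda>s. iter_deriv_within {0..} p (u s) x) t)))) \<and>
     (\<exists>P :: real \<Rightarrow> real \<Rightarrow> real \<Rightarrow> real.
        (\<forall>t>0. \<forall>x\<ge>0. (\<forall>y>0. 0 \<le> P t x y) \<and>
           K t x = density (restrict_space lborel {0..}) (\<lambda>y. ennreal (P t x y))) \<and>
        smooth_on (\<lambda>(t, x, y). P t x y) ({0<..} \<times> {0..} \<times> {0<..}) \<and>
        (\<forall>k p q. locally_uniform_limit_on ({0<..} \<times> {0..} \<times> {0<..})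
           (\<lambda>N (t, x, y). \<Sum>n=p..N. (- real n) ^ k * exp (- real n * t) *
              (deriv ^^ q) (W_fun \<alpha> \<beta> n) y * (deriv ^^ p) (P_poly \<alpha> \<beta> n) x)
           (\<lambda>(t, x, y). iter_deriv_within {0<..} k (\<lambda>s.
              iter_deriv_within {0..} p (\<lambda>x'.
                iter_deriv_within {0<..} q (P s x') y) x) t))) \<and>
     (\<forall>t>0. \<forall>f :: real \<Rightarrow> real. f \<in> borel_measurable half_line \<and> bounded (f ` {0..}) \<longrightarrow>
        bounded (sg K t f ` {0..}) \<and> continuous_on {0..} (sg K t f))"
proof -
  interpret gauss_laguerre \<alpha> \<beta> K lam
    by unfold_locales (use assms in auto)
  have adm: "admissible f T" if "(f \<in> L2 ew \<and> T = T_crit \<alpha>) \<or> (f \<in> Ran_Lambda \<alpha> \<beta> lam \<union> L2 (e_bar \<eta> \<gamma> \<beta> \<alpha>) \<and> T = 0)" for f T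
    using that admissible_L2 admissible_Ran_Lambda admissible_e_bar assms(4-6) by blast
  show ?thesis
  proof (intro conjI)
    show "\<exists>A. op_holomorphic_on ew A {z. Re z > T_crit \<alpha>} \<and>
        (\<forall>t>T_crit \<alpha>. \<forall>f\<in>L2 ew. AE x in wmeas ew. A (complex_of_real t) f x = sg K t f x)"
      by (rule exI[of _ complex_sg]) (auto simp: AE_ew intro!: complex_sg_holomorphic complex_sg_of_real)
  next
    show "\<exists>P :: real \<Rightarrow> real \<Rightarrow> real \<Rightarrow> real.
        (\<forall>t>0. \<forall>x\<ge>0. (\<forall>y>0. 0 \<le> P t x y) \<and>
           K t x = density (restrict_space lborel {0..}) (\<lambda>y. ennreal (P t x y))) \<and>
        smooth_on (\<lambda>(t, x, y). P t x y) ({0<..} \<times> {0..} \<times> {0<..}) \<and>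
        (\<forall>k p q. locally_uniform_limit_on ({0<..} \<times> {0..} \<times> {0<..})
           (\<lambda>N (t, x, y). \<Sum>n=p..N. (- real n) ^ k * exp (- real n * t) *
              (deriv ^^ q) (W_fun \<alpha> \<beta> n) y * (deriv ^^ p) (P_poly \<alpha> \<beta> n) x)
           (\<lambda>(t, x, y). iter_deriv_within {0<..} k (\<lambda>s.
              iter_deriv_within {0..} p (\<lambda>x'.
                iter_deriv_within {0<..} q (P s x') y) x) t))"
      by (rule exI[of _ heat]) (use heat_nonneg K_eq_heat_density heat_smooth heat_locally_uniform in blast)
  qed (use adm admissible_expansion(2) admissible_smooth strong_feller in \<open>unfold coeff_L2_inner, blast+\<close>)
qed

end
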